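(* Let $k$ be a field of characteristic zero, $N\ge2$, and let $E_N$ be the $k$-vector space with basis $\{[ij]\mid 1\le i<j\le N\}$, with $[ij]=-[ji]$ for $i>j$. Then: (a) $E_N$ is a left $S_N$-crossed module with $$g.[ij]=[g(i)\,g(j)]=\begin{cases}[g(i)\,g(j)]&\text{if }g(i)<g(j)\\-[g(j)\,g(i)]&\text{if }g(i)>g(j)\end{cases}\quad(g\in S_N,\ i<j),\qquad |[ij]|=(ij),$$ where $|\ |$ denotes the $S_N$-degree. (b) Let $\Psi$ be the induced braiding on $E_N\otimes E_N$. Then the Fomin–Kirillov algebra is $\mathcal{E}_N=TE_N/\langle\ker(\mathrm{id}+\Psi)\rangle$. (c) $\mathcal{E}_N$ is a braided group (Hopf algebra) in the braided category of $S_N$-crossed modules, with coproduct and counit determined on generators by $$\underline{\Delta}[ij]=[ij]\otimes1+1\otimes[ij],\qquad\underline{\epsilon}[ij]=0$$ (an additive braided group, or "linear braided space").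
   Context: The Fomin–Kirillov algebra $\mathcal{E}_N$ is the associative unital $k$-algebra generated by $[ij]$, $i\neq j\in\{1,\dots,N\}$, with relations $[ij]=-[ji]$, $[ij]^2=0$, $[ij][km]=[km][ij]$, and $[ij][jk]+[jk][ki]+[ki][ij]=0$ for distinct $i,j,k,m$. A left $G$-crossed module ($G$ a finite group) is a $G$-module $V$ with a $G$-grading $V=\bigoplus_{g}V_g$ (degree $|v|=g$ for $v\in V_g$) such that $h.V_g\subseteq V_{hgh^{-1}}$. Morphisms are grading-preserving $G$-module maps. The tensor product has diagonal action and product degree, and the category is braided with $\Psi_{V,W}(v\otimes w)=|v|.w\otimes v$ for $v$ homogeneous. A braided group (Hopf algebra in this category) is an algebra $B$ in the category with morphisms $\underline\Delta:B\to B\underline\otimes B$ (coassociative), counit $\underline\epsilon:B\to k$ and antipode $\underline S:B\to B$ obeying the usual Hopf algebra axioms, where $\underline\Delta,\underline\epsilon$ are algebra homomorphisms and $B\underline\otimes B$ has the braided tensor product algebra structure $(a\otimes b)(c\otimes d)=a\,\Psi_{B,B}(b\otimes c)\,d$. Quotients $TE_N/\langle R\rangle$ are by the two-sided ideal generated by $R\subseteq E_N\otimes E_N$. *)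

theory Defs
  imports "HOL-Algebra.Sym_Groups" "HOL-Algebra.QuotRing" "HOL-Algebra.Module"
begin

section \<open>Vector spaces and associative algebras\<close>

text \<open>
  Everything is relative to a coefficient ring \<open>K\<close> (a field in the applications). Vector spaces
  are records of type \<^typ>\<open>('k, 'v) module\<close>; their fields \<open>mult\<close> and \<open>one\<close> are meaningful only for
  algebras. The library locale \<^locale>\<open>algebra\<close> is restricted to commutative algebras, hence the
  following one.
\<close>

locale assoc_algebra = module R M + ring M for R (structure) and M (structure) +
  assumes smult_mult_left:
      "\<lbrakk>a \<in> carrier R; x \<in> carrier M; y \<in> carrier M\<rbrakk> \<Longrightarrow>
        (a \<odot>\<^bsub>M\<^esub> x) \<otimes>\<^bsub>M\<^esub> y = a \<odot>\<^bsub>M\<^esub> (x \<otimes>\<^bsub>M\<^esub> y)"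
    and smult_mult_right:
      "\<lbrakk>a \<in> carrier R; x \<in> carrier M; y \<in> carrier M\<rbrakk> \<Longrightarrow>
        x \<otimes>\<^bsub>M\<^esub> (a \<odot>\<^bsub>M\<^esub> y) = a \<odot>\<^bsub>M\<^esub> (x \<otimes>\<^bsub>M\<^esub> y)"

definition lin_map ::
  "('k, 'r) ring_scheme \<Rightarrow> ('k, 'v, 'm) module_scheme \<Rightarrow> ('k, 'w, 'n) module_scheme \<Rightarrow> ('v \<Rightarrow> 'w) set"
  where "lin_map K V W =
    {f \<in> hom (add_monoid V) (add_monoid W).
      \<forall>a\<in>carrier K. \<forall>v\<in>carrier V. f (a \<odot>\<^bsub>V\<^esub> v) = a \<odot>\<^bsub>W\<^esub> f v}"

definition alg_hom ::
  "('k, 'r) ring_scheme \<Rightarrow> ('k, 'v, 'm) module_scheme \<Rightarrow> ('k, 'w, 'n) module_scheme \<Rightarrow> ('v \<Rightarrow> 'w) set"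
  where "alg_hom K A B = lin_map K A B \<inter> ring_hom A B"

definition lin_span :: "('k, 'r) ring_scheme \<Rightarrow> ('k, 'v, 'm) module_scheme \<Rightarrow> 'v set \<Rightarrow> 'v set"
  where "lin_span K V S = \<Inter>{H. submodule H K V \<and> S \<subseteq> H}"

text \<open>
  Quotient by a subspace, and also quotient of an algebra by a two-sided ideal: \<^const>\<open>FactRing\<close>
  equipped with scalar multiplication.
\<close>

definition quot :: "('k, 'v, 'm) module_scheme \<Rightarrow> 'v set \<Rightarrow> ('k, 'v set) module"
  where "quot A I = ring.extend (A Quot I)
    (module.fields (\<lambda>a C. \<Union>x\<in>C. I +>\<^bsub>A\<^esub> (a \<odot>\<^bsub>A\<^esub> x)))"

text \<open>The vector space with basis \<open>X\<close>: functions of finite support contained in \<open>X\<close>.\<close>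

definition free_module :: "('k, 'r) ring_scheme \<Rightarrow> 'x set \<Rightarrow> ('k, 'x \<Rightarrow> 'k) module"
  where "free_module K X =
    \<lparr>carrier = {f. (\<forall>x. f x \<in> carrier K) \<and> {x. f x \<noteq> \<zero>\<^bsub>K\<^esub>} \<subseteq> X \<and> finite {x. f x \<noteq> \<zero>\<^bsub>K\<^esub>}},
     mult = undefined, one = undefined,
     zero = (\<lambda>x. \<zero>\<^bsub>K\<^esub>), add = (\<lambda>f g x. f x \<oplus>\<^bsub>K\<^esub> g x),
     smult = (\<lambda>a f x. a \<otimes>\<^bsub>K\<^esub> f x)\<rparr>"

definition basis_vec :: "('k, 'r) ring_scheme \<Rightarrow> 'x \<Rightarrow> 'x \<Rightarrow> 'k"
  where "basis_vec K x = (\<lambda>y. if y = x then \<one>\<^bsub>K\<^esub> else \<zero>\<^bsub>K\<^esub>)"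

text \<open>The free unital associative algebra on \<open>X\<close>; its basis consists of the words in \<open>X\<close>.\<close>

definition free_algebra :: "('k, 'r) ring_scheme \<Rightarrow> 'x set \<Rightarrow> ('k, 'x list \<Rightarrow> 'k) module"
  where "free_algebra K X = (free_module K (lists X))
    \<lparr>mult := (\<lambda>f g w. \<Oplus>\<^bsub>K\<^esub>i\<in>{..length w}. f (take i w) \<otimes>\<^bsub>K\<^esub> g (drop i w)),
     one := basis_vec K []\<rparr>"

section \<open>Tensor products and tensor algebras\<close>

text \<open>
  \<open>V \<otimes> W\<close> is the free vector space on the pairs \<open>(v, w)\<close> modulo the bilinearity relations.
\<close>

definition tensor_rels ::
  "('k, 'r) ring_scheme \<Rightarrow> ('k, 'v, 'm) module_scheme \<Rightarrow> ('k, 'w, 'n) module_scheme \<Rightarrow>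
    ('v \<times> 'w \<Rightarrow> 'k) set"
  where "tensor_rels K V W =
    (let F = free_module K (carrier V \<times> carrier W); d = basis_vec K in
      {d (v \<oplus>\<^bsub>V\<^esub> v', w) \<ominus>\<^bsub>F\<^esub> (d (v, w) \<oplus>\<^bsub>F\<^esub> d (v', w)) | v v' w.
          v \<in> carrier V \<and> v' \<in> carrier V \<and> w \<in> carrier W} \<union>
      {d (v, w \<oplus>\<^bsub>W\<^esub> w') \<ominus>\<^bsub>F\<^esub> (d (v, w) \<oplus>\<^bsub>F\<^esub> d (v, w')) | v w w'.
          v \<in> carrier V \<and> w \<in> carrier W \<and> w' \<in> carrier W} \<union>
      {d (a \<odot>\<^bsub>V\<^esub> v, w) \<ominus>\<^bsub>F\<^esub> a \<odot>\<^bsub>F\<^esub> d (v, w) | a v w.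
          a \<in> carrier K \<and> v \<in> carrier V \<and> w \<in> carrier W} \<union>
      {d (v, a \<odot>\<^bsub>W\<^esub> w) \<ominus>\<^bsub>F\<^esub> a \<odot>\<^bsub>F\<^esub> d (v, w) | a v w.
          a \<in> carrier K \<and> v \<in> carrier V \<and> w \<in> carrier W})"

definition tensor_null ::
  "('k, 'r) ring_scheme \<Rightarrow> ('k, 'v, 'm) module_scheme \<Rightarrow> ('k, 'w, 'n) module_scheme \<Rightarrow>
    ('v \<times> 'w \<Rightarrow> 'k) set"
  where "tensor_null K V W =
    lin_span K (free_module K (carrier V \<times> carrier W)) (tensor_rels K V W)"

definition tensor ::
  "('k, 'r) ring_scheme \<Rightarrow> ('k, 'v, 'm) module_scheme \<Rightarrow> ('k, 'w, 'n) module_scheme \<Rightarrow>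
    ('k, ('v \<times> 'w \<Rightarrow> 'k) set) module"
  where "tensor K V W = quot (free_module K (carrier V \<times> carrier W)) (tensor_null K V W)"

definition pure ::
  "('k, 'r) ring_scheme \<Rightarrow> ('k, 'v, 'm) module_scheme \<Rightarrow> ('k, 'w, 'n) module_scheme \<Rightarrow>
    'v \<Rightarrow> 'w \<Rightarrow> ('v \<times> 'w \<Rightarrow> 'k) set"
  where "pure K V W v w =
    tensor_null K V W +>\<^bsub>free_module K (carrier V \<times> carrier W)\<^esub> basis_vec K (v, w)"

text \<open>
  The linear map \<open>V \<otimes> W \<rightarrow> U\<close> induced by a bilinear map \<open>b\<close>, i.e. the one with
  \<open>v \<otimes> w \<mapsto> b v w\<close>. All representatives \<open>f\<close> of a tensor \<open>t\<close> give the same value.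
\<close>

definition tensor_lift ::
  "('k, 'r) ring_scheme \<Rightarrow> ('k, 'u, 'm) module_scheme \<Rightarrow> ('v \<Rightarrow> 'w \<Rightarrow> 'u) \<Rightarrow>
    ('v \<times> 'w \<Rightarrow> 'k) set \<Rightarrow> 'u"
  where "tensor_lift K U b t =
    the_elem ((\<lambda>f. \<Oplus>\<^bsub>U\<^esub>p\<in>{p. f p \<noteq> \<zero>\<^bsub>K\<^esub>}. f p \<odot>\<^bsub>U\<^esub> b (fst p) (snd p)) ` t)"

text \<open>The map \<open>f \<otimes> g : V \<otimes> W \<rightarrow> V' \<otimes> W'\<close>.\<close>

definition tensor_map ::
  "('k, 'r) ring_scheme \<Rightarrow> ('k, 'a, 'm) module_scheme \<Rightarrow> ('k, 'b, 'n) module_scheme \<Rightarrow>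
    ('v \<Rightarrow> 'a) \<Rightarrow> ('w \<Rightarrow> 'b) \<Rightarrow> ('v \<times> 'w \<Rightarrow> 'k) set \<Rightarrow> ('a \<times> 'b \<Rightarrow> 'k) set"
  where "tensor_map K V' W' f g =
    tensor_lift K (tensor K V' W') (\<lambda>v w. pure K V' W' (f v) (g w))"

text \<open>The associativity isomorphism \<open>(U \<otimes> V) \<otimes> W \<rightarrow> U \<otimes> (V \<otimes> W)\<close>.\<close>

definition tensor_assoc ::
  "('k, 'r) ring_scheme \<Rightarrow> ('k, 'u, 'l) module_scheme \<Rightarrow> ('k, 'v, 'm) module_scheme \<Rightarrow>
    ('k, 'w, 'n) module_scheme \<Rightarrow> (('u \<times> 'v \<Rightarrow> 'k) set \<times> 'w \<Rightarrow> 'k) set \<Rightarrow>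
    ('u \<times> ('v \<times> 'w \<Rightarrow> 'k) set \<Rightarrow> 'k) set"
  where "tensor_assoc K U V W =
    (let VW = tensor K V W; T = tensor K U VW in
      tensor_lift K T (\<lambda>t w. tensor_lift K T (\<lambda>u v. pure K U VW u (pure K V W v w)) t))"

text \<open>
  The tensor algebra \<open>TV = \<Oplus>n. V\<^sup>\<otimes>\<^sup>n\<close>: the word \<open>[v\<^sub>1, \<dots>, v\<^sub>n]\<close> represents
  \<open>v\<^sub>1 \<otimes> \<dots> \<otimes> v\<^sub>n\<close>, and the ideal generated by the linearity relations on letters is the span
  of the multilinearity relations on words.
\<close>

definition linearity_rels ::
  "('k, 'r) ring_scheme \<Rightarrow> ('k, 'v, 'm) module_scheme \<Rightarrow> ('v list \<Rightarrow> 'k) set"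
  where "linearity_rels K V =
    (let F = free_algebra K (carrier V); d = (\<lambda>v. basis_vec K [v]) in
      {d (v \<oplus>\<^bsub>V\<^esub> v') \<ominus>\<^bsub>F\<^esub> (d v \<oplus>\<^bsub>F\<^esub> d v') | v v'. v \<in> carrier V \<and> v' \<in> carrier V} \<union>
      {d (a \<odot>\<^bsub>V\<^esub> v) \<ominus>\<^bsub>F\<^esub> a \<odot>\<^bsub>F\<^esub> d v | a v. a \<in> carrier K \<and> v \<in> carrier V})"

definition tensor_algebra ::
  "('k, 'r) ring_scheme \<Rightarrow> ('k, 'v, 'm) module_scheme \<Rightarrow> ('k, ('v list \<Rightarrow> 'k) set) module"
  where "tensor_algebra K V =
    (let F = free_algebra K (carrier V) in quot F (Idl\<^bsub>F\<^esub> (linearity_rels K V)))"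

definition tensor_algebra_incl ::
  "('k, 'r) ring_scheme \<Rightarrow> ('k, 'v, 'm) module_scheme \<Rightarrow> 'v \<Rightarrow> ('v list \<Rightarrow> 'k) set"
  where "tensor_algebra_incl K V v =
    (let F = free_algebra K (carrier V) in Idl\<^bsub>F\<^esub> (linearity_rels K V) +>\<^bsub>F\<^esub> basis_vec K [v])"

text \<open>The canonical map \<open>V \<otimes> V \<rightarrow> TV\<close>.\<close>

definition tensor_algebra_incl2 ::
  "('k, 'r) ring_scheme \<Rightarrow> ('k, 'v, 'm) module_scheme \<Rightarrow> ('v \<times> 'v \<Rightarrow> 'k) set \<Rightarrow>
    ('v list \<Rightarrow> 'k) set"
  where "tensor_algebra_incl2 K V =
    tensor_lift K (tensor_algebra K V)
      (\<lambda>v w. tensor_algebra_incl K V v \<otimes>\<^bsub>tensor_algebra K V\<^esub> tensor_algebra_incl K V w)"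

section \<open>Crossed modules\<close>

record ('k, 'v, 'g) crossed = "('k, 'v) module" +
  act :: "'g \<Rightarrow> 'v \<Rightarrow> 'v"
  grade :: "'g \<Rightarrow> 'v set"

text \<open>\<open>c\<close> is the family of homogeneous components of \<open>v\<close>.\<close>

definition homog_decomp ::
  "('g, 'h) monoid_scheme \<Rightarrow> ('k, 'v, 'g, 'm) crossed_scheme \<Rightarrow> 'v \<Rightarrow> ('g \<Rightarrow> 'v) \<Rightarrow> bool"
  where "homog_decomp G V v c \<longleftrightarrow>
    c \<in> (\<Pi>\<^sub>E g\<in>carrier G. grade V g) \<and> v = (\<Oplus>\<^bsub>V\<^esub>g\<in>carrier G. c g)"

locale crossed_module = module K V + group G
  for K (structure) and G (structure) and V :: "('k, 'v, 'g, 'm) crossed_scheme" (structure) +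
  assumes finite_group: "finite (carrier G)"
    and act_linear: "g \<in> carrier G \<Longrightarrow> act V g \<in> lin_map K V V"
    and act_one: "v \<in> carrier V \<Longrightarrow> act V \<one>\<^bsub>G\<^esub> v = v"
    and act_mult: "\<lbrakk>g \<in> carrier G; h \<in> carrier G; v \<in> carrier V\<rbrakk> \<Longrightarrow>
      act V (g \<otimes>\<^bsub>G\<^esub> h) v = act V g (act V h v)"
    and grade_submodule: "g \<in> carrier G \<Longrightarrow> submodule (grade V g) K V"
    and grade_direct_sum: "v \<in> carrier V \<Longrightarrow> \<exists>!c. homog_decomp G V v c"
    and act_grade: "\<lbrakk>g \<in> carrier G; h \<in> carrier G\<rbrakk> \<Longrightarrow>
      act V h ` grade V g \<subseteq> grade V (h \<otimes>\<^bsub>G\<^esub> g \<otimes>\<^bsub>G\<^esub> inv\<^bsub>G\<^esub> h)"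

definition homog_comp ::
  "('g, 'h) monoid_scheme \<Rightarrow> ('k, 'v, 'g, 'm) crossed_scheme \<Rightarrow> 'v \<Rightarrow> 'g \<Rightarrow> 'v"
  where "homog_comp G V v = (THE c. homog_decomp G V v c)"

definition crossed_hom ::
  "('k, 'r) ring_scheme \<Rightarrow> ('g, 'h) monoid_scheme \<Rightarrow> ('k, 'v, 'g, 'm) crossed_scheme \<Rightarrow>
    ('k, 'w, 'g, 'n) crossed_scheme \<Rightarrow> ('v \<Rightarrow> 'w) set"
  where "crossed_hom K G V W =
    {f \<in> lin_map K V W. \<forall>g\<in>carrier G.
      (\<forall>v\<in>carrier V. f (act V g v) = act W g (f v)) \<and> f ` grade V g \<subseteq> grade W g}"

text \<open>The unit object \<open>K\<close>: trivial action, concentrated in degree \<open>1\<close>.\<close>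

definition crossed_unit ::
  "('k, 'r) ring_scheme \<Rightarrow> ('g, 'h) monoid_scheme \<Rightarrow> ('k, 'k, 'g) crossed"
  where "crossed_unit K G =
    \<lparr>carrier = carrier K, mult = mult K, one = \<one>\<^bsub>K\<^esub>, zero = \<zero>\<^bsub>K\<^esub>, add = add K, smult = mult K,
     act = (\<lambda>g a. a), grade = (\<lambda>g. if g = \<one>\<^bsub>G\<^esub> then carrier K else {\<zero>\<^bsub>K\<^esub>})\<rparr>"

definition crossed_tensor ::
  "('k, 'r) ring_scheme \<Rightarrow> ('g, 'h) monoid_scheme \<Rightarrow> ('k, 'v, 'g, 'm) crossed_scheme \<Rightarrow>
    ('k, 'w, 'g, 'n) crossed_scheme \<Rightarrow> ('k, ('v \<times> 'w \<Rightarrow> 'k) set, 'g) crossed"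
  where "crossed_tensor K G V W = module.extend (tensor K V W)
    (crossed.fields
      (\<lambda>g. tensor_map K V W (act V g) (act W g))
      (\<lambda>g. lin_span K (tensor K V W)
        {pure K V W v w | v w h l.
          h \<in> carrier G \<and> l \<in> carrier G \<and> h \<otimes>\<^bsub>G\<^esub> l = g \<and> v \<in> grade V h \<and> w \<in> grade W l}))"

text \<open>
  The braiding \<open>\<Psi> : V \<otimes> W \<rightarrow> W \<otimes> V\<close>, given by \<open>v \<otimes> w \<mapsto> |v|.w \<otimes> v\<close> for homogeneous \<open>v\<close>
  and extended to all \<open>v\<close> by splitting \<open>v\<close> into homogeneous components.
\<close>

definition braiding ::
  "('k, 'r) ring_scheme \<Rightarrow> ('g, 'h) monoid_scheme \<Rightarrow> ('k, 'v, 'g, 'm) crossed_scheme \<Rightarrow>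
    ('k, 'w, 'g, 'n) crossed_scheme \<Rightarrow> ('v \<times> 'w \<Rightarrow> 'k) set \<Rightarrow> ('w \<times> 'v \<Rightarrow> 'k) set"
  where "braiding K G V W = tensor_lift K (tensor K W V)
    (\<lambda>v w. \<Oplus>\<^bsub>tensor K W V\<^esub>g\<in>carrier G. pure K W V (act W g w) (homog_comp G V v g))"

section \<open>Braided groups\<close>

text \<open>
  \<open>B \<otimes> B\<close> with the braided tensor product algebra structure
  \<open>(a \<otimes> b)(c \<otimes> d) = a \<Psi>(b \<otimes> c) d\<close>.
\<close>

definition braided_square ::
  "('k, 'r) ring_scheme \<Rightarrow> ('g, 'h) monoid_scheme \<Rightarrow> ('k, 'b, 'g, 'm) crossed_scheme \<Rightarrow>
    ('k, ('b \<times> 'b \<Rightarrow> 'k) set, 'g) crossed"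
  where "braided_square K G B =
    (let T = tensor K B B in
      (crossed_tensor K G B B)
        \<lparr>mult := (\<lambda>s t.
           tensor_lift K T (\<lambda>a b.
             tensor_lift K T (\<lambda>c d.
               tensor_lift K T (\<lambda>p q. pure K B B (a \<otimes>\<^bsub>B\<^esub> p) (q \<otimes>\<^bsub>B\<^esub> d))
                 (braiding K G B B (pure K B B b c))) t) s),
         one := pure K B B \<one>\<^bsub>B\<^esub> \<one>\<^bsub>B\<^esub>\<rparr>)"

locale braided_algebra = crossed_module K G B + assoc_algebra K B
  for K (structure) and G (structure) and B :: "('k, 'b, 'g, 'm) crossed_scheme" (structure) +
  assumes mult_morphism:
      "tensor_lift K B (mult B) \<in> crossed_hom K G (crossed_tensor K G B B) B"
    and unit_morphism: "(\<lambda>a. a \<odot>\<^bsub>B\<^esub> \<one>\<^bsub>B\<^esub>) \<in> crossed_hom K G (crossed_unit K G) B"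

locale braided_group = braided_algebra K G B
  for K (structure) and G (structure) and B :: "('k, 'b, 'g, 'm) crossed_scheme" (structure) +
  fixes \<Delta> :: "'b \<Rightarrow> ('b \<times> 'b \<Rightarrow> 'k) set" and \<epsilon> :: "'b \<Rightarrow> 'k" and S :: "'b \<Rightarrow> 'b"
  assumes coproduct_morphism: "\<Delta> \<in> crossed_hom K G B (crossed_tensor K G B B)"
    and counit_morphism: "\<epsilon> \<in> crossed_hom K G B (crossed_unit K G)"
    and antipode_morphism: "S \<in> crossed_hom K G B B"
    and coproduct_alg_hom: "\<Delta> \<in> alg_hom K B (braided_square K G B)"
    and counit_alg_hom: "\<epsilon> \<in> alg_hom K B (crossed_unit K G)"
    and coassoc: "x \<in> carrier B \<Longrightarrow>
      tensor_assoc K B B B (tensor_map K (tensor K B B) B \<Delta> (\<lambda>y. y) (\<Delta> x)) =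
      tensor_map K B (tensor K B B) (\<lambda>y. y) \<Delta> (\<Delta> x)"
    and counit_left: "x \<in> carrier B \<Longrightarrow> tensor_lift K B (\<lambda>y z. \<epsilon> y \<odot>\<^bsub>B\<^esub> z) (\<Delta> x) = x"
    and counit_right: "x \<in> carrier B \<Longrightarrow> tensor_lift K B (\<lambda>y z. \<epsilon> z \<odot>\<^bsub>B\<^esub> y) (\<Delta> x) = x"
    and antipode_left: "x \<in> carrier B \<Longrightarrow>
      tensor_lift K B (\<lambda>y z. S y \<otimes>\<^bsub>B\<^esub> z) (\<Delta> x) = \<epsilon> x \<odot>\<^bsub>B\<^esub> \<one>\<^bsub>B\<^esub>"
    and antipode_right: "x \<in> carrier B \<Longrightarrow>
      tensor_lift K B (\<lambda>y z. y \<otimes>\<^bsub>B\<^esub> S z) (\<Delta> x) = \<epsilon> x \<odot>\<^bsub>B\<^esub> \<one>\<^bsub>B\<^esub>"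

section \<open>The crossed module \<open>E\<^sub>N\<close> and the Fomin--Kirillov algebra\<close>

definition E_basis :: "nat \<Rightarrow> (nat \<times> nat) set"
  where "E_basis N = {(i, j). 1 \<le> i \<and> i < j \<and> j \<le> N}"

text \<open>The element \<open>[ij]\<close> of \<open>E\<^sub>N\<close> (for \<open>i \<noteq> j\<close>).\<close>

definition E_gen :: "('k, 'r) ring_scheme \<Rightarrow> nat \<Rightarrow> nat \<Rightarrow> nat \<Rightarrow> nat \<times> nat \<Rightarrow> 'k"
  where "E_gen K N i j =
    (if i < j then basis_vec K (i, j) else \<ominus>\<^bsub>free_module K (E_basis N)\<^esub> basis_vec K (j, i))"

text \<open>
  \<open>E\<^sub>N\<close> with the action \<open>g.[ij] = [g(i) g(j)]\<close> extended linearly and the grading in which the degree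
  \<open>g\<close> part is spanned by the basis elements \<open>[ij]\<close> whose transposition \<open>(ij)\<close> is \<open>g\<close>.
\<close>

definition E_space :: "('k, 'r) ring_scheme \<Rightarrow> nat \<Rightarrow> ('k, nat \<times> nat \<Rightarrow> 'k, nat \<Rightarrow> nat) crossed"
  where "E_space K N =
    (let E = free_module K (E_basis N) in
      module.extend E
        (crossed.fields
          (\<lambda>g f. \<Oplus>\<^bsub>E\<^esub>p\<in>E_basis N. f p \<odot>\<^bsub>E\<^esub> E_gen K N (g (fst p)) (g (snd p)))
          (\<lambda>g. lin_span K E
            {E_gen K N i j | i j. (i, j) \<in> E_basis N \<and> Transposition.transpose i j = g})))"

definition FK_letters :: "nat \<Rightarrow> (nat \<times> nat) set"
  where "FK_letters N = {(i, j). i \<in> {1..N} \<and> j \<in> {1..N} \<and> i \<noteq> j}"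

definition FK_rels :: "('k, 'r) ring_scheme \<Rightarrow> nat \<Rightarrow> ((nat \<times> nat) list \<Rightarrow> 'k) set"
  where "FK_rels K N =
    (let F = free_algebra K (FK_letters N); x = (\<lambda>i j. basis_vec K [(i, j)]) in
      {x i j \<oplus>\<^bsub>F\<^esub> x j i | i j. {i, j} \<subseteq> {1..N} \<and> i \<noteq> j} \<union>
      {x i j \<otimes>\<^bsub>F\<^esub> x i j | i j. {i, j} \<subseteq> {1..N} \<and> i \<noteq> j} \<union>
      {x i j \<otimes>\<^bsub>F\<^esub> x k m \<ominus>\<^bsub>F\<^esub> x k m \<otimes>\<^bsub>F\<^esub> x i j | i j k m.
          {i, j, k, m} \<subseteq> {1..N} \<and> distinct [i, j, k, m]} \<union>
      {x i j \<otimes>\<^bsub>F\<^esub> x j k \<oplus>\<^bsub>F\<^esub> x j k \<otimes>\<^bsub>F\<^esub> x k i \<oplus>\<^bsub>F\<^esub> x k i \<otimes>\<^bsub>F\<^esub> x i j | i j k.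
          {i, j, k} \<subseteq> {1..N} \<and> distinct [i, j, k]})"

definition FK_algebra ::
  "('k, 'r) ring_scheme \<Rightarrow> nat \<Rightarrow> ('k, ((nat \<times> nat) list \<Rightarrow> 'k) set) module"
  where "FK_algebra K N =
    (let F = free_algebra K (FK_letters N) in quot F (Idl\<^bsub>F\<^esub> (FK_rels K N)))"

definition FK_gen ::
  "('k, 'r) ring_scheme \<Rightarrow> nat \<Rightarrow> nat \<Rightarrow> nat \<Rightarrow> ((nat \<times> nat) list \<Rightarrow> 'k) set"
  where "FK_gen K N i j =
    (let F = free_algebra K (FK_letters N) in Idl\<^bsub>F\<^esub> (FK_rels K N) +>\<^bsub>F\<^esub> basis_vec K [(i, j)])"

text \<open>The two-sided ideal \<open>\<langle>ker (id + \<Psi>)\<rangle>\<close> of \<open>TE\<^sub>N\<close>.\<close>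

definition braided_ideal ::
  "('k, 'r) ring_scheme \<Rightarrow> ('g, 'h) monoid_scheme \<Rightarrow> ('k, 'v, 'g, 'm) crossed_scheme \<Rightarrow>
    ('v list \<Rightarrow> 'k) set set"
  where "braided_ideal K G V =
    (let T = tensor K V V in
      Idl\<^bsub>tensor_algebra K V\<^esub>
        (tensor_algebra_incl2 K V `
          a_kernel T T (\<lambda>t. t \<oplus>\<^bsub>T\<^esub> braiding K G V V t)))"

end

theory Submission
  imports Defs
begin

text \<open>
  Both the tensor algebra and the Fomin--Kirillov algebra \<open>A\<close> are given by generators and relations, so
  a linear map from \<open>A\<close> to a vector space \<open>U\<close> is obtained from operators \<open>\<theta>\<^sub>p\<close> on \<open>U\<close>, one for each
  letter \<open>p = (i, j)\<close>, that satisfy the defining relations: the map sends \<open>1\<close> to a chosen vector and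
  turns left multiplication by \<open>x\<^sub>p\<close> into \<open>\<theta>\<^sub>p\<close>. All structure maps arise in this way. The action and the
  grading come from \<open>\<theta>\<^sub>p b = x\<^bsub>g(p)\<^esub> b\<close> and \<open>\<theta>\<^sub>p (b \<otimes> h) = x\<^sub>p b \<otimes> |p| h\<close>, the coproduct from
  \<open>\<theta>\<^sub>p (b \<otimes> c) = x\<^sub>p b \<otimes> c + |p|.b \<otimes> x\<^sub>p c\<close>, and the antipode from \<open>\<theta>\<^sub>p b = - (|p|.b) x\<^sub>p\<close>. Each Hopf
  algebra axiom is then an induction over left multiplication by letters; in particular neither the
  associativity of the braided square nor that of the braided cube is needed.

  For the comparison with the tensor algebra, \<open>-\<Psi>\<close> permutes the tensors \<open>[ij] \<otimes> [km]\<close> up to sign in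
  orbits of length 1, 2 or 3, whose orbit sums are exactly the quadratic relations.
\<close>

section \<open>Linear maps, spans and free modules\<close>

text \<open>The coproduct takes values in the braided square, whose product is associative only by
  naturality and the hexagon identities of the braiding. A universal property for algebra maps would
  presuppose this; the one for operators asks for no product on the target, and it also yields maps
  that are not multiplicative, such as the antipode. The price is that multiplicativity of the
  coproduct has to be proved separately. It comes down to \<Delta>(x_p) (s t) = (\<Delta>(x_p) s) t,
  where the first factor is so simple that both sides can be written out. The relations survive the
  coproduct because the unmixed terms of \<Delta>(x_p) \<Delta>(x_q) reproduce the relation in one
  tensor factor, while the mixed terms cancel among the products in the relation. The kernel of id +
  \<Psi> is never computed. A tensor in it is fixed by -\<Psi>, so 6 times it is a sum of orbit
  sums, where 6 is the least common multiple of the orbit lengths; orbit sums vanish in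
  \<open>A\<close>, and characteristic zero allows division by 6.\<close>

lemma lin_mapI:
  assumes "\<And>v. v \<in> carrier V \<Longrightarrow> f v \<in> carrier W"
    and "\<And>u v. \<lbrakk>u \<in> carrier V; v \<in> carrier V\<rbrakk> \<Longrightarrow> f (u \<oplus>\<^bsub>V\<^esub> v) = f u \<oplus>\<^bsub>W\<^esub> f v"
    and "\<And>a v. \<lbrakk>a \<in> carrier K; v \<in> carrier V\<rbrakk> \<Longrightarrow> f (a \<odot>\<^bsub>V\<^esub> v) = a \<odot>\<^bsub>W\<^esub> f v"
  shows "f \<in> lin_map K V W"
  using assms by (auto simp: lin_map_def hom_def)

lemma lin_map_closed: "\<lbrakk>f \<in> lin_map K V W; v \<in> carrier V\<rbrakk> \<Longrightarrow> f v \<in> carrier W"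
  by (auto simp: lin_map_def hom_def)

lemma lin_map_add:
  "\<lbrakk>f \<in> lin_map K V W; u \<in> carrier V; v \<in> carrier V\<rbrakk> \<Longrightarrow> f (u \<oplus>\<^bsub>V\<^esub> v) = f u \<oplus>\<^bsub>W\<^esub> f v"
  by (auto simp: lin_map_def hom_def)

lemma lin_map_smult:
  "\<lbrakk>f \<in> lin_map K V W; a \<in> carrier K; v \<in> carrier V\<rbrakk> \<Longrightarrow> f (a \<odot>\<^bsub>V\<^esub> v) = a \<odot>\<^bsub>W\<^esub> f v"
  by (auto simp: lin_map_def)

lemma lin_map_zero:
  assumes "module K V" "module K W" "f \<in> lin_map K V W"
  shows "f \<zero>\<^bsub>V\<^esub> = \<zero>\<^bsub>W\<^esub>"
proof -
  interpret V: module K V by fact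
  interpret W: module K W by fact
  have "f \<zero>\<^bsub>V\<^esub> = f (\<zero>\<^bsub>K\<^esub> \<odot>\<^bsub>V\<^esub> \<zero>\<^bsub>V\<^esub>)" by simp
  also have "\<dots> = \<zero>\<^bsub>K\<^esub> \<odot>\<^bsub>W\<^esub> f \<zero>\<^bsub>V\<^esub>" by (rule lin_map_smult[OF assms(3)]) auto
  also have "\<dots> = \<zero>\<^bsub>W\<^esub>" using lin_map_closed[OF assms(3)] by simp
  finally show ?thesis .
qed

lemma (in module) uminus_smult: "v \<in> carrier M \<Longrightarrow> \<ominus>\<^bsub>M\<^esub> v = (\<ominus>\<^bsub>R\<^esub> \<one>\<^bsub>R\<^esub>) \<odot>\<^bsub>M\<^esub> v"
  using smult_l_minus[of "\<one>\<^bsub>R\<^esub>" v] by simp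

lemma lin_map_uminus:
  assumes "module K V" "module K W" "f \<in> lin_map K V W" "v \<in> carrier V"
  shows "f (\<ominus>\<^bsub>V\<^esub> v) = \<ominus>\<^bsub>W\<^esub> f v"
proof -
  interpret V: module K V by fact
  interpret W: module K W by fact
  show ?thesis
    using assms lin_map_closed[OF assms(3,4)] lin_map_smult[OF assms(3)]
    by (simp add: V.uminus_smult W.uminus_smult)
qed

lemma lin_map_minus:
  assumes "module K V" "module K W" "f \<in> lin_map K V W" "u \<in> carrier V" "v \<in> carrier V"
  shows "f (u \<ominus>\<^bsub>V\<^esub> v) = f u \<ominus>\<^bsub>W\<^esub> f v"
proof -
  interpret V: module K V by fact
  show ?thesis
    using assms by (simp add: a_minus_def lin_map_add lin_map_uminus)
qed

lemma lin_map_finsum: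
  assumes "module K V" "module K W" "f \<in> lin_map K V W" "finite A" "g \<in> A \<rightarrow> carrier V"
  shows "f (\<Oplus>\<^bsub>V\<^esub>i\<in>A. g i) = (\<Oplus>\<^bsub>W\<^esub>i\<in>A. f (g i))"
proof -
  interpret V: module K V by fact
  interpret W: module K W by fact
  from \<open>finite A\<close> \<open>g \<in> A \<rightarrow> carrier V\<close> show ?thesis
  proof (induction rule: finite_induct)
    case empty then show ?case using lin_map_zero[OF assms(1-3)] by simp
  next
    case (insert x A)
    then have g: "g x \<in> carrier V" "g \<in> A \<rightarrow> carrier V" "(\<lambda>i. f (g i)) \<in> A \<rightarrow> carrier W" "f (g x) \<in> carrier W"
      using lin_map_closed[OF assms(3)] by (auto simp: Pi_iff)
    with insert show ?case
      by (simp add: V.M.finsum_insert W.M.finsum_insert lin_map_add[OF assms(3)])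
  qed
qed

lemma lin_map_id: "(\<lambda>x. x) \<in> lin_map K V V"
  by (rule lin_mapI) simp_all

lemma lin_map_comp:
  "\<lbrakk>f \<in> lin_map K U V; g \<in> lin_map K V W\<rbrakk> \<Longrightarrow> (\<lambda>x. g (f x)) \<in> lin_map K U W"
  by (rule lin_mapI) (simp_all add: lin_map_closed lin_map_add lin_map_smult)

lemma lin_map_plus:
  assumes "module K W" "f \<in> lin_map K V W" "g \<in> lin_map K V W"
  shows "(\<lambda>x. f x \<oplus>\<^bsub>W\<^esub> g x) \<in> lin_map K V W"
proof -
  interpret W: module K W by fact
  note [simp] = lin_map_closed[OF assms(2)] lin_map_closed[OF assms(3)]
  show ?thesis
    by (rule lin_mapI)
      (simp_all add: lin_map_add[OF assms(2)] lin_map_add[OF assms(3)] lin_map_smult[OF assms(2)]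
        lin_map_smult[OF assms(3)] W.smult_r_distr W.M.a_ac)
qed

lemma lin_map_scale:
  assumes "module K W" "f \<in> lin_map K V W" "a \<in> carrier K"
  shows "(\<lambda>x. a \<odot>\<^bsub>W\<^esub> f x) \<in> lin_map K V W"
proof -
  interpret W: module K W by fact
  note [simp] = lin_map_closed[OF assms(2)]
  show ?thesis
    using assms(3) by (intro lin_mapI)
      (simp_all add: lin_map_add[OF assms(2)] lin_map_smult[OF assms(2)] W.smult_r_distr
        flip: W.smult_assoc1, simp_all add: W.R.m_comm)
qed

lemma lin_map_neg:
  assumes "module K W" "f \<in> lin_map K V W"
  shows "(\<lambda>x. \<ominus>\<^bsub>W\<^esub> f x) \<in> lin_map K V W"
proof -
  interpret W: module K W by fact
  note [simp] = lin_map_closed[OF assms(2)]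
  show ?thesis
    by (intro lin_mapI)
      (simp_all add: lin_map_add[OF assms(2)] lin_map_smult[OF assms(2)] W.smult_r_minus W.M.minus_add)
qed

lemma lin_map_const_zero:
  assumes "module K W" shows "(\<lambda>x. \<zero>\<^bsub>W\<^esub>) \<in> lin_map K V W"
proof -
  interpret W: module K W by fact
  show ?thesis by (rule lin_mapI) simp_all
qed

text \<open>\<open>lin_map\<close> constrains values on the carrier only. Replacing a function by
  one that agrees there is needed for functions given by description operators, such as
  \<open>homog_comp\<close> and \<open>tensor_lift\<close>.\<close>

lemma lin_map_cong:
  assumes "module K V" "f \<in> lin_map K V W" "\<And>x. x \<in> carrier V \<Longrightarrow> f x = g x"
  shows "g \<in> lin_map K V W"
proof -
  interpret V: module K V by fact
  show ?thesis
    using lin_map_closed[OF assms(2)] lin_map_add[OF assms(2)] lin_map_smult[OF assms(2)]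
    by (intro lin_mapI) (simp_all flip: assms(3))
qed

lemma lin_map_sum:
  assumes "module K V" "module K W" "finite A" "\<And>i. i \<in> A \<Longrightarrow> f i \<in> lin_map K V W"
  shows "(\<lambda>x. \<Oplus>\<^bsub>W\<^esub>i\<in>A. f i x) \<in> lin_map K V W"
  using assms(3,4)
proof (induction rule: finite_induct)
  case empty
  interpret W: module K W by fact
  show ?case using lin_map_const_zero[OF assms(2)] by (simp add: W.M.finsum_empty)
next
  case (insert i A)
  interpret W: module K W by fact
  have "(\<lambda>x. f i x \<oplus>\<^bsub>W\<^esub> (\<Oplus>\<^bsub>W\<^esub>i\<in>A. f i x)) \<in> lin_map K V W"
    using insert by (intro lin_map_plus[OF assms(2)]) auto
  moreover have "f i x \<oplus>\<^bsub>W\<^esub> (\<Oplus>\<^bsub>W\<^esub>i\<in>A. f i x) = (\<Oplus>\<^bsub>W\<^esub>i\<in>insert i A. f i x)"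
    if "x \<in> carrier V" for x
  proof -
    have "(\<lambda>i. f i x) \<in> A \<rightarrow> carrier W" "f i x \<in> carrier W"
      using insert.prems lin_map_closed that by fastforce+
    with insert.hyps show ?thesis by (simp add: W.M.finsum_insert)
  qed
  ultimately show ?case by (rule lin_map_cong[OF assms(1)])
qed

section \<open>Subspaces and linear spans\<close>

lemma submoduleI':
  assumes "module K V" "H \<subseteq> carrier V" "\<zero>\<^bsub>V\<^esub> \<in> H"
    "\<And>x y. \<lbrakk>x \<in> H; y \<in> H\<rbrakk> \<Longrightarrow> x \<oplus>\<^bsub>V\<^esub> y \<in> H" "\<And>a x. \<lbrakk>a \<in> carrier K; x \<in> H\<rbrakk> \<Longrightarrow> a \<odot>\<^bsub>V\<^esub> x \<in> H"
  shows "submodule H K V"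
proof -
  interpret V: module K V by fact
  show ?thesis
  proof (rule V.submoduleI)
    fix a assume "a \<in> H"
    \<comment> \<open>Negation is multiplication by the scalar -1, so closure under scalars covers
      it.\<close>
    then have "(\<ominus>\<^bsub>K\<^esub> \<one>\<^bsub>K\<^esub>) \<odot>\<^bsub>V\<^esub> a \<in> H" using assms(5) by simp
    with \<open>a \<in> H\<close> assms(2) show "\<ominus>\<^bsub>V\<^esub> a \<in> H" by (simp add: V.uminus_smult subset_iff)
  qed (use assms in auto)
qed

lemma submodule_zero: "submodule H K V \<Longrightarrow> \<zero>\<^bsub>V\<^esub> \<in> H"
  using subgroup.one_closed[of H "add_monoid V"] by (auto simp: submodule_def)

lemma submodule_subset: "submodule H K V \<Longrightarrow> H \<subseteq> carrier V"
  using subgroup.subset[of H "add_monoid V"] by (auto simp: submodule_def)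

lemma submodule_add: "\<lbrakk>submodule H K V; x \<in> H; y \<in> H\<rbrakk> \<Longrightarrow> x \<oplus>\<^bsub>V\<^esub> y \<in> H"
  using subgroup.m_closed[of H "add_monoid V" x y] by (auto simp: submodule_def)

lemma submodule_smult: "\<lbrakk>submodule H K V; a \<in> carrier K; x \<in> H\<rbrakk> \<Longrightarrow> a \<odot>\<^bsub>V\<^esub> x \<in> H"
  by (rule submodule.smult_closed)

lemma submodule_finsum:
  assumes "module K V" "submodule H K V" "finite A" "\<And>i. i \<in> A \<Longrightarrow> f i \<in> H"
  shows "(\<Oplus>\<^bsub>V\<^esub>i\<in>A. f i) \<in> H"
proof -
  interpret V: module K V by fact
  from assms(3,4) show ?thesis
  proof (induction rule: finite_induct)
    case empty then show ?case using submodule_zero[OF assms(2)] by simp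
  next
    case (insert i A)
    moreover have "f \<in> insert i A \<rightarrow> carrier V"
      using insert submodule_subset[OF assms(2)] by auto
    ultimately show ?case by (auto simp: Pi_def submodule_add[OF assms(2)])
  qed
qed

lemma submodule_Inter:
  assumes "module K V" "\<And>H. H \<in> \<H> \<Longrightarrow> submodule H K V" "\<H> \<noteq> {}"
  shows "submodule (\<Inter>\<H>) K V"
proof (rule submoduleI'[OF assms(1)])
  show "\<Inter>\<H> \<subseteq> carrier V" using assms(2,3) submodule_subset by blast
qed (use assms(2) submodule_zero submodule_add submodule_smult in \<open>fastforce+\<close>)

lemma submodule_preimage:
  assumes "module K V" "module K W" "f \<in> lin_map K V W" "submodule H K W"
  shows "submodule {x \<in> carrier V. f x \<in> H} K V"
proof -
  interpret V: module K V by fact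
  show ?thesis
    using assms(4) by (intro submoduleI'[OF assms(1)])
      (auto simp: lin_map_zero[OF assms(1-3)] lin_map_add[OF assms(3)] lin_map_smult[OF assms(3)]
        intro: submodule_zero submodule_add submodule_smult)
qed

text \<open>Inductions over generators use subspaces as predicates; equations between linear maps
  become such predicates through this fact.\<close>

lemma submodule_equalizer:
  assumes "module K V" "module K W" "f \<in> lin_map K V W" "g \<in> lin_map K V W"
  shows "submodule {x \<in> carrier V. f x = g x} K V"
proof -
  interpret V: module K V by fact
  show ?thesis
    by (intro submoduleI'[OF assms(1)])
      (auto simp: lin_map_zero[OF assms(1-3)] lin_map_zero[OF assms(1,2,4)]
        lin_map_add[OF assms(3)] lin_map_smult[OF assms(3)]
        lin_map_add[OF assms(4)] lin_map_smult[OF assms(4)])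
qed

lemma submodule_carrier: "module K V \<Longrightarrow> submodule (carrier V) K V"
  by (rule module.carrier_is_submodule)

lemma lin_span_submodule:
  assumes "module K V" "S \<subseteq> carrier V"
  shows "submodule (lin_span K V S) K V"
  unfolding lin_span_def
  by (rule submodule_Inter) (use assms submodule_carrier in blast)+

lemma lin_span_incl: "S \<subseteq> lin_span K V S"
  by (auto simp: lin_span_def)

lemma lin_span_base: "x \<in> S \<Longrightarrow> x \<in> lin_span K V S"
  by (auto simp: lin_span_def)

lemma lin_span_minimal: "\<lbrakk>submodule H K V; S \<subseteq> H\<rbrakk> \<Longrightarrow> lin_span K V S \<subseteq> H"
  by (auto simp: lin_span_def)

lemma lin_span_map:
  assumes "module K V" "module K W" "f \<in> lin_map K V W" "submodule H K W"
    "\<And>x. x \<in> S \<Longrightarrow> f x \<in> H" "S \<subseteq> carrier V" "x \<in> lin_span K V S"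
  shows "f x \<in> H"
  using lin_span_minimal[OF submodule_preimage[OF assms(1-4)], of S] assms(5-7) by auto

lemma lin_map_eq_on_span:
  assumes "module K V" "module K W" "f \<in> lin_map K V W" "g \<in> lin_map K V W"
    "\<And>x. x \<in> S \<Longrightarrow> f x = g x" "S \<subseteq> carrier V" "x \<in> lin_span K V S"
  shows "f x = g x"
  using lin_span_minimal[OF submodule_equalizer[OF assms(1-4)], of S] assms(5-7) by auto

text \<open>Records such as \<open>free_algebra\<close>, \<open>E_space\<close> and
  \<open>braided_square\<close> add or override fields of a vector space. Being a module depends
  only on the four fields listed, so it passes from one record to the other.\<close>

lemma module_cong:
  assumes "module K V" "carrier W = carrier V" "add W = add V" "zero W = zero V" "smult W = smult V"
  shows "module K W"
proof -
  interpret V: module K V by fact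
  show ?thesis
  proof (rule moduleI)
    show "abelian_group W"
      using V.M.l_neg by (intro abelian_groupI) (auto simp: assms V.M.a_ac)
  qed (auto simp: assms V.smult_l_distr V.smult_r_distr V.smult_assoc1 intro: V.R.is_cring)
qed

lemma lin_map_dom_cong:
  assumes "carrier W = carrier V" "add W = add V" "smult W = smult V"
  shows "lin_map K W U = lin_map K V U"
  by (simp add: lin_map_def hom_def assms)

lemma lin_map_cod_cong:
  assumes "carrier W = carrier V" "add W = add V" "smult W = smult V"
  shows "lin_map K U W = lin_map K U V"
  by (simp add: lin_map_def hom_def assms)

section \<open>Free modules and linear extension from a basis\<close>

definition lin_ext :: "('k, 'r) ring_scheme \<Rightarrow> ('k, 'u, 'm) module_scheme \<Rightarrow> ('x \<Rightarrow> 'u) \<Rightarrow> ('x \<Rightarrow> 'k) \<Rightarrow> 'u"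
  where "lin_ext K U \<phi> f = (\<Oplus>\<^bsub>U\<^esub>x\<in>{x. f x \<noteq> \<zero>\<^bsub>K\<^esub>}. f x \<odot>\<^bsub>U\<^esub> \<phi> x)"

lemma free_module_simps [simp]:
  "zero (free_module K X) = (\<lambda>x. \<zero>\<^bsub>K\<^esub>)"
  "add (free_module K X) = (\<lambda>f g x. f x \<oplus>\<^bsub>K\<^esub> g x)"
  "smult (free_module K X) = (\<lambda>a f x. a \<otimes>\<^bsub>K\<^esub> f x)"
  by (simp_all add: free_module_def)

lemma free_module_carrier:
  "f \<in> carrier (free_module K X) \<longleftrightarrow> (\<forall>x. f x \<in> carrier K) \<and> {x. f x \<noteq> \<zero>\<^bsub>K\<^esub>} \<subseteq> X \<and>
    finite {x. f x \<noteq> \<zero>\<^bsub>K\<^esub>}"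
  by (simp add: free_module_def)

lemma free_module_module:
  assumes "cring K" shows "module K (free_module K X)"
proof -
  interpret K: cring K by fact
  let ?F = "free_module K X"
  \<comment> \<open>The support of a pointwise combination of \<open>f\<close> and \<open>g\<close>
    lies in the union of their supports. One statement serves sums and scalar multiples
    alike.\<close>
  have fin: "finite {x. h x \<noteq> \<zero>\<^bsub>K\<^esub>} \<and> {x. h x \<noteq> \<zero>\<^bsub>K\<^esub>} \<subseteq> X"
    if "f \<in> carrier ?F" "g \<in> carrier ?F" "\<And>x. \<lbrakk>f x = \<zero>\<^bsub>K\<^esub>; g x = \<zero>\<^bsub>K\<^esub>\<rbrakk> \<Longrightarrow> h x = \<zero>\<^bsub>K\<^esub>" for f g h
  proof -
    have "{x. h x \<noteq> \<zero>\<^bsub>K\<^esub>} \<subseteq> {x. f x \<noteq> \<zero>\<^bsub>K\<^esub>} \<union> {x. g x \<noteq> \<zero>\<^bsub>K\<^esub>}" using that(3) by blast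
    then show ?thesis using that(1,2) unfolding free_module_carrier
      by (meson finite_UnI finite_subset le_sup_iff subset_trans Un_least)
  qed
  have add: "(\<lambda>x. f x \<oplus>\<^bsub>K\<^esub> g x) \<in> carrier ?F" if "f \<in> carrier ?F" "g \<in> carrier ?F" for f g
    using fin[OF that, of "\<lambda>x. f x \<oplus>\<^bsub>K\<^esub> g x"] that by (simp add: free_module_carrier)
  have smult: "(\<lambda>x. a \<otimes>\<^bsub>K\<^esub> f x) \<in> carrier ?F" if "f \<in> carrier ?F" "a \<in> carrier K" for f a
    using fin[of f f "\<lambda>x. a \<otimes>\<^bsub>K\<^esub> f x"] that by (simp add: free_module_carrier)
  show ?thesis
  proof (rule moduleI)
    show "abelian_group ?F"
    proof (rule abelian_groupI)
      fix f assume f: "f \<in> carrier ?F"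
      have "(\<lambda>x. (\<ominus>\<^bsub>K\<^esub> \<one>\<^bsub>K\<^esub>) \<otimes>\<^bsub>K\<^esub> f x) \<in> carrier ?F" using f by (intro smult) auto
      moreover have "(\<ominus>\<^bsub>K\<^esub> \<one>\<^bsub>K\<^esub>) \<otimes>\<^bsub>K\<^esub> f x \<oplus>\<^bsub>K\<^esub> f x = \<zero>\<^bsub>K\<^esub>" for x
        using f by (simp add: free_module_carrier K.l_minus K.l_neg)
      ultimately show "\<exists>g\<in>carrier ?F. g \<oplus>\<^bsub>?F\<^esub> f = \<zero>\<^bsub>?F\<^esub>"
        by (intro bexI[of _ "\<lambda>x. (\<ominus>\<^bsub>K\<^esub> \<one>\<^bsub>K\<^esub>) \<otimes>\<^bsub>K\<^esub> f x"]) (auto simp: fun_eq_iff)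
    qed (auto simp: add free_module_carrier[of "\<lambda>x. \<zero>\<^bsub>K\<^esub>"],
        auto simp: free_module_carrier K.a_ac)
  qed (auto simp: assms add smult, auto simp: free_module_carrier K.l_distr K.r_distr K.m_assoc)
qed

lemma basis_vec_closed: "\<lbrakk>cring K; x \<in> X\<rbrakk> \<Longrightarrow> basis_vec K x \<in> carrier (free_module K X)"
proof -
  assume "cring K" "x \<in> X"
  interpret K: cring K by fact
  have "{y. basis_vec K x y \<noteq> \<zero>\<^bsub>K\<^esub>} \<subseteq> {x}" by (auto simp: basis_vec_def)
  with \<open>x \<in> X\<close> show ?thesis
    by (auto simp: free_module_carrier basis_vec_def intro: finite_subset split: if_splits)
qed

text \<open>Induction on the size of the support, splitting off one coefficient at a time.\<close>

lemma free_module_induct [consumes 2, case_names zero step]: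
  assumes "cring K" "f \<in> carrier (free_module K X)" "P \<zero>\<^bsub>free_module K X\<^esub>"
    and "\<And>a x g. \<lbrakk>a \<in> carrier K; x \<in> X; g \<in> carrier (free_module K X); P g\<rbrakk> \<Longrightarrow>
      P (a \<odot>\<^bsub>free_module K X\<^esub> basis_vec K x \<oplus>\<^bsub>free_module K X\<^esub> g)"
  shows "P f"
proof -
  interpret K: cring K by fact
  have "finite {x. f x \<noteq> \<zero>\<^bsub>K\<^esub>}" using assms(2) by (simp add: free_module_carrier)
  then show ?thesis using assms(2)
  proof (induction "{x. f x \<noteq> \<zero>\<^bsub>K\<^esub>}" arbitrary: f rule: finite_induct)
    case empty
    then have "f = \<zero>\<^bsub>free_module K X\<^esub>" by auto
    then show ?case using assms(3) by simp
  next
    case (insert x A)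
    have f: "\<And>y. f y \<in> carrier K" and x: "x \<in> X" and "finite {x. f x \<noteq> \<zero>\<^bsub>K\<^esub>}"
      using insert.prems insert.hyps(4) by (auto simp: free_module_carrier)
    let ?g = "f(x := \<zero>\<^bsub>K\<^esub>)"
    have A: "{y. ?g y \<noteq> \<zero>\<^bsub>K\<^esub>} = A" using insert.hyps(2,4) by auto
    moreover have "?g \<in> carrier (free_module K X)"
      using insert.prems insert.hyps(1,4) unfolding free_module_carrier A by (auto simp: set_eq_iff)
    ultimately have "P (f x \<odot>\<^bsub>free_module K X\<^esub> basis_vec K x \<oplus>\<^bsub>free_module K X\<^esub> ?g)"
      using insert.hyps(3)[of ?g] x f by (intro assms(4)) auto
    also have "f x \<odot>\<^bsub>free_module K X\<^esub> basis_vec K x \<oplus>\<^bsub>free_module K X\<^esub> ?g = f"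
      using f by (auto simp: basis_vec_def fun_eq_iff)
    finally show ?case .
  qed
qed

lemma free_module_span:
  assumes "cring K"
  shows "lin_span K (free_module K X) (basis_vec K ` X) = carrier (free_module K X)"
proof
  note mod = free_module_module[OF assms, of X]
  have sub: "basis_vec K ` X \<subseteq> carrier (free_module K X)" using basis_vec_closed[OF assms] by auto
  note S = lin_span_submodule[OF mod sub]
  show "lin_span K (free_module K X) (basis_vec K ` X) \<subseteq> carrier (free_module K X)"
    by (rule submodule_subset[OF S])
  show "carrier (free_module K X) \<subseteq> lin_span K (free_module K X) (basis_vec K ` X)"
  proof
    fix f assume "f \<in> carrier (free_module K X)"
    from assms this show "f \<in> lin_span K (free_module K X) (basis_vec K ` X)"
    proof (induction rule: free_module_induct)
      case zero show ?case by (rule submodule_zero[OF S])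
    next
      case (step a x g)
      then show ?case
        by (intro submodule_add[OF S] submodule_smult[OF S]) (auto intro: lin_span_base)
    qed
  qed
qed

text \<open>\<open>lin_ext\<close> sums over the support of its argument, which varies with the
  argument. Enlarging the range to a common finite set makes the sums for different vectors
  comparable.\<close>

lemma lin_ext_eq:
  assumes "module K U" "\<phi> \<in> X \<rightarrow> carrier U" "f \<in> carrier (free_module K X)"
    "finite A" "{x. f x \<noteq> \<zero>\<^bsub>K\<^esub>} \<subseteq> A" "A \<subseteq> X"
  shows "lin_ext K U \<phi> f = (\<Oplus>\<^bsub>U\<^esub>x\<in>A. f x \<odot>\<^bsub>U\<^esub> \<phi> x)"
proof -
  interpret U: module K U by fact
  have "\<phi> x \<in> carrier U" if "x \<in> A" for x using assms(2,6) that by blast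
  then show ?thesis unfolding lin_ext_def
    by (intro U.M.add.finprod_mono_neutral_cong_left)
      (use assms in \<open>auto simp: free_module_carrier Pi_iff\<close>)
qed

lemma lin_ext_lin_map:
  assumes "module K U" "\<phi> \<in> X \<rightarrow> carrier U"
  shows "lin_ext K U \<phi> \<in> lin_map K (free_module K X) U"
proof -
  interpret U: module K U by fact
  let ?F = "free_module K X"
  interpret F: module K ?F by (rule free_module_module) (rule U.R.is_cring)
  note eq = lin_ext_eq[OF assms]
  have supp: "finite {x. f x \<noteq> \<zero>\<^bsub>K\<^esub>}" "{x. f x \<noteq> \<zero>\<^bsub>K\<^esub>} \<subseteq> X" "\<And>x. f x \<in> carrier K"
    if "f \<in> carrier ?F" for f using that by (auto simp: free_module_carrier)
  have phi: "\<phi> x \<in> carrier U" if "x \<in> X" for x using assms(2) that by blast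
  show ?thesis
  proof (rule lin_mapI)
    fix f assume f: "f \<in> carrier ?F"
    then show "lin_ext K U \<phi> f \<in> carrier U"
      unfolding lin_ext_def using supp[OF f] phi by (intro U.M.finsum_closed) auto
  next
    fix f g assume f: "f \<in> carrier ?F" and g: "g \<in> carrier ?F"
    let ?A = "{x. f x \<noteq> \<zero>\<^bsub>K\<^esub>} \<union> {x. g x \<noteq> \<zero>\<^bsub>K\<^esub>}"
    have A: "finite ?A" "?A \<subseteq> X" using supp[OF f] supp[OF g] by auto
    have fg: "f \<oplus>\<^bsub>?F\<^esub> g \<in> carrier ?F" using f g by (rule F.M.a_closed)
    have "lin_ext K U \<phi> (f \<oplus>\<^bsub>?F\<^esub> g) = (\<Oplus>\<^bsub>U\<^esub>x\<in>?A. (f \<oplus>\<^bsub>?F\<^esub> g) x \<odot>\<^bsub>U\<^esub> \<phi> x)"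
      by (rule eq[OF fg A(1) _ A(2)]) auto
    also have "\<dots> = (\<Oplus>\<^bsub>U\<^esub>x\<in>?A. f x \<odot>\<^bsub>U\<^esub> \<phi> x \<oplus>\<^bsub>U\<^esub> g x \<odot>\<^bsub>U\<^esub> \<phi> x)"
      using supp(3)[OF f] supp(3)[OF g] phi[OF subsetD[OF A(2)]]
      by (intro U.M.finsum_cong') (auto simp: U.smult_l_distr)
    also have "\<dots> = (\<Oplus>\<^bsub>U\<^esub>x\<in>?A. f x \<odot>\<^bsub>U\<^esub> \<phi> x) \<oplus>\<^bsub>U\<^esub> (\<Oplus>\<^bsub>U\<^esub>x\<in>?A. g x \<odot>\<^bsub>U\<^esub> \<phi> x)"
      using supp(3)[OF f] supp(3)[OF g] phi[OF subsetD[OF A(2)]] by (intro U.M.finsum_addf) auto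
    also have "\<dots> = lin_ext K U \<phi> f \<oplus>\<^bsub>U\<^esub> lin_ext K U \<phi> g"
      using eq[OF f A(1) _ A(2)] eq[OF g A(1) _ A(2)] by auto
    finally show "lin_ext K U \<phi> (f \<oplus>\<^bsub>?F\<^esub> g) = lin_ext K U \<phi> f \<oplus>\<^bsub>U\<^esub> lin_ext K U \<phi> g" .
  next
    fix a f assume a: "a \<in> carrier K" and f: "f \<in> carrier ?F"
    let ?A = "{x. f x \<noteq> \<zero>\<^bsub>K\<^esub>}"
    have A: "finite ?A" "?A \<subseteq> X" using supp[OF f] by auto
    have fg: "a \<odot>\<^bsub>?F\<^esub> f \<in> carrier ?F" using a f by (rule F.smult_closed)
    have "lin_ext K U \<phi> (a \<odot>\<^bsub>?F\<^esub> f) = (\<Oplus>\<^bsub>U\<^esub>x\<in>?A. (a \<odot>\<^bsub>?F\<^esub> f) x \<odot>\<^bsub>U\<^esub> \<phi> x)"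
      using a by (intro eq[OF fg A(1) _ A(2)]) auto
    also have "\<dots> = (\<Oplus>\<^bsub>U\<^esub>x\<in>?A. a \<odot>\<^bsub>U\<^esub> (f x \<odot>\<^bsub>U\<^esub> \<phi> x))"
      using supp[OF f] a phi[OF subsetD[OF A(2)]] by (intro U.M.finsum_cong') (auto simp: U.smult_assoc1)
    also have "\<dots> = a \<odot>\<^bsub>U\<^esub> lin_ext K U \<phi> f"
      unfolding lin_ext_def
      using supp[OF f] a phi[OF subsetD[OF A(2)]] by (intro U.finsum_smult_ldistr[symmetric]) auto
    finally show "lin_ext K U \<phi> (a \<odot>\<^bsub>?F\<^esub> f) = a \<odot>\<^bsub>U\<^esub> lin_ext K U \<phi> f" .
  qed
qed

lemma lin_ext_basis:
  assumes "module K U" "\<phi> x \<in> carrier U"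
  shows "lin_ext K U \<phi> (basis_vec K x) = \<phi> x"
proof -
  interpret U: module K U by fact
  have "lin_ext K U \<phi> (basis_vec K x) = (\<Oplus>\<^bsub>U\<^esub>y\<in>{x}. basis_vec K x y \<odot>\<^bsub>U\<^esub> \<phi> y)"
    using assms by (intro lin_ext_eq[where X = "{x}"])
      (auto simp: basis_vec_closed U.R.is_cring, auto simp: basis_vec_def split: if_splits)
  also have "\<dots> = \<phi> x" using assms by (simp add: basis_vec_def U.M.finsum_insert)
  finally show ?thesis .
qed

section \<open>Quotients\<close>

lemma (in abelian_group) minus_eq_zero_iff:
  assumes "x \<in> carrier G" "y \<in> carrier G" shows "x \<ominus> y = \<zero> \<longleftrightarrow> x = y"
  using assms add.inv_solve_right[of \<zero> x y] by (auto simp: a_minus_def r_neg)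

context
  fixes K :: "('k, 'r) ring_scheme" and A :: "('k, 'v, 'm) module_scheme" and I :: "'v set"
  assumes A: "module K A" and I: "submodule I K A"
begin

interpretation A: module K A by (rule A)

interpretation I: abelian_subgroup I A
  using I by (intro abelian_subgroupI3 additive_subgroupI A.M.abelian_group_axioms)
    (auto simp: submodule_def)

lemma quot_carrier: "carrier (quot A I) = (\<lambda>x. I +>\<^bsub>A\<^esub> x) ` carrier A"
  by (auto simp: quot_def ring.defs module.defs FactRing_def A_RCOSETS_def')

lemma coset_closed: "x \<in> carrier A \<Longrightarrow> I +>\<^bsub>A\<^esub> x \<in> carrier (quot A I)"
  by (simp add: quot_carrier)

lemma coset_mem: "x \<in> carrier A \<Longrightarrow> y \<in> carrier A \<Longrightarrow> y \<in> I +>\<^bsub>A\<^esub> x \<longleftrightarrow> y \<ominus>\<^bsub>A\<^esub> x \<in> I"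
  unfolding a_minus_def by (rule I.a_rcos_module)

lemma coset_subset: "x \<in> carrier A \<Longrightarrow> I +>\<^bsub>A\<^esub> x \<subseteq> carrier A"
  by (rule A.M.a_r_coset_subset_G[OF I.a_subset])

lemma coset_self: "x \<in> carrier A \<Longrightarrow> x \<in> I +>\<^bsub>A\<^esub> x"
  by (rule I.a_rcos_self)

lemma coset_eq_iff:
  assumes "x \<in> carrier A" "y \<in> carrier A"
  shows "I +>\<^bsub>A\<^esub> x = I +>\<^bsub>A\<^esub> y \<longleftrightarrow> x \<ominus>\<^bsub>A\<^esub> y \<in> I"
  using assms coset_mem[of y x] I.a_repr_independence' coset_self by metis

lemma quot_zero: "zero (quot A I) = I +>\<^bsub>A\<^esub> \<zero>\<^bsub>A\<^esub>"
  using A.M.a_coset_add_zero[OF I.a_subset] by (simp add: quot_def ring.defs module.defs FactRing_def)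

lemma coset_add:
  "\<lbrakk>x \<in> carrier A; y \<in> carrier A\<rbrakk> \<Longrightarrow> (I +>\<^bsub>A\<^esub> x) \<oplus>\<^bsub>quot A I\<^esub> (I +>\<^bsub>A\<^esub> y) = I +>\<^bsub>A\<^esub> (x \<oplus>\<^bsub>A\<^esub> y)"
  by (simp add: quot_def ring.defs module.defs FactRing_def I.a_rcos_sum)

text \<open>The scalar multiplication of \<open>quot\<close> is a union over all representatives.
  Two representatives differ by an element of \<open>I\<close>, and so do their multiples, hence the
  union is of one and the same coset.\<close>

lemma coset_smult:
  assumes a: "a \<in> carrier K" and x: "x \<in> carrier A"
  shows "a \<odot>\<^bsub>quot A I\<^esub> (I +>\<^bsub>A\<^esub> x) = I +>\<^bsub>A\<^esub> (a \<odot>\<^bsub>A\<^esub> x)"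
proof -
  have "I +>\<^bsub>A\<^esub> (a \<odot>\<^bsub>A\<^esub> y) = I +>\<^bsub>A\<^esub> (a \<odot>\<^bsub>A\<^esub> x)" if "y \<in> I +>\<^bsub>A\<^esub> x" for y
  proof -
    have y: "y \<in> carrier A" using that coset_subset[OF x] by auto
    have "y \<ominus>\<^bsub>A\<^esub> x \<in> I" using that coset_mem[OF x y] by simp
    then have "a \<odot>\<^bsub>A\<^esub> (y \<ominus>\<^bsub>A\<^esub> x) \<in> I" by (rule submodule_smult[OF I a])
    also have "a \<odot>\<^bsub>A\<^esub> (y \<ominus>\<^bsub>A\<^esub> x) = a \<odot>\<^bsub>A\<^esub> y \<ominus>\<^bsub>A\<^esub> a \<odot>\<^bsub>A\<^esub> x"
      unfolding a_minus_def using a x y by (simp only: A.smult_r_distr A.smult_r_minus A.M.a_inv_closed)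
    finally show ?thesis
      using a x y by (simp only: coset_eq_iff A.smult_closed)
  qed
  then have "(\<Union>y\<in>I +>\<^bsub>A\<^esub> x. I +>\<^bsub>A\<^esub> (a \<odot>\<^bsub>A\<^esub> y)) = I +>\<^bsub>A\<^esub> (a \<odot>\<^bsub>A\<^esub> x)"
    using coset_self[OF x] by blast
  then show ?thesis by (simp only: quot_def ring.defs module.defs module.simps)
qed

lemma quot_module: "module K (quot A I)"
proof (rule moduleI)
  show "abelian_group (quot A I)"
  proof (rule abelian_groupI)
    fix t assume "t \<in> carrier (quot A I)"
    then obtain x where "x \<in> carrier A" "t = I +>\<^bsub>A\<^esub> x" by (auto simp: quot_carrier)
    then show "\<exists>y\<in>carrier (quot A I). y \<oplus>\<^bsub>quot A I\<^esub> t = \<zero>\<^bsub>quot A I\<^esub>"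
      by (intro bexI[of _ "I +>\<^bsub>A\<^esub> (\<ominus>\<^bsub>A\<^esub> x)"]) (auto simp: coset_add quot_zero A.M.l_neg coset_closed)
  qed (auto simp: quot_carrier coset_add quot_zero A.M.a_ac)
qed (auto simp: A.R.is_cring quot_carrier coset_add coset_smult A.smult_l_distr A.smult_r_distr
    A.smult_assoc1)

lemma coset_lin_map: "(\<lambda>x. I +>\<^bsub>A\<^esub> x) \<in> lin_map K A (quot A I)"
  by (rule lin_mapI) (auto simp: coset_add coset_smult coset_closed)

text \<open>A linear map that vanishes on \<open>I\<close> is constant on each coset, so the image
  of a coset is a singleton and \<open>the_elem\<close> returns its value. All maps out of
  quotients, in particular \<open>tensor_lift\<close> and \<open>word_rec\<close>, are built in this
  way.\<close>

lemma quot_lift_coset: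
  assumes "module K U" "f \<in> lin_map K A U" "\<And>x. x \<in> I \<Longrightarrow> f x = \<zero>\<^bsub>U\<^esub>" "x \<in> carrier A"
  shows "the_elem (f ` (I +>\<^bsub>A\<^esub> x)) = f x"
proof -
  interpret U: module K U by fact
  have "f y = f x" if "y \<in> I +>\<^bsub>A\<^esub> x" for y
  proof -
    have y: "y \<in> carrier A" using that coset_subset assms(4) by auto
    have "y \<ominus>\<^bsub>A\<^esub> x \<in> I" using that coset_mem[OF assms(4) y] by simp
    then have "f (y \<ominus>\<^bsub>A\<^esub> x) = \<zero>\<^bsub>U\<^esub>" by (rule assms(3))
    then have "f y \<ominus>\<^bsub>U\<^esub> f x = \<zero>\<^bsub>U\<^esub>"
      by (simp only: lin_map_minus[OF A assms(1,2) y assms(4)])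
    then show ?thesis
      by (simp only: U.M.minus_eq_zero_iff lin_map_closed[OF assms(2) y] lin_map_closed[OF assms(2,4)])
  qed
  then have "f ` (I +>\<^bsub>A\<^esub> x) = {f x}" using coset_self[OF assms(4)] by blast
  then show ?thesis by simp
qed

lemma quot_lift_lin_map:
  assumes "module K U" "f \<in> lin_map K A U" "\<And>x. x \<in> I \<Longrightarrow> f x = \<zero>\<^bsub>U\<^esub>"
  shows "(\<lambda>t. the_elem (f ` t)) \<in> lin_map K (quot A I) U"
  by (rule lin_mapI)
    (auto simp: quot_carrier coset_add coset_smult quot_lift_coset[OF assms] lin_map_closed[OF assms(2)]
      lin_map_add[OF assms(2)] lin_map_smult[OF assms(2)])

end

section \<open>Bilinear maps and tensor products\<close>

definition bilin ::
  "('k, 'r) ring_scheme \<Rightarrow> ('k, 'v, 'm) module_scheme \<Rightarrow> ('k, 'w, 'n) module_scheme \<Rightarrow>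
    ('k, 'u, 'l) module_scheme \<Rightarrow> ('v \<Rightarrow> 'w \<Rightarrow> 'u) \<Rightarrow> bool"
  where "bilin K V W U b \<longleftrightarrow>
    (\<forall>v\<in>carrier V. (\<lambda>w. b v w) \<in> lin_map K W U) \<and> (\<forall>w\<in>carrier W. (\<lambda>v. b v w) \<in> lin_map K V U)"

lemma bilinI:
  assumes "\<And>v. v \<in> carrier V \<Longrightarrow> (\<lambda>w. b v w) \<in> lin_map K W U"
    and "\<And>w. w \<in> carrier W \<Longrightarrow> (\<lambda>v. b v w) \<in> lin_map K V U"
  shows "bilin K V W U b"
  using assms by (auto simp: bilin_def)

lemma bilin_right: "\<lbrakk>bilin K V W U b; v \<in> carrier V\<rbrakk> \<Longrightarrow> (\<lambda>w. b v w) \<in> lin_map K W U"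
  by (auto simp: bilin_def)

lemma bilin_left: "\<lbrakk>bilin K V W U b; w \<in> carrier W\<rbrakk> \<Longrightarrow> (\<lambda>v. b v w) \<in> lin_map K V U"
  by (auto simp: bilin_def)

lemma bilin_closed: "\<lbrakk>bilin K V W U b; v \<in> carrier V; w \<in> carrier W\<rbrakk> \<Longrightarrow> b v w \<in> carrier U"
  using lin_map_closed[OF bilin_right] by fast

lemma bilin_comp:
  assumes "bilin K V W U b" "f \<in> lin_map K V' V" "g \<in> lin_map K W' W"
  shows "bilin K V' W' U (\<lambda>v w. b (f v) (g w))"
  using lin_map_comp[OF assms(2) bilin_left[OF assms(1)]] lin_map_comp[OF assms(3) bilin_right[OF assms(1)]]
    lin_map_closed[OF assms(2)] lin_map_closed[OF assms(3)]
  by (intro bilinI) auto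

lemma bilin_post:
  assumes "bilin K V W U b" "f \<in> lin_map K U U'"
  shows "bilin K V W U' (\<lambda>v w. f (b v w))"
  using lin_map_comp[OF bilin_left[OF assms(1)] assms(2)] lin_map_comp[OF bilin_right[OF assms(1)] assms(2)]
  by (intro bilinI) auto

lemma bilin_plus:
  assumes "module K U" "bilin K V W U b" "bilin K V W U c"
  shows "bilin K V W U (\<lambda>v w. b v w \<oplus>\<^bsub>U\<^esub> c v w)"
  by (intro bilinI lin_map_plus[OF assms(1)] bilin_left[OF assms(2)] bilin_left[OF assms(3)]
      bilin_right[OF assms(2)] bilin_right[OF assms(3)])

lemma bilin_swap: "bilin K V W U b \<Longrightarrow> bilin K W V U (\<lambda>w v. b v w)"
  by (auto simp: bilin_def)

text \<open>The target \<open>U\<close> of the linear form is any record that shares carrier,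
  addition and scalar multiplication with \<open>K\<close>: the counit lands in
  \<open>crossed_unit\<close>, the coefficient forms on the group algebra in an ad hoc
  record.\<close>

lemma bilin_smult:
  assumes "module K V" "f \<in> lin_map K W U" "carrier U = carrier K" "add U = add K" "smult U = mult K"
  shows "bilin K W V V (\<lambda>w v. f w \<odot>\<^bsub>V\<^esub> v)"
proof -
  interpret V: module K V by fact
  have f: "f w \<in> carrier K" if "w \<in> carrier W" for w using lin_map_closed[OF assms(2) that] assms(3) by simp
  show ?thesis
  proof (intro bilinI lin_mapI)
    fix w a v assume "w \<in> carrier W" "a \<in> carrier K" "v \<in> carrier V"
    then show "f w \<odot>\<^bsub>V\<^esub> (a \<odot>\<^bsub>V\<^esub> v) = a \<odot>\<^bsub>V\<^esub> (f w \<odot>\<^bsub>V\<^esub> v)"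
      using f V.smult_assoc1[of a "f w" v] V.smult_assoc1[of "f w" a v] V.R.m_comm[of a "f w"] by simp
  qed (simp_all add: f V.smult_r_distr V.smult_l_distr V.smult_assoc1
      lin_map_add[OF assms(2)] lin_map_smult[OF assms(2)] assms(4,5))
qed

text \<open>One argument at a time: with the left argument in \<open>S\<close> both sides are linear
  in the right one, and once the right argument is arbitrary they are linear in the left
  one.\<close>

lemma bilin_eq_on_span:
  assumes "module K V" "module K W" "module K U" "bilin K V W U b" "bilin K V W U c"
    and "lin_span K V S = carrier V" "lin_span K W T = carrier W"
    and "\<And>s t. \<lbrakk>s \<in> S; t \<in> T\<rbrakk> \<Longrightarrow> b s t = c s t"
    and "v \<in> carrier V" "w \<in> carrier W"
  shows "b v w = c v w"
proof -
  have S: "S \<subseteq> carrier V" and T: "T \<subseteq> carrier W"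
    using lin_span_incl[of S K V] lin_span_incl[of T K W] assms(6,7) by simp_all
  have "b s w = c s w" if "s \<in> S" for s
  proof -
    have s: "s \<in> carrier V" using that S by blast
    show ?thesis
      using lin_map_eq_on_span[OF assms(2,3) bilin_right[OF assms(4) s] bilin_right[OF assms(5) s]
        assms(8)[OF that] T] assms(7,10) by simp
  qed
  then show ?thesis
    using lin_map_eq_on_span[OF assms(1,3) bilin_left[OF assms(4,10)] bilin_left[OF assms(5,10)] _ S]
      assms(6,9) by simp
qed

text \<open>Exhibits \<open>tensor_lift\<close> as a linear extension pushed down to a quotient, the
  form to which \<open>quot_lift_coset\<close> and \<open>quot_lift_lin_map\<close> apply.\<close>

lemma tensor_lift_eq: "tensor_lift K U b t = the_elem (lin_ext K U (\<lambda>p. b (fst p) (snd p)) ` t)"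
  by (simp add: tensor_lift_def lin_ext_def[abs_def])

context
  fixes K :: "('k, 'r) ring_scheme" and V :: "('k, 'v, 'm) module_scheme" and W :: "('k, 'w, 'n) module_scheme"
  assumes V: "module K V" and W: "module K W"
begin

interpretation V: module K V by (rule V)
interpretation W: module K W by (rule W)

abbreviation (input) "free_VW \<equiv> free_module K (carrier V \<times> carrier W)"

lemma free_pairs_module: "module K free_VW"
  by (rule free_module_module[OF V.R.is_cring])

interpretation F: module K free_VW by (rule free_pairs_module)

lemma basis_pair: "\<lbrakk>v \<in> carrier V; w \<in> carrier W\<rbrakk> \<Longrightarrow> basis_vec K (v, w) \<in> carrier free_VW"
  by (rule basis_vec_closed[OF V.R.is_cring]) auto

lemma tensor_rels_subset: "tensor_rels K V W \<subseteq> carrier free_VW"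
  unfolding tensor_rels_def Let_def
  by (auto simp del: free_module_simps intro!: F.M.minus_closed F.M.a_closed F.smult_closed basis_pair)

lemma tensor_null_submodule: "submodule (tensor_null K V W) K free_VW"
  unfolding tensor_null_def by (rule lin_span_submodule[OF free_pairs_module tensor_rels_subset])

lemma tensor_module: "module K (tensor K V W)"
  unfolding tensor_def by (rule quot_module[OF free_pairs_module tensor_null_submodule])

interpretation T: module K "tensor K V W" by (rule tensor_module)

text \<open>Each equation is an equality of cosets, and the difference of the two representatives is
  literally one of the elements of \<open>tensor_rels\<close>.\<close>

lemma pure_bilin: "bilin K V W (tensor K V W) (pure K V W)"
proof -
  note cs = coset_closed[OF free_pairs_module tensor_null_submodule]
    coset_add[OF free_pairs_module tensor_null_submodule]
    coset_smult[OF free_pairs_module tensor_null_submodule]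
    coset_eq_iff[OF free_pairs_module tensor_null_submodule]
  have rels: "x \<in> tensor_null K V W" if "x \<in> tensor_rels K V W" for x
    using that lin_span_base unfolding tensor_null_def by metis
  show ?thesis
  proof (intro bilinI lin_mapI; unfold pure_def tensor_def)
  qed (auto simp del: free_module_simps simp: cs basis_pair
      intro!: rels, auto simp: tensor_rels_def Let_def simp del: free_module_simps)
qed

lemma pure_closed: "\<lbrakk>v \<in> carrier V; w \<in> carrier W\<rbrakk> \<Longrightarrow> pure K V W v w \<in> carrier (tensor K V W)"
  by (rule bilin_closed[OF pure_bilin])

text \<open>Zero and scalar multiples need no cases of their own, since the zero tensor is the pure
  tensor of zeros and a scalar multiple of a pure tensor is again pure.\<close>

lemma tensor_induct [consumes 1, case_names pure add]:
  assumes "t \<in> carrier (tensor K V W)"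
    and pure: "\<And>v w. \<lbrakk>v \<in> carrier V; w \<in> carrier W\<rbrakk> \<Longrightarrow> P (pure K V W v w)"
    and add: "\<And>s t. \<lbrakk>s \<in> carrier (tensor K V W); t \<in> carrier (tensor K V W); P s; P t\<rbrakk> \<Longrightarrow>
      P (s \<oplus>\<^bsub>tensor K V W\<^esub> t)"
  shows "P t"
proof -
  note cs = coset_lin_map[OF free_pairs_module tensor_null_submodule]
  obtain f where f: "f \<in> carrier free_VW" "t = tensor_null K V W +>\<^bsub>free_VW\<^esub> f"
    using assms(1) quot_carrier[OF free_pairs_module tensor_null_submodule] by (auto simp: tensor_def)
  have "P (tensor_null K V W +>\<^bsub>free_VW\<^esub> f)" using V.R.is_cring f(1)
  proof (induction rule: free_module_induct)
    case zero
    have "tensor_null K V W +>\<^bsub>free_VW\<^esub> \<zero>\<^bsub>free_VW\<^esub> = \<zero>\<^bsub>tensor K V W\<^esub>"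
      by (rule quot_zero[OF free_pairs_module tensor_null_submodule, symmetric, folded tensor_def])
    also have "\<dots> = pure K V W \<zero>\<^bsub>V\<^esub> \<zero>\<^bsub>W\<^esub>"
      by (rule lin_map_zero[OF W tensor_module bilin_right[OF pure_bilin], symmetric]) simp
    finally show ?case using pure by simp
  next
    case (step a x g)
    obtain v w where x: "x = (v, w)" "v \<in> carrier V" "w \<in> carrier W" using step(2) by auto
    have "tensor_null K V W +>\<^bsub>free_VW\<^esub> (a \<odot>\<^bsub>free_VW\<^esub> basis_vec K x \<oplus>\<^bsub>free_VW\<^esub> g) =
       a \<odot>\<^bsub>tensor K V W\<^esub> pure K V W v w \<oplus>\<^bsub>tensor K V W\<^esub> (tensor_null K V W +>\<^bsub>free_VW\<^esub> g)"
      using step(1,3) x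
      by (simp del: free_module_simps add: lin_map_add[OF cs] lin_map_smult[OF cs] basis_pair pure_def
          flip: tensor_def)
    also have "a \<odot>\<^bsub>tensor K V W\<^esub> pure K V W v w = pure K V W (a \<odot>\<^bsub>V\<^esub> v) w"
      using lin_map_smult[OF bilin_left[OF pure_bilin x(3)] step(1) x(2)] by simp
    finally show ?case
      using step(1,3,4) x by (auto simp del: free_module_simps
        intro!: add pure pure_closed lin_map_closed[OF cs, folded tensor_def])
  qed
  with f show ?thesis by simp
qed

lemma tensor_eqI:
  assumes "module K U" "f \<in> lin_map K (tensor K V W) U" "g \<in> lin_map K (tensor K V W) U"
    and "\<And>v w. \<lbrakk>v \<in> carrier V; w \<in> carrier W\<rbrakk> \<Longrightarrow> f (pure K V W v w) = g (pure K V W v w)"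
    and "t \<in> carrier (tensor K V W)"
  shows "f t = g t"
  using assms(5) by (induction rule: tensor_induct)
    (simp_all add: assms(4) lin_map_add[OF assms(2)] lin_map_add[OF assms(3)])

text \<open>For equations that can be computed only on special factors: homogeneous elements for the
  braided product, basis elements for the braiding on \<open>E_space\<close>.\<close>

lemma tensor_eqI_span:
  assumes "module K U" "f \<in> lin_map K (tensor K V W) U" "g \<in> lin_map K (tensor K V W) U"
    and "lin_span K V S = carrier V" "lin_span K W T = carrier W"
    and "\<And>v w. \<lbrakk>v \<in> S; w \<in> T\<rbrakk> \<Longrightarrow> f (pure K V W v w) = g (pure K V W v w)"
    and "t \<in> carrier (tensor K V W)"
  shows "f t = g t"
proof (rule tensor_eqI[OF assms(1-3) _ assms(7)])
  fix v w assume "v \<in> carrier V" "w \<in> carrier W"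
  then show "f (pure K V W v w) = g (pure K V W v w)"
    using bilin_eq_on_span[OF V W assms(1) bilin_post[OF pure_bilin assms(2)]
        bilin_post[OF pure_bilin assms(3)] assms(4,5)] assms(6) by blast
qed

context
  fixes U :: "('k, 'u, 'l) module_scheme" and b
  assumes U: "module K U" and b: "bilin K V W U b"
begin

interpretation U: module K U by (rule U)

lemma lin_ext_pairs: "lin_ext K U (\<lambda>p. b (fst p) (snd p)) \<in> lin_map K free_VW U"
  by (rule lin_ext_lin_map[OF U]) (auto intro: bilin_closed[OF b])

lemma lin_ext_basis_pair:
  "\<lbrakk>v \<in> carrier V; w \<in> carrier W\<rbrakk> \<Longrightarrow> lin_ext K U (\<lambda>p. b (fst p) (snd p)) (basis_vec K (v, w)) = b v w"
  using lin_ext_basis[OF U, of "\<lambda>p. b (fst p) (snd p)" "(v, w)"] bilin_closed[OF b] by simp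

text \<open>The four families of \<open>tensor_rels\<close> are exactly what additivity and
  homogeneity of \<open>b\<close> in each argument send to zero, and vanishing extends from the
  relations to their span.\<close>

lemma lin_ext_tensor_null:
  assumes "x \<in> tensor_null K V W" shows "lin_ext K U (\<lambda>p. b (fst p) (snd p)) x = \<zero>\<^bsub>U\<^esub>"
proof (rule lin_map_eq_on_span[OF free_pairs_module U lin_ext_pairs lin_map_const_zero[OF U] _
      tensor_rels_subset assms[unfolded tensor_null_def]])
  fix x assume "x \<in> tensor_rels K V W"
  then show "lin_ext K U (\<lambda>p. b (fst p) (snd p)) x = \<zero>\<^bsub>U\<^esub>"
    unfolding tensor_rels_def Let_def using bilin_closed[OF b]
    by (auto simp del: free_module_simps
        simp: lin_map_minus[OF free_pairs_module U lin_ext_pairs] lin_map_add[OF lin_ext_pairs]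
          lin_map_smult[OF lin_ext_pairs] basis_pair lin_ext_basis_pair
          lin_map_add[OF bilin_left[OF b]] lin_map_add[OF bilin_right[OF b]]
          lin_map_smult[OF bilin_left[OF b]] lin_map_smult[OF bilin_right[OF b]] U.M.minus_eq_zero_iff)
qed

lemma tensor_lift_lin_map: "tensor_lift K U b \<in> lin_map K (tensor K V W) U"
  unfolding tensor_lift_eq[abs_def] tensor_def
  by (rule quot_lift_lin_map[OF free_pairs_module tensor_null_submodule U lin_ext_pairs lin_ext_tensor_null])

lemma tensor_lift_pure:
  "\<lbrakk>v \<in> carrier V; w \<in> carrier W\<rbrakk> \<Longrightarrow> tensor_lift K U b (pure K V W v w) = b v w"
  unfolding tensor_lift_eq pure_def
  by (subst quot_lift_coset[OF free_pairs_module tensor_null_submodule U lin_ext_pairs lin_ext_tensor_null])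
    (auto simp: basis_pair lin_ext_basis_pair)

end

text \<open>Linearity in a parameter hidden inside the bilinear map. It is clear on pure tensors and
  passes to sums. Nested uses of \<open>tensor_lift\<close>, as in \<open>tensor_assoc\<close> and
  in the braided product, are bilinear for this reason.\<close>

lemma tensor_lift_param:
  assumes "module K D" "module K U" "\<And>d. d \<in> carrier D \<Longrightarrow> bilin K V W U (\<lambda>v w. b d v w)"
    "\<And>v w. \<lbrakk>v \<in> carrier V; w \<in> carrier W\<rbrakk> \<Longrightarrow> (\<lambda>d. b d v w) \<in> lin_map K D U"
    "t \<in> carrier (tensor K V W)"
  shows "(\<lambda>d. tensor_lift K U (\<lambda>v w. b d v w) t) \<in> lin_map K D U"
  using assms(5)
proof (induction rule: tensor_induct)
  case (pure v w)
  show ?case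
    by (rule lin_map_cong[OF assms(1) assms(4)[OF pure]]) (simp add: tensor_lift_pure[OF assms(2,3)] pure)
next
  case (add s t)
  show ?case
    by (rule lin_map_cong[OF assms(1) lin_map_plus[OF assms(2) add(3,4)]])
      (simp add: lin_map_add[OF tensor_lift_lin_map[OF assms(2,3)]] add)
qed

end

lemma tensor_map_lin_map:
  assumes "module K V" "module K W" "module K V'" "module K W'" "f \<in> lin_map K V V'" "g \<in> lin_map K W W'"
  shows "tensor_map K V' W' f g \<in> lin_map K (tensor K V W) (tensor K V' W')"
  unfolding tensor_map_def
  by (rule tensor_lift_lin_map[OF assms(1,2) tensor_module[OF assms(3,4)]
        bilin_comp[OF pure_bilin[OF assms(3,4)] assms(5,6)]])

lemma tensor_map_pure:
  assumes "module K V" "module K W" "module K V'" "module K W'" "f \<in> lin_map K V V'" "g \<in> lin_map K W W'"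
    "v \<in> carrier V" "w \<in> carrier W"
  shows "tensor_map K V' W' f g (pure K V W v w) = pure K V' W' (f v) (g w)"
  unfolding tensor_map_def
  by (rule tensor_lift_pure[OF assms(1,2) tensor_module[OF assms(3,4)]
        bilin_comp[OF pure_bilin[OF assms(3,4)] assms(5,6)] assms(7,8)])

context
  fixes K :: "('k, 'r) ring_scheme" and U :: "('k, 'u, 'l) module_scheme"
    and V :: "('k, 'v, 'm) module_scheme" and W :: "('k, 'w, 'n) module_scheme"
  assumes U: "module K U" and V: "module K V" and W: "module K W"
begin

lemma pure3_bilin:
  "w \<in> carrier W \<Longrightarrow>
    bilin K U V (tensor K U (tensor K V W)) (\<lambda>u v. pure K U (tensor K V W) u (pure K V W v w))"
  by (rule bilin_comp[OF pure_bilin[OF U tensor_module[OF V W]] lin_map_id bilin_left[OF pure_bilin[OF V W]]])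

lemma tensor_assoc_bilin:
  "bilin K (tensor K U V) W (tensor K U (tensor K V W))
    (\<lambda>t w. tensor_lift K (tensor K U (tensor K V W)) (\<lambda>u v. pure K U (tensor K V W) u (pure K V W v w)) t)"
proof (rule bilinI)
  note T = tensor_module[OF U tensor_module[OF V W]]
  fix t assume "t \<in> carrier (tensor K U V)"
  then show "(\<lambda>w. tensor_lift K (tensor K U (tensor K V W)) (\<lambda>u v. pure K U (tensor K V W) u (pure K V W v w)) t)
      \<in> lin_map K W (tensor K U (tensor K V W))"
    by (intro tensor_lift_param[OF U V W T]) (auto intro: pure3_bilin
      lin_map_comp[OF bilin_right[OF pure_bilin[OF V W]] bilin_right[OF pure_bilin[OF U tensor_module[OF V W]]]])
qed (rule tensor_lift_lin_map[OF U V tensor_module[OF U tensor_module[OF V W]] pure3_bilin])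

lemma tensor_assoc_lin_map:
  "tensor_assoc K U V W \<in> lin_map K (tensor K (tensor K U V) W) (tensor K U (tensor K V W))"
  unfolding tensor_assoc_def Let_def
  by (rule tensor_lift_lin_map[OF tensor_module[OF U V] W tensor_module[OF U tensor_module[OF V W]]
        tensor_assoc_bilin])

lemma tensor_assoc_pure:
  assumes "u \<in> carrier U" "v \<in> carrier V" "w \<in> carrier W"
  shows "tensor_assoc K U V W (pure K (tensor K U V) W (pure K U V u v) w) =
    pure K U (tensor K V W) u (pure K V W v w)"
  unfolding tensor_assoc_def Let_def
  using assms pure_closed[OF U V]
  by (simp add: tensor_lift_pure[OF tensor_module[OF U V] W tensor_module[OF U tensor_module[OF V W]]
        tensor_assoc_bilin] tensor_lift_pure[OF U V tensor_module[OF U tensor_module[OF V W]] pure3_bilin])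

end

section \<open>Associative algebras presented by generators and relations\<close>

lemma assoc_algebraI:
  assumes "module K A" "bilin K A A A (mult A)" "\<one>\<^bsub>A\<^esub> \<in> carrier A"
    and "\<And>x y z. \<lbrakk>x \<in> carrier A; y \<in> carrier A; z \<in> carrier A\<rbrakk> \<Longrightarrow> (x \<otimes>\<^bsub>A\<^esub> y) \<otimes>\<^bsub>A\<^esub> z = x \<otimes>\<^bsub>A\<^esub> (y \<otimes>\<^bsub>A\<^esub> z)"
    and "\<And>x. x \<in> carrier A \<Longrightarrow> \<one>\<^bsub>A\<^esub> \<otimes>\<^bsub>A\<^esub> x = x" "\<And>x. x \<in> carrier A \<Longrightarrow> x \<otimes>\<^bsub>A\<^esub> \<one>\<^bsub>A\<^esub> = x"
  shows "assoc_algebra K A"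
proof (intro assoc_algebra.intro assms(1) assoc_algebra_axioms.intro)
  interpret A: module K A by fact
  note l = bilin_left[OF assms(2)] and r = bilin_right[OF assms(2)]
  show "ring A"
    by (rule ringI[OF A.M.abelian_group_axioms])
      (auto intro!: monoidI simp: assms bilin_closed[OF assms(2)] lin_map_add[OF l] lin_map_add[OF r])
qed (auto simp: lin_map_smult[OF bilin_left[OF assms(2)]] lin_map_smult[OF bilin_right[OF assms(2)]])

lemma (in assoc_algebra) assoc_algebra: "assoc_algebra R M"
  by (rule assoc_algebra_axioms)

lemma assoc_algebra_module: "assoc_algebra K A \<Longrightarrow> module K A"
  by (simp add: assoc_algebra_def)

lemma mult_bilin:
  assumes "assoc_algebra K A" shows "bilin K A A A (mult A)"
proof -
  interpret assoc_algebra K A by fact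
  show ?thesis
    by (intro bilinI lin_mapI) (simp_all add: smult_mult_left smult_mult_right l_distr r_distr)
qed

lemma mult_left_lin_map:
  "\<lbrakk>assoc_algebra K A; a \<in> carrier A\<rbrakk> \<Longrightarrow> (\<lambda>x. a \<otimes>\<^bsub>A\<^esub> x) \<in> lin_map K A A"
  by (rule bilin_right[OF mult_bilin])

lemma mult_right_lin_map:
  "\<lbrakk>assoc_algebra K A; a \<in> carrier A\<rbrakk> \<Longrightarrow> (\<lambda>x. x \<otimes>\<^bsub>A\<^esub> a) \<in> lin_map K A A"
  by (rule bilin_left[OF mult_bilin])

lemma assoc_algebra_cong:
  assumes "assoc_algebra K A" "carrier B = carrier A" "add B = add A" "zero B = zero A"
    "smult B = smult A" "mult B = mult A" "one B = one A"
  shows "assoc_algebra K B"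
proof -
  interpret A: assoc_algebra K A by fact
  have "lin_map K B B = lin_map K A A"
    by (simp add: lin_map_dom_cong[OF assms(2,3,5)] lin_map_cod_cong[OF assms(2,3,5)])
  then have "bilin K B B B (mult B)"
    using mult_bilin[OF assms(1)] by (simp add: bilin_def assms)
  then show ?thesis
    by (intro assoc_algebraI module_cong[OF assoc_algebra_module[OF assms(1)]])
      (auto simp: assms A.m_assoc)
qed

text \<open>A scalar acts as multiplication by its multiple of the unit, so an ideal absorbs
  scalars.\<close>

lemma ideal_submodule:
  assumes "assoc_algebra K A" "ideal I A" shows "submodule I K A"
proof -
  interpret A: assoc_algebra K A by fact
  interpret I: ideal I A by fact
  show ?thesis
  proof (rule submoduleI'[OF assoc_algebra_module[OF assms(1)]])
    fix a x assume a: "a \<in> carrier K" and x: "x \<in> I"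
    then have "(a \<odot>\<^bsub>A\<^esub> \<one>\<^bsub>A\<^esub>) \<otimes>\<^bsub>A\<^esub> x \<in> I" by (intro I.I_l_closed) auto
    with a x show "a \<odot>\<^bsub>A\<^esub> x \<in> I" by (simp add: A.smult_mult_left)
  qed (use I.a_subset in auto)
qed

lemma coset_mult:
  assumes "ideal I A" "x \<in> carrier A" "y \<in> carrier A"
  shows "(I +>\<^bsub>A\<^esub> x) \<otimes>\<^bsub>quot A I\<^esub> (I +>\<^bsub>A\<^esub> y) = I +>\<^bsub>A\<^esub> (x \<otimes>\<^bsub>A\<^esub> y)"
  using ideal.rcoset_mult_add[OF assms] by (simp add: quot_def ring.defs module.defs FactRing_def)

lemma quot_one: "\<one>\<^bsub>quot A I\<^esub> = I +>\<^bsub>A\<^esub> \<one>\<^bsub>A\<^esub>"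
  by (simp add: quot_def ring.defs module.defs FactRing_def)

lemma quot_assoc_algebra:
  assumes "assoc_algebra K A" "ideal I A" shows "assoc_algebra K (quot A I)"
proof -
  interpret A: assoc_algebra K A by fact
  note sub = assoc_algebra_module[OF assms(1)] ideal_submodule[OF assms]
  note simps = coset_mult[OF assms(2)] coset_add[OF sub] coset_smult[OF sub] quot_one
    A.l_distr A.r_distr A.smult_mult_left A.smult_mult_right A.m_assoc
  show ?thesis
    by (intro assoc_algebraI quot_module[OF sub] bilinI lin_mapI)
      (auto simp: quot_carrier[OF sub] simps)
qed

lemma genideal_coset_zero:
  assumes "assoc_algebra K A" "S \<subseteq> carrier A" "x \<in> S"
  shows "Idl\<^bsub>A\<^esub> S +>\<^bsub>A\<^esub> x = \<zero>\<^bsub>quot A (Idl\<^bsub>A\<^esub> S)\<^esub>"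
proof -
  interpret A: assoc_algebra K A by fact
  note I = A.genideal_ideal[OF assms(2)]
  note sub = assoc_algebra_module[OF assms(1)] ideal_submodule[OF assms(1) I]
  have "x \<ominus>\<^bsub>A\<^esub> \<zero>\<^bsub>A\<^esub> = x" using assms(2,3) by (auto simp: a_minus_def)
  then have "x \<ominus>\<^bsub>A\<^esub> \<zero>\<^bsub>A\<^esub> \<in> Idl\<^bsub>A\<^esub> S" using A.genideal_self[OF assms(2)] assms(3) by auto
  then show ?thesis
    using assms(2,3) by (subst quot_zero[OF sub], subst coset_eq_iff[OF sub]) auto
qed

subsection \<open>The free algebra\<close>

context
  fixes K :: "('k, 'r) ring_scheme" and X :: "'x set"
  assumes K: "cring K"
begin

interpretation K: cring K by (rule K)

abbreviation (input) "FX \<equiv> free_algebra K X"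

lemma free_algebra_simps:
  "carrier FX = carrier (free_module K (lists X))"
  "zero FX = zero (free_module K (lists X))"
  "add FX = add (free_module K (lists X))"
  "smult FX = smult (free_module K (lists X))"
  "\<one>\<^bsub>FX\<^esub> = basis_vec K []"
  "f \<otimes>\<^bsub>FX\<^esub> g = (\<lambda>w. \<Oplus>\<^bsub>K\<^esub>i\<in>{..length w}. f (take i w) \<otimes>\<^bsub>K\<^esub> g (drop i w))"
  by (simp_all add: free_algebra_def)

lemma free_algebra_module: "module K FX"
  by (rule module_cong[OF free_module_module[OF K, of "lists X"]]) (simp_all only: free_algebra_simps)

lemma free_algebra_span: "lin_span K FX (basis_vec K ` lists X) = carrier FX"
proof -
  \<comment> \<open>The predicate \<open>submodule\<close> does not look at \<open>mult\<close> and
    \<open>one\<close>, the fields in which the free algebra differs from the free module on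
    words.\<close>
  have "submodule H K FX \<longleftrightarrow> submodule H K (free_module K (lists X))" for H
    by (simp add: submodule_def subgroup_def submodule_axioms_def free_algebra_simps m_inv_def
        del: free_module_simps)
  then show ?thesis
    using free_module_span[OF K, of "lists X"] by (simp add: lin_span_def free_algebra_simps(1))
qed

lemma basis_word_closed: "w \<in> lists X \<Longrightarrow> basis_vec K w \<in> carrier FX"
  unfolding free_algebra_simps by (rule basis_vec_closed[OF K])

text \<open>In the sum over all ways of cutting \<open>w\<close> in two, only the cut after
  \<open>length u\<close> letters can contribute, and it does so exactly when
  \<open>w = u @ v\<close>. If \<open>w\<close> is shorter than \<open>u\<close>, this cut is out of
  range and every term vanishes.\<close>

lemma basis_word_mult: "basis_vec K u \<otimes>\<^bsub>FX\<^esub> basis_vec K v = basis_vec K (u @ v)"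
proof
  fix w
  have "(basis_vec K u \<otimes>\<^bsub>FX\<^esub> basis_vec K v) w =
    (\<Oplus>\<^bsub>K\<^esub>i\<in>{..length w}. if length u = i then (if w = u @ v then \<one>\<^bsub>K\<^esub> else \<zero>\<^bsub>K\<^esub>) else \<zero>\<^bsub>K\<^esub>)"
    unfolding free_algebra_simps
  proof (rule K.finsum_cong')
    fix i assume "i \<in> {..length w}"
    then have "take i w = u \<and> drop i w = v \<longleftrightarrow> length u = i \<and> w = u @ v" by auto
    then show "basis_vec K u (take i w) \<otimes>\<^bsub>K\<^esub> basis_vec K v (drop i w) =
      (if length u = i then (if w = u @ v then \<one>\<^bsub>K\<^esub> else \<zero>\<^bsub>K\<^esub>) else \<zero>\<^bsub>K\<^esub>)"
      by (auto simp: basis_vec_def)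
  qed auto
  also have "\<dots> = basis_vec K (u @ v) w"
  proof (cases "length u \<le> length w")
    case True
    then show ?thesis
      by (subst K.finsum_singleton) (auto simp: basis_vec_def)
  next
    case False
    then have "(\<Oplus>\<^bsub>K\<^esub>i\<in>{..length w}. if length u = i then (if w = u @ v then \<one>\<^bsub>K\<^esub> else \<zero>\<^bsub>K\<^esub>) else \<zero>\<^bsub>K\<^esub>) =
      (\<Oplus>\<^bsub>K\<^esub>i\<in>{..length w}. \<zero>\<^bsub>K\<^esub>)" by (intro K.finsum_cong') auto
    with False show ?thesis by (auto simp: basis_vec_def)
  qed
  finally show "(basis_vec K u \<otimes>\<^bsub>FX\<^esub> basis_vec K v) w = basis_vec K (u @ v) w" .
qed

text \<open>A word in the support of the product splits into a word from each support, so the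
  support is contained in the finite set of such concatenations.\<close>

lemma free_algebra_mult_closed:
  assumes f: "f \<in> carrier FX" and g: "g \<in> carrier FX" shows "f \<otimes>\<^bsub>FX\<^esub> g \<in> carrier FX"
proof -
  let ?S = "{x. f x \<noteq> \<zero>\<^bsub>K\<^esub>}" and ?T = "{x. g x \<noteq> \<zero>\<^bsub>K\<^esub>}"
  have fg: "\<And>w. f w \<in> carrier K" "\<And>w. g w \<in> carrier K" "finite ?S" "finite ?T" "?S \<subseteq> lists X" "?T \<subseteq> lists X"
    using f g by (auto simp: free_algebra_simps(1) free_module_carrier)
  have "w \<in> (\<lambda>(u, v). u @ v) ` (?S \<times> ?T)" if "(f \<otimes>\<^bsub>FX\<^esub> g) w \<noteq> \<zero>\<^bsub>K\<^esub>" for w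
  proof (rule ccontr)
    assume w: "w \<notin> (\<lambda>(u, v). u @ v) ` (?S \<times> ?T)"
    have "f (take i w) \<otimes>\<^bsub>K\<^esub> g (drop i w) = \<zero>\<^bsub>K\<^esub>" for i
    proof -
      have "f (take i w) = \<zero>\<^bsub>K\<^esub> \<or> g (drop i w) = \<zero>\<^bsub>K\<^esub>"
        using w append_take_drop_id[of i w] by (force simp: image_iff)
      with fg show ?thesis by auto
    qed
    then have "(f \<otimes>\<^bsub>FX\<^esub> g) w = \<zero>\<^bsub>K\<^esub>" unfolding free_algebra_simps by simp
    with that show False by simp
  qed
  then have sub: "{w. (f \<otimes>\<^bsub>FX\<^esub> g) w \<noteq> \<zero>\<^bsub>K\<^esub>} \<subseteq> (\<lambda>(u, v). u @ v) ` (?S \<times> ?T)" by blast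
  also have "\<dots> \<subseteq> lists X"
  proof (rule image_subsetI)
    fix p assume "p \<in> ?S \<times> ?T"
    then have p: "fst p \<in> ?S" "snd p \<in> ?T" by auto
    show "(case p of (u, v) \<Rightarrow> u @ v) \<in> lists X"
      using subsetD[OF fg(5) p(1)] subsetD[OF fg(6) p(2)] by (simp add: case_prod_beta)
  qed
  finally have "{w. (f \<otimes>\<^bsub>FX\<^esub> g) w \<noteq> \<zero>\<^bsub>K\<^esub>} \<subseteq> lists X" .
  moreover have "finite {w. (f \<otimes>\<^bsub>FX\<^esub> g) w \<noteq> \<zero>\<^bsub>K\<^esub>}" using sub fg(3,4) by (meson finite_SigmaI finite_imageI finite_subset)
  moreover have "(f \<otimes>\<^bsub>FX\<^esub> g) w \<in> carrier K" for w
    unfolding free_algebra_simps using fg by (intro K.finsum_closed) auto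
  ultimately show ?thesis by (simp add: free_algebra_simps(1) free_module_carrier)
qed

lemma free_algebra_bilin: "bilin K FX FX FX (mult FX)"
proof (intro bilinI lin_mapI free_algebra_mult_closed)
  have closed: "\<And>f w. f \<in> carrier FX \<Longrightarrow> f w \<in> carrier K"
    by (auto simp: free_algebra_simps(1) free_module_carrier)
  note [simp] = closed free_algebra_simps(2-4,6) fun_eq_iff
  fix f g h a assume f: "f \<in> carrier FX" and g: "g \<in> carrier FX" 
  {
    assume h: "h \<in> carrier FX"
    show "f \<otimes>\<^bsub>FX\<^esub> (g \<oplus>\<^bsub>FX\<^esub> h) = f \<otimes>\<^bsub>FX\<^esub> g \<oplus>\<^bsub>FX\<^esub> f \<otimes>\<^bsub>FX\<^esub> h"
      using f g h by (simp add: K.r_distr K.finsum_addf)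
    show "(g \<oplus>\<^bsub>FX\<^esub> h) \<otimes>\<^bsub>FX\<^esub> f = g \<otimes>\<^bsub>FX\<^esub> f \<oplus>\<^bsub>FX\<^esub> h \<otimes>\<^bsub>FX\<^esub> f"
      using f g h by (simp add: K.l_distr K.finsum_addf)
  }
  assume a: "a \<in> carrier K"
  have 1: "a \<otimes>\<^bsub>K\<^esub> (\<Oplus>\<^bsub>K\<^esub>i\<in>{..length w}. p (take i w) \<otimes>\<^bsub>K\<^esub> q (drop i w)) =
     (\<Oplus>\<^bsub>K\<^esub>i\<in>{..length w}. a \<otimes>\<^bsub>K\<^esub> (p (take i w) \<otimes>\<^bsub>K\<^esub> q (drop i w)))"
    if "p \<in> carrier FX" "q \<in> carrier FX" for p q w
    using that a by (intro K.finsum_rdistr) auto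
  show "f \<otimes>\<^bsub>FX\<^esub> (a \<odot>\<^bsub>FX\<^esub> g) = a \<odot>\<^bsub>FX\<^esub> (f \<otimes>\<^bsub>FX\<^esub> g)"
    using f g a by (simp add: 1 K.m_lcomm)
  show "(a \<odot>\<^bsub>FX\<^esub> g) \<otimes>\<^bsub>FX\<^esub> f = a \<odot>\<^bsub>FX\<^esub> (g \<otimes>\<^bsub>FX\<^esub> f)"
    using f g a by (simp add: 1 K.m_assoc)
qed

lemma free_algebra_eqI:
  assumes "module K U" "f \<in> lin_map K FX U" "g \<in> lin_map K FX U"
    and "\<And>w. w \<in> lists X \<Longrightarrow> f (basis_vec K w) = g (basis_vec K w)" "x \<in> carrier FX"
  shows "f x = g x"
  using lin_map_eq_on_span[OF free_algebra_module assms(1-3), of "basis_vec K ` lists X" x]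
    assms(4,5) free_algebra_span basis_word_closed by auto

text \<open>Associativity is linear in each argument and holds for words by associativity of
  concatenation. The words are replaced by general elements in the order \<open>f\<close>,
  \<open>g\<close>, \<open>h\<close>.\<close>

lemma free_algebra_assoc_algebra: "assoc_algebra K FX"
proof (rule assoc_algebraI[OF free_algebra_module free_algebra_bilin])
  note l = bilin_left[OF free_algebra_bilin] and r = bilin_right[OF free_algebra_bilin]
  note eqI = free_algebra_eqI[OF free_algebra_module]
  show one: "\<one>\<^bsub>FX\<^esub> \<in> carrier FX" unfolding free_algebra_simps(5) by (rule basis_word_closed) simp
  fix f assume f: "f \<in> carrier FX"
  show "\<one>\<^bsub>FX\<^esub> \<otimes>\<^bsub>FX\<^esub> f = f"
    by (rule eqI[OF r[OF one] lin_map_id _ f]) (simp only: free_algebra_simps(5) basis_word_mult append.simps)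
  show "f \<otimes>\<^bsub>FX\<^esub> \<one>\<^bsub>FX\<^esub> = f"
    by (rule eqI[OF l[OF one] lin_map_id _ f]) (simp only: free_algebra_simps(5) basis_word_mult append_Nil2)
  fix g h assume g: "g \<in> carrier FX" and h: "h \<in> carrier FX"
  have 1: "(f \<otimes>\<^bsub>FX\<^esub> basis_vec K v) \<otimes>\<^bsub>FX\<^esub> basis_vec K w = f \<otimes>\<^bsub>FX\<^esub> (basis_vec K v \<otimes>\<^bsub>FX\<^esub> basis_vec K w)"
    if v: "v \<in> lists X" and w: "w \<in> lists X" for v w
    by (rule eqI[OF lin_map_comp[OF l l] l _ f])
      (simp_all only: basis_word_mult append_assoc basis_word_closed v w append_in_lists_conv simp_thms)
  have 2: "(f \<otimes>\<^bsub>FX\<^esub> g) \<otimes>\<^bsub>FX\<^esub> basis_vec K w = f \<otimes>\<^bsub>FX\<^esub> (g \<otimes>\<^bsub>FX\<^esub> basis_vec K w)" if w: "w \<in> lists X" for w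
    by (rule eqI[OF lin_map_comp[OF r[OF f] l[OF basis_word_closed[OF w]]]
          lin_map_comp[OF l[OF basis_word_closed[OF w]] r[OF f]] _ g]) (rule 1[OF _ w])
  show "(f \<otimes>\<^bsub>FX\<^esub> g) \<otimes>\<^bsub>FX\<^esub> h = f \<otimes>\<^bsub>FX\<^esub> (g \<otimes>\<^bsub>FX\<^esub> h)"
    by (rule eqI[OF r[OF free_algebra_mult_closed[OF f g]] lin_map_comp[OF r[OF g] r[OF f]] _ h]) (rule 2)
qed

end

section \<open>Representations of the free algebra and cyclic maps out of its quotients\<close>

definition word_act ::
  "('k, 'r) ring_scheme \<Rightarrow> ('k, 'u, 'm) module_scheme \<Rightarrow> ('x \<Rightarrow> 'u \<Rightarrow> 'u) \<Rightarrow> 'u \<Rightarrow> ('x list \<Rightarrow> 'k) \<Rightarrow> 'u"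
  where "word_act K U \<theta> u = lin_ext K U (\<lambda>w. foldr \<theta> w u)"

text \<open>The map sending a coset to the vector obtained by letting a representative act on
  \<open>u\<close>. In \<open>word_act\<close> the function \<open>foldr\<close> applies the last
  letter first, so prepending a letter applies its operator last, as left multiplication
  should.\<close>

definition word_rec ::
  "('k, 'r) ring_scheme \<Rightarrow> ('k, 'u, 'm) module_scheme \<Rightarrow> ('x \<Rightarrow> 'u \<Rightarrow> 'u) \<Rightarrow> 'u \<Rightarrow> ('x list \<Rightarrow> 'k) set \<Rightarrow> 'u"
  where "word_rec K U \<theta> u t = the_elem (word_act K U \<theta> u ` t)"

context
  fixes K :: "('k, 'r) ring_scheme" and X :: "'x set" and U :: "('k, 'u, 'm) module_scheme" and \<theta>
  assumes U: "module K U" and \<theta>: "\<And>x. x \<in> X \<Longrightarrow> \<theta> x \<in> lin_map K U U"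
begin

interpretation U: module K U by (rule U)

lemma foldr_lin_map: "w \<in> lists X \<Longrightarrow> (\<lambda>u. foldr \<theta> w u) \<in> lin_map K U U"
proof (induction w)
  case (Cons x w)
  then show ?case using lin_map_comp[of "\<lambda>u. foldr \<theta> w u" K U U "\<theta> x" U] \<theta> by simp
qed (simp add: lin_map_id id_def)

lemma word_act_lin_map:
  assumes "u \<in> carrier U" shows "word_act K U \<theta> u \<in> lin_map K (free_algebra K X) U"
proof -
  have "word_act K U \<theta> u \<in> lin_map K (free_module K (lists X)) U"
    unfolding word_act_def
    by (rule lin_ext_lin_map[OF U]) (auto intro!: lin_map_closed[OF foldr_lin_map] assms)
  then show ?thesis
    by (subst lin_map_dom_cong) (simp_all only: free_algebra_simps[OF U.R.is_cring])
qed

lemma word_act_basis: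
  "\<lbrakk>u \<in> carrier U; w \<in> lists X\<rbrakk> \<Longrightarrow> word_act K U \<theta> u (basis_vec K w) = foldr \<theta> w u"
  unfolding word_act_def
  by (rule lin_ext_basis[OF U]) (rule lin_map_closed[OF foldr_lin_map])

text \<open>Each element of the free algebra thus acts as a linear operator. This is needed to
  compare composites of actions and to see that \<open>0\<close> stays \<open>0\<close> under the
  action.\<close>

lemma word_act_param:
  assumes "f \<in> carrier (free_algebra K X)"
  shows "(\<lambda>u. word_act K U \<theta> u f) \<in> lin_map K U U"
proof -
  let ?F = "free_module K (lists X)"
  interpret F: module K ?F by (rule free_module_module[OF U.R.is_cring])
  have "f \<in> carrier ?F" using assms by (simp only: free_algebra_simps[OF U.R.is_cring])
  with U.R.is_cring have "f \<in> carrier ?F \<and> (\<lambda>u. word_act K U \<theta> u f) \<in> lin_map K U U"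
  proof (induction rule: free_module_induct)
    case zero
    have "word_act K U \<theta> u \<zero>\<^bsub>?F\<^esub> = \<zero>\<^bsub>U\<^esub>" for u
      by (simp add: word_act_def lin_ext_def)
    then show ?case by (simp del: free_module_simps add: lin_map_const_zero[OF U])
  next
    case (step a w g)
    note lin = word_act_lin_map[unfolded lin_map_dom_cong[of "free_algebra K X" ?F, OF
      free_algebra_simps(1,3,4)[OF U.R.is_cring]]]
    have "(\<lambda>u. word_act K U \<theta> u (a \<odot>\<^bsub>?F\<^esub> basis_vec K w \<oplus>\<^bsub>?F\<^esub> g)) \<in> lin_map K U U"
    proof (rule lin_map_cong[OF U])
      show "(\<lambda>u. a \<odot>\<^bsub>U\<^esub> foldr \<theta> w u \<oplus>\<^bsub>U\<^esub> word_act K U \<theta> u g) \<in> lin_map K U U"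
        using step by (intro lin_map_plus[OF U] lin_map_scale[OF U] foldr_lin_map) auto
      fix u assume u: "u \<in> carrier U"
      have b: "basis_vec K w \<in> carrier ?F" using step(2) by (rule basis_vec_closed[OF U.R.is_cring])
      show "a \<odot>\<^bsub>U\<^esub> foldr \<theta> w u \<oplus>\<^bsub>U\<^esub> word_act K U \<theta> u g =
        word_act K U \<theta> u (a \<odot>\<^bsub>?F\<^esub> basis_vec K w \<oplus>\<^bsub>?F\<^esub> g)"
        using lin_map_add[OF lin[OF u] F.smult_closed[OF step(1) b] step(3)]
          lin_map_smult[OF lin[OF u] step(1) b] word_act_basis[OF u step(2)] by (simp only:)
    qed
    with step U.R.is_cring show ?case
      by (simp del: free_module_simps add: basis_vec_closed)
  qed
  then show ?thesis ..
qed

text \<open>For two words this is the behaviour of \<open>foldr\<close> on a concatenation. It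
  extends first to arbitrary \<open>g\<close> and then to arbitrary \<open>f\<close>, both sides
  being linear in each.\<close>

lemma word_act_mult:
  assumes "f \<in> carrier (free_algebra K X)" "g \<in> carrier (free_algebra K X)" "u \<in> carrier U"
  shows "word_act K U \<theta> u (f \<otimes>\<^bsub>free_algebra K X\<^esub> g) = word_act K U \<theta> (word_act K U \<theta> u g) f"
proof -
  note K = U.R.is_cring
  note bil = free_algebra_bilin[OF K, of X]
  have 1: "word_act K U \<theta> u (basis_vec K v \<otimes>\<^bsub>free_algebra K X\<^esub> g) = word_act K U \<theta> (word_act K U \<theta> u g) (basis_vec K v)"
    if v: "v \<in> lists X" for v
  proof (rule free_algebra_eqI[OF K U lin_map_comp[OF bilin_right[OF bil] word_act_lin_map]
        lin_map_comp[OF word_act_lin_map word_act_param] _ assms(2)])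
    fix w assume w: "w \<in> lists X"
    show "word_act K U \<theta> u (basis_vec K v \<otimes>\<^bsub>free_algebra K X\<^esub> basis_vec K w) =
      word_act K U \<theta> (word_act K U \<theta> u (basis_vec K w)) (basis_vec K v)"
      using v w assms(3) lin_map_closed[OF foldr_lin_map[OF w] assms(3)]
      by (simp add: basis_word_mult[OF K] word_act_basis)
  qed (use v assms(3) basis_word_closed[OF K v] in auto)
  show ?thesis
    by (rule free_algebra_eqI[OF K U lin_map_comp[OF bilin_left[OF bil] word_act_lin_map]
        word_act_lin_map _ assms(1)])
      (use 1 assms lin_map_closed[OF word_act_lin_map] in auto)
qed

context
  fixes R :: "('x list \<Rightarrow> 'k) set"
  assumes R: "R \<subseteq> carrier (free_algebra K X)"
    and \<theta>_R: "\<And>r u. \<lbrakk>r \<in> R; u \<in> carrier U\<rbrakk> \<Longrightarrow> word_act K U \<theta> u r = \<zero>\<^bsub>U\<^esub>"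
begin

interpretation F: assoc_algebra K "free_algebra K X" by (rule free_algebra_assoc_algebra[OF U.R.is_cring])

lemma word_act_ideal:
  assumes "f \<in> Idl\<^bsub>free_algebra K X\<^esub> R" "u \<in> carrier U"
  shows "word_act K U \<theta> u f = \<zero>\<^bsub>U\<^esub>"
proof -
  \<comment> \<open>\<open>?H\<close> annihilates all of \<open>U\<close>, not just one start
    vector: right multiplication by \<open>g\<close> replaces \<open>u\<close> by the result of
    \<open>g\<close> acting on \<open>u\<close>, so closure on the right requires every
    vector.\<close>
  let ?H = "{f \<in> carrier (free_algebra K X). \<forall>u\<in>carrier U. word_act K U \<theta> u f = \<zero>\<^bsub>U\<^esub>}"
  note mod = assoc_algebra_module[OF F.assoc_algebra]
  note zero = lin_map_zero[OF mod U word_act_lin_map]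
  have "ideal ?H (free_algebra K X)"
  proof (rule idealI)
    show "subgroup ?H (add_monoid (free_algebra K X))"
      by (intro group.subgroupI[OF F.M.a_group])
        (auto simp: lin_map_add[OF word_act_lin_map] lin_map_uminus[OF mod U word_act_lin_map]
          zero simp flip: a_inv_def intro!: exI[of _ "\<zero>\<^bsub>free_algebra K X\<^esub>"])
    fix f g assume f: "f \<in> ?H" and g: "g \<in> carrier (free_algebra K X)"
    then show "g \<otimes>\<^bsub>free_algebra K X\<^esub> f \<in> ?H" "f \<otimes>\<^bsub>free_algebra K X\<^esub> g \<in> ?H"
      using lin_map_closed[OF word_act_lin_map] lin_map_zero[OF U U word_act_param]
      by (auto simp: word_act_mult)
  qed (rule F.ring_axioms)
  moreover have "R \<subseteq> ?H" using R \<theta>_R by auto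
  ultimately have "Idl\<^bsub>free_algebra K X\<^esub> R \<subseteq> ?H" by (rule F.genideal_minimal)
  with assms show ?thesis by auto
qed

lemma word_rec_lin_map:
  assumes "u \<in> carrier U"
  shows "word_rec K U \<theta> u \<in> lin_map K (quot (free_algebra K X) (Idl\<^bsub>free_algebra K X\<^esub> R)) U"
  unfolding word_rec_def[abs_def]
  by (rule quot_lift_lin_map[OF assoc_algebra_module[OF F.assoc_algebra]
        ideal_submodule[OF F.assoc_algebra F.genideal_ideal[OF R]] U word_act_lin_map[OF assms]
        word_act_ideal[OF _ assms]])

lemma word_rec_coset:
  assumes "u \<in> carrier U" "f \<in> carrier (free_algebra K X)"
  shows "word_rec K U \<theta> u (Idl\<^bsub>free_algebra K X\<^esub> R +>\<^bsub>free_algebra K X\<^esub> f) = word_act K U \<theta> u f"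
  unfolding word_rec_def[abs_def]
  by (rule quot_lift_coset[OF assoc_algebra_module[OF F.assoc_algebra]
        ideal_submodule[OF F.assoc_algebra F.genideal_ideal[OF R]] U word_act_lin_map[OF assms(1)]
        word_act_ideal[OF _ assms(1)] assms(2)])

lemma word_rec_one:
  assumes "u \<in> carrier U"
  shows "word_rec K U \<theta> u \<one>\<^bsub>quot (free_algebra K X) (Idl\<^bsub>free_algebra K X\<^esub> R)\<^esub> = u"
  using assms word_act_basis[of u "[]"]
  by (simp add: quot_one word_rec_coset free_algebra_simps(5)[OF U.R.is_cring]
      basis_word_closed[OF U.R.is_cring])

lemma word_rec_mult:
  assumes "u \<in> carrier U" "x \<in> X" "b \<in> carrier (quot (free_algebra K X) (Idl\<^bsub>free_algebra K X\<^esub> R))"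
  shows "word_rec K U \<theta> u
    ((Idl\<^bsub>free_algebra K X\<^esub> R +>\<^bsub>free_algebra K X\<^esub> basis_vec K [x])
      \<otimes>\<^bsub>quot (free_algebra K X) (Idl\<^bsub>free_algebra K X\<^esub> R)\<^esub> b) = \<theta> x (word_rec K U \<theta> u b)"
proof -
  note I = F.genideal_ideal[OF R]
  note sub = assoc_algebra_module[OF F.assoc_algebra] ideal_submodule[OF F.assoc_algebra I]
  obtain f where f: "f \<in> carrier (free_algebra K X)" "b = Idl\<^bsub>free_algebra K X\<^esub> R +>\<^bsub>free_algebra K X\<^esub> f"
    using assms(3) by (auto simp: quot_carrier[OF sub])
  have x: "basis_vec K [x] \<in> carrier (free_algebra K X)"
    using assms(2) by (intro basis_word_closed[OF U.R.is_cring]) auto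
  have "word_act K U \<theta> u f \<in> carrier U" by (rule lin_map_closed[OF word_act_lin_map[OF assms(1)] f(1)])
  then show ?thesis
    unfolding f(2) coset_mult[OF I x f(1)]
    using assms f x by (simp add: word_rec_coset word_act_mult word_act_basis)
qed

end

end

text \<open>The quotient is spanned by cosets of words, and each of these arises from the unit by
  repeated left multiplication with letters.\<close>

lemma presented_induct:
  fixes K :: "('k, 'r) ring_scheme" and X :: "'x set"
  defines "F \<equiv> free_algebra K X"
  assumes K: "cring K" and R: "R \<subseteq> carrier F"
    and H: "submodule H K (quot F (Idl\<^bsub>F\<^esub> R))" "\<one>\<^bsub>quot F (Idl\<^bsub>F\<^esub> R)\<^esub> \<in> H"
    and step: "\<And>x b. \<lbrakk>x \<in> X; b \<in> H\<rbrakk> \<Longrightarrow> (Idl\<^bsub>F\<^esub> R +>\<^bsub>F\<^esub> basis_vec K [x]) \<otimes>\<^bsub>quot F (Idl\<^bsub>F\<^esub> R)\<^esub> b \<in> H"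
    and "b \<in> carrier (quot F (Idl\<^bsub>F\<^esub> R))"
  shows "b \<in> H"
proof -
  interpret F: assoc_algebra K F unfolding F_def by (rule free_algebra_assoc_algebra[OF K])
  note I = F.genideal_ideal[OF R]
  note sub = assoc_algebra_module[OF F.assoc_algebra] ideal_submodule[OF F.assoc_algebra I]
  obtain f where f: "f \<in> carrier F" "b = Idl\<^bsub>F\<^esub> R +>\<^bsub>F\<^esub> f"
    using \<open>b \<in> _\<close> by (auto simp: quot_carrier[OF sub])
  have word: "Idl\<^bsub>F\<^esub> R +>\<^bsub>F\<^esub> basis_vec K w \<in> H" if "w \<in> lists X" for w
    using that
  proof (induction w)
    case Nil then show ?case using H(2) by (simp add: quot_one F_def free_algebra_simps(5)[OF K])
  next
    case (Cons x w)
    then have xw: "basis_vec K [x] \<in> carrier F" "basis_vec K w \<in> carrier F"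
      unfolding F_def by (auto intro: basis_word_closed[OF K])
    have "basis_vec K (x # w) = basis_vec K [x] \<otimes>\<^bsub>F\<^esub> basis_vec K w"
      unfolding F_def basis_word_mult[OF K] by simp
    then have "Idl\<^bsub>F\<^esub> R +>\<^bsub>F\<^esub> basis_vec K (x # w) =
      (Idl\<^bsub>F\<^esub> R +>\<^bsub>F\<^esub> basis_vec K [x]) \<otimes>\<^bsub>quot F (Idl\<^bsub>F\<^esub> R)\<^esub> (Idl\<^bsub>F\<^esub> R +>\<^bsub>F\<^esub> basis_vec K w)"
      by (simp only: coset_mult[OF I xw])
    with Cons step show ?case by auto
  qed
  show ?thesis
    unfolding f(2)
  proof (rule lin_span_map[OF sub(1) quot_module[OF sub] coset_lin_map[OF sub] H(1)])
    show "f \<in> lin_span K F (basis_vec K ` lists X)"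
      using f(1) unfolding F_def free_algebra_span[OF K] .
  qed (use word basis_word_closed[OF K, of _ X] in \<open>auto simp: F_def\<close>)
qed

section \<open>The Fomin--Kirillov algebra as a universal object\<close>

lemma FK_letters_iff: "(i, j) \<in> FK_letters N \<longleftrightarrow> i \<in> {1..N} \<and> j \<in> {1..N} \<and> i \<noteq> j"
  by (simp add: FK_letters_def)

definition FK_ops ::
  "('k, 'r) ring_scheme \<Rightarrow> nat \<Rightarrow> ('k, 'u, 'm) module_scheme \<Rightarrow> (nat \<times> nat \<Rightarrow> 'u \<Rightarrow> 'u) \<Rightarrow> bool"
  where "FK_ops K N U \<theta> \<longleftrightarrow>
    (\<forall>p\<in>FK_letters N. \<theta> p \<in> lin_map K U U) \<and>
    (\<forall>i j. (i, j) \<in> FK_letters N \<longrightarrow> (\<forall>u\<in>carrier U. \<theta> (i, j) u \<oplus>\<^bsub>U\<^esub> \<theta> (j, i) u = \<zero>\<^bsub>U\<^esub>)) \<and>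
    (\<forall>i j. (i, j) \<in> FK_letters N \<longrightarrow> (\<forall>u\<in>carrier U. \<theta> (i, j) (\<theta> (i, j) u) = \<zero>\<^bsub>U\<^esub>)) \<and>
    (\<forall>i j k m. {i, j, k, m} \<subseteq> {1..N} \<and> distinct [i, j, k, m] \<longrightarrow>
      (\<forall>u\<in>carrier U. \<theta> (i, j) (\<theta> (k, m) u) = \<theta> (k, m) (\<theta> (i, j) u))) \<and>
    (\<forall>i j k. {i, j, k} \<subseteq> {1..N} \<and> distinct [i, j, k] \<longrightarrow>
      (\<forall>u\<in>carrier U. \<theta> (i, j) (\<theta> (j, k) u) \<oplus>\<^bsub>U\<^esub> \<theta> (j, k) (\<theta> (k, i) u) \<oplus>\<^bsub>U\<^esub> \<theta> (k, i) (\<theta> (i, j) u) = \<zero>\<^bsub>U\<^esub>))"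

lemma FK_opsI:
  assumes "\<And>i j. (i, j) \<in> FK_letters N \<Longrightarrow> \<theta> (i, j) \<in> lin_map K U U"
    and "\<And>i j u. \<lbrakk>(i, j) \<in> FK_letters N; u \<in> carrier U\<rbrakk> \<Longrightarrow> \<theta> (i, j) u \<oplus>\<^bsub>U\<^esub> \<theta> (j, i) u = \<zero>\<^bsub>U\<^esub>"
    and "\<And>i j u. \<lbrakk>(i, j) \<in> FK_letters N; u \<in> carrier U\<rbrakk> \<Longrightarrow> \<theta> (i, j) (\<theta> (i, j) u) = \<zero>\<^bsub>U\<^esub>"
    and "\<And>i j k m u. \<lbrakk>{i, j, k, m} \<subseteq> {1..N}; distinct [i, j, k, m]; u \<in> carrier U\<rbrakk> \<Longrightarrow>
      \<theta> (i, j) (\<theta> (k, m) u) = \<theta> (k, m) (\<theta> (i, j) u)"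
    and "\<And>i j k u. \<lbrakk>{i, j, k} \<subseteq> {1..N}; distinct [i, j, k]; u \<in> carrier U\<rbrakk> \<Longrightarrow>
      \<theta> (i, j) (\<theta> (j, k) u) \<oplus>\<^bsub>U\<^esub> \<theta> (j, k) (\<theta> (k, i) u) \<oplus>\<^bsub>U\<^esub> \<theta> (k, i) (\<theta> (i, j) u) = \<zero>\<^bsub>U\<^esub>"
  shows "FK_ops K N U \<theta>"
proof -
  have 1: "\<theta> p \<in> lin_map K U U" if "p \<in> FK_letters N" for p
    using assms(1)[of "fst p" "snd p"] that by simp
  show ?thesis
    unfolding FK_ops_def
    by (intro conjI ballI allI impI; (elim conjE)?; (rule 1 assms(2-5); assumption))
qed

lemma FK_opsD:
  assumes "FK_ops K N U \<theta>"
  shows "p \<in> FK_letters N \<Longrightarrow> \<theta> p \<in> lin_map K U U"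
    and "\<lbrakk>(i, j) \<in> FK_letters N; u \<in> carrier U\<rbrakk> \<Longrightarrow> \<theta> (i, j) u \<oplus>\<^bsub>U\<^esub> \<theta> (j, i) u = \<zero>\<^bsub>U\<^esub>"
    and "\<lbrakk>(i, j) \<in> FK_letters N; u \<in> carrier U\<rbrakk> \<Longrightarrow> \<theta> (i, j) (\<theta> (i, j) u) = \<zero>\<^bsub>U\<^esub>"
    and "\<lbrakk>{i, j, k, m} \<subseteq> {1..N}; distinct [i, j, k, m]; u \<in> carrier U\<rbrakk> \<Longrightarrow>
      \<theta> (i, j) (\<theta> (k, m) u) = \<theta> (k, m) (\<theta> (i, j) u)"
    and "\<lbrakk>{i, j, k} \<subseteq> {1..N}; distinct [i, j, k]; u \<in> carrier U\<rbrakk> \<Longrightarrow>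
      \<theta> (i, j) (\<theta> (j, k) u) \<oplus>\<^bsub>U\<^esub> \<theta> (j, k) (\<theta> (k, i) u) \<oplus>\<^bsub>U\<^esub> \<theta> (k, i) (\<theta> (i, j) u) = \<zero>\<^bsub>U\<^esub>"
  using assms by (simp_all add: FK_ops_def)

text \<open>The counterpart of \<open>FK_ops\<close> for targets already known to be associative
  algebras, namely the Fomin-Kirillov algebra itself and the quotient of the tensor algebra. Left
  multiplication by such elements gives operators.\<close>

definition FK_elems ::
  "('k, 'r) ring_scheme \<Rightarrow> nat \<Rightarrow> ('k, 'u, 'm) module_scheme \<Rightarrow> (nat \<times> nat \<Rightarrow> 'u) \<Rightarrow> bool"
  where "FK_elems K N A y \<longleftrightarrow>
    (\<forall>p\<in>FK_letters N. y p \<in> carrier A) \<and>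
    (\<forall>i j. (i, j) \<in> FK_letters N \<longrightarrow> y (i, j) \<oplus>\<^bsub>A\<^esub> y (j, i) = \<zero>\<^bsub>A\<^esub>) \<and>
    (\<forall>i j. (i, j) \<in> FK_letters N \<longrightarrow> y (i, j) \<otimes>\<^bsub>A\<^esub> y (i, j) = \<zero>\<^bsub>A\<^esub>) \<and>
    (\<forall>i j k m. {i, j, k, m} \<subseteq> {1..N} \<and> distinct [i, j, k, m] \<longrightarrow>
      y (i, j) \<otimes>\<^bsub>A\<^esub> y (k, m) = y (k, m) \<otimes>\<^bsub>A\<^esub> y (i, j)) \<and>
    (\<forall>i j k. {i, j, k} \<subseteq> {1..N} \<and> distinct [i, j, k] \<longrightarrow>
      y (i, j) \<otimes>\<^bsub>A\<^esub> y (j, k) \<oplus>\<^bsub>A\<^esub> y (j, k) \<otimes>\<^bsub>A\<^esub> y (k, i) \<oplus>\<^bsub>A\<^esub> y (k, i) \<otimes>\<^bsub>A\<^esub> y (i, j) = \<zero>\<^bsub>A\<^esub>)"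

lemma FK_elemsD:
  assumes "FK_elems K N A y"
  shows "p \<in> FK_letters N \<Longrightarrow> y p \<in> carrier A"
    and "(i, j) \<in> FK_letters N \<Longrightarrow> y (i, j) \<oplus>\<^bsub>A\<^esub> y (j, i) = \<zero>\<^bsub>A\<^esub>"
    and "(i, j) \<in> FK_letters N \<Longrightarrow> y (i, j) \<otimes>\<^bsub>A\<^esub> y (i, j) = \<zero>\<^bsub>A\<^esub>"
    and "\<lbrakk>{i, j, k, m} \<subseteq> {1..N}; distinct [i, j, k, m]\<rbrakk> \<Longrightarrow>
      y (i, j) \<otimes>\<^bsub>A\<^esub> y (k, m) = y (k, m) \<otimes>\<^bsub>A\<^esub> y (i, j)"
    and "\<lbrakk>{i, j, k} \<subseteq> {1..N}; distinct [i, j, k]\<rbrakk> \<Longrightarrow>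
      y (i, j) \<otimes>\<^bsub>A\<^esub> y (j, k) \<oplus>\<^bsub>A\<^esub> y (j, k) \<otimes>\<^bsub>A\<^esub> y (k, i) \<oplus>\<^bsub>A\<^esub> y (k, i) \<otimes>\<^bsub>A\<^esub> y (i, j) = \<zero>\<^bsub>A\<^esub>"
  using assms by (simp_all add: FK_elems_def)

lemma FK_elemsI:
  assumes "\<And>p. p \<in> FK_letters N \<Longrightarrow> y p \<in> carrier A"
    and "\<And>i j. (i, j) \<in> FK_letters N \<Longrightarrow> y (i, j) \<oplus>\<^bsub>A\<^esub> y (j, i) = \<zero>\<^bsub>A\<^esub>"
    and "\<And>i j. (i, j) \<in> FK_letters N \<Longrightarrow> y (i, j) \<otimes>\<^bsub>A\<^esub> y (i, j) = \<zero>\<^bsub>A\<^esub>"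
    and "\<And>i j k m. \<lbrakk>{i, j, k, m} \<subseteq> {1..N}; distinct [i, j, k, m]\<rbrakk> \<Longrightarrow>
      y (i, j) \<otimes>\<^bsub>A\<^esub> y (k, m) = y (k, m) \<otimes>\<^bsub>A\<^esub> y (i, j)"
    and "\<And>i j k. \<lbrakk>{i, j, k} \<subseteq> {1..N}; distinct [i, j, k]\<rbrakk> \<Longrightarrow>
      y (i, j) \<otimes>\<^bsub>A\<^esub> y (j, k) \<oplus>\<^bsub>A\<^esub> y (j, k) \<otimes>\<^bsub>A\<^esub> y (k, i) \<oplus>\<^bsub>A\<^esub> y (k, i) \<otimes>\<^bsub>A\<^esub> y (i, j) = \<zero>\<^bsub>A\<^esub>"
  shows "FK_elems K N A y"
  unfolding FK_elems_def
  by (intro conjI ballI allI impI; (elim conjE)?; (rule assms; assumption))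

lemma FK_letters_of:
  "{i, j, k} \<subseteq> {1..N} \<and> distinct [i, j, k] \<Longrightarrow>
    (i, j) \<in> FK_letters N \<and> (j, k) \<in> FK_letters N \<and> (k, i) \<in> FK_letters N \<and>
    (j, i) \<in> FK_letters N \<and> (k, j) \<in> FK_letters N \<and> (i, k) \<in> FK_letters N"
  by (auto simp: FK_letters_iff)

lemma FK_letters_of4:
  "{i, j, k, m} \<subseteq> {1..N} \<and> distinct [i, j, k, m] \<Longrightarrow> (i, j) \<in> FK_letters N \<and> (k, m) \<in> FK_letters N"
  by (auto simp: FK_letters_iff)

lemma FK_letters_swap: "(i, j) \<in> FK_letters N \<Longrightarrow> (j, i) \<in> FK_letters N"
  by (auto simp: FK_letters_iff)

lemma FK_ops_mult:
  assumes A: "assoc_algebra K A" and y: "FK_elems K N A y"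
  shows "FK_ops K N A (\<lambda>p b. y p \<otimes>\<^bsub>A\<^esub> b)"
proof -
  interpret A: assoc_algebra K A by fact
  note yc = FK_elemsD(1)[OF y]
  show ?thesis
  proof (rule FK_opsI)
    fix i j assume ij: "(i, j) \<in> FK_letters N"
    then show "(\<lambda>b. y (i, j) \<otimes>\<^bsub>A\<^esub> b) \<in> lin_map K A A" by (intro mult_left_lin_map[OF A] yc)
    fix u assume u: "u \<in> carrier A"
    show "y (i, j) \<otimes>\<^bsub>A\<^esub> u \<oplus>\<^bsub>A\<^esub> y (j, i) \<otimes>\<^bsub>A\<^esub> u = \<zero>\<^bsub>A\<^esub>"
      using A.l_distr[of "y (i, j)" "y (j, i)" u] FK_elemsD(2)[OF y ij] yc ij FK_letters_swap[OF ij] u by simp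
    show "y (i, j) \<otimes>\<^bsub>A\<^esub> (y (i, j) \<otimes>\<^bsub>A\<^esub> u) = \<zero>\<^bsub>A\<^esub>"
      using FK_elemsD(3)[OF y ij] yc ij u by (simp flip: A.m_assoc)
  next
    fix i j k m u
    assume ijkm: "{i, j, k, m} \<subseteq> {1..N}" "distinct [i, j, k, m]" and u: "u \<in> carrier A"
    then have l: "(i, j) \<in> FK_letters N" "(k, m) \<in> FK_letters N" using FK_letters_of4 by blast+
    show "y (i, j) \<otimes>\<^bsub>A\<^esub> (y (k, m) \<otimes>\<^bsub>A\<^esub> u) = y (k, m) \<otimes>\<^bsub>A\<^esub> (y (i, j) \<otimes>\<^bsub>A\<^esub> u)"
      using FK_elemsD(4)[OF y ijkm] yc l u by (simp flip: A.m_assoc)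
  next
    fix i j k u assume ijk: "{i, j, k} \<subseteq> {1..N}" "distinct [i, j, k]" and u: "u \<in> carrier A"
    then have l: "(i, j) \<in> FK_letters N" "(j, k) \<in> FK_letters N" "(k, i) \<in> FK_letters N"
      using FK_letters_of by blast+
    have "y (i, j) \<otimes>\<^bsub>A\<^esub> (y (j, k) \<otimes>\<^bsub>A\<^esub> u) \<oplus>\<^bsub>A\<^esub> y (j, k) \<otimes>\<^bsub>A\<^esub> (y (k, i) \<otimes>\<^bsub>A\<^esub> u) \<oplus>\<^bsub>A\<^esub>
        y (k, i) \<otimes>\<^bsub>A\<^esub> (y (i, j) \<otimes>\<^bsub>A\<^esub> u) =
      (y (i, j) \<otimes>\<^bsub>A\<^esub> y (j, k) \<oplus>\<^bsub>A\<^esub> y (j, k) \<otimes>\<^bsub>A\<^esub> y (k, i) \<oplus>\<^bsub>A\<^esub> y (k, i) \<otimes>\<^bsub>A\<^esub> y (i, j)) \<otimes>\<^bsub>A\<^esub> u"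
      using yc l u by (simp add: A.l_distr A.m_assoc)
    then show "y (i, j) \<otimes>\<^bsub>A\<^esub> (y (j, k) \<otimes>\<^bsub>A\<^esub> u) \<oplus>\<^bsub>A\<^esub> y (j, k) \<otimes>\<^bsub>A\<^esub> (y (k, i) \<otimes>\<^bsub>A\<^esub> u) \<oplus>\<^bsub>A\<^esub>
        y (k, i) \<otimes>\<^bsub>A\<^esub> (y (i, j) \<otimes>\<^bsub>A\<^esub> u) = \<zero>\<^bsub>A\<^esub>"
      using FK_elemsD(5)[OF y ijk] u by simp
  qed
qed

abbreviation (input) letter_gen :: "('k, 'r) ring_scheme \<Rightarrow> nat \<Rightarrow> nat \<times> nat \<Rightarrow> ((nat \<times> nat) list \<Rightarrow> 'k) set"
  where "letter_gen K N p \<equiv> FK_gen K N (fst p) (snd p)"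

lemma alg_homI:
  assumes "f \<in> lin_map K C D" "f \<one>\<^bsub>C\<^esub> = \<one>\<^bsub>D\<^esub>"
    "\<And>x y. \<lbrakk>x \<in> carrier C; y \<in> carrier C\<rbrakk> \<Longrightarrow> f (x \<otimes>\<^bsub>C\<^esub> y) = f x \<otimes>\<^bsub>D\<^esub> f y"
  shows "f \<in> alg_hom K C D"
  using assms lin_map_closed[OF assms(1)] lin_map_add[OF assms(1)]
  by (auto simp: alg_hom_def ring_hom_def)

lemma alg_homD:
  assumes "f \<in> alg_hom K C D"
  shows "f \<in> lin_map K C D" "f \<one>\<^bsub>C\<^esub> = \<one>\<^bsub>D\<^esub>"
    "\<And>x y. \<lbrakk>x \<in> carrier C; y \<in> carrier C\<rbrakk> \<Longrightarrow> f (x \<otimes>\<^bsub>C\<^esub> y) = f x \<otimes>\<^bsub>D\<^esub> f y"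
  using assms by (auto simp: alg_hom_def ring_hom_def)

text \<open>Coefficients in a commutative ring. The invertibility of 6 is added as an explicit
  assumption in the context that deals with the kernel of \<open>id + \<Psi>\<close>.\<close>

locale FK_base =
  fixes K :: "('k, 'r) ring_scheme" and N :: nat
  assumes K: "cring K"
begin

interpretation K: cring K by (rule K)

interpretation F: assoc_algebra K "free_algebra K (FK_letters N)" by (rule free_algebra_assoc_algebra[OF K])

abbreviation (input) "A \<equiv> FK_algebra K N"
abbreviation (input) "FL \<equiv> free_algebra K (FK_letters N)"

lemma FK_rels_cases:
  assumes "r \<in> FK_rels K N"
  obtains (sym) i j where "(i, j) \<in> FK_letters N" "r = basis_vec K [(i, j)] \<oplus>\<^bsub>FL\<^esub> basis_vec K [(j, i)]"
  | (square) i j where "(i, j) \<in> FK_letters N" "r = basis_vec K [(i, j), (i, j)]"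
  | (comm) i j k m where "{i, j, k, m} \<subseteq> {1..N}" "distinct [i, j, k, m]"
      "r = basis_vec K [(i, j), (k, m)] \<ominus>\<^bsub>FL\<^esub> basis_vec K [(k, m), (i, j)]"
  | (triple) i j k where "{i, j, k} \<subseteq> {1..N}" "distinct [i, j, k]"
      "r = basis_vec K [(i, j), (j, k)] \<oplus>\<^bsub>FL\<^esub> basis_vec K [(j, k), (k, i)] \<oplus>\<^bsub>FL\<^esub> basis_vec K [(k, i), (i, j)]"
  using assms unfolding FK_rels_def Let_def basis_word_mult[OF K] append.simps
  by (elim UnE CollectE exE conjE) (auto simp: FK_letters_iff intro: that)

lemma FK_rels_mem:
  "(i, j) \<in> FK_letters N \<Longrightarrow> basis_vec K [(i, j)] \<oplus>\<^bsub>FL\<^esub> basis_vec K [(j, i)] \<in> FK_rels K N"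
  "(i, j) \<in> FK_letters N \<Longrightarrow> basis_vec K [(i, j)] \<otimes>\<^bsub>FL\<^esub> basis_vec K [(i, j)] \<in> FK_rels K N"
  "\<lbrakk>{i, j, k, m} \<subseteq> {1..N}; distinct [i, j, k, m]\<rbrakk> \<Longrightarrow>
    basis_vec K [(i, j)] \<otimes>\<^bsub>FL\<^esub> basis_vec K [(k, m)] \<ominus>\<^bsub>FL\<^esub> basis_vec K [(k, m)] \<otimes>\<^bsub>FL\<^esub> basis_vec K [(i, j)] \<in> FK_rels K N"
  "\<lbrakk>{i, j, k} \<subseteq> {1..N}; distinct [i, j, k]\<rbrakk> \<Longrightarrow>
    basis_vec K [(i, j)] \<otimes>\<^bsub>FL\<^esub> basis_vec K [(j, k)] \<oplus>\<^bsub>FL\<^esub> basis_vec K [(j, k)] \<otimes>\<^bsub>FL\<^esub> basis_vec K [(k, i)] \<oplus>\<^bsub>FL\<^esub>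
      basis_vec K [(k, i)] \<otimes>\<^bsub>FL\<^esub> basis_vec K [(i, j)] \<in> FK_rels K N"
  unfolding FK_rels_def Let_def FK_letters_iff by blast+

lemma letter_word_closed: "p \<in> FK_letters N \<Longrightarrow> basis_vec K [p] \<in> carrier FL"
  by (rule basis_word_closed[OF K]) simp

lemma letter_word2_closed:
  "\<lbrakk>p \<in> FK_letters N; q \<in> FK_letters N\<rbrakk> \<Longrightarrow> basis_vec K [p, q] \<in> carrier FL"
  by (rule basis_word_closed[OF K]) simp

lemma FK_rels_subset: "FK_rels K N \<subseteq> carrier FL"
proof
  fix r assume "r \<in> FK_rels K N"
  then show "r \<in> carrier FL"
  proof (cases rule: FK_rels_cases)
    case (comm i j k m)
    then show ?thesis using FK_letters_of4[of i j k m N] by (auto intro!: F.M.minus_closed letter_word2_closed)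
  next
    case (triple i j k)
    then show ?thesis using FK_letters_of[of i j k N] by (auto intro!: F.M.a_closed letter_word2_closed)
  qed (auto intro!: F.M.a_closed letter_word_closed letter_word2_closed dest: FK_letters_swap)
qed

lemmas FK_ideal = F.genideal_ideal[OF FK_rels_subset]

lemma FK_algebra_eq: "FK_algebra K N = quot FL (Idl\<^bsub>FL\<^esub> FK_rels K N)"
  by (simp add: FK_algebra_def Let_def)

lemma FK_gen_eq: "letter_gen K N p = Idl\<^bsub>FL\<^esub> FK_rels K N +>\<^bsub>FL\<^esub> basis_vec K [p]"
  by (simp add: FK_gen_def Let_def)

lemma FK_assoc_algebra: "assoc_algebra K A"
  unfolding FK_algebra_eq by (rule quot_assoc_algebra[OF F.assoc_algebra FK_ideal])

interpretation A: assoc_algebra K A by (rule FK_assoc_algebra)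

lemma FK_elems_gen: "FK_elems K N A (letter_gen K N)"
proof -
  note sub = assoc_algebra_module[OF F.assoc_algebra] ideal_submodule[OF F.assoc_algebra FK_ideal]
  note c = letter_word_closed
  note closed = coset_closed[OF sub c, folded FK_algebra_eq, folded FK_gen_eq]
  note hom = coset_mult[OF FK_ideal c c, folded FK_algebra_eq, folded FK_gen_eq]
  note lin = coset_lin_map[OF sub, folded FK_algebra_eq]
  note add = coset_add[OF sub, folded FK_algebra_eq]
  note zero = genideal_coset_zero[OF F.assoc_algebra FK_rels_subset, folded FK_algebra_eq]
  show ?thesis
  proof (rule FK_elemsI)
    fix p assume "p \<in> FK_letters N"
    then show "letter_gen K N p \<in> carrier A" by (rule closed)
  next
    fix i j assume ij: "(i, j) \<in> FK_letters N"
    note ji = FK_letters_swap[OF ij]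
    show "letter_gen K N (i, j) \<oplus>\<^bsub>A\<^esub> letter_gen K N (j, i) = \<zero>\<^bsub>A\<^esub>"
      unfolding FK_gen_eq add[OF c[OF ij] c[OF ji]] by (rule zero[OF FK_rels_mem(1)[OF ij]])
    show "letter_gen K N (i, j) \<otimes>\<^bsub>A\<^esub> letter_gen K N (i, j) = \<zero>\<^bsub>A\<^esub>"
      unfolding hom[OF ij ij] by (rule zero[OF FK_rels_mem(2)[OF ij]])
  next
    fix i j k m assume ijkm: "{i, j, k, m} \<subseteq> {1..N}" "distinct [i, j, k, m]"
    then have l: "(i, j) \<in> FK_letters N" "(k, m) \<in> FK_letters N" using FK_letters_of4 by blast+
    have "letter_gen K N (i, j) \<otimes>\<^bsub>A\<^esub> letter_gen K N (k, m) \<ominus>\<^bsub>A\<^esub>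
      letter_gen K N (k, m) \<otimes>\<^bsub>A\<^esub> letter_gen K N (i, j) = \<zero>\<^bsub>A\<^esub>"
      using zero[OF FK_rels_mem(3)[OF ijkm]]
      unfolding hom[OF l] hom[OF l(2,1)]
      by (subst (asm) lin_map_minus[OF sub(1) assoc_algebra_module[OF A.assoc_algebra] lin])
        (intro F.m_closed c l; simp)+
    then show "letter_gen K N (i, j) \<otimes>\<^bsub>A\<^esub> letter_gen K N (k, m) =
      letter_gen K N (k, m) \<otimes>\<^bsub>A\<^esub> letter_gen K N (i, j)"
      by (subst (asm) A.M.minus_eq_zero_iff) (intro A.m_closed closed l; simp)+
  next
    fix i j k assume ijk: "{i, j, k} \<subseteq> {1..N}" "distinct [i, j, k]"
    then have l: "(i, j) \<in> FK_letters N" "(j, k) \<in> FK_letters N" "(k, i) \<in> FK_letters N"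
      using FK_letters_of by blast+
    show "letter_gen K N (i, j) \<otimes>\<^bsub>A\<^esub> letter_gen K N (j, k) \<oplus>\<^bsub>A\<^esub> letter_gen K N (j, k) \<otimes>\<^bsub>A\<^esub> letter_gen K N (k, i) \<oplus>\<^bsub>A\<^esub>
      letter_gen K N (k, i) \<otimes>\<^bsub>A\<^esub> letter_gen K N (i, j) = \<zero>\<^bsub>A\<^esub>"
      unfolding hom[OF l(1,2)] hom[OF l(2,3)] hom[OF l(3,1)]
        add[OF F.m_closed[OF c[OF l(1)] c[OF l(2)]] F.m_closed[OF c[OF l(2)] c[OF l(3)]]]
        add[OF F.a_closed[OF F.m_closed[OF c[OF l(1)] c[OF l(2)]] F.m_closed[OF c[OF l(2)] c[OF l(3)]]]
          F.m_closed[OF c[OF l(3)] c[OF l(1)]]]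
      by (rule zero[OF FK_rels_mem(4)[OF ijk]])
  qed
qed

lemma FK_induct:
  assumes "submodule H K A" "\<one>\<^bsub>A\<^esub> \<in> H"
    "\<And>p b. \<lbrakk>p \<in> FK_letters N; b \<in> H; b \<in> carrier A\<rbrakk> \<Longrightarrow> letter_gen K N p \<otimes>\<^bsub>A\<^esub> b \<in> H" "b \<in> carrier A"
  shows "b \<in> H"
proof (rule presented_induct[OF K FK_rels_subset, folded FK_algebra_eq, OF assms(1,2) _ assms(4)])
  fix p b assume "p \<in> FK_letters N" and b: "b \<in> H"
  then show "(Idl\<^bsub>FL\<^esub> FK_rels K N +>\<^bsub>FL\<^esub> basis_vec K [p]) \<otimes>\<^bsub>A\<^esub> b \<in> H"
    using assms(3) subsetD[OF submodule_subset[OF assms(1)] b] by (simp only: FK_gen_eq)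
qed

text \<open>The common form of nearly all later inductions. The maps are merely linear, so that
  composites with homogeneous projections, tensor lifts or the antipode fall under it.\<close>

lemma FK_eqI:
  assumes "module K U" "f \<in> lin_map K A U" "g \<in> lin_map K A U" "f \<one>\<^bsub>A\<^esub> = g \<one>\<^bsub>A\<^esub>"
    "\<And>p b. \<lbrakk>p \<in> FK_letters N; b \<in> carrier A; f b = g b\<rbrakk> \<Longrightarrow>
      f (letter_gen K N p \<otimes>\<^bsub>A\<^esub> b) = g (letter_gen K N p \<otimes>\<^bsub>A\<^esub> b)"
    "b \<in> carrier A"
  shows "f b = g b"
proof -
  have "b \<in> {b \<in> carrier A. f b = g b}"
  proof (rule FK_induct[OF submodule_equalizer[OF assoc_algebra_module[OF FK_assoc_algebra] assms(1-3)] _ _ assms(6)])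
    show "\<one>\<^bsub>A\<^esub> \<in> {b \<in> carrier A. f b = g b}" using assms(4) A.one_closed by blast
    fix p b assume "p \<in> FK_letters N" "b \<in> {b \<in> carrier A. f b = g b}" "b \<in> carrier A"
    then show "letter_gen K N p \<otimes>\<^bsub>A\<^esub> b \<in> {b \<in> carrier A. f b = g b}"
      using assms(5)[of p b] A.m_closed[of "letter_gen K N p" b] FK_elemsD(1)[OF FK_elems_gen, of p]
      by blast
  qed
  then show ?thesis by blast
qed

context
  fixes U :: "('k, 'u, 'm) module_scheme" and \<theta> and u
  assumes U: "module K U" and \<theta>: "FK_ops K N U \<theta>" and u: "u \<in> carrier U"
begin

interpretation U: module K U by (rule U)

lemma FK_ops_lin: "p \<in> FK_letters N \<Longrightarrow> \<theta> p \<in> lin_map K U U"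
  using \<theta> unfolding FK_ops_def by blast

lemma FK_ops_kill_rels:
  assumes "r \<in> FK_rels K N" "v \<in> carrier U"
  shows "word_act K U \<theta> v r = \<zero>\<^bsub>U\<^esub>"
proof -
  note lin = word_act_lin_map[OF U FK_ops_lin assms(2)]
  note mod = assoc_algebra_module[OF F.assoc_algebra]
  note basis = word_act_basis[OF U FK_ops_lin assms(2)]
  show ?thesis
    using assms(1)
  proof (cases rule: FK_rels_cases)
    case (sym i j)
    then show ?thesis
      using FK_letters_swap[OF sym(1)] \<theta> assms(2)
      by (simp add: lin_map_add[OF lin] letter_word_closed basis FK_ops_def)
  next
    case (square i j)
    then show ?thesis using \<theta> assms(2) by (simp add: basis FK_ops_def)
  next
    case (comm i j k m)
    have l: "(i, j) \<in> FK_letters N" "(k, m) \<in> FK_letters N" using FK_letters_of4 comm by blast+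
    have "\<theta> (i, j) (\<theta> (k, m) v) = \<theta> (k, m) (\<theta> (i, j) v)"
      using \<theta> comm assms(2) unfolding FK_ops_def by blast
    moreover have "\<theta> (k, m) (\<theta> (i, j) v) \<in> carrier U" using lin_map_closed[OF FK_ops_lin] l assms(2) by auto
    ultimately show ?thesis
      using l comm(3) by (simp add: lin_map_minus[OF mod U lin] letter_word2_closed basis U.M.minus_eq_zero_iff)
  next
    case (triple i j k)
    have l: "(i, j) \<in> FK_letters N" "(j, k) \<in> FK_letters N" "(k, i) \<in> FK_letters N"
      using FK_letters_of triple by blast+
    have "\<theta> (i, j) (\<theta> (j, k) v) \<oplus>\<^bsub>U\<^esub> \<theta> (j, k) (\<theta> (k, i) v) \<oplus>\<^bsub>U\<^esub> \<theta> (k, i) (\<theta> (i, j) v) = \<zero>\<^bsub>U\<^esub>"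
      using \<theta> triple assms(2) unfolding FK_ops_def by blast
    then show ?thesis
      using l triple(3) by (simp add: lin_map_add[OF lin] letter_word2_closed basis)
  qed
qed

lemma FK_rec_lin_map: "word_rec K U \<theta> u \<in> lin_map K A U"
  unfolding FK_algebra_eq by (rule word_rec_lin_map[OF U FK_ops_lin FK_rels_subset FK_ops_kill_rels u])

lemma FK_rec_one: "word_rec K U \<theta> u \<one>\<^bsub>A\<^esub> = u"
  unfolding FK_algebra_eq by (rule word_rec_one[OF U FK_ops_lin FK_rels_subset FK_ops_kill_rels u])

lemma FK_rec_mult:
  "\<lbrakk>p \<in> FK_letters N; b \<in> carrier A\<rbrakk> \<Longrightarrow>
    word_rec K U \<theta> u (letter_gen K N p \<otimes>\<^bsub>A\<^esub> b) = \<theta> p (word_rec K U \<theta> u b)"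
  unfolding FK_algebra_eq FK_gen_eq
  by (rule word_rec_mult[OF U FK_ops_lin FK_rels_subset FK_ops_kill_rels u])

end

lemma FK_alg_hom_unique:
  assumes "module K U" "f \<in> alg_hom K A U" "g \<in> alg_hom K A U"
    "\<And>p. p \<in> FK_letters N \<Longrightarrow> f (letter_gen K N p) = g (letter_gen K N p)" "b \<in> carrier A"
  shows "f b = g b"
  using FK_elemsD(1)[OF FK_elems_gen]
  by (intro FK_eqI[OF assms(1) alg_homD(1)[OF assms(2)] alg_homD(1)[OF assms(3)] _ _ assms(5)])
    (auto simp: alg_homD(2,3)[OF assms(2)] alg_homD(2,3)[OF assms(3)] assms(4))

context
  fixes C :: "('k, 'u, 'm) module_scheme" and y
  assumes C: "assoc_algebra K C" and y: "FK_elems K N C y"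
begin

interpretation C: assoc_algebra K C by (rule C)

text \<open>By construction the map turns left multiplication by \<open>X p\<close> into left
  multiplication by \<open>y p\<close>. With the right factor fixed, both sides are linear in the
  left factor, so an induction over letters gives multiplicativity.\<close>

lemma FK_rec_alg_hom: "word_rec K C (\<lambda>p b. y p \<otimes>\<^bsub>C\<^esub> b) \<one>\<^bsub>C\<^esub> \<in> alg_hom K A C"
proof -
  let ?h = "word_rec K C (\<lambda>p b. y p \<otimes>\<^bsub>C\<^esub> b) \<one>\<^bsub>C\<^esub>"
  note ops = FK_ops_mult[OF C y]
  note Cmod = assoc_algebra_module[OF C]
  note lin = FK_rec_lin_map[OF Cmod ops C.one_closed]
  note mult = FK_rec_mult[OF Cmod ops C.one_closed]
  note one = FK_rec_one[OF Cmod ops C.one_closed]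
  note gen = FK_elemsD(1)[OF FK_elems_gen] and yc = FK_elemsD(1)[OF y]
  show ?thesis
  proof (rule alg_homI[OF lin one])
    fix a b assume a: "a \<in> carrier A" and b: "b \<in> carrier A"
    show "?h (a \<otimes>\<^bsub>A\<^esub> b) = ?h a \<otimes>\<^bsub>C\<^esub> ?h b"
    proof (rule FK_eqI[OF Cmod lin_map_comp[OF mult_right_lin_map[OF A.assoc_algebra b] lin]
          lin_map_comp[OF lin mult_right_lin_map[OF C lin_map_closed[OF lin b]]] _ _ a])
      show "?h (\<one>\<^bsub>A\<^esub> \<otimes>\<^bsub>A\<^esub> b) = ?h \<one>\<^bsub>A\<^esub> \<otimes>\<^bsub>C\<^esub> ?h b"
        using b lin_map_closed[OF lin b] by (simp add: one)
      fix p c assume p: "p \<in> FK_letters N" and c: "c \<in> carrier A" and IH: "?h (c \<otimes>\<^bsub>A\<^esub> b) = ?h c \<otimes>\<^bsub>C\<^esub> ?h b"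
      show "?h (letter_gen K N p \<otimes>\<^bsub>A\<^esub> c \<otimes>\<^bsub>A\<^esub> b) = ?h (letter_gen K N p \<otimes>\<^bsub>A\<^esub> c) \<otimes>\<^bsub>C\<^esub> ?h b"
        using IH p c b gen[OF p] yc[OF p] lin_map_closed[OF lin]
        by (simp add: A.m_assoc C.m_assoc mult)
    qed
  qed
qed

lemma FK_rec_gen:
  assumes "p \<in> FK_letters N"
  shows "word_rec K C (\<lambda>p b. y p \<otimes>\<^bsub>C\<^esub> b) \<one>\<^bsub>C\<^esub> (letter_gen K N p) = y p"
proof -
  note C.one_closed[simp] FK_elemsD(1)[OF y assms, simp] FK_elemsD(1)[OF FK_elems_gen assms, simp]
  show ?thesis
    using FK_rec_mult[OF assoc_algebra_module[OF C] FK_ops_mult[OF C y] C.one_closed assms A.one_closed]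
    by (simp add: FK_rec_one[OF assoc_algebra_module[OF C] FK_ops_mult[OF C y] C.one_closed])
qed

end

end

section \<open>Crossed modules from projections\<close>

lemma sym_group_finite: "finite (carrier (sym_group N))"
  using finite_permutations[of "{1..N}"] by (simp add: sym_group_def)

lemma sym_group_inv: "g \<in> carrier (sym_group N) \<Longrightarrow> inv\<^bsub>sym_group N\<^esub> g = inv' g"
  by (rule group.inv_equality[OF sym_group_is_group])
    (auto simp: sym_group_carrier sym_group_mult sym_group_one permutes_inv permutes_inv_o)

context
  fixes K :: "('k, 'r) ring_scheme" and G :: "('g, 'h) monoid_scheme"
    and V :: "('k, 'v, 'g, 'm) crossed_scheme" and P :: "'g \<Rightarrow> 'v \<Rightarrow> 'v"
  assumes V: "module K V" and G: "group G" and fin: "finite (carrier G)"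
    and P: "\<And>g. g \<in> carrier G \<Longrightarrow> P g \<in> lin_map K V V"
    and grade: "\<And>g. g \<in> carrier G \<Longrightarrow> grade V g = {v \<in> carrier V. P g v = v}"
    and P_P: "\<And>g h v. \<lbrakk>g \<in> carrier G; h \<in> carrier G; v \<in> carrier V\<rbrakk> \<Longrightarrow>
      P g (P h v) = (if g = h then P g v else \<zero>\<^bsub>V\<^esub>)"
    and P_sum: "\<And>v. v \<in> carrier V \<Longrightarrow> (\<Oplus>\<^bsub>V\<^esub>g\<in>carrier G. P g v) = v"
begin

interpretation V: module K V by (rule V)
interpretation G: group G by (rule G)

lemma proj_grade: "\<lbrakk>g \<in> carrier G; v \<in> carrier V\<rbrakk> \<Longrightarrow> P g v \<in> grade V g"
  using lin_map_closed[OF P] P_P by (simp add: grade)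

lemma proj_homogeneous:
  assumes "h \<in> carrier G" "g \<in> carrier G" "v \<in> grade V g"
  shows "P h v = (if h = g then v else \<zero>\<^bsub>V\<^esub>)"
proof -
  have v: "v \<in> carrier V" "P g v = v" using assms by (auto simp: grade)
  then show ?thesis using P_P[OF assms(1,2) v(1)] by auto
qed

text \<open>Applying \<open>P h\<close> to a decomposition of \<open>v\<close> isolates the
  component of degree \<open>h\<close>, so the components are forced; they exist because the
  projections add up to the identity. The restriction to the carrier matches the extensional
  function space in \<open>homog_decomp\<close>.\<close>

lemma homog_decomp_iff:
  assumes "v \<in> carrier V"
  shows "homog_decomp G V v c \<longleftrightarrow> c = (\<lambda>g\<in>carrier G. P g v)"
proof
  assume c: "homog_decomp G V v c"
  then have cg: "c g \<in> grade V g" if "g \<in> carrier G" for g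
    using that by (auto simp: homog_decomp_def PiE_iff)
  then have cV: "c g \<in> carrier V" if "g \<in> carrier G" for g using that by (auto simp: grade)
  have "c h = P h v" if h: "h \<in> carrier G" for h
  proof -
    have "P h v = P h (\<Oplus>\<^bsub>V\<^esub>g\<in>carrier G. c g)" using c by (simp add: homog_decomp_def)
    also have "\<dots> = (\<Oplus>\<^bsub>V\<^esub>g\<in>carrier G. P h (c g))"
      by (rule lin_map_finsum[OF V V P[OF h] fin]) (use cV in auto)
    also have "\<dots> = (\<Oplus>\<^bsub>V\<^esub>g\<in>carrier G. if h = g then c g else \<zero>\<^bsub>V\<^esub>)"
      by (rule V.M.finsum_cong') (use proj_homogeneous[OF h] cg cV in auto)
    also have "\<dots> = c h" by (rule V.M.finsum_singleton[OF h fin]) (use cV in auto)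
    finally show ?thesis ..
  qed
  moreover have "c \<in> extensional (carrier G)" using c by (auto simp: homog_decomp_def PiE_def)
  ultimately show "c = (\<lambda>g\<in>carrier G. P g v)" by (intro extensionalityI[of _ "carrier G"]) auto
next
  assume c: "c = (\<lambda>g\<in>carrier G. P g v)"
  have "(\<Oplus>\<^bsub>V\<^esub>g\<in>carrier G. c g) = (\<Oplus>\<^bsub>V\<^esub>g\<in>carrier G. P g v)"
    by (rule V.M.finsum_cong') (use assms lin_map_closed[OF P] in \<open>auto simp: c\<close>)
  moreover have "c \<in> (\<Pi>\<^sub>E g\<in>carrier G. grade V g)"
    unfolding c using proj_grade[OF _ assms] by simp
  ultimately show "homog_decomp G V v c"
    unfolding homog_decomp_def using P_sum[OF assms] by simp
qed

lemma homog_comp_eq: "\<lbrakk>v \<in> carrier V; g \<in> carrier G\<rbrakk> \<Longrightarrow> homog_comp G V v g = P g v"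
  by (simp add: homog_comp_def homog_decomp_iff)

text \<open>The last premise says that the action conjugates the projections. It is the equational
  form of the inclusion \<open>act_grade\<close>, and equations are what an induction over letters
  can prove.\<close>

lemma crossed_moduleI:
  assumes "\<And>g. g \<in> carrier G \<Longrightarrow> act V g \<in> lin_map K V V"
    and "\<And>v. v \<in> carrier V \<Longrightarrow> act V \<one>\<^bsub>G\<^esub> v = v"
    and "\<And>g h v. \<lbrakk>g \<in> carrier G; h \<in> carrier G; v \<in> carrier V\<rbrakk> \<Longrightarrow>
      act V (g \<otimes>\<^bsub>G\<^esub> h) v = act V g (act V h v)"
    and "\<And>g h v. \<lbrakk>g \<in> carrier G; h \<in> carrier G; v \<in> carrier V\<rbrakk> \<Longrightarrow>
      act V h (P g v) = P (h \<otimes>\<^bsub>G\<^esub> g \<otimes>\<^bsub>G\<^esub> inv\<^bsub>G\<^esub> h) (act V h v)"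
  shows "crossed_module K G V"
proof (intro crossed_module.intro V G crossed_module_axioms.intro assms(1-3) fin)
  fix g assume g: "g \<in> carrier G"
  show "submodule (grade V g) K V"
    unfolding grade[OF g] by (rule submodule_equalizer[OF V V P[OF g] lin_map_id])
next
  fix v assume "v \<in> carrier V" then show "\<exists>!c. homog_decomp G V v c"
    by (simp add: homog_decomp_iff)
next
  fix g h assume g: "g \<in> carrier G" and h: "h \<in> carrier G"
  then have hg: "h \<otimes>\<^bsub>G\<^esub> g \<otimes>\<^bsub>G\<^esub> inv\<^bsub>G\<^esub> h \<in> carrier G" by simp
  show "act V h ` grade V g \<subseteq> grade V (h \<otimes>\<^bsub>G\<^esub> g \<otimes>\<^bsub>G\<^esub> inv\<^bsub>G\<^esub> h)"
  proof (rule image_subsetI)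
    fix v assume "v \<in> grade V g"
    then have v: "v \<in> carrier V" "P g v = v" using g by (auto simp: grade)
    then show "act V h v \<in> grade V (h \<otimes>\<^bsub>G\<^esub> g \<otimes>\<^bsub>G\<^esub> inv\<^bsub>G\<^esub> h)"
      using assms(4)[OF g h v(1)] lin_map_closed[OF assms(1)[OF h] v(1)] by (simp add: grade[OF hg])
  qed
qed

context
  fixes W :: "('k, 'w, 'g, 'n) crossed_scheme"
  assumes W: "module K W" and act_W: "\<And>g. g \<in> carrier G \<Longrightarrow> act W g \<in> lin_map K W W"
begin

interpretation W: module K W by (rule W)

lemma braiding_bilin:
  "bilin K V W (tensor K W V) (\<lambda>v w. \<Oplus>\<^bsub>tensor K W V\<^esub>g\<in>carrier G. pure K W V (act W g w) (homog_comp G V v g))"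
proof -
  note T = tensor_module[OF W V]
  note pb = pure_bilin[OF W V]
  show ?thesis
  proof (rule bilinI)
    fix v assume v: "v \<in> carrier V"
    then have "homog_comp G V v g \<in> carrier V" if "g \<in> carrier G" for g
      using lin_map_closed[OF P[OF that] v] that by (simp add: homog_comp_eq)
    then show "(\<lambda>w. \<Oplus>\<^bsub>tensor K W V\<^esub>g\<in>carrier G. pure K W V (act W g w) (homog_comp G V v g))
        \<in> lin_map K W (tensor K W V)"
      by (intro lin_map_sum[OF W T fin] lin_map_comp[OF act_W bilin_left[OF pb]])
  next
    fix w assume w: "w \<in> carrier W"
    have "(\<lambda>v. homog_comp G V v g) \<in> lin_map K V V" if "g \<in> carrier G" for g
      by (rule lin_map_cong[OF V P[OF that]]) (simp add: homog_comp_eq that)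
    then show "(\<lambda>v. \<Oplus>\<^bsub>tensor K W V\<^esub>g\<in>carrier G. pure K W V (act W g w) (homog_comp G V v g))
        \<in> lin_map K V (tensor K W V)"
      using w by (intro lin_map_sum[OF V T fin] lin_map_comp[OF _ bilin_right[OF pb]] lin_map_closed[OF act_W])
  qed
qed

lemma braiding_lin_map: "braiding K G V W \<in> lin_map K (tensor K V W) (tensor K W V)"
  unfolding braiding_def by (rule tensor_lift_lin_map[OF V W tensor_module[OF W V] braiding_bilin])

lemma braiding_homogeneous:
  assumes g: "g \<in> carrier G" and v: "v \<in> grade V g" and w: "w \<in> carrier W"
  shows "braiding K G V W (pure K V W v w) = pure K W V (act W g w) v"
proof -
  interpret T: module K "tensor K W V" by (rule tensor_module[OF W V])
  have vV: "v \<in> carrier V" using v by (simp add: grade[OF g])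
  have closed: "pure K W V (act W h w) v \<in> carrier (tensor K W V)" if "h \<in> carrier G" for h
    using pure_closed[OF W V lin_map_closed[OF act_W[OF that] w] vV] .
  have "pure K W V (act W h w) \<zero>\<^bsub>V\<^esub> = \<zero>\<^bsub>tensor K W V\<^esub>" if "h \<in> carrier G" for h
    by (rule lin_map_zero[OF V tensor_module[OF W V] bilin_right[OF pure_bilin[OF W V]
            lin_map_closed[OF act_W[OF that] w]]])
  then have "(\<Oplus>\<^bsub>tensor K W V\<^esub>h\<in>carrier G. pure K W V (act W h w) (homog_comp G V v h)) =
    (\<Oplus>\<^bsub>tensor K W V\<^esub>h\<in>carrier G. if g = h then pure K W V (act W h w) v else \<zero>\<^bsub>tensor K W V\<^esub>)"
    using closed by (intro T.M.finsum_cong') (auto simp: homog_comp_eq[OF vV] proj_homogeneous[OF _ g v])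
  also have "\<dots> = pure K W V (act W g w) v"
    using closed by (intro T.M.finsum_singleton[OF g fin]) auto
  finally show ?thesis
    unfolding braiding_def
    by (simp add: tensor_lift_pure[OF V W tensor_module[OF W V] braiding_bilin vV w])
qed

end

end

section \<open>Action and grading on the Fomin--Kirillov algebra\<close>

abbreviation (input) perm_letter :: "(nat \<Rightarrow> nat) \<Rightarrow> nat \<times> nat \<Rightarrow> nat \<times> nat"
  where "perm_letter g p \<equiv> (g (fst p), g (snd p))"

definition letter_deg :: "nat \<times> nat \<Rightarrow> nat \<Rightarrow> nat"
  where "letter_deg p = Transposition.transpose (fst p) (snd p)"

text \<open>The trailing factor \<open>g\<close> lets the simplifier cancel two equal transpositions
  inside a right-nested composition.\<close>

lemma letter_deg_invol [simp]: "letter_deg p \<circ> (letter_deg p \<circ> g) = g"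
  by (simp add: letter_deg_def fun_eq_iff)

lemma letter_deg_closed: "p \<in> FK_letters N \<Longrightarrow> letter_deg p \<in> carrier (sym_group N)"
  by (auto simp: letter_deg_def sym_group_carrier FK_letters_def intro!: permutes_swap_id)

lemma letter_deg_swap: "letter_deg (j, i) = letter_deg (i, j)"
  by (simp add: letter_deg_def transpose_commute)

lemma letter_deg_commute:
  "distinct [i, j, k, m] \<Longrightarrow> letter_deg (k, m) \<circ> letter_deg (i, j) = letter_deg (i, j) \<circ> letter_deg (k, m)"
  by (auto simp: letter_deg_def fun_eq_iff Transposition.transpose_def)

text \<open>The triple relation is homogeneous: its three terms have the same 3-cycle as degree. The
  products come in reverse order here because nested translations of functions on the group compose
  in reverse order.\<close>

lemma letter_deg_triple:
  assumes "distinct [i, j, k]"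
  shows "letter_deg (k, i) \<circ> letter_deg (j, k) = letter_deg (j, k) \<circ> letter_deg (i, j)"
    "letter_deg (i, j) \<circ> letter_deg (k, i) = letter_deg (j, k) \<circ> letter_deg (i, j)"
  using assms by (auto simp: letter_deg_def fun_eq_iff Transposition.transpose_def)

lemma letter_deg_perm:
  assumes "g \<in> carrier (sym_group N)"
  shows "letter_deg (perm_letter g p) \<circ> g = g \<circ> letter_deg p"
proof -
  have "inj g" using assms permutes_inj by (auto simp: sym_group_carrier)
  then show ?thesis by (auto simp: letter_deg_def fun_eq_iff Transposition.transpose_def inj_eq)
qed

lemma perm_subset:
  assumes "g \<in> carrier (sym_group N)"
  shows "i \<in> {1..N} \<Longrightarrow> g i \<in> {1..N}" "g i = g j \<longleftrightarrow> i = j"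
proof -
  have g: "g permutes {1..N}" using assms by (simp only: sym_group_carrier)
  show "i \<in> {1..N} \<Longrightarrow> g i \<in> {1..N}" by (simp only: permutes_in_image[OF g])
  show "g i = g j \<longleftrightarrow> i = j" by (rule inj_eq[OF permutes_inj[OF g]])
qed

lemma perm_letter_closed:
  assumes "g \<in> carrier (sym_group N)" "p \<in> FK_letters N"
  shows "perm_letter g p \<in> FK_letters N"
  using assms(2) perm_subset[OF assms(1)] by (cases p) (simp only: FK_letters_iff fst_conv snd_conv simp_thms)

text \<open>A permutation preserves the range and the distinctness of indices, so it permutes the
  relations among themselves. As (i, j) and (j, i) are both letters, no signs appear.\<close>

lemma FK_elems_perm:
  assumes y: "FK_elems K N A y" and g: "g \<in> carrier (sym_group N)"
  shows "FK_elems K N A (\<lambda>p. y (perm_letter g p))"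
proof (rule FK_elemsI)
  note gp = perm_subset[OF g] and pl = perm_letter_closed[OF g]
  fix p assume "p \<in> FK_letters N" then show "y (perm_letter g p) \<in> carrier A"
    by (intro FK_elemsD(1)[OF y] pl)
next
  note gp = perm_subset[OF g] and pl = perm_letter_closed[OF g]
  fix i j assume "(i, j) \<in> FK_letters N"
  note ij = pl[OF this]
  show "y (perm_letter g (i, j)) \<oplus>\<^bsub>A\<^esub> y (perm_letter g (j, i)) = \<zero>\<^bsub>A\<^esub>"
    "y (perm_letter g (i, j)) \<otimes>\<^bsub>A\<^esub> y (perm_letter g (i, j)) = \<zero>\<^bsub>A\<^esub>"
    using FK_elemsD(2,3)[OF y ij] by simp_all
next
  note gp = perm_subset[OF g]
  fix i j k m assume "{i, j, k, m} \<subseteq> {1..N}" "distinct [i, j, k, m]"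
  then have "{g i, g j, g k, g m} \<subseteq> {1..N}" "distinct [g i, g j, g k, g m]" using gp by auto
  from FK_elemsD(4)[OF y this]
  show "y (perm_letter g (i, j)) \<otimes>\<^bsub>A\<^esub> y (perm_letter g (k, m)) = y (perm_letter g (k, m)) \<otimes>\<^bsub>A\<^esub> y (perm_letter g (i, j))"
    by simp
next
  note gp = perm_subset[OF g]
  fix i j k assume "{i, j, k} \<subseteq> {1..N}" "distinct [i, j, k]"
  then have "{g i, g j, g k} \<subseteq> {1..N}" "distinct [g i, g j, g k]" using gp by auto
  from FK_elemsD(5)[OF y this]
  show "y (perm_letter g (i, j)) \<otimes>\<^bsub>A\<^esub> y (perm_letter g (j, k)) \<oplus>\<^bsub>A\<^esub>
    y (perm_letter g (j, k)) \<otimes>\<^bsub>A\<^esub> y (perm_letter g (k, i)) \<oplus>\<^bsub>A\<^esub>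
    y (perm_letter g (k, i)) \<otimes>\<^bsub>A\<^esub> y (perm_letter g (i, j)) = \<zero>\<^bsub>A\<^esub>" by simp
qed

definition FK_act :: "('k, 'r) ring_scheme \<Rightarrow> nat \<Rightarrow> (nat \<Rightarrow> nat) \<Rightarrow>
    ((nat \<times> nat) list \<Rightarrow> 'k) set \<Rightarrow> ((nat \<times> nat) list \<Rightarrow> 'k) set"
  where "FK_act K N g = word_rec K (FK_algebra K N)
    (\<lambda>p b. letter_gen K N (perm_letter g p) \<otimes>\<^bsub>FK_algebra K N\<^esub> b) \<one>\<^bsub>FK_algebra K N\<^esub>"

text \<open>
  The grading is the coaction \<open>b \<mapsto> b \<otimes> |b|\<close> of the group algebra, here as a left module over itself;
  the component of degree \<open>g\<close> is read off from the coefficient of \<open>g\<close>.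
\<close>

definition FK_coact :: "('k, 'r) ring_scheme \<Rightarrow> nat \<Rightarrow> ((nat \<times> nat) list \<Rightarrow> 'k) set \<Rightarrow>
    (((nat \<times> nat) list \<Rightarrow> 'k) set \<times> ((nat \<Rightarrow> nat) \<Rightarrow> 'k) \<Rightarrow> 'k) set"
  where "FK_coact K N =
    (let A = FK_algebra K N; KG = free_module K (carrier (sym_group N)) in
      word_rec K (tensor K A KG)
        (\<lambda>p. tensor_map K A KG (\<lambda>b. letter_gen K N p \<otimes>\<^bsub>A\<^esub> b) (\<lambda>s h. s (letter_deg p \<circ> h)))
        (pure K A KG \<one>\<^bsub>A\<^esub> (basis_vec K id)))"

definition FK_comp :: "('k, 'r) ring_scheme \<Rightarrow> nat \<Rightarrow> (nat \<Rightarrow> nat) \<Rightarrow>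
    ((nat \<times> nat) list \<Rightarrow> 'k) set \<Rightarrow> ((nat \<times> nat) list \<Rightarrow> 'k) set"
  where "FK_comp K N g b = tensor_lift K (FK_algebra K N) (\<lambda>a s. s g \<odot>\<^bsub>FK_algebra K N\<^esub> a) (FK_coact K N b)"

context FK_base
begin

interpretation K: cring K by (rule K)

abbreviation (input) "G \<equiv> sym_group N"
abbreviation (input) "KG \<equiv> free_module K (carrier (sym_group N))"
abbreviation (input) "X \<equiv> letter_gen K N"

interpretation A: assoc_algebra K A by (rule FK_assoc_algebra)

lemmas A_mod = assoc_algebra_module[OF FK_assoc_algebra]
lemmas gen_closed = FK_elemsD(1)[OF FK_elems_gen]
lemmas gen_mult_lin_map = mult_left_lin_map[OF FK_assoc_algebra gen_closed]

text \<open>A simultaneous induction for a whole family of equations. Left multiplication by a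
  letter shifts degrees, so the induction hypothesis is called at an index different from that of
  the goal.\<close>

lemma FK_eqI_family:
  assumes "module K U" "\<And>i. f i \<in> lin_map K A U" "\<And>i. f' i \<in> lin_map K A U"
    "\<And>i. f i \<one>\<^bsub>A\<^esub> = f' i \<one>\<^bsub>A\<^esub>"
    "\<And>p b i. \<lbrakk>p \<in> FK_letters N; b \<in> carrier A; \<And>j. f j b = f' j b\<rbrakk> \<Longrightarrow>
      f i (X p \<otimes>\<^bsub>A\<^esub> b) = f' i (X p \<otimes>\<^bsub>A\<^esub> b)"
    "b \<in> carrier A"
  shows "f i b = f' i b"
proof -
  let ?H = "\<Inter>(range (\<lambda>i. {b \<in> carrier A. f i b = f' i b}))"
  have sub: "submodule ?H K A"
    by (rule submodule_Inter[OF A_mod])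
      (use submodule_equalizer[OF A_mod assms(1) assms(2,3)] in auto)
  have "b \<in> ?H"
  proof (rule FK_induct[OF sub _ _ assms(6)])
    show "\<one>\<^bsub>A\<^esub> \<in> ?H" using assms(4) A.one_closed by blast
    fix p b assume p: "p \<in> FK_letters N" and b: "b \<in> ?H" "b \<in> carrier A"
    from b have "f j b = f' j b" for j by blast
    with p b assms(5) have "f i (X p \<otimes>\<^bsub>A\<^esub> b) = f' i (X p \<otimes>\<^bsub>A\<^esub> b)" for i by blast
    then show "X p \<otimes>\<^bsub>A\<^esub> b \<in> ?H" using A.m_closed[OF gen_closed[OF p] b(2)] by blast
  qed
  then show ?thesis by blast
qed

subsection \<open>The action\<close>

context
  fixes g assumes g: "g \<in> carrier G"
begin

lemma FK_act_alg_hom: "FK_act K N g \<in> alg_hom K A A"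
  unfolding FK_act_def
  by (rule FK_rec_alg_hom[OF FK_assoc_algebra FK_elems_perm[OF FK_elems_gen g]])

lemmas FK_act_lin_map = alg_homD(1)[OF FK_act_alg_hom]
lemmas FK_act_one = alg_homD(2)[OF FK_act_alg_hom]
lemmas FK_act_mult = alg_homD(3)[OF FK_act_alg_hom]
lemmas FK_act_closed = lin_map_closed[OF FK_act_lin_map]

lemma FK_act_gen: "p \<in> FK_letters N \<Longrightarrow> FK_act K N g (X p) = X (perm_letter g p)"
  unfolding FK_act_def
  by (rule FK_rec_gen[OF FK_assoc_algebra FK_elems_perm[OF FK_elems_gen g]])

end

lemma alg_hom_id: "(\<lambda>x. x) \<in> alg_hom K A A"
  by (rule alg_homI[OF lin_map_id]) simp_all

lemma alg_hom_comp:
  assumes "f \<in> alg_hom K A A" "h \<in> alg_hom K A A" shows "(\<lambda>x. h (f x)) \<in> alg_hom K A A"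
  using lin_map_closed[OF alg_homD(1)[OF assms(1)]]
  by (intro alg_homI lin_map_comp[OF alg_homD(1)[OF assms(1)] alg_homD(1)[OF assms(2)]])
    (simp_all add: alg_homD(2,3)[OF assms(1)] alg_homD(2,3)[OF assms(2)])

lemma id_in_sym: "id \<in> carrier G" by (simp add: sym_group_carrier permutes_id)

lemma FK_act_id: "b \<in> carrier A \<Longrightarrow> FK_act K N id b = b"
  by (rule FK_alg_hom_unique[OF A_mod FK_act_alg_hom[OF id_in_sym] alg_hom_id])
    (simp_all add: FK_act_gen[OF id_in_sym])

lemma FK_act_comp:
  assumes g: "g \<in> carrier G" and h: "h \<in> carrier G" and "b \<in> carrier A"
  shows "FK_act K N (g \<circ> h) b = FK_act K N g (FK_act K N h b)"
proof -
  have gh: "g \<circ> h \<in> carrier G" using g h by (simp add: sym_group_carrier permutes_compose)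
  show ?thesis
    by (rule FK_alg_hom_unique[OF A_mod FK_act_alg_hom[OF gh]
          alg_hom_comp[OF FK_act_alg_hom[OF h] FK_act_alg_hom[OF g]] _ \<open>b \<in> carrier A\<close>])
      (use FK_act_gen[OF g perm_letter_closed[OF h]] in \<open>simp add: FK_act_gen[OF h] FK_act_gen[OF gh]\<close>)
qed

subsection \<open>The grading\<close>

lemmas KG_mod = free_module_module[OF K, of "carrier (sym_group N)"]

text \<open>On basis vectors this is left translation by the inverse of \<open>t\<close>. For the
  transposition attached to a letter it is left translation by the transposition itself.\<close>

lemma translate_lin_map:
  assumes t: "t \<in> carrier G"
  shows "(\<lambda>s h. s (t \<circ> h)) \<in> lin_map K KG KG"
proof (rule lin_mapI)
  fix s assume s: "s \<in> carrier KG"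
  have inj: "inj (\<lambda>h. t \<circ> h)"
    using fun.inj_map[OF permutes_inj] t by (auto simp: sym_group_carrier)
  have "(\<lambda>h. t \<circ> h) -` {x. s x \<noteq> \<zero>\<^bsub>K\<^esub>} = {h. s (t \<circ> h) \<noteq> \<zero>\<^bsub>K\<^esub>}" by auto
  then have "finite {h. s (t \<circ> h) \<noteq> \<zero>\<^bsub>K\<^esub>}"
    using finite_vimageI[OF _ inj, of "{x. s x \<noteq> \<zero>\<^bsub>K\<^esub>}"] s by (simp add: free_module_carrier)
  moreover have "h \<in> carrier G" if "s (t \<circ> h) \<noteq> \<zero>\<^bsub>K\<^esub>" for h
  proof -
    have "t \<circ> h \<in> carrier G" using that s by (auto simp: free_module_carrier)
    then have "inv' t \<circ> (t \<circ> h) permutes {1..N}"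
      using t by (simp add: sym_group_carrier permutes_compose permutes_inv)
    moreover have "inv' t \<circ> (t \<circ> h) = h"
      using t by (auto simp: sym_group_carrier permutes_inverses fun_eq_iff)
    ultimately show ?thesis by (simp add: sym_group_carrier)
  qed
  ultimately show "(\<lambda>h. s (t \<circ> h)) \<in> carrier KG" using s by (auto simp: free_module_carrier)
qed auto


text \<open>This is where homogeneity of the defining relations enters. All terms of a relation
  translate the group algebra factor in the same way, so on a pure tensor that factor can be pulled
  out and the relation remains in the factor \<open>A\<close>.\<close>

lemma coact_ops:
  "FK_ops K N (tensor K A KG)
    (\<lambda>p. tensor_map K A KG (\<lambda>b. X p \<otimes>\<^bsub>A\<^esub> b) (\<lambda>s h. s (letter_deg p \<circ> h)))"
  (is "FK_ops K N ?T ?\<theta>")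
proof -
  interpret T: module K ?T by (rule tensor_module[OF A_mod KG_mod])
  note T = tensor_module[OF A_mod KG_mod]
  note lin = tensor_map_lin_map[OF A_mod KG_mod A_mod KG_mod gen_mult_lin_map translate_lin_map[OF letter_deg_closed]]
  note mp = tensor_map_pure[OF A_mod KG_mod A_mod KG_mod gen_mult_lin_map translate_lin_map[OF letter_deg_closed]]
  note eqI = tensor_eqI[OF A_mod KG_mod T _ lin_map_const_zero[OF T]]
  note pb = pure_bilin[OF A_mod KG_mod]
  note pl = bilin_left[OF pb]
  note ops = FK_ops_mult[OF FK_assoc_algebra FK_elems_gen]
  note tc = lin_map_closed[OF translate_lin_map[OF letter_deg_closed]]
  have pz: "pure K A KG \<zero>\<^bsub>A\<^esub> s = \<zero>\<^bsub>?T\<^esub>" if "s \<in> carrier KG" for s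
    by (rule lin_map_zero[OF A_mod T pl[OF that]])
  show ?thesis
  proof (rule FK_opsI)
    fix i j assume "(i, j) \<in> FK_letters N" then show "?\<theta> (i, j) \<in> lin_map K ?T ?T" by (intro lin)
  next
    fix i j u assume ij: "(i, j) \<in> FK_letters N" and u: "u \<in> carrier ?T"
    note ji = FK_letters_swap[OF ij]
    show "?\<theta> (i, j) u \<oplus>\<^bsub>?T\<^esub> ?\<theta> (j, i) u = \<zero>\<^bsub>?T\<^esub>"
    proof (rule eqI[OF lin_map_plus[OF T lin[OF ij ij] lin[OF ji ji]] _ u])
      fix v s assume v: "v \<in> carrier A" and s: "s \<in> carrier KG"
      have "X (i, j) \<otimes>\<^bsub>A\<^esub> v \<oplus>\<^bsub>A\<^esub> X (j, i) \<otimes>\<^bsub>A\<^esub> v = \<zero>\<^bsub>A\<^esub>" by (rule FK_opsD(2)[OF ops ij v])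
      then show "?\<theta> (i, j) (pure K A KG v s) \<oplus>\<^bsub>?T\<^esub> ?\<theta> (j, i) (pure K A KG v s) = \<zero>\<^bsub>?T\<^esub>"
        using pz[OF tc[OF ij s]] lin_map_add[OF pl[OF tc[OF ij s]] A.m_closed[OF gen_closed[OF ij] v]
            A.m_closed[OF gen_closed[OF ji] v], symmetric]
        unfolding mp[OF ij ij v s] mp[OF ji ji v s] unfolding letter_deg_swap[of j i] by simp
    qed
    show "?\<theta> (i, j) (?\<theta> (i, j) u) = \<zero>\<^bsub>?T\<^esub>"
    proof (rule eqI[OF lin_map_comp[OF lin[OF ij ij] lin[OF ij ij]] _ u])
      fix v s assume v: "v \<in> carrier A" and s: "s \<in> carrier KG"
      have "X (i, j) \<otimes>\<^bsub>A\<^esub> (X (i, j) \<otimes>\<^bsub>A\<^esub> v) = \<zero>\<^bsub>A\<^esub>" by (rule FK_opsD(3)[OF ops ij v])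
      then show "?\<theta> (i, j) (?\<theta> (i, j) (pure K A KG v s)) = \<zero>\<^bsub>?T\<^esub>"
        unfolding mp[OF ij ij v s] mp[OF ij ij A.m_closed[OF gen_closed[OF ij] v] tc[OF ij s]]
        using pz[OF tc[OF ij tc[OF ij s]]] by simp
    qed
  next
    fix i j k m u assume ijkm: "{i, j, k, m} \<subseteq> {1..N}" "distinct [i, j, k, m]" and u: "u \<in> carrier ?T"
    then have l: "(i, j) \<in> FK_letters N" "(k, m) \<in> FK_letters N" using FK_letters_of4 by blast+
    note l' = l(1) l(1) l(2) l(2)
    show "?\<theta> (i, j) (?\<theta> (k, m) u) = ?\<theta> (k, m) (?\<theta> (i, j) u)"
    proof (rule tensor_eqI[OF A_mod KG_mod T lin_map_comp[OF lin[OF l'(3,4)] lin[OF l'(1,2)]]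
          lin_map_comp[OF lin[OF l'(1,2)] lin[OF l'(3,4)]] _ u])
      fix v s assume v: "v \<in> carrier A" and s: "s \<in> carrier KG"
      have "X (i, j) \<otimes>\<^bsub>A\<^esub> (X (k, m) \<otimes>\<^bsub>A\<^esub> v) = X (k, m) \<otimes>\<^bsub>A\<^esub> (X (i, j) \<otimes>\<^bsub>A\<^esub> v)"
        by (rule FK_opsD(4)[OF ops ijkm v])
      moreover have "(\<lambda>h. s (letter_deg (k, m) \<circ> (letter_deg (i, j) \<circ> h))) =
          (\<lambda>h. s (letter_deg (i, j) \<circ> (letter_deg (k, m) \<circ> h)))"
        unfolding o_assoc letter_deg_commute[OF ijkm(2)] ..
      ultimately show "?\<theta> (i, j) (?\<theta> (k, m) (pure K A KG v s)) = ?\<theta> (k, m) (?\<theta> (i, j) (pure K A KG v s))"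
        unfolding mp[OF l'(1,2) v s] mp[OF l'(3,4) v s]
          mp[OF l'(1,2) A.m_closed[OF gen_closed[OF l(2)] v] tc[OF l(2) s]]
          mp[OF l'(3,4) A.m_closed[OF gen_closed[OF l(1)] v] tc[OF l(1) s]] by (simp only:)
    qed
  next
    fix i j k u assume ijk: "{i, j, k} \<subseteq> {1..N}" "distinct [i, j, k]" and u: "u \<in> carrier ?T"
    then have l: "(i, j) \<in> FK_letters N" "(j, k) \<in> FK_letters N" "(k, i) \<in> FK_letters N"
      using FK_letters_of by blast+
    note lc = lin[OF l(1) l(1)] lin[OF l(2) l(2)] lin[OF l(3) l(3)]
    note mpl = mp[OF l(1) l(1)] mp[OF l(2) l(2)] mp[OF l(3) l(3)]
    show "?\<theta> (i, j) (?\<theta> (j, k) u) \<oplus>\<^bsub>?T\<^esub> ?\<theta> (j, k) (?\<theta> (k, i) u) \<oplus>\<^bsub>?T\<^esub> ?\<theta> (k, i) (?\<theta> (i, j) u) = \<zero>\<^bsub>?T\<^esub>"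
    proof (rule eqI[OF lin_map_plus[OF T lin_map_plus[OF T lin_map_comp[OF lc(2,1)] lin_map_comp[OF lc(3,2)]]
            lin_map_comp[OF lc(1,3)]] _ u])
      fix v s assume v: "v \<in> carrier A" and s: "s \<in> carrier KG"
      let ?s = "\<lambda>h. s (letter_deg (j, k) \<circ> (letter_deg (i, j) \<circ> h))"
      have x: "X (i, j) \<in> carrier A" "X (j, k) \<in> carrier A" "X (k, i) \<in> carrier A" using gen_closed l by blast+
      have s': "?s \<in> carrier KG" using tc[OF l(1) tc[OF l(2) s]] .
      have eq: "(\<lambda>h. s (letter_deg (k, i) \<circ> (letter_deg (j, k) \<circ> h))) = ?s"
        "(\<lambda>h. s (letter_deg (i, j) \<circ> (letter_deg (k, i) \<circ> h))) = ?s"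
        unfolding o_assoc letter_deg_triple[OF ijk(2)] by (rule refl)+
      have "X (i, j) \<otimes>\<^bsub>A\<^esub> (X (j, k) \<otimes>\<^bsub>A\<^esub> v) \<oplus>\<^bsub>A\<^esub> X (j, k) \<otimes>\<^bsub>A\<^esub> (X (k, i) \<otimes>\<^bsub>A\<^esub> v) \<oplus>\<^bsub>A\<^esub>
        X (k, i) \<otimes>\<^bsub>A\<^esub> (X (i, j) \<otimes>\<^bsub>A\<^esub> v) = \<zero>\<^bsub>A\<^esub>" by (rule FK_opsD(5)[OF ops ijk v])
      then have "pure K A KG (X (i, j) \<otimes>\<^bsub>A\<^esub> (X (j, k) \<otimes>\<^bsub>A\<^esub> v)) ?s \<oplus>\<^bsub>?T\<^esub>
        pure K A KG (X (j, k) \<otimes>\<^bsub>A\<^esub> (X (k, i) \<otimes>\<^bsub>A\<^esub> v)) ?s \<oplus>\<^bsub>?T\<^esub>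
        pure K A KG (X (k, i) \<otimes>\<^bsub>A\<^esub> (X (i, j) \<otimes>\<^bsub>A\<^esub> v)) ?s = \<zero>\<^bsub>?T\<^esub>"
        using pz[OF s'] by (simp only: x v A.m_closed A.M.a_closed lin_map_add[OF pl[OF s'], symmetric])
      then show "?\<theta> (i, j) (?\<theta> (j, k) (pure K A KG v s)) \<oplus>\<^bsub>?T\<^esub> ?\<theta> (j, k) (?\<theta> (k, i) (pure K A KG v s)) \<oplus>\<^bsub>?T\<^esub>
        ?\<theta> (k, i) (?\<theta> (i, j) (pure K A KG v s)) = \<zero>\<^bsub>?T\<^esub>"
        unfolding mpl[OF v s] mpl(1)[OF A.m_closed[OF x(2) v] tc[OF l(2) s]]
          mpl(2)[OF A.m_closed[OF x(3) v] tc[OF l(3) s]] mpl(3)[OF A.m_closed[OF x(1) v] tc[OF l(1) s]] eq .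
    qed
  qed
qed

lemma coact_start: "pure K A KG \<one>\<^bsub>A\<^esub> (basis_vec K id) \<in> carrier (tensor K A KG)"
  by (rule pure_closed[OF A_mod KG_mod A.one_closed basis_vec_closed[OF K id_in_sym]])

lemmas coact_simps =
  FK_rec_lin_map[OF tensor_module[OF A_mod KG_mod] coact_ops coact_start]
  FK_rec_one[OF tensor_module[OF A_mod KG_mod] coact_ops coact_start]
  FK_rec_mult[OF tensor_module[OF A_mod KG_mod] coact_ops coact_start]

lemma coeff_bilin: "bilin K A KG A (\<lambda>a s. s g \<odot>\<^bsub>A\<^esub> a)"
proof -
  have "bilin K KG A A (\<lambda>s a. s g \<odot>\<^bsub>A\<^esub> a)"
  proof (rule bilin_smult[OF A_mod])
    show "(\<lambda>s. s g) \<in> lin_map K KG \<lparr>carrier = carrier K, mult = undefined, one = undefined,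
      zero = undefined, add = add K, smult = mult K\<rparr>"
      by (rule lin_mapI) (auto simp: free_module_carrier)
  qed simp_all
  then show ?thesis by (rule bilin_swap)
qed

lemmas coeff_lin_map = tensor_lift_lin_map[OF A_mod KG_mod A_mod coeff_bilin]
lemmas coeff_pure = tensor_lift_pure[OF A_mod KG_mod A_mod coeff_bilin]

lemma FK_comp_lin_map: "FK_comp K N g \<in> lin_map K A A"
  unfolding FK_comp_def[abs_def] FK_coact_def Let_def
  by (rule lin_map_comp[OF coact_simps(1) coeff_lin_map])

lemmas FK_comp_closed = lin_map_closed[OF FK_comp_lin_map]

lemma FK_comp_one: "FK_comp K N g \<one>\<^bsub>A\<^esub> = (if g = id then \<one>\<^bsub>A\<^esub> else \<zero>\<^bsub>A\<^esub>)"
  unfolding FK_comp_def FK_coact_def Let_def coact_simps(2)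
    coeff_pure[OF A.one_closed basis_vec_closed[OF K id_in_sym]]
  by (simp add: basis_vec_def)

text \<open>The letter adds its degree on the left. The shift is by \<open>letter_deg p\<close>
  rather than by its inverse because a transposition is its own inverse.\<close>

lemma FK_comp_mult:
  assumes p: "p \<in> FK_letters N" and b: "b \<in> carrier A"
  shows "FK_comp K N g (X p \<otimes>\<^bsub>A\<^esub> b) = X p \<otimes>\<^bsub>A\<^esub> FK_comp K N (letter_deg p \<circ> g) b"
proof -
  let ?\<theta> = "tensor_map K A KG (\<lambda>b. X p \<otimes>\<^bsub>A\<^esub> b) (\<lambda>s h. s (letter_deg p \<circ> h))"
  note tl = translate_lin_map[OF letter_deg_closed[OF p]]
  note lin = tensor_map_lin_map[OF A_mod KG_mod A_mod KG_mod gen_mult_lin_map[OF p] tl]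
  note mp = tensor_map_pure[OF A_mod KG_mod A_mod KG_mod gen_mult_lin_map[OF p] tl]
  have "tensor_lift K A (\<lambda>a s. s g \<odot>\<^bsub>A\<^esub> a) (?\<theta> t) =
      X p \<otimes>\<^bsub>A\<^esub> tensor_lift K A (\<lambda>a s. s (letter_deg p \<circ> g) \<odot>\<^bsub>A\<^esub> a) t"
    if t: "t \<in> carrier (tensor K A KG)" for t
  proof (rule tensor_eqI[OF A_mod KG_mod A_mod lin_map_comp[OF lin coeff_lin_map]
        lin_map_comp[OF coeff_lin_map gen_mult_lin_map[OF p]] _ t])
    fix v s assume v: "v \<in> carrier A" and s: "s \<in> carrier KG"
    then have "s h \<in> carrier K" for h by (simp add: free_module_carrier)
    with v show "tensor_lift K A (\<lambda>a s. s g \<odot>\<^bsub>A\<^esub> a) (?\<theta> (pure K A KG v s)) =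
      X p \<otimes>\<^bsub>A\<^esub> tensor_lift K A (\<lambda>a s. s (letter_deg p \<circ> g) \<odot>\<^bsub>A\<^esub> a) (pure K A KG v s)"
      unfolding mp[OF v s] coeff_pure[OF v s]
        coeff_pure[OF A.m_closed[OF gen_closed[OF p] v] lin_map_closed[OF tl s]]
      by (simp add: A.smult_mult_right gen_closed[OF p])
  qed
  from this[OF lin_map_closed[OF coact_simps(1) b]] show ?thesis
    unfolding FK_comp_def FK_coact_def Let_def coact_simps(3)[OF p b] .
qed

lemma FK_comp_proj:
  assumes "b \<in> carrier A"
  shows "FK_comp K N g (FK_comp K N h b) = (if g = h then FK_comp K N g b else \<zero>\<^bsub>A\<^esub>)"
proof -
  \<comment> \<open>The family is indexed by pairs because a letter shifts both degrees at once; the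
    shift preserves whether they are equal.\<close>
  define f where "f = (\<lambda>(g, h) b. FK_comp K N g (FK_comp K N h b))"
  define f' where "f' = (\<lambda>(g, h) b. if g = h then FK_comp K N g b else \<zero>\<^bsub>A\<^esub>)"
  have "f (g, h) b = f' (g, h) b"
  proof (rule FK_eqI_family[where f = f and f' = f', OF A_mod _ _ _ _ assms])
    fix i show "f i \<in> lin_map K A A"
      by (auto simp: f_def split: prod.split intro!: lin_map_comp[OF FK_comp_lin_map FK_comp_lin_map])
    show "f' i \<in> lin_map K A A"
      by (cases i; cases "fst i = snd i") (simp_all add: f'_def FK_comp_lin_map lin_map_const_zero[OF A_mod])
    show "f i \<one>\<^bsub>A\<^esub> = f' i \<one>\<^bsub>A\<^esub>"
      by (auto simp: f_def f'_def FK_comp_one lin_map_zero[OF A_mod A_mod FK_comp_lin_map] split: prod.split)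
  next
    fix p b and i :: "(nat \<Rightarrow> nat) \<times> (nat \<Rightarrow> nat)"
    assume p: "p \<in> FK_letters N" and b: "b \<in> carrier A" and IH: "\<And>j. f j b = f' j b"
    obtain g h where i: "i = (g, h)" by (cases i)
    have "letter_deg p \<circ> g = letter_deg p \<circ> h \<longleftrightarrow> g = h" by (metis letter_deg_invol)
    then show "f i (X p \<otimes>\<^bsub>A\<^esub> b) = f' i (X p \<otimes>\<^bsub>A\<^esub> b)"
      using IH[of "(letter_deg p \<circ> g, letter_deg p \<circ> h)"] p b gen_closed[OF p]
      by (simp add: f_def f'_def i FK_comp_mult FK_comp_closed)
  qed
  then show ?thesis by (simp add: f_def f'_def)
qed

lemma FK_comp_sum:
  assumes "b \<in> carrier A" shows "(\<Oplus>\<^bsub>A\<^esub>g\<in>carrier G. FK_comp K N g b) = b"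
proof (rule FK_eqI[OF A_mod lin_map_sum[OF A_mod A_mod sym_group_finite FK_comp_lin_map] lin_map_id _ _ assms])
  have "(\<Oplus>\<^bsub>A\<^esub>g\<in>carrier G. FK_comp K N g \<one>\<^bsub>A\<^esub>) = (\<Oplus>\<^bsub>A\<^esub>g\<in>carrier G. if id = g then \<one>\<^bsub>A\<^esub> else \<zero>\<^bsub>A\<^esub>)"
    by (rule A.M.finsum_cong') (auto simp: FK_comp_one)
  also have "\<dots> = \<one>\<^bsub>A\<^esub>" by (rule A.M.finsum_singleton[OF id_in_sym sym_group_finite]) simp
  finally show "(\<Oplus>\<^bsub>A\<^esub>g\<in>carrier G. FK_comp K N g \<one>\<^bsub>A\<^esub>) = \<one>\<^bsub>A\<^esub>" .
next
  fix p b assume p: "p \<in> FK_letters N" and b: "b \<in> carrier A" and IH: "(\<Oplus>\<^bsub>A\<^esub>g\<in>carrier G. FK_comp K N g b) = b"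
  let ?t = "\<lambda>g. letter_deg p \<circ> g"
  have tG: "?t g \<in> carrier G" if "g \<in> carrier G" for g
    using that letter_deg_closed[OF p] by (simp add: sym_group_carrier permutes_compose)
  \<comment> \<open>Composition with the transposition permutes the group, so the shifted sum can be
    reindexed to the original one.\<close>
  then have img: "?t ` carrier G = carrier G"
    by (auto intro!: image_eqI[of _ ?t "?t _"])
  have inj: "inj_on ?t (carrier G)" by (rule inj_onI) (metis letter_deg_invol)
  have "(\<Oplus>\<^bsub>A\<^esub>g\<in>carrier G. FK_comp K N g (X p \<otimes>\<^bsub>A\<^esub> b)) = (\<Oplus>\<^bsub>A\<^esub>g\<in>carrier G. X p \<otimes>\<^bsub>A\<^esub> FK_comp K N (?t g) b)"
    by (rule A.M.finsum_cong') (use p b gen_closed FK_comp_closed in \<open>auto simp: FK_comp_mult\<close>)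
  also have "\<dots> = X p \<otimes>\<^bsub>A\<^esub> (\<Oplus>\<^bsub>A\<^esub>g\<in>carrier G. FK_comp K N (?t g) b)"
    by (rule lin_map_finsum[OF A_mod A_mod gen_mult_lin_map[OF p] sym_group_finite, symmetric])
      (use b FK_comp_closed in auto)
  also have "(\<Oplus>\<^bsub>A\<^esub>g\<in>carrier G. FK_comp K N (?t g) b) = (\<Oplus>\<^bsub>A\<^esub>g\<in>?t ` carrier G. FK_comp K N g b)"
    by (rule A.M.finsum_reindex[OF _ inj, symmetric]) (use b FK_comp_closed in auto)
  finally show "(\<Oplus>\<^bsub>A\<^esub>g\<in>carrier G. FK_comp K N g (X p \<otimes>\<^bsub>A\<^esub> b)) = X p \<otimes>\<^bsub>A\<^esub> b" by (simp add: img IH)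
qed

lemma FK_act_comp_proj:
  assumes h: "h \<in> carrier G" and b: "b \<in> carrier A"
  shows "FK_act K N h (FK_comp K N g b) = FK_comp K N (h \<circ> g \<circ> inv' h) (FK_act K N h b)"
proof (rule FK_eqI_family[where f = "\<lambda>g b. FK_act K N h (FK_comp K N g b)" and i = g and
      f' = "\<lambda>g b. FK_comp K N (h \<circ> g \<circ> inv' h) (FK_act K N h b)", OF A_mod
      lin_map_comp[OF FK_comp_lin_map FK_act_lin_map[OF h]]
      lin_map_comp[OF FK_act_lin_map[OF h] FK_comp_lin_map] _ _ b])
  have hi: "inv' h \<circ> h = id" "h \<circ> inv' h = id" using h by (simp_all add: sym_group_carrier permutes_inv_o)
  fix g
  have "g = inv' h \<circ> (h \<circ> g \<circ> inv' h) \<circ> h" by (simp add: hi o_assoc) (simp add: hi flip: o_assoc)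
  then have "h \<circ> g \<circ> inv' h = id \<longleftrightarrow> g = id" using hi by auto
  then show "FK_act K N h (FK_comp K N g \<one>\<^bsub>A\<^esub>) = FK_comp K N (h \<circ> g \<circ> inv' h) (FK_act K N h \<one>\<^bsub>A\<^esub>)"
    by (simp add: FK_comp_one FK_act_one[OF h] lin_map_zero[OF A_mod A_mod FK_act_lin_map[OF h]])
next
  fix p b g
  assume p: "p \<in> FK_letters N" and b: "b \<in> carrier A"
    and IH: "\<And>g. FK_act K N h (FK_comp K N g b) = FK_comp K N (h \<circ> g \<circ> inv' h) (FK_act K N h b)"
  note hp = perm_letter_closed[OF h p]
  \<comment> \<open>The degree of the letter moved by \<open>h\<close> is the conjugate of its old
    degree, so conjugation by \<open>h\<close> turns one shift of degrees into the other.\<close>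
  have deg: "letter_deg (perm_letter h p) \<circ> (h \<circ> g \<circ> inv' h) = h \<circ> (letter_deg p \<circ> g) \<circ> inv' h"
    using letter_deg_perm[OF h, of p] by (simp add: o_assoc)
  show "FK_act K N h (FK_comp K N g (X p \<otimes>\<^bsub>A\<^esub> b)) = FK_comp K N (h \<circ> g \<circ> inv' h) (FK_act K N h (X p \<otimes>\<^bsub>A\<^esub> b))"
    unfolding FK_comp_mult[OF p b] FK_act_mult[OF h gen_closed[OF p] FK_comp_closed[OF b]]
      FK_act_mult[OF h gen_closed[OF p] b] FK_act_gen[OF h p]
      FK_comp_mult[OF hp FK_act_closed[OF h b]] deg IH ..
qed

text \<open>For homogeneous factors this says that degrees multiply. Projecting the left factor,
  instead of assuming it homogeneous, makes both sides linear in \<open>b\<close>, as the induction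
  requires.\<close>

lemma FK_comp_mult_left:
  assumes c: "c \<in> carrier A" and b: "b \<in> carrier A"
  shows "FK_comp K N (g \<circ> k) (FK_comp K N g b \<otimes>\<^bsub>A\<^esub> c) = FK_comp K N g b \<otimes>\<^bsub>A\<^esub> FK_comp K N k c"
proof (rule FK_eqI_family[where f = "\<lambda>g b. FK_comp K N (g \<circ> k) (FK_comp K N g b \<otimes>\<^bsub>A\<^esub> c)" and i = g and
      f' = "\<lambda>g b. FK_comp K N g b \<otimes>\<^bsub>A\<^esub> FK_comp K N k c", OF A_mod
      lin_map_comp[OF lin_map_comp[OF FK_comp_lin_map
        mult_right_lin_map[OF FK_assoc_algebra c]] FK_comp_lin_map]
      lin_map_comp[OF FK_comp_lin_map mult_right_lin_map[OF FK_assoc_algebra FK_comp_closed[OF c]]] _ _ b])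
  fix g show "FK_comp K N (g \<circ> k) (FK_comp K N g \<one>\<^bsub>A\<^esub> \<otimes>\<^bsub>A\<^esub> c) = FK_comp K N g \<one>\<^bsub>A\<^esub> \<otimes>\<^bsub>A\<^esub> FK_comp K N k c"
    using c FK_comp_closed[OF c] by (simp add: FK_comp_one lin_map_zero[OF A_mod A_mod FK_comp_lin_map])
next
  fix p b g
  assume p: "p \<in> FK_letters N" and b: "b \<in> carrier A"
    and IH: "\<And>g. FK_comp K N (g \<circ> k) (FK_comp K N g b \<otimes>\<^bsub>A\<^esub> c) = FK_comp K N g b \<otimes>\<^bsub>A\<^esub> FK_comp K N k c"
  show "FK_comp K N (g \<circ> k) (FK_comp K N g (X p \<otimes>\<^bsub>A\<^esub> b) \<otimes>\<^bsub>A\<^esub> c) =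
    FK_comp K N g (X p \<otimes>\<^bsub>A\<^esub> b) \<otimes>\<^bsub>A\<^esub> FK_comp K N k c"
    using IH[of "letter_deg p \<circ> g"] p b c gen_closed[OF p]
    by (simp add: FK_comp_mult FK_comp_closed A.m_assoc o_assoc)
qed

text \<open>Needed for the antipode, whose recursion puts the letter on the right. The induction
  still runs over letters on the left of \<open>b\<close>, which do not interfere with the one on
  the right.\<close>

lemma FK_comp_mult_right:
  assumes p: "p \<in> FK_letters N" and b: "b \<in> carrier A"
  shows "FK_comp K N g (b \<otimes>\<^bsub>A\<^esub> X p) = FK_comp K N (g \<circ> letter_deg p) b \<otimes>\<^bsub>A\<^esub> X p"
proof (rule FK_eqI_family[where f = "\<lambda>g b. FK_comp K N g (b \<otimes>\<^bsub>A\<^esub> X p)" and i = g and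
      f' = "\<lambda>g b. FK_comp K N (g \<circ> letter_deg p) b \<otimes>\<^bsub>A\<^esub> X p", OF A_mod
      lin_map_comp[OF mult_right_lin_map[OF FK_assoc_algebra gen_closed[OF p]] FK_comp_lin_map]
      lin_map_comp[OF FK_comp_lin_map mult_right_lin_map[OF FK_assoc_algebra gen_closed[OF p]]] _ _ b])
  fix g
  have "letter_deg p \<circ> g = id \<longleftrightarrow> g \<circ> letter_deg p = id"
    by (metis comp_id id_comp letter_deg_invol o_assoc)
  then show "FK_comp K N g (\<one>\<^bsub>A\<^esub> \<otimes>\<^bsub>A\<^esub> X p) = FK_comp K N (g \<circ> letter_deg p) \<one>\<^bsub>A\<^esub> \<otimes>\<^bsub>A\<^esub> X p"
    using FK_comp_mult[OF p A.one_closed, of g] gen_closed[OF p] by (simp add: FK_comp_one)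
next
  fix q b g
  assume q: "q \<in> FK_letters N" and b: "b \<in> carrier A"
    and IH: "\<And>g. FK_comp K N g (b \<otimes>\<^bsub>A\<^esub> X p) = FK_comp K N (g \<circ> letter_deg p) b \<otimes>\<^bsub>A\<^esub> X p"
  show "FK_comp K N g (X q \<otimes>\<^bsub>A\<^esub> b \<otimes>\<^bsub>A\<^esub> X p) = FK_comp K N (g \<circ> letter_deg p) (X q \<otimes>\<^bsub>A\<^esub> b) \<otimes>\<^bsub>A\<^esub> X p"
    using IH[of "letter_deg q \<circ> g"] p q b gen_closed[OF p] gen_closed[OF q]
    by (simp add: FK_comp_mult FK_comp_closed A.m_assoc o_assoc)
qed

end

section \<open>The braided group structure\<close>

definition FK_crossed ::
  "('k, 'r) ring_scheme \<Rightarrow> nat \<Rightarrow> ('k, ((nat \<times> nat) list \<Rightarrow> 'k) set, nat \<Rightarrow> nat) crossed"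
  where "FK_crossed K N = module.extend (FK_algebra K N)
    (crossed.fields (FK_act K N) (\<lambda>g. {b \<in> carrier (FK_algebra K N). FK_comp K N g b = b}))"

lemma FK_crossed_simps [simp]:
  "carrier (FK_crossed K N) = carrier (FK_algebra K N)"
  "mult (FK_crossed K N) = mult (FK_algebra K N)"
  "one (FK_crossed K N) = one (FK_algebra K N)"
  "zero (FK_crossed K N) = zero (FK_algebra K N)"
  "add (FK_crossed K N) = add (FK_algebra K N)"
  "smult (FK_crossed K N) = smult (FK_algebra K N)"
  "act (FK_crossed K N) = FK_act K N"
  "grade (FK_crossed K N) g = {b \<in> carrier (FK_algebra K N). FK_comp K N g b = b}"
  by (simp_all add: FK_crossed_def module.defs crossed.defs)

lemma FK_crossed_truncate: "module.truncate (FK_crossed K N) = FK_algebra K N"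
  by (simp add: FK_crossed_def module.defs crossed.defs)

lemma lin_map_FK_crossed [simp]:
  "lin_map K (FK_crossed K N) U = lin_map K (FK_algebra K N) U"
  "lin_map K U (FK_crossed K N) = lin_map K U (FK_algebra K N)"
  by (rule lin_map_dom_cong lin_map_cod_cong; simp)+

lemma crossed_tensor_simps [simp]:
  "carrier (crossed_tensor K G V W) = carrier (tensor K V W)"
  "zero (crossed_tensor K G V W) = zero (tensor K V W)"
  "add (crossed_tensor K G V W) = add (tensor K V W)"
  "smult (crossed_tensor K G V W) = smult (tensor K V W)"
  "act (crossed_tensor K G V W) = (\<lambda>g. tensor_map K V W (act V g) (act W g))"
  "grade (crossed_tensor K G V W) = (\<lambda>g. lin_span K (tensor K V W)
        {pure K V W v w | v w h l.
          h \<in> carrier G \<and> l \<in> carrier G \<and> h \<otimes>\<^bsub>G\<^esub> l = g \<and> v \<in> grade V h \<and> w \<in> grade W l})"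
  by (simp_all add: crossed_tensor_def module.defs crossed.defs)

lemma lin_map_crossed_tensor [simp]:
  "lin_map K (crossed_tensor K G V W) U = lin_map K (tensor K V W) U"
  "lin_map K U (crossed_tensor K G V W) = lin_map K U (tensor K V W)"
  by (rule lin_map_dom_cong lin_map_cod_cong; simp)+

lemma (in abelian_group) cancel_pairs:
  "\<lbrakk>a \<in> carrier G; b \<in> carrier G\<rbrakk> \<Longrightarrow> (a \<oplus> b) \<oplus> (\<ominus> a \<oplus> \<ominus> b) = \<zero>"
  by (simp add: r_neg flip: minus_add)

text \<open>The shape of the triple relation after the coproduct: the \<open>a\<close> terms are the
  relation in the left tensor factor, the \<open>c\<close> terms the relation in the right one, and
  \<open>u\<close>, \<open>v\<close>, \<open>w\<close> are the mixed terms, each occurring once with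
  either sign.\<close>

lemma (in abelian_group) cancel_triple:
  assumes "a1 \<in> carrier G" "a2 \<in> carrier G" "a3 \<in> carrier G" "c1 \<in> carrier G" "c2 \<in> carrier G" "c3 \<in> carrier G"
    "u \<in> carrier G" "v \<in> carrier G" "w \<in> carrier G" "a1 \<oplus> a2 \<oplus> a3 = \<zero>" "c1 \<oplus> c2 \<oplus> c3 = \<zero>"
  shows "(a1 \<oplus> \<ominus> w \<oplus> (u \<oplus> c1)) \<oplus> (a2 \<oplus> \<ominus> u \<oplus> (v \<oplus> c2)) \<oplus> (a3 \<oplus> \<ominus> v \<oplus> (w \<oplus> c3)) = \<zero>"
proof -
  have "(a1 \<oplus> \<ominus> w \<oplus> (u \<oplus> c1)) \<oplus> (a2 \<oplus> \<ominus> u \<oplus> (v \<oplus> c2)) \<oplus> (a3 \<oplus> \<ominus> v \<oplus> (w \<oplus> c3)) =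
    (a1 \<oplus> a2 \<oplus> a3) \<oplus> (c1 \<oplus> c2 \<oplus> c3) \<oplus> ((u \<oplus> \<ominus> u) \<oplus> (v \<oplus> \<ominus> v) \<oplus> (w \<oplus> \<ominus> w))"
    using assms(1-9) by (simp only: a_ac a_closed a_inv_closed)
  also have "\<dots> = \<zero>" using assms by (simp add: r_neg)
  finally show ?thesis .
qed

lemma lin_span_carrier: "module K V \<Longrightarrow> lin_span K V (carrier V) = carrier V"
  using submodule_subset[OF lin_span_submodule[of K V "carrier V"]] lin_span_incl[of "carrier V" K V] by auto

context FK_base
begin

interpretation K: cring K by (rule K)

interpretation A: assoc_algebra K A by (rule FK_assoc_algebra)

abbreviation (input) "B \<equiv> FK_crossed K N"
abbreviation (input) "T \<equiv> tensor K (FK_crossed K N) (FK_crossed K N)"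
abbreviation (input) "P \<equiv> pure K (FK_crossed K N) (FK_crossed K N)"
abbreviation (input) "da p \<equiv> FK_act K N (letter_deg p)"

lemma B_alg: "assoc_algebra K B"
  by (rule assoc_algebra_cong[OF FK_assoc_algebra]) simp_all

lemma B_mod: "module K B"
  by (rule assoc_algebra_module[OF B_alg])

lemma T_mod: "module K T"
  by (rule tensor_module[OF B_mod B_mod])

interpretation T: module K T by (rule T_mod)

lemma P_bilin: "bilin K A A T P"
  using pure_bilin[OF B_mod B_mod] by (simp add: bilin_def)

lemmas P_closed = bilin_closed[OF P_bilin]
lemmas P_left = bilin_left[OF P_bilin]
lemmas P_right = bilin_right[OF P_bilin]

lemma P_minus_left: "\<lbrakk>b \<in> carrier A; c \<in> carrier A\<rbrakk> \<Longrightarrow> P (\<ominus>\<^bsub>A\<^esub> b) c = \<ominus>\<^bsub>T\<^esub> P b c"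
  by (rule lin_map_uminus[OF A_mod T_mod P_left])

lemma P_zero_left: "c \<in> carrier A \<Longrightarrow> P \<zero>\<^bsub>A\<^esub> c = \<zero>\<^bsub>T\<^esub>"
  by (rule lin_map_zero[OF A_mod T_mod P_left])

lemma P_zero_right: "b \<in> carrier A \<Longrightarrow> P b \<zero>\<^bsub>A\<^esub> = \<zero>\<^bsub>T\<^esub>"
  by (rule lin_map_zero[OF A_mod T_mod P_right])

lemma P_minus_right: "\<lbrakk>b \<in> carrier A; c \<in> carrier A\<rbrakk> \<Longrightarrow> P b (\<ominus>\<^bsub>A\<^esub> c) = \<ominus>\<^bsub>T\<^esub> P b c"
  by (rule lin_map_uminus[OF A_mod T_mod P_right])

lemma T_eqI:
  assumes "module K U" "f \<in> lin_map K T U" "g \<in> lin_map K T U"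
    "\<And>b c. \<lbrakk>b \<in> carrier A; c \<in> carrier A\<rbrakk> \<Longrightarrow> f (P b c) = g (P b c)" "t \<in> carrier T"
  shows "f t = g t"
  by (rule tensor_eqI[OF B_mod B_mod assms(1-3) _ assms(5)]) (simp add: assms(4))

lemma T_lift_lin_map:
  "\<lbrakk>module K U; bilin K A A U b\<rbrakk> \<Longrightarrow> tensor_lift K U b \<in> lin_map K T U"
  by (rule tensor_lift_lin_map[OF B_mod B_mod]) (simp_all add: bilin_def)

lemma T_lift_pure:
  "\<lbrakk>module K U; bilin K A A U b; v \<in> carrier A; w \<in> carrier A\<rbrakk> \<Longrightarrow> tensor_lift K U b (P v w) = b v w"
  by (rule tensor_lift_pure[OF B_mod B_mod]) (simp_all add: bilin_def)

lemma gen_swap: "(i, j) \<in> FK_letters N \<Longrightarrow> FK_gen K N j i = \<ominus>\<^bsub>A\<^esub> FK_gen K N i j"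
  using FK_elemsD(2)[OF FK_elems_gen, of j i] gen_closed[of "(i, j)"] gen_closed[of "(j, i)"] FK_letters_swap[of i j N]
  by (intro A.M.minus_equality[symmetric]) auto

lemma da_gen:
  assumes "p \<in> FK_letters N" "q \<in> FK_letters N"
  shows "da p (X q) = X (perm_letter (letter_deg p) q)"
  by (rule FK_act_gen[OF letter_deg_closed[OF assms(1)] assms(2)])

lemma da_closed: "p \<in> FK_letters N \<Longrightarrow> b \<in> carrier A \<Longrightarrow> da p b \<in> carrier A"
  by (rule FK_act_closed[OF letter_deg_closed])

lemma da_mult_gen:
  assumes "p \<in> FK_letters N" "q \<in> FK_letters N" "b \<in> carrier A"
  shows "da p (X q \<otimes>\<^bsub>A\<^esub> b) = X (perm_letter (letter_deg p) q) \<otimes>\<^bsub>A\<^esub> da p b"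
  unfolding FK_act_mult[OF letter_deg_closed[OF assms(1)] gen_closed[OF assms(2)] assms(3)]
    da_gen[OF assms(1,2)] ..

lemma da_comp:
  assumes "p \<in> FK_letters N" "q \<in> FK_letters N" "b \<in> carrier A"
  shows "da p (da q b) = FK_act K N (letter_deg p \<circ> letter_deg q) b"
  by (rule FK_act_comp[OF letter_deg_closed[OF assms(1)] letter_deg_closed[OF assms(2)] assms(3), symmetric])

lemma letter_deg_apply:
  "letter_deg (i, j) i = j" "letter_deg (i, j) j = i" "\<lbrakk>k \<noteq> i; k \<noteq> j\<rbrakk> \<Longrightarrow> letter_deg (i, j) k = k"
  by (simp_all add: letter_deg_def Transposition.transpose_def)


text \<open>Again the common degree of the triple relation, now multiplied in the order in which the
  action composes, opposite to that in \<open>letter_deg_triple\<close>.\<close>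

lemma letter_deg_cycle:
  assumes "distinct [i, j, k]"
  shows "letter_deg (j, k) \<circ> letter_deg (k, i) = letter_deg (i, j) \<circ> letter_deg (j, k)"
    "letter_deg (k, i) \<circ> letter_deg (i, j) = letter_deg (i, j) \<circ> letter_deg (j, k)"
  using assms by (auto simp: letter_deg_def fun_eq_iff Transposition.transpose_def)

subsection \<open>The coproduct\<close>

text \<open>Left multiplication by \<open>\<Delta> x\<^sub>p = x\<^sub>p \<otimes> 1 + 1 \<otimes> x\<^sub>p\<close> in the braided square.\<close>

definition "coprod_op p = tensor_lift K T (\<lambda>b c. P (X p \<otimes>\<^bsub>A\<^esub> b) c \<oplus>\<^bsub>T\<^esub> P (da p b) (X p \<otimes>\<^bsub>A\<^esub> c))"

lemma coprod_op_bilin: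
  assumes "p \<in> FK_letters N"
  shows "bilin K A A T (\<lambda>b c. P (X p \<otimes>\<^bsub>A\<^esub> b) c \<oplus>\<^bsub>T\<^esub> P (da p b) (X p \<otimes>\<^bsub>A\<^esub> c))"
  by (rule bilin_plus[OF T_mod bilin_comp[OF P_bilin gen_mult_lin_map[OF assms] lin_map_id]
        bilin_comp[OF P_bilin FK_act_lin_map[OF letter_deg_closed[OF assms]] gen_mult_lin_map[OF assms]]])

lemma coprod_op_lin_map: "p \<in> FK_letters N \<Longrightarrow> coprod_op p \<in> lin_map K T T"
  unfolding coprod_op_def by (rule T_lift_lin_map[OF T_mod coprod_op_bilin])

lemma coprod_op_pure:
  "\<lbrakk>p \<in> FK_letters N; b \<in> carrier A; c \<in> carrier A\<rbrakk> \<Longrightarrow>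
    coprod_op p (P b c) = P (X p \<otimes>\<^bsub>A\<^esub> b) c \<oplus>\<^bsub>T\<^esub> P (da p b) (X p \<otimes>\<^bsub>A\<^esub> c)"
  unfolding coprod_op_def by (rule T_lift_pure[OF T_mod coprod_op_bilin])

text \<open>The four summands of \<Delta>(x_p) \<Delta>(x_q) (b \<otimes> c): both letters on the
  left, two mixed terms, both on the right. In the first mixed term \<open>q\<close> has been
  relabelled, since passing the right-hand \<open>X p\<close> to the other side applies its degree
  to everything in the left factor.\<close>

lemma coprod_op_op_pure:
  assumes p: "p \<in> FK_letters N" and q: "q \<in> FK_letters N" and b: "b \<in> carrier A" and c: "c \<in> carrier A"
  shows "coprod_op p (coprod_op q (P b c)) =
    P (X p \<otimes>\<^bsub>A\<^esub> (X q \<otimes>\<^bsub>A\<^esub> b)) c \<oplus>\<^bsub>T\<^esub> P (X (perm_letter (letter_deg p) q) \<otimes>\<^bsub>A\<^esub> da p b) (X p \<otimes>\<^bsub>A\<^esub> c) \<oplus>\<^bsub>T\<^esub>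
    (P (X p \<otimes>\<^bsub>A\<^esub> da q b) (X q \<otimes>\<^bsub>A\<^esub> c) \<oplus>\<^bsub>T\<^esub>
     P (FK_act K N (letter_deg p \<circ> letter_deg q) b) (X p \<otimes>\<^bsub>A\<^esub> (X q \<otimes>\<^bsub>A\<^esub> c)))"
proof -
  note xq = gen_closed[OF q]
  have 1: "X q \<otimes>\<^bsub>A\<^esub> b \<in> carrier A" "X q \<otimes>\<^bsub>A\<^esub> c \<in> carrier A" "da q b \<in> carrier A"
    using xq b c da_closed[OF q] by auto
  show ?thesis
    unfolding coprod_op_pure[OF q b c]
      lin_map_add[OF coprod_op_lin_map[OF p] P_closed[OF 1(1) c] P_closed[OF 1(3,2)]]
      coprod_op_pure[OF p 1(1) c] coprod_op_pure[OF p 1(3,2)] da_mult_gen[OF p q b] da_comp[OF p q b] ..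
qed

lemma gen_ops: "FK_ops K N A (\<lambda>p b. X p \<otimes>\<^bsub>A\<^esub> b)"
  by (rule FK_ops_mult[OF FK_assoc_algebra FK_elems_gen])

lemma coprod_ops: "FK_ops K N T coprod_op"
proof (rule FK_opsI)
  note lin = coprod_op_lin_map
  note eq0 = T_eqI[OF T_mod _ lin_map_const_zero[OF T_mod]]
  fix i j assume ij: "(i, j) \<in> FK_letters N"
  note ji = FK_letters_swap[OF ij]
  note x = gen_closed[OF ij, simplified]
  show "coprod_op (i, j) \<in> lin_map K T T" by (rule lin[OF ij])
  fix t assume t: "t \<in> carrier T"
  show "coprod_op (i, j) t \<oplus>\<^bsub>T\<^esub> coprod_op (j, i) t = \<zero>\<^bsub>T\<^esub>"
  proof (rule eq0[OF lin_map_plus[OF T_mod lin[OF ij] lin[OF ji]] _ t])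
    fix b c assume b: "b \<in> carrier A" and c: "c \<in> carrier A"
    note bc = A.m_closed[OF x b] A.m_closed[OF x c] da_closed[OF ij b]
    have "coprod_op (j, i) (P b c) = \<ominus>\<^bsub>T\<^esub> P (FK_gen K N i j \<otimes>\<^bsub>A\<^esub> b) c \<oplus>\<^bsub>T\<^esub>
        \<ominus>\<^bsub>T\<^esub> P (da (i, j) b) (FK_gen K N i j \<otimes>\<^bsub>A\<^esub> c)"
      using bc b c x by (simp add: coprod_op_pure[OF ji] gen_swap[OF ij] letter_deg_swap[of j i]
          A.l_minus P_minus_left P_minus_right)
    then show "coprod_op (i, j) (P b c) \<oplus>\<^bsub>T\<^esub> coprod_op (j, i) (P b c) = \<zero>\<^bsub>T\<^esub>"
      using bc b c by (simp add: coprod_op_pure[OF ij] T.M.cancel_pairs P_closed)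
  qed
  show "coprod_op (i, j) (coprod_op (i, j) t) = \<zero>\<^bsub>T\<^esub>"
  proof (rule eq0[OF lin_map_comp[OF lin[OF ij] lin[OF ij]] _ t])
    fix b c assume b: "b \<in> carrier A" and c: "c \<in> carrier A"
    note db = da_closed[OF ij b]
    have dd: "FK_act K N (letter_deg (i, j) \<circ> letter_deg (i, j)) b \<in> carrier A"
      unfolding da_comp[OF ij ij b, symmetric] by (rule da_closed[OF ij db])
    \<comment> \<open>The transposition of (i, j) reverses that letter, so one mixed term is minus
      the other; the unmixed terms contain the square of a letter.\<close>
    show "coprod_op (i, j) (coprod_op (i, j) (P b c)) = \<zero>\<^bsub>T\<^esub>"
      using b c db dd x FK_opsD(3)[OF gen_ops ij] A.m_closed[OF x db] A.m_closed[OF x c]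
      by (simp add: coprod_op_op_pure[OF ij ij] letter_deg_apply gen_swap[OF ij] A.l_minus P_minus_left
          P_zero_left P_zero_right T.M.l_neg P_closed)
  qed
next
  note lin = coprod_op_lin_map
  fix i j k m t assume ijkm: "{i, j, k, m} \<subseteq> {1..N}" "distinct [i, j, k, m]" and t: "t \<in> carrier T"
  have l: "(i, j) \<in> FK_letters N" "(k, m) \<in> FK_letters N" using FK_letters_of4 ijkm by blast+
  note x = gen_closed[OF l(1), simplified] gen_closed[OF l(2), simplified]
  show "coprod_op (i, j) (coprod_op (k, m) t) = coprod_op (k, m) (coprod_op (i, j) t)"
  proof (rule T_eqI[OF T_mod lin_map_comp[OF lin[OF l(2)] lin[OF l(1)]] lin_map_comp[OF lin[OF l(1)] lin[OF l(2)]] _ t])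
    fix b c assume b: "b \<in> carrier A" and c: "c \<in> carrier A"
    note db = da_closed[OF l(1) b] da_closed[OF l(2) b]
    have dd: "FK_act K N (letter_deg (i, j) \<circ> letter_deg (k, m)) b \<in> carrier A"
      unfolding da_comp[OF l b, symmetric] by (rule da_closed[OF l(1) db(2)])
    \<comment> \<open>Disjoint letters are fixed by each other's transposition, so exchanging the
      operators only exchanges the two mixed terms.\<close>
    have pl: "perm_letter (letter_deg (i, j)) (k, m) = (k, m)" "perm_letter (letter_deg (k, m)) (i, j) = (i, j)"
      using ijkm(2) by (auto simp: letter_deg_apply)
    show "coprod_op (i, j) (coprod_op (k, m) (P b c)) = coprod_op (k, m) (coprod_op (i, j) (P b c))"
      unfolding coprod_op_op_pure[OF l b c] coprod_op_op_pure[OF l(2,1) b c] pl letter_deg_commute[OF ijkm(2)]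
        FK_opsD(4)[OF gen_ops ijkm b] FK_opsD(4)[OF gen_ops ijkm c]
      using b c x db dd by (simp add: P_closed T.M.a_ac)
  qed
next
  note lin = coprod_op_lin_map
  note eq0 = T_eqI[OF T_mod _ lin_map_const_zero[OF T_mod]]
  fix i j k t assume ijk: "{i, j, k} \<subseteq> {1..N}" "distinct [i, j, k]" and t: "t \<in> carrier T"
  have l: "(i, j) \<in> FK_letters N" "(j, k) \<in> FK_letters N" "(k, i) \<in> FK_letters N"
    using FK_letters_of ijk by blast+
  note x = gen_closed[OF l(1), simplified] gen_closed[OF l(2), simplified] gen_closed[OF l(3), simplified]
  have la: "letter_deg (i, j) j = i" "letter_deg (i, j) k = k" "letter_deg (j, k) k = j"
    "letter_deg (j, k) i = i" "letter_deg (k, i) i = k" "letter_deg (k, i) j = j"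
    using ijk(2) by (auto simp: letter_deg_apply)
  show "coprod_op (i, j) (coprod_op (j, k) t) \<oplus>\<^bsub>T\<^esub> coprod_op (j, k) (coprod_op (k, i) t) \<oplus>\<^bsub>T\<^esub>
    coprod_op (k, i) (coprod_op (i, j) t) = \<zero>\<^bsub>T\<^esub>"
  proof (rule eq0[OF lin_map_plus[OF T_mod lin_map_plus[OF T_mod lin_map_comp[OF lin[OF l(2)] lin[OF l(1)]]
          lin_map_comp[OF lin[OF l(3)] lin[OF l(2)]]] lin_map_comp[OF lin[OF l(1)] lin[OF l(3)]]] _ t])
    fix b c assume b: "b \<in> carrier A" and c: "c \<in> carrier A"
    let ?x = "FK_gen K N i j" and ?y = "FK_gen K N j k" and ?z = "FK_gen K N k i"
    let ?D = "FK_act K N (letter_deg (i, j) \<circ> letter_deg (j, k)) b"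
    note db = da_closed[OF l(1) b] da_closed[OF l(2) b] da_closed[OF l(3) b]
    have D: "?D \<in> carrier A"
      unfolding da_comp[OF l(1,2) b, symmetric] by (rule da_closed[OF l(1) db(2)])
    note cl = A.m_closed P_closed x db D b c
    have b0: "P (?x \<otimes>\<^bsub>A\<^esub> (?y \<otimes>\<^bsub>A\<^esub> b)) c \<oplus>\<^bsub>T\<^esub> P (?y \<otimes>\<^bsub>A\<^esub> (?z \<otimes>\<^bsub>A\<^esub> b)) c \<oplus>\<^bsub>T\<^esub> P (?z \<otimes>\<^bsub>A\<^esub> (?x \<otimes>\<^bsub>A\<^esub> b)) c = \<zero>\<^bsub>T\<^esub>"
      using FK_opsD(5)[OF gen_ops ijk b] P_zero_left[OF c]
      by (simp add: cl lin_map_add[OF P_left[OF c], symmetric])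
    have c0: "P ?D (?x \<otimes>\<^bsub>A\<^esub> (?y \<otimes>\<^bsub>A\<^esub> c)) \<oplus>\<^bsub>T\<^esub> P ?D (?y \<otimes>\<^bsub>A\<^esub> (?z \<otimes>\<^bsub>A\<^esub> c)) \<oplus>\<^bsub>T\<^esub> P ?D (?z \<otimes>\<^bsub>A\<^esub> (?x \<otimes>\<^bsub>A\<^esub> c)) = \<zero>\<^bsub>T\<^esub>"
      using FK_opsD(5)[OF gen_ops ijk c] P_zero_right[OF D]
      by (simp add: cl lin_map_add[OF P_right[OF D], symmetric])
    \<comment> \<open>Relabelling gives each first mixed term a reversed letter, and undoing the
      reversal shows it to be minus the second mixed term of another of the three products.\<close>
    have m: "P (FK_gen K N i k \<otimes>\<^bsub>A\<^esub> da (i, j) b) (?x \<otimes>\<^bsub>A\<^esub> c) = \<ominus>\<^bsub>T\<^esub> P (?z \<otimes>\<^bsub>A\<^esub> da (i, j) b) (?x \<otimes>\<^bsub>A\<^esub> c)"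
      "P (FK_gen K N j i \<otimes>\<^bsub>A\<^esub> da (j, k) b) (?y \<otimes>\<^bsub>A\<^esub> c) = \<ominus>\<^bsub>T\<^esub> P (?x \<otimes>\<^bsub>A\<^esub> da (j, k) b) (?y \<otimes>\<^bsub>A\<^esub> c)"
      "P (FK_gen K N k j \<otimes>\<^bsub>A\<^esub> da (k, i) b) (?z \<otimes>\<^bsub>A\<^esub> c) = \<ominus>\<^bsub>T\<^esub> P (?y \<otimes>\<^bsub>A\<^esub> da (k, i) b) (?z \<otimes>\<^bsub>A\<^esub> c)"
      using x by (simp_all add: gen_swap[OF l(1)] gen_swap[OF l(2)] gen_swap[OF l(3)] A.l_minus P_minus_left cl)
    show "coprod_op (i, j) (coprod_op (j, k) (P b c)) \<oplus>\<^bsub>T\<^esub> coprod_op (j, k) (coprod_op (k, i) (P b c)) \<oplus>\<^bsub>T\<^esub>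
      coprod_op (k, i) (coprod_op (i, j) (P b c)) = \<zero>\<^bsub>T\<^esub>"
      unfolding coprod_op_op_pure[OF l(1,2) b c] coprod_op_op_pure[OF l(2,3) b c] coprod_op_op_pure[OF l(3,1) b c]
        letter_deg_cycle[OF ijk(2)] fst_conv snd_conv la m
      by (rule T.M.cancel_triple[OF _ _ _ _ _ _ _ _ _ b0 c0]; intro cl)
  qed
qed

lemma one_one_closed: "P \<one>\<^bsub>A\<^esub> \<one>\<^bsub>A\<^esub> \<in> carrier T"
  by (rule P_closed) auto

definition "coprod = word_rec K T coprod_op (P \<one>\<^bsub>A\<^esub> \<one>\<^bsub>A\<^esub>)"

lemma coprod_lin_map: "coprod \<in> lin_map K A T"
  unfolding coprod_def by (rule FK_rec_lin_map[OF T_mod coprod_ops one_one_closed])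

lemma coprod_one: "coprod \<one>\<^bsub>A\<^esub> = P \<one>\<^bsub>A\<^esub> \<one>\<^bsub>A\<^esub>"
  unfolding coprod_def by (rule FK_rec_one[OF T_mod coprod_ops one_one_closed])

lemma coprod_mult: "\<lbrakk>p \<in> FK_letters N; b \<in> carrier A\<rbrakk> \<Longrightarrow> coprod (X p \<otimes>\<^bsub>A\<^esub> b) = coprod_op p (coprod b)"
  unfolding coprod_def by (rule FK_rec_mult[OF T_mod coprod_ops one_one_closed])

lemmas coprod_closed = lin_map_closed[OF coprod_lin_map]

lemma coprod_gen:
  assumes p: "p \<in> FK_letters N"
  shows "coprod (X p) = P (X p) \<one>\<^bsub>A\<^esub> \<oplus>\<^bsub>T\<^esub> P \<one>\<^bsub>A\<^esub> (X p)"
  using coprod_mult[OF p A.one_closed] gen_closed[OF p]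
  by (simp add: coprod_one coprod_op_pure[OF p] FK_act_one[OF letter_deg_closed[OF p]])

end

lemma crossed_unit_simps [simp]:
  "carrier (crossed_unit K G) = carrier K"
  "mult (crossed_unit K G) = mult K"
  "one (crossed_unit K G) = one K"
  "zero (crossed_unit K G) = zero K"
  "add (crossed_unit K G) = add K"
  "smult (crossed_unit K G) = mult K"
  "act (crossed_unit K G) = (\<lambda>g a. a)"
  "grade (crossed_unit K G) = (\<lambda>g. if g = \<one>\<^bsub>G\<^esub> then carrier K else {\<zero>\<^bsub>K\<^esub>})"
  by (simp_all add: crossed_unit_def)

lemma crossed_unit_module:
  assumes "cring K" shows "module K (crossed_unit K G)"
proof -
  interpret K: cring K by fact
  show ?thesis
  proof (rule moduleI)
    show "abelian_group (crossed_unit K G)"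
    proof (rule abelian_groupI)
      fix x assume "x \<in> carrier (crossed_unit K G)"
      then show "\<exists>y\<in>carrier (crossed_unit K G). y \<oplus>\<^bsub>crossed_unit K G\<^esub> x = \<zero>\<^bsub>crossed_unit K G\<^esub>"
        by (intro bexI[of _ "\<ominus>\<^bsub>K\<^esub> x"]) (auto simp: K.l_neg)
    qed (auto simp: K.a_ac)
  qed (auto simp: assms K.l_distr K.r_distr K.m_assoc)
qed

context FK_base
begin

interpretation K: cring K by (rule K)

interpretation A: assoc_algebra K A by (rule FK_assoc_algebra)

interpretation T: module K T by (rule T_mod)

abbreviation (input) "TT \<equiv> tensor K (FK_crossed K N) (tensor K (FK_crossed K N) (FK_crossed K N))"
abbreviation (input) "ga g \<equiv> tensor_map K (FK_crossed K N) (FK_crossed K N) (FK_act K N g) (FK_act K N g)"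
abbreviation (input) "Tgrade g \<equiv> grade (crossed_tensor K (sym_group N) (FK_crossed K N) (FK_crossed K N)) g"

lemma ga_lin_map: "g \<in> carrier G \<Longrightarrow> ga g \<in> lin_map K T T"
  by (rule tensor_map_lin_map[OF B_mod B_mod B_mod B_mod]) (simp_all add: FK_act_lin_map)

lemma ga_pure:
  "\<lbrakk>g \<in> carrier G; b \<in> carrier A; c \<in> carrier A\<rbrakk> \<Longrightarrow> ga g (P b c) = P (FK_act K N g b) (FK_act K N g c)"
  by (rule tensor_map_pure[OF B_mod B_mod B_mod B_mod]) (simp_all add: FK_act_lin_map)

lemma act_deg_commute:
  assumes g: "g \<in> carrier G" and p: "p \<in> FK_letters N" and b: "b \<in> carrier A"
  shows "da (perm_letter g p) (FK_act K N g b) = FK_act K N g (da p b)"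
  unfolding FK_act_comp[OF letter_deg_closed[OF perm_letter_closed[OF g p]] g b, symmetric]
    letter_deg_perm[OF g] FK_act_comp[OF g letter_deg_closed[OF p] b] ..

lemma act_mult_gen:
  assumes g: "g \<in> carrier G" and p: "p \<in> FK_letters N" and b: "b \<in> carrier A"
  shows "FK_act K N g (X p \<otimes>\<^bsub>A\<^esub> b) = X (perm_letter g p) \<otimes>\<^bsub>A\<^esub> FK_act K N g b"
  unfolding FK_act_mult[OF g gen_closed[OF p] b] FK_act_gen[OF g p] ..

text \<open>The operator combines left multiplication by \<open>X p\<close> with the action of the
  degree of \<open>p\<close>. The group moves the first to the permuted letter and conjugates the
  second to the degree of that letter.\<close>

lemma ga_coprod_op:
  assumes g: "g \<in> carrier G" and p: "p \<in> FK_letters N" and t: "t \<in> carrier T"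
  shows "ga g (coprod_op p t) = coprod_op (perm_letter g p) (ga g t)"
proof (rule T_eqI[OF T_mod lin_map_comp[OF coprod_op_lin_map[OF p] ga_lin_map[OF g]]
      lin_map_comp[OF ga_lin_map[OF g] coprod_op_lin_map[OF perm_letter_closed[OF g p]]] _ t])
  fix b c assume b: "b \<in> carrier A" and c: "c \<in> carrier A"
  note gp = perm_letter_closed[OF g p]
  note cl = P_closed A.m_closed da_closed[OF p] gen_closed[OF p] b c
  show "ga g (coprod_op p (P b c)) = coprod_op (perm_letter g p) (ga g (P b c))"
    unfolding coprod_op_pure[OF p b c] ga_pure[OF g b c]
      coprod_op_pure[OF gp FK_act_closed[OF g b] FK_act_closed[OF g c]]
    by (subst lin_map_add[OF ga_lin_map[OF g]], (intro cl)+, subst ga_pure[OF g], (intro cl)+,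
        subst ga_pure[OF g], (intro cl)+)
      (simp only: act_mult_gen[OF g p] act_deg_commute[OF g p] b c)
qed

lemma coprod_act:
  assumes g: "g \<in> carrier G" and b: "b \<in> carrier A"
  shows "coprod (FK_act K N g b) = ga g (coprod b)"
proof (rule FK_eqI[OF T_mod lin_map_comp[OF FK_act_lin_map[OF g] coprod_lin_map]
      lin_map_comp[OF coprod_lin_map ga_lin_map[OF g]] _ _ b])
  show "coprod (FK_act K N g \<one>\<^bsub>A\<^esub>) = ga g (coprod \<one>\<^bsub>A\<^esub>)"
    unfolding FK_act_one[OF g] coprod_one ga_pure[OF g A.one_closed A.one_closed] ..
  fix p b assume p: "p \<in> FK_letters N" and b: "b \<in> carrier A"
    and IH: "coprod (FK_act K N g b) = ga g (coprod b)"
  show "coprod (FK_act K N g (X p \<otimes>\<^bsub>A\<^esub> b)) = ga g (coprod (X p \<otimes>\<^bsub>A\<^esub> b))"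
    unfolding act_mult_gen[OF g p b] coprod_mult[OF perm_letter_closed[OF g p] FK_act_closed[OF g b]]
      coprod_mult[OF p b] ga_coprod_op[OF g p coprod_closed[OF b]] IH ..
qed

subsection \<open>Degrees\<close>

lemma comp_closed: "\<lbrakk>g \<in> carrier G; h \<in> carrier G\<rbrakk> \<Longrightarrow> g \<circ> h \<in> carrier G"
  by (simp add: sym_group_carrier permutes_compose)

lemma grade_mult:
  assumes "b \<in> grade B g" "c \<in> grade B h"
  shows "b \<otimes>\<^bsub>A\<^esub> c \<in> grade B (g \<circ> h)"
  using assms FK_comp_mult_left[of c b g h] by simp

lemma grade_gen:
  assumes p: "p \<in> FK_letters N" shows "X p \<in> grade B (letter_deg p)"
proof -
  have "letter_deg p \<circ> letter_deg p = id" using letter_deg_invol[of p id] by simp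
  then show ?thesis
    using FK_comp_mult[OF p A.one_closed, of "letter_deg p"] gen_closed[OF p] by (simp add: FK_comp_one)
qed

lemma grade_one: "\<one>\<^bsub>A\<^esub> \<in> grade B id"
  by (simp add: FK_comp_one)

lemma grade_act:
  assumes h: "h \<in> carrier G" and b: "b \<in> grade B g"
  shows "FK_act K N h b \<in> grade B (h \<circ> g \<circ> inv' h)"
  using b FK_act_comp_proj[OF h, of b g] FK_act_closed[OF h] by simp

lemma B_sum: "b \<in> carrier A \<Longrightarrow> (\<Oplus>\<^bsub>B\<^esub>g\<in>carrier G. FK_comp K N g b) = b"
  using lin_map_finsum[OF A_mod B_mod _ sym_group_finite, of "\<lambda>x. x" "\<lambda>g. FK_comp K N g b"]
    FK_comp_sum[of b] FK_comp_closed[of b] by (simp add: lin_map_id)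

lemmas B_proj_facts = B_mod sym_group_is_group[of N] sym_group_finite[of N]

lemma B_crossed_module: "crossed_module K G B"
proof (rule crossed_moduleI[OF B_proj_facts, of "FK_comp K N"])
  fix g h v assume g: "g \<in> carrier G" and h: "h \<in> carrier G" and "v \<in> carrier B"
  then show "act B h (FK_comp K N g v) = FK_comp K N (h \<otimes>\<^bsub>G\<^esub> g \<otimes>\<^bsub>G\<^esub> inv\<^bsub>G\<^esub> h) (act B h v)"
    by (simp add: sym_group_mult sym_group_inv FK_act_comp_proj)
qed (simp_all add: FK_comp_lin_map FK_comp_proj B_sum FK_act_lin_map sym_group_one sym_group_mult
    FK_act_id FK_act_comp)

lemma B_braiding_lin_map: "braiding K G B B \<in> lin_map K T T"
  by (rule braiding_lin_map[OF B_proj_facts, of "FK_comp K N"])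
    (simp_all add: FK_comp_lin_map FK_comp_proj B_sum FK_act_lin_map B_mod)

lemma B_braiding:
  assumes "g \<in> carrier G" "b \<in> grade B g" "c \<in> carrier A"
  shows "braiding K G B B (P b c) = P (FK_act K N g c) b"
  using braiding_homogeneous[OF B_proj_facts, of "FK_comp K N" B g b c] assms
  by (simp add: FK_comp_lin_map FK_comp_proj B_sum FK_act_lin_map B_mod)

lemma B_span: "lin_span K B (\<Union>g\<in>carrier G. grade B g) = carrier B"
proof
  have sub: "(\<Union>g\<in>carrier G. grade B g) \<subseteq> carrier B" by auto
  note S = lin_span_submodule[OF B_mod sub]
  show "lin_span K B (\<Union>g\<in>carrier G. grade B g) \<subseteq> carrier B" by (rule submodule_subset[OF S])
  show "carrier B \<subseteq> lin_span K B (\<Union>g\<in>carrier G. grade B g)"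
  proof
    fix b assume "b \<in> carrier B"
    then have b: "b \<in> carrier A" by simp
    have "(\<Oplus>\<^bsub>B\<^esub>g\<in>carrier G. FK_comp K N g b) \<in> lin_span K B (\<Union>g\<in>carrier G. grade B g)"
    proof (rule submodule_finsum[OF B_mod S sym_group_finite])
      fix g assume "g \<in> carrier G"
      moreover have "FK_comp K N g b \<in> grade B g" using b by (simp add: FK_comp_closed FK_comp_proj)
      ultimately show "FK_comp K N g b \<in> lin_span K B (\<Union>g\<in>carrier G. grade B g)"
        by (intro lin_span_base) blast
    qed
    then show "b \<in> lin_span K B (\<Union>g\<in>carrier G. grade B g)" using B_sum[OF b] by simp
  qed
qed

lemma Tgrade_gens_subset:
  "{P v w | v w h l. h \<in> carrier G \<and> l \<in> carrier G \<and> h \<otimes>\<^bsub>G\<^esub> l = g \<and> v \<in> grade B h \<and> w \<in> grade B l} \<subseteq> carrier T"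
  using P_closed by auto

lemma Tgrade_submodule: "submodule (Tgrade g) K T"
  unfolding crossed_tensor_simps by (rule lin_span_submodule[OF T_mod Tgrade_gens_subset])

lemma Tgrade_pure:
  assumes "h \<in> carrier G" "l \<in> carrier G" "v \<in> grade B h" "w \<in> grade B l"
  shows "P v w \<in> Tgrade (h \<circ> l)"
  unfolding crossed_tensor_simps sym_group_mult using assms by (intro lin_span_base) blast

lemma Tgrade_map:
  assumes "module K U" "f \<in> lin_map K T U" "submodule H K U" "t \<in> Tgrade g"
    and "\<And>h l v w. \<lbrakk>h \<in> carrier G; l \<in> carrier G; g = h \<circ> l; v \<in> grade B h; w \<in> grade B l\<rbrakk> \<Longrightarrow> f (P v w) \<in> H"
  shows "f t \<in> H"
proof (rule lin_span_map[OF T_mod assms(1,2,3) _ Tgrade_gens_subset assms(4)[unfolded crossed_tensor_simps]])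
  fix t assume "t \<in> {P v w | v w h l. h \<in> carrier G \<and> l \<in> carrier G \<and> h \<otimes>\<^bsub>G\<^esub> l = g \<and> v \<in> grade B h \<and> w \<in> grade B l}"
  then obtain v w h l where "t = P v w" "h \<in> carrier G" "l \<in> carrier G" "h \<otimes>\<^bsub>G\<^esub> l = g" "v \<in> grade B h" "w \<in> grade B l"
    by (elim CollectE exE conjE)
  then show "f t \<in> H" using assms(5)[of h l v w] by (simp add: sym_group_mult del: FK_crossed_simps)
qed

text \<open>On factors of degrees \<open>h\<close> and \<open>l\<close> both summands have degree
  |p| h l. In the second, the conjugate |p| h |p| on the left meets |p| l on the right, and the
  adjacent transpositions cancel.\<close>

lemma coprod_op_grade:
  assumes p: "p \<in> FK_letters N" and t: "t \<in> Tgrade g"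
  shows "coprod_op p t \<in> Tgrade (letter_deg p \<circ> g)"
proof (rule Tgrade_map[OF T_mod coprod_op_lin_map[OF p] Tgrade_submodule t])
  fix h l v w
  assume h: "h \<in> carrier G" and l: "l \<in> carrier G" and g: "g = h \<circ> l" and v: "v \<in> grade B h" and w: "w \<in> grade B l"
  let ?d = "letter_deg p"
  note d = letter_deg_closed[OF p]
  have inv: "inv' ?d = ?d" by (simp add: letter_deg_def)
  have "P (X p \<otimes>\<^bsub>A\<^esub> v) w \<in> Tgrade ((?d \<circ> h) \<circ> l)"
    by (rule Tgrade_pure[OF comp_closed[OF d h] l grade_mult[OF grade_gen[OF p] v] w])
  moreover have "P (da p v) (X p \<otimes>\<^bsub>A\<^esub> w) \<in> Tgrade ((?d \<circ> h \<circ> inv' ?d) \<circ> (?d \<circ> l))"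
    unfolding inv
    by (rule Tgrade_pure[OF comp_closed[OF comp_closed[OF d h] d] comp_closed[OF d l]
          grade_act[OF d v, unfolded inv] grade_mult[OF grade_gen[OF p] w]])
  moreover have "(?d \<circ> h \<circ> inv' ?d) \<circ> (?d \<circ> l) = ?d \<circ> g" "(?d \<circ> h) \<circ> l = ?d \<circ> g"
    unfolding g inv o_assoc[symmetric] letter_deg_invol by (rule refl)+
  ultimately have "P (X p \<otimes>\<^bsub>A\<^esub> v) w \<oplus>\<^bsub>T\<^esub> P (da p v) (X p \<otimes>\<^bsub>A\<^esub> w) \<in> Tgrade (?d \<circ> g)"
    by (intro submodule_add[OF Tgrade_submodule]) (simp_all only:)
  moreover have "v \<in> carrier A" "w \<in> carrier A" using v w by simp_all
  ultimately show "coprod_op p (P v w) \<in> Tgrade (?d \<circ> g)" by (simp only: coprod_op_pure[OF p])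
qed

text \<open>Phrased with the projection so that the condition is linear in \<open>b\<close>; on a
  homogeneous element the projection is the identity. The induction predicate takes all degrees
  together because a letter shifts them.\<close>

lemma coprod_comp:
  assumes "g \<in> carrier G" "b \<in> carrier A"
  shows "coprod (FK_comp K N g b) \<in> Tgrade g"
proof -
  let ?H = "\<Inter>g\<in>carrier G. {b \<in> carrier A. coprod (FK_comp K N g b) \<in> Tgrade g}"
  have sub: "submodule ?H K A"
  proof (rule submodule_Inter[OF A_mod])
    fix H assume "H \<in> (\<lambda>g. {b \<in> carrier A. coprod (FK_comp K N g b) \<in> Tgrade g}) ` carrier G"
    then obtain g where "H = {b \<in> carrier A. coprod (FK_comp K N g b) \<in> Tgrade g}" by blast
    then show "submodule H K A"
      using submodule_preimage[OF A_mod T_mod lin_map_comp[OF FK_comp_lin_map coprod_lin_map] Tgrade_submodule]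
      by simp
  qed (use id_in_sym in blast)
  have "b \<in> ?H"
  proof (rule FK_induct[OF sub _ _ assms(2)])
    have "coprod (FK_comp K N g \<one>\<^bsub>A\<^esub>) \<in> Tgrade g" for g
    proof (cases "g = id")
      case True
      then show ?thesis
        using Tgrade_pure[OF id_in_sym id_in_sym grade_one grade_one] by (simp only: FK_comp_one coprod_one if_True id_comp refl)
    next
      case False
      then show ?thesis
        using submodule_zero[OF Tgrade_submodule] lin_map_zero[OF A_mod T_mod coprod_lin_map]
        by (simp only: FK_comp_one if_False)
    qed
    then show "\<one>\<^bsub>A\<^esub> \<in> ?H" using A.one_closed by blast
  next
    fix p b assume p: "p \<in> FK_letters N" and b: "b \<in> ?H" "b \<in> carrier A"
    have "coprod (FK_comp K N g (X p \<otimes>\<^bsub>A\<^esub> b)) \<in> Tgrade g" if g: "g \<in> carrier G" for g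
    proof -
      have "coprod (FK_comp K N (letter_deg p \<circ> g) b) \<in> Tgrade (letter_deg p \<circ> g)"
        using b(1) comp_closed[OF letter_deg_closed[OF p] g] by blast
      from coprod_op_grade[OF p this] show ?thesis
        by (simp only: FK_comp_mult[OF p b(2)] coprod_mult[OF p FK_comp_closed[OF b(2)]] letter_deg_invol)
    qed
    then show "X p \<otimes>\<^bsub>A\<^esub> b \<in> ?H" using A.m_closed[OF gen_closed[OF p] b(2)] by blast
  qed
  then show ?thesis using assms(1) by blast
qed

lemma coprod_morphism: "coprod \<in> crossed_hom K G B (crossed_tensor K G B B)"
  unfolding crossed_hom_def mem_Collect_eq
proof (intro conjI ballI)
  show "coprod \<in> lin_map K B (crossed_tensor K G B B)" by (simp add: coprod_lin_map)
  fix g assume g: "g \<in> carrier G"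
  show "coprod (act B g v) = act (crossed_tensor K G B B) g (coprod v)" if "v \<in> carrier B" for v
    using that coprod_act[OF g, of v] by simp
  have "coprod b \<in> Tgrade g" if "b \<in> grade B g" for b
  proof -
    have b: "b \<in> carrier A" "FK_comp K N g b = b" using that by simp_all
    show ?thesis using coprod_comp[OF g b(1)] by (simp only: b(2))
  qed
  then show "coprod ` grade B g \<subseteq> grade (crossed_tensor K G B B) g" by blast
qed

subsection \<open>The counit\<close>

abbreviation (input) "E1 \<equiv> crossed_unit K (sym_group N)"

lemmas E1_mod = crossed_unit_module[OF K, of "sym_group N"]

lemma counit_ops: "FK_ops K N E1 (\<lambda>p u. \<zero>\<^bsub>K\<^esub>)"
  using lin_map_const_zero[OF E1_mod, of E1] by (intro FK_opsI) simp_all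

lemma E1_one_closed: "\<one>\<^bsub>K\<^esub> \<in> carrier E1"
  by simp

definition "counit = word_rec K E1 (\<lambda>p u. \<zero>\<^bsub>K\<^esub>) \<one>\<^bsub>K\<^esub>"

lemma counit_lin_map: "counit \<in> lin_map K A E1"
  unfolding counit_def by (rule FK_rec_lin_map[OF E1_mod counit_ops E1_one_closed])

lemma counit_one: "counit \<one>\<^bsub>A\<^esub> = \<one>\<^bsub>K\<^esub>"
  unfolding counit_def by (rule FK_rec_one[OF E1_mod counit_ops E1_one_closed])

lemma counit_mult: "\<lbrakk>p \<in> FK_letters N; b \<in> carrier A\<rbrakk> \<Longrightarrow> counit (X p \<otimes>\<^bsub>A\<^esub> b) = \<zero>\<^bsub>K\<^esub>"
  unfolding counit_def by (rule FK_rec_mult[OF E1_mod counit_ops E1_one_closed])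

lemma counit_closed: "b \<in> carrier A \<Longrightarrow> counit b \<in> carrier K"
  using lin_map_closed[OF counit_lin_map] by simp

lemma counit_gen: "p \<in> FK_letters N \<Longrightarrow> counit (X p) = \<zero>\<^bsub>K\<^esub>"
  using counit_mult[of p "\<one>\<^bsub>A\<^esub>"] gen_closed[of p] by simp

lemma counit_act:
  assumes g: "g \<in> carrier G" and b: "b \<in> carrier A" shows "counit (FK_act K N g b) = counit b"
proof (rule FK_eqI[OF E1_mod lin_map_comp[OF FK_act_lin_map[OF g] counit_lin_map] counit_lin_map _ _ b])
  show "counit (FK_act K N g \<one>\<^bsub>A\<^esub>) = counit \<one>\<^bsub>A\<^esub>" by (simp only: FK_act_one[OF g])
  fix p b assume p: "p \<in> FK_letters N" and b: "b \<in> carrier A"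
  show "counit (FK_act K N g (X p \<otimes>\<^bsub>A\<^esub> b)) = counit (X p \<otimes>\<^bsub>A\<^esub> b)"
    by (simp only: act_mult_gen[OF g p b] counit_mult[OF p b] counit_mult[OF perm_letter_closed[OF g p] FK_act_closed[OF g b]])
qed

text \<open>The counit kills everything that starts with a letter, so only the unit could
  contribute, and its degree is \<open>id\<close>.\<close>

lemma counit_comp:
  assumes b: "b \<in> carrier A" and "g \<noteq> id" shows "counit (FK_comp K N g b) = \<zero>\<^bsub>K\<^esub>"
proof -
  have "counit (FK_comp K N g b) = (\<lambda>b. \<zero>\<^bsub>E1\<^esub>) b"
  proof (rule FK_eqI[OF E1_mod lin_map_comp[OF FK_comp_lin_map counit_lin_map] lin_map_const_zero[OF E1_mod] _ _ b])
    show "counit (FK_comp K N g \<one>\<^bsub>A\<^esub>) = \<zero>\<^bsub>E1\<^esub>"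
      using assms(2) lin_map_zero[OF A_mod E1_mod counit_lin_map] by (simp add: FK_comp_one)
    fix p b assume p: "p \<in> FK_letters N" and b: "b \<in> carrier A"
    show "counit (FK_comp K N g (X p \<otimes>\<^bsub>A\<^esub> b)) = \<zero>\<^bsub>E1\<^esub>"
      by (simp add: FK_comp_mult[OF p b] counit_mult[OF p FK_comp_closed[OF b]])
  qed
  then show ?thesis by simp
qed

lemma counit_morphism: "counit \<in> crossed_hom K G B E1"
  unfolding crossed_hom_def mem_Collect_eq
proof (intro conjI ballI)
  show "counit \<in> lin_map K B E1" by (simp add: counit_lin_map)
  fix g assume g: "g \<in> carrier G"
  show "counit (act B g v) = act E1 g (counit v)" if "v \<in> carrier B" for v
    using that counit_act[OF g, of v] by simp
  have "counit b \<in> grade E1 g" if "b \<in> grade B g" for b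
  proof -
    have b: "b \<in> carrier A" "FK_comp K N g b = b" using that by simp_all
    show ?thesis using counit_comp[OF b(1), of g] counit_closed[OF b(1)] by (simp add: b(2) sym_group_one)
  qed
  then show "counit ` grade B g \<subseteq> grade E1 g" by blast
qed

lemma counit_alg_hom: "counit \<in> alg_hom K B E1"
proof (rule alg_homI)
  show "counit \<in> lin_map K B E1" by (simp add: counit_lin_map)
  show "counit \<one>\<^bsub>B\<^esub> = \<one>\<^bsub>E1\<^esub>" by (simp add: counit_one)
  fix a b assume "a \<in> carrier B" "b \<in> carrier B"
  then have a: "a \<in> carrier A" and b: "b \<in> carrier A" by simp_all
  have lin: "(\<lambda>a. a \<odot>\<^bsub>E1\<^esub> counit b) \<in> lin_map K E1 E1"
    using counit_closed[OF b] by (intro lin_mapI) (simp_all add: K.l_distr K.m_assoc)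
  have "counit (a \<otimes>\<^bsub>A\<^esub> b) = (counit a) \<odot>\<^bsub>E1\<^esub> (counit b)"
  proof (rule FK_eqI[OF E1_mod lin_map_comp[OF mult_right_lin_map[OF FK_assoc_algebra b] counit_lin_map]
        lin_map_comp[OF counit_lin_map lin] _ _ a])
    show "counit (\<one>\<^bsub>A\<^esub> \<otimes>\<^bsub>A\<^esub> b) = counit \<one>\<^bsub>A\<^esub> \<odot>\<^bsub>E1\<^esub> counit b"
      using b counit_closed[OF b] by (simp add: counit_one)
    fix p a assume p: "p \<in> FK_letters N" and a: "a \<in> carrier A"
    show "counit (X p \<otimes>\<^bsub>A\<^esub> a \<otimes>\<^bsub>A\<^esub> b) = counit (X p \<otimes>\<^bsub>A\<^esub> a) \<odot>\<^bsub>E1\<^esub> counit b"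
      using a b gen_closed[OF p] counit_closed[OF b] by (simp add: A.m_assoc counit_mult[OF p])
  qed
  then show "counit (a \<otimes>\<^bsub>B\<^esub> b) = counit a \<otimes>\<^bsub>E1\<^esub> counit b" by simp
qed

lemma bilin_FK_crossed: "bilin K A A B b = bilin K A A A b"
  by (simp add: bilin_def)

lemma counit_left_bilin: "bilin K A A A (\<lambda>y z. counit y \<odot>\<^bsub>A\<^esub> z)"
  by (rule bilin_smult[OF A_mod counit_lin_map]) simp_all

lemma counit_right_bilin: "bilin K A A A (\<lambda>y z. counit z \<odot>\<^bsub>A\<^esub> y)"
  by (rule bilin_swap[OF counit_left_bilin])

text \<open>Evaluating the left factor by the counit turns \<open>coprod_op p\<close> into left
  multiplication by \<open>X p\<close>: the first summand dies, and in the second the counit does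
  not see the action.\<close>

lemma counit_left:
  assumes b: "b \<in> carrier A"
  shows "tensor_lift K B (\<lambda>y z. counit y \<odot>\<^bsub>A\<^esub> z) (coprod b) = b"
proof -
  note lin = T_lift_lin_map[OF B_mod counit_left_bilin[folded bilin_FK_crossed], unfolded lin_map_FK_crossed]
  note pure = T_lift_pure[OF B_mod counit_left_bilin[folded bilin_FK_crossed]]
  have op: "tensor_lift K B (\<lambda>y z. counit y \<odot>\<^bsub>A\<^esub> z) (coprod_op p t) =
      X p \<otimes>\<^bsub>A\<^esub> tensor_lift K B (\<lambda>y z. counit y \<odot>\<^bsub>A\<^esub> z) t" if p: "p \<in> FK_letters N" and t: "t \<in> carrier T" for p t
  proof (rule T_eqI[OF A_mod lin_map_comp[OF coprod_op_lin_map[OF p] lin] lin_map_comp[OF lin gen_mult_lin_map[OF p]] _ t])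
    fix b c assume b: "b \<in> carrier A" and c: "c \<in> carrier A"
    show "tensor_lift K B (\<lambda>y z. counit y \<odot>\<^bsub>A\<^esub> z) (coprod_op p (P b c)) =
      X p \<otimes>\<^bsub>A\<^esub> tensor_lift K B (\<lambda>y z. counit y \<odot>\<^bsub>A\<^esub> z) (P b c)"
      using b c gen_closed[OF p] da_closed[OF p b] counit_closed[OF b]
      by (simp add: coprod_op_pure[OF p] lin_map_add[OF lin] P_closed pure counit_mult[OF p]
          counit_act[OF letter_deg_closed[OF p]] A.smult_mult_right)
  qed
  show ?thesis
    by (rule FK_eqI[OF A_mod lin_map_comp[OF coprod_lin_map lin] lin_map_id _ _ b])
      (simp_all add: coprod_one pure counit_one coprod_mult op coprod_closed)
qed

text \<open>Here the second summand of \<open>coprod_op p\<close> dies, and what is left is again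
  multiplication by \<open>X p\<close>.\<close>

lemma counit_right:
  assumes b: "b \<in> carrier A"
  shows "tensor_lift K B (\<lambda>y z. counit z \<odot>\<^bsub>A\<^esub> y) (coprod b) = b"
proof -
  note lin = T_lift_lin_map[OF B_mod counit_right_bilin[folded bilin_FK_crossed], unfolded lin_map_FK_crossed]
  note pure = T_lift_pure[OF B_mod counit_right_bilin[folded bilin_FK_crossed]]
  have op: "tensor_lift K B (\<lambda>y z. counit z \<odot>\<^bsub>A\<^esub> y) (coprod_op p t) =
      X p \<otimes>\<^bsub>A\<^esub> tensor_lift K B (\<lambda>y z. counit z \<odot>\<^bsub>A\<^esub> y) t" if p: "p \<in> FK_letters N" and t: "t \<in> carrier T" for p t
  proof (rule T_eqI[OF A_mod lin_map_comp[OF coprod_op_lin_map[OF p] lin] lin_map_comp[OF lin gen_mult_lin_map[OF p]] _ t])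
    fix b c assume b: "b \<in> carrier A" and c: "c \<in> carrier A"
    show "tensor_lift K B (\<lambda>y z. counit z \<odot>\<^bsub>A\<^esub> y) (coprod_op p (P b c)) =
      X p \<otimes>\<^bsub>A\<^esub> tensor_lift K B (\<lambda>y z. counit z \<odot>\<^bsub>A\<^esub> y) (P b c)"
      using b c gen_closed[OF p] da_closed[OF p b] counit_closed[OF c]
      by (simp add: coprod_op_pure[OF p] lin_map_add[OF lin] P_closed pure counit_mult[OF p] A.smult_mult_right)
  qed
  show ?thesis
    by (rule FK_eqI[OF A_mod lin_map_comp[OF coprod_lin_map lin] lin_map_id _ _ b])
      (simp_all add: coprod_one pure counit_one coprod_mult op coprod_closed)
qed


subsection \<open>The antipode\<close>

text \<open>A braided antipode satisfies S(ab) = \<mu>(\<Psi>(S a \<otimes> S b)), where \<mu> is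
  the multiplication. With \<open>a = X p\<close> and S(x_p) = -x_p this gives the recursion encoded
  here.\<close>

definition "antipode_op p b = \<ominus>\<^bsub>A\<^esub> (da p b \<otimes>\<^bsub>A\<^esub> X p)"

lemma antipode_op_lin_map:
  assumes "p \<in> FK_letters N" shows "antipode_op p \<in> lin_map K A A"
  unfolding antipode_op_def[abs_def]
  by (rule lin_map_neg[OF A_mod lin_map_comp[OF FK_act_lin_map[OF letter_deg_closed[OF assms]]
        mult_right_lin_map[OF FK_assoc_algebra gen_closed[OF assms]]]])

lemma antipode_op_op:
  assumes p: "p \<in> FK_letters N" and q: "q \<in> FK_letters N" and b: "b \<in> carrier A"
  shows "antipode_op p (antipode_op q b) =
    FK_act K N (letter_deg p \<circ> letter_deg q) b \<otimes>\<^bsub>A\<^esub> (X (perm_letter (letter_deg p) q) \<otimes>\<^bsub>A\<^esub> X p)"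
proof -
  note dp = letter_deg_closed[OF p]
  note db = da_closed[OF q b] da_closed[OF p da_closed[OF q b]]
  note x = gen_closed[OF p] gen_closed[OF q] gen_closed[OF perm_letter_closed[OF dp q]]
  have "da p (\<ominus>\<^bsub>A\<^esub> (da q b \<otimes>\<^bsub>A\<^esub> X q)) = \<ominus>\<^bsub>A\<^esub> (da p (da q b) \<otimes>\<^bsub>A\<^esub> X (perm_letter (letter_deg p) q))"
    unfolding lin_map_uminus[OF A_mod A_mod FK_act_lin_map[OF dp] A.m_closed[OF db(1) x(2)]]
      FK_act_mult[OF dp db(1) x(2)] da_gen[OF p q] ..
  then show ?thesis
    unfolding antipode_op_def using db x b
    by (simp add: A.l_minus A.m_assoc A.M.minus_minus da_comp[OF p q])
qed

lemma antipode_ops: "FK_ops K N A antipode_op"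
proof (rule FK_opsI)
  fix i j b assume ij: "(i, j) \<in> FK_letters N"
  show "antipode_op (i, j) \<in> lin_map K A A" by (rule antipode_op_lin_map[OF ij])
  assume b: "b \<in> carrier A"
  note x = gen_closed[OF ij, simplified] and ji = FK_letters_swap[OF ij]
  note db = da_closed[OF ij b]
  show "antipode_op (i, j) b \<oplus>\<^bsub>A\<^esub> antipode_op (j, i) b = \<zero>\<^bsub>A\<^esub>"
    using db x by (simp add: antipode_op_def letter_deg_swap[of j i] gen_swap[OF ij] A.r_minus A.M.l_neg A.M.minus_minus)
  have D: "FK_act K N (letter_deg (i, j) \<circ> letter_deg (i, j)) b \<in> carrier A"
    unfolding da_comp[OF ij ij b, symmetric] by (rule da_closed[OF ij db])
  show "antipode_op (i, j) (antipode_op (i, j) b) = \<zero>\<^bsub>A\<^esub>"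
    using D x FK_elemsD(3)[OF FK_elems_gen ij]
    by (simp add: antipode_op_op[OF ij ij b] letter_deg_apply gen_swap[OF ij] A.l_minus)
next
  fix i j k m b assume ijkm: "{i, j, k, m} \<subseteq> {1..N}" "distinct [i, j, k, m]" and b: "b \<in> carrier A"
  have l: "(i, j) \<in> FK_letters N" "(k, m) \<in> FK_letters N" using FK_letters_of4 ijkm by blast+
  have la: "letter_deg (i, j) k = k" "letter_deg (i, j) m = m" "letter_deg (k, m) i = i" "letter_deg (k, m) j = j"
    using ijkm(2) by (auto simp: letter_deg_apply)
  show "antipode_op (i, j) (antipode_op (k, m) b) = antipode_op (k, m) (antipode_op (i, j) b)"
    unfolding antipode_op_op[OF l b] antipode_op_op[OF l(2,1) b] fst_conv snd_conv la letter_deg_commute[OF ijkm(2)]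
      FK_elemsD(4)[OF FK_elems_gen ijkm, unfolded fst_conv snd_conv] ..
next
  fix i j k b assume ijk: "{i, j, k} \<subseteq> {1..N}" "distinct [i, j, k]" and b: "b \<in> carrier A"
  have l: "(i, j) \<in> FK_letters N" "(j, k) \<in> FK_letters N" "(k, i) \<in> FK_letters N"
    using FK_letters_of ijk by blast+
  have la: "letter_deg (i, j) j = i" "letter_deg (i, j) k = k" "letter_deg (j, k) k = j"
    "letter_deg (j, k) i = i" "letter_deg (k, i) i = k" "letter_deg (k, i) j = j"
    using ijk(2) by (auto simp: letter_deg_apply)
  note x = gen_closed[OF l(1), simplified] gen_closed[OF l(2), simplified] gen_closed[OF l(3), simplified]
  let ?x = "FK_gen K N i j" and ?y = "FK_gen K N j k" and ?z = "FK_gen K N k i"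
  let ?D = "FK_act K N (letter_deg (i, j) \<circ> letter_deg (j, k)) b"
  have D: "?D \<in> carrier A"
    unfolding da_comp[OF l(1,2) b, symmetric] by (rule da_closed[OF l(1) da_closed[OF l(2) b]])
  have rel: "?x \<otimes>\<^bsub>A\<^esub> ?y \<oplus>\<^bsub>A\<^esub> ?y \<otimes>\<^bsub>A\<^esub> ?z \<oplus>\<^bsub>A\<^esub> ?z \<otimes>\<^bsub>A\<^esub> ?x = \<zero>\<^bsub>A\<^esub>"
    using FK_elemsD(5)[OF FK_elems_gen ijk] by simp
  \<comment> \<open>Every product has the second letter relabelled and the factors reversed. For
    example (i, j), (j, k) leads to x_ik x_ij = -x_ki x_ij, so the sum is minus the triple relation
    with its terms cyclically permuted.\<close>
  have "antipode_op (i, j) (antipode_op (j, k) b) \<oplus>\<^bsub>A\<^esub> antipode_op (j, k) (antipode_op (k, i) b) \<oplus>\<^bsub>A\<^esub>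
      antipode_op (k, i) (antipode_op (i, j) b) =
    \<ominus>\<^bsub>A\<^esub> (?D \<otimes>\<^bsub>A\<^esub> (?z \<otimes>\<^bsub>A\<^esub> ?x)) \<oplus>\<^bsub>A\<^esub> \<ominus>\<^bsub>A\<^esub> (?D \<otimes>\<^bsub>A\<^esub> (?x \<otimes>\<^bsub>A\<^esub> ?y)) \<oplus>\<^bsub>A\<^esub> \<ominus>\<^bsub>A\<^esub> (?D \<otimes>\<^bsub>A\<^esub> (?y \<otimes>\<^bsub>A\<^esub> ?z))"
    unfolding antipode_op_op[OF l(1,2) b] antipode_op_op[OF l(2,3) b] antipode_op_op[OF l(3,1) b]
      fst_conv snd_conv la letter_deg_cycle[OF ijk(2)] gen_swap[OF l(1)] gen_swap[OF l(2)] gen_swap[OF l(3)]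
    using x D by (simp add: A.l_minus A.r_minus)
  also have "\<dots> = \<ominus>\<^bsub>A\<^esub> (?D \<otimes>\<^bsub>A\<^esub> (?x \<otimes>\<^bsub>A\<^esub> ?y \<oplus>\<^bsub>A\<^esub> ?y \<otimes>\<^bsub>A\<^esub> ?z \<oplus>\<^bsub>A\<^esub> ?z \<otimes>\<^bsub>A\<^esub> ?x))"
    using x D by (simp add: A.r_distr A.M.minus_add A.M.a_ac)
  also have "\<dots> = \<zero>\<^bsub>A\<^esub>" using D by (simp add: rel)
  finally show "antipode_op (i, j) (antipode_op (j, k) b) \<oplus>\<^bsub>A\<^esub> antipode_op (j, k) (antipode_op (k, i) b) \<oplus>\<^bsub>A\<^esub>
      antipode_op (k, i) (antipode_op (i, j) b) = \<zero>\<^bsub>A\<^esub>" .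
qed

definition "antipode = word_rec K A antipode_op \<one>\<^bsub>A\<^esub>"

lemma antipode_lin_map: "antipode \<in> lin_map K A A"
  unfolding antipode_def by (rule FK_rec_lin_map[OF A_mod antipode_ops A.one_closed])

lemma antipode_one: "antipode \<one>\<^bsub>A\<^esub> = \<one>\<^bsub>A\<^esub>"
  unfolding antipode_def by (rule FK_rec_one[OF A_mod antipode_ops A.one_closed])

lemmas antipode_closed = lin_map_closed[OF antipode_lin_map]

lemma antipode_mult:
  "\<lbrakk>p \<in> FK_letters N; b \<in> carrier A\<rbrakk> \<Longrightarrow> antipode (X p \<otimes>\<^bsub>A\<^esub> b) = \<ominus>\<^bsub>A\<^esub> (da p (antipode b) \<otimes>\<^bsub>A\<^esub> X p)"
  using FK_rec_mult[OF A_mod antipode_ops A.one_closed] by (simp add: antipode_def antipode_op_def)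

lemma antipode_act:
  assumes g: "g \<in> carrier G" and b: "b \<in> carrier A"
  shows "antipode (FK_act K N g b) = FK_act K N g (antipode b)"
proof (rule FK_eqI[OF A_mod lin_map_comp[OF FK_act_lin_map[OF g] antipode_lin_map]
      lin_map_comp[OF antipode_lin_map FK_act_lin_map[OF g]] _ _ b])
  show "antipode (FK_act K N g \<one>\<^bsub>A\<^esub>) = FK_act K N g (antipode \<one>\<^bsub>A\<^esub>)"
    by (simp only: FK_act_one[OF g] antipode_one)
  fix p b assume p: "p \<in> FK_letters N" and b: "b \<in> carrier A"
    and IH: "antipode (FK_act K N g b) = FK_act K N g (antipode b)"
  note gp = perm_letter_closed[OF g p] and Sb = antipode_closed[OF b]
  have "FK_act K N g (\<ominus>\<^bsub>A\<^esub> (da p (antipode b) \<otimes>\<^bsub>A\<^esub> X p)) =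
    \<ominus>\<^bsub>A\<^esub> (FK_act K N g (da p (antipode b)) \<otimes>\<^bsub>A\<^esub> X (perm_letter g p))"
    unfolding lin_map_uminus[OF A_mod A_mod FK_act_lin_map[OF g] A.m_closed[OF da_closed[OF p Sb] gen_closed[OF p]]]
      FK_act_mult[OF g da_closed[OF p Sb] gen_closed[OF p]] FK_act_gen[OF g p] ..
  then show "antipode (FK_act K N g (X p \<otimes>\<^bsub>A\<^esub> b)) = FK_act K N g (antipode (X p \<otimes>\<^bsub>A\<^esub> b))"
    unfolding act_mult_gen[OF g p b] antipode_mult[OF gp FK_act_closed[OF g b]] antipode_mult[OF p b] IH
      act_deg_commute[OF g p Sb] by (rule sym)
qed

lemma antipode_comp:
  assumes b: "b \<in> carrier A"
  shows "antipode (FK_comp K N g b) = FK_comp K N g (antipode b)"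
proof (rule FK_eqI_family[where f = "\<lambda>g b. antipode (FK_comp K N g b)" and f' = "\<lambda>g b. FK_comp K N g (antipode b)"
      and i = g, OF A_mod lin_map_comp[OF FK_comp_lin_map antipode_lin_map]
      lin_map_comp[OF antipode_lin_map FK_comp_lin_map] _ _ b])
  fix g show "antipode (FK_comp K N g \<one>\<^bsub>A\<^esub>) = FK_comp K N g (antipode \<one>\<^bsub>A\<^esub>)"
    using lin_map_zero[OF A_mod A_mod antipode_lin_map] by (simp add: FK_comp_one antipode_one)
next
  fix p b g assume p: "p \<in> FK_letters N" and b: "b \<in> carrier A"
    and IH: "\<And>g. antipode (FK_comp K N g b) = FK_comp K N g (antipode b)"
  let ?d = "letter_deg p"
  note d = letter_deg_closed[OF p] and Sb = antipode_closed[OF b]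
  have "inv' ?d = ?d" by (simp add: letter_deg_def)
  \<comment> \<open>The rule for a letter on the right asks for the component of degree g |p| of
    |p|.S(b). By conjugation it comes from the component of S(b) of degree |p| g, the one that the
    induction hypothesis is about.\<close>
  then have deg: "?d \<circ> (?d \<circ> g) \<circ> inv' ?d = g \<circ> ?d" by simp
  have "FK_comp K N g (\<ominus>\<^bsub>A\<^esub> (da p (antipode b) \<otimes>\<^bsub>A\<^esub> X p)) =
    \<ominus>\<^bsub>A\<^esub> (da p (FK_comp K N (?d \<circ> g) (antipode b)) \<otimes>\<^bsub>A\<^esub> X p)"
    unfolding lin_map_uminus[OF A_mod A_mod FK_comp_lin_map A.m_closed[OF da_closed[OF p Sb] gen_closed[OF p]]]
      FK_comp_mult_right[OF p da_closed[OF p Sb]] FK_act_comp_proj[OF d Sb] deg ..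
  then show "antipode (FK_comp K N g (X p \<otimes>\<^bsub>A\<^esub> b)) = FK_comp K N g (antipode (X p \<otimes>\<^bsub>A\<^esub> b))"
    unfolding FK_comp_mult[OF p b] antipode_mult[OF p FK_comp_closed[OF b]] antipode_mult[OF p b] IH by (rule sym)
qed

lemma antipode_morphism: "antipode \<in> crossed_hom K G B B"
  using antipode_lin_map antipode_act antipode_closed
  by (auto simp: crossed_hom_def antipode_comp[symmetric])

lemma antipode_left_bilin: "bilin K A A A (\<lambda>y z. antipode y \<otimes>\<^bsub>A\<^esub> z)"
  by (rule bilin_comp[OF mult_bilin[OF FK_assoc_algebra] antipode_lin_map lin_map_id])

lemma antipode_right_bilin: "bilin K A A A (\<lambda>y z. y \<otimes>\<^bsub>A\<^esub> antipode z)"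
  by (rule bilin_comp[OF mult_bilin[OF FK_assoc_algebra] lin_map_id antipode_lin_map])

lemma unit_lin_map: "(\<lambda>a. a \<odot>\<^bsub>A\<^esub> \<one>\<^bsub>A\<^esub>) \<in> lin_map K E1 A"
  by (intro lin_mapI) (simp_all add: A.smult_l_distr A.smult_assoc1)

text \<open>After applying the antipode on the left and multiplying, the two summands of
  \<open>coprod_op p\<close> are -(|p|.S b) x_p c and (|p|.S b) x_p c. They cancel, so only the unit
  survives, as it does under the counit.\<close>

lemma antipode_left:
  assumes b: "b \<in> carrier A"
  shows "tensor_lift K B (\<lambda>y z. antipode y \<otimes>\<^bsub>A\<^esub> z) (coprod b) = counit b \<odot>\<^bsub>A\<^esub> \<one>\<^bsub>A\<^esub>"
proof -
  let ?S = "tensor_lift K B (\<lambda>y z. antipode y \<otimes>\<^bsub>A\<^esub> z)"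
  note lin = T_lift_lin_map[OF B_mod antipode_left_bilin[folded bilin_FK_crossed], unfolded lin_map_FK_crossed]
  note pure = T_lift_pure[OF B_mod antipode_left_bilin[folded bilin_FK_crossed]]
  have op: "?S (coprod_op p t) = \<zero>\<^bsub>A\<^esub>" if p: "p \<in> FK_letters N" and t: "t \<in> carrier T" for p t
  proof (rule T_eqI[OF A_mod lin_map_comp[OF coprod_op_lin_map[OF p] lin] lin_map_const_zero[OF A_mod] _ t])
    fix b c assume b: "b \<in> carrier A" and c: "c \<in> carrier A"
    note cl = gen_closed[OF p] da_closed[OF p b] antipode_closed[OF b] da_closed[OF p antipode_closed[OF b]]
    show "?S (coprod_op p (P b c)) = \<zero>\<^bsub>A\<^esub>"
      using b c cl
      by (simp add: coprod_op_pure[OF p] lin_map_add[OF lin] P_closed pure antipode_mult[OF p]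
          antipode_act[OF letter_deg_closed[OF p]] A.l_minus A.m_assoc A.M.l_neg)
  qed
  show ?thesis
  proof (rule FK_eqI[OF A_mod lin_map_comp[OF coprod_lin_map lin] lin_map_comp[OF counit_lin_map unit_lin_map] _ _ b])
    show "?S (coprod \<one>\<^bsub>A\<^esub>) = counit \<one>\<^bsub>A\<^esub> \<odot>\<^bsub>A\<^esub> \<one>\<^bsub>A\<^esub>"
      by (simp add: coprod_one pure antipode_one counit_one)
    fix p b assume p: "p \<in> FK_letters N" and b: "b \<in> carrier A"
    show "?S (coprod (X p \<otimes>\<^bsub>A\<^esub> b)) = counit (X p \<otimes>\<^bsub>A\<^esub> b) \<odot>\<^bsub>A\<^esub> \<one>\<^bsub>A\<^esub>"
      by (simp add: coprod_mult[OF p b] op[OF p coprod_closed[OF b]] counit_mult[OF p b])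
  qed
qed

text \<open>Here \<open>coprod_op p\<close> becomes the braided commutator m \<mapsto> x_p m -
  (|p|.m) x_p. By the induction hypothesis m is a multiple of the unit; such elements are fixed by
  the action and commute with x_p.\<close>

lemma antipode_right:
  assumes b: "b \<in> carrier A"
  shows "tensor_lift K B (\<lambda>y z. y \<otimes>\<^bsub>A\<^esub> antipode z) (coprod b) = counit b \<odot>\<^bsub>A\<^esub> \<one>\<^bsub>A\<^esub>"
proof -
  let ?S = "tensor_lift K B (\<lambda>y z. y \<otimes>\<^bsub>A\<^esub> antipode z)"
  note lin = T_lift_lin_map[OF B_mod antipode_right_bilin[folded bilin_FK_crossed], unfolded lin_map_FK_crossed]
  note pure = T_lift_pure[OF B_mod antipode_right_bilin[folded bilin_FK_crossed]]
  have op: "?S (coprod_op p t) = X p \<otimes>\<^bsub>A\<^esub> ?S t \<oplus>\<^bsub>A\<^esub> \<ominus>\<^bsub>A\<^esub> (da p (?S t) \<otimes>\<^bsub>A\<^esub> X p)"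
    if p: "p \<in> FK_letters N" and t: "t \<in> carrier T" for p t
  proof (rule T_eqI[OF A_mod lin_map_comp[OF coprod_op_lin_map[OF p] lin]
        lin_map_plus[OF A_mod lin_map_comp[OF lin gen_mult_lin_map[OF p]]
          lin_map_neg[OF A_mod lin_map_comp[OF lin_map_comp[OF lin FK_act_lin_map[OF letter_deg_closed[OF p]]]
            mult_right_lin_map[OF FK_assoc_algebra gen_closed[OF p]]]]] _ t])
    fix b c assume b: "b \<in> carrier A" and c: "c \<in> carrier A"
    note cl = gen_closed[OF p] da_closed[OF p b] antipode_closed[OF c] da_closed[OF p antipode_closed[OF c]]
    show "?S (coprod_op p (P b c)) = X p \<otimes>\<^bsub>A\<^esub> ?S (P b c) \<oplus>\<^bsub>A\<^esub> \<ominus>\<^bsub>A\<^esub> (da p (?S (P b c)) \<otimes>\<^bsub>A\<^esub> X p)"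
      using b c cl
      by (simp add: coprod_op_pure[OF p] lin_map_add[OF lin] P_closed pure antipode_mult[OF p]
          FK_act_mult[OF letter_deg_closed[OF p]] A.r_minus A.m_assoc)
  qed
  show ?thesis
  proof (rule FK_eqI[OF A_mod lin_map_comp[OF coprod_lin_map lin] lin_map_comp[OF counit_lin_map unit_lin_map] _ _ b])
    show "?S (coprod \<one>\<^bsub>A\<^esub>) = counit \<one>\<^bsub>A\<^esub> \<odot>\<^bsub>A\<^esub> \<one>\<^bsub>A\<^esub>"
      by (simp add: coprod_one pure antipode_one counit_one)
    fix p b assume p: "p \<in> FK_letters N" and b: "b \<in> carrier A"
      and IH: "?S (coprod b) = counit b \<odot>\<^bsub>A\<^esub> \<one>\<^bsub>A\<^esub>"
    note d = letter_deg_closed[OF p]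
    have "da p (counit b \<odot>\<^bsub>A\<^esub> \<one>\<^bsub>A\<^esub>) = counit b \<odot>\<^bsub>A\<^esub> \<one>\<^bsub>A\<^esub>"
      unfolding lin_map_smult[OF FK_act_lin_map[OF d] counit_closed[OF b] A.one_closed] FK_act_one[OF d] ..
    then have "?S (coprod (X p \<otimes>\<^bsub>A\<^esub> b)) = \<zero>\<^bsub>A\<^esub>"
      using counit_closed[OF b] gen_closed[OF p]
      by (simp add: coprod_mult[OF p b] op[OF p coprod_closed[OF b]] IH A.smult_mult_left A.smult_mult_right A.M.r_neg)
    then show "?S (coprod (X p \<otimes>\<^bsub>A\<^esub> b)) = counit (X p \<otimes>\<^bsub>A\<^esub> b) \<odot>\<^bsub>A\<^esub> \<one>\<^bsub>A\<^esub>"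
      by (simp add: counit_mult[OF p b])
  qed
qed

subsection \<open>Coassociativity\<close>

abbreviation (input) "PT \<equiv> pure K (FK_crossed K N) (tensor K (FK_crossed K N) (FK_crossed K N))"
abbreviation (input) "TP \<equiv> pure K (tensor K (FK_crossed K N) (FK_crossed K N)) (FK_crossed K N)"
abbreviation (input) "id_coprod \<equiv> tensor_map K (FK_crossed K N) (tensor K (FK_crossed K N) (FK_crossed K N)) (\<lambda>y. y) coprod"
abbreviation (input) "coprod_id \<equiv> tensor_map K (tensor K (FK_crossed K N) (FK_crossed K N)) (FK_crossed K N) coprod (\<lambda>y. y)"
abbreviation (input) "BBB_assoc \<equiv> tensor_assoc K (FK_crossed K N) (FK_crossed K N) (FK_crossed K N)"

lemma TT_mod: "module K TT"
  by (rule tensor_module[OF B_mod T_mod])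

interpretation TT: module K TT by (rule TT_mod)

lemma PT_bilin: "bilin K A T TT PT"
  using pure_bilin[OF B_mod T_mod] by (simp add: bilin_def)

lemmas PT_closed = bilin_closed[OF PT_bilin]

lemma TP_closed: "\<lbrakk>t \<in> carrier T; c \<in> carrier A\<rbrakk> \<Longrightarrow> TP t c \<in> carrier (tensor K T B)"
  by (rule pure_closed[OF T_mod B_mod]) simp_all

text \<open>Left multiplication by \<open>x\<^sub>p \<otimes> 1 \<otimes> 1 + 1 \<otimes> x\<^sub>p \<otimes> 1 + 1 \<otimes> 1 \<otimes> x\<^sub>p\<close> in the braided cube.\<close>

definition "coprod3_op p = tensor_lift K TT
  (\<lambda>b t. PT (X p \<otimes>\<^bsub>A\<^esub> b) t \<oplus>\<^bsub>TT\<^esub> PT (da p b) (coprod_op p t))"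

context
  fixes p assumes p: "p \<in> FK_letters N"
begin

lemma coprod3_op_bilin:
  "bilin K A T TT (\<lambda>b t. PT (X p \<otimes>\<^bsub>A\<^esub> b) t \<oplus>\<^bsub>TT\<^esub> PT (da p b) (coprod_op p t))"
  by (rule bilin_plus[OF TT_mod bilin_comp[OF PT_bilin gen_mult_lin_map[OF p] lin_map_id]
        bilin_comp[OF PT_bilin FK_act_lin_map[OF letter_deg_closed[OF p]] coprod_op_lin_map[OF p]]])

lemma coprod3_op_lin_map: "coprod3_op p \<in> lin_map K TT TT"
  unfolding coprod3_op_def
  by (rule tensor_lift_lin_map[OF B_mod T_mod TT_mod])
    (use coprod3_op_bilin in \<open>simp add: bilin_def\<close>)

lemma coprod3_op_pure:
  "\<lbrakk>b \<in> carrier A; t \<in> carrier T\<rbrakk> \<Longrightarrow>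
    coprod3_op p (PT b t) = PT (X p \<otimes>\<^bsub>A\<^esub> b) t \<oplus>\<^bsub>TT\<^esub> PT (da p b) (coprod_op p t)"
  unfolding coprod3_op_def
  by (rule tensor_lift_pure[OF B_mod T_mod TT_mod])
    (use coprod3_op_bilin in \<open>simp_all add: bilin_def\<close>)

end

lemma id_coprod_lin_map: "id_coprod \<in> lin_map K T TT"
  by (rule tensor_map_lin_map[OF B_mod B_mod B_mod T_mod lin_map_id]) (simp add: coprod_lin_map)

lemma id_coprod_pure:
  "\<lbrakk>b \<in> carrier A; c \<in> carrier A\<rbrakk> \<Longrightarrow> id_coprod (P b c) = PT b (coprod c)"
  by (rule tensor_map_pure[OF B_mod B_mod B_mod T_mod lin_map_id]) (simp_all add: coprod_lin_map)

lemma coprod_id_lin_map: "coprod_id \<in> lin_map K T (tensor K T B)"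
  by (rule tensor_map_lin_map[OF B_mod B_mod T_mod B_mod _ lin_map_id]) (simp add: coprod_lin_map)

lemma coprod_id_pure:
  "\<lbrakk>b \<in> carrier A; c \<in> carrier A\<rbrakk> \<Longrightarrow> coprod_id (P b c) = TP (coprod b) c"
  by (rule tensor_map_pure[OF B_mod B_mod T_mod B_mod _ lin_map_id]) (simp_all add: coprod_lin_map)

lemmas BBB_assoc_lin_map = tensor_assoc_lin_map[OF B_mod B_mod B_mod]

lemma BBB_assoc_pure:
  "\<lbrakk>a \<in> carrier A; b \<in> carrier A; c \<in> carrier A\<rbrakk> \<Longrightarrow> BBB_assoc (TP (P a b) c) = PT a (P b c)"
  by (rule tensor_assoc_pure[OF B_mod B_mod B_mod]) simp_all

lemma TP_left: "c \<in> carrier A \<Longrightarrow> (\<lambda>t. TP t c) \<in> lin_map K T (tensor K T B)"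
  by (rule bilin_left[OF pure_bilin[OF T_mod B_mod]]) simp

text \<open>Expresses \<open>coprod3_op\<close> in the other bracketing: the letter either acts
  inside the first two factors, or passes them, applying its degree to both, and then multiplies the
  third.\<close>

lemma BBB_assoc_coprod_op:
  assumes p: "p \<in> FK_letters N" and t: "t \<in> carrier T" and c: "c \<in> carrier A"
  shows "BBB_assoc (TP (coprod_op p t) c) \<oplus>\<^bsub>TT\<^esub> BBB_assoc (TP (ga (letter_deg p) t) (X p \<otimes>\<^bsub>A\<^esub> c)) =
    coprod3_op p (BBB_assoc (TP t c))"
proof -
  note d = letter_deg_closed[OF p]
  have xc: "X p \<otimes>\<^bsub>A\<^esub> c \<in> carrier A" using gen_closed[OF p] c by simp
  show ?thesis
  proof (rule T_eqI[OF TT_mod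
        lin_map_plus[OF TT_mod lin_map_comp[OF lin_map_comp[OF coprod_op_lin_map[OF p] TP_left[OF c]] BBB_assoc_lin_map]
          lin_map_comp[OF lin_map_comp[OF ga_lin_map[OF d] TP_left[OF xc]] BBB_assoc_lin_map]]
        lin_map_comp[OF lin_map_comp[OF TP_left[OF c] BBB_assoc_lin_map] coprod3_op_lin_map[OF p]] _ t])
    fix u v assume u: "u \<in> carrier A" and v: "v \<in> carrier A"
    note cl = gen_closed[OF p] da_closed[OF p u] da_closed[OF p v] u v c
    have cl': "X p \<otimes>\<^bsub>A\<^esub> u \<in> carrier A" "X p \<otimes>\<^bsub>A\<^esub> v \<in> carrier A" using cl by auto
    have 1: "BBB_assoc (TP (coprod_op p (P u v)) c) =
      PT (X p \<otimes>\<^bsub>A\<^esub> u) (P v c) \<oplus>\<^bsub>TT\<^esub> PT (da p u) (P (X p \<otimes>\<^bsub>A\<^esub> v) c)"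
      unfolding coprod_op_pure[OF p u v]
        lin_map_add[OF TP_left[OF c] P_closed[OF cl'(1) v] P_closed[OF cl(2) cl'(2)]]
        lin_map_add[OF BBB_assoc_lin_map TP_closed[OF P_closed[OF cl'(1) v] c] TP_closed[OF P_closed[OF cl(2) cl'(2)] c]]
        BBB_assoc_pure[OF cl'(1) v c] BBB_assoc_pure[OF cl(2) cl'(2) c] ..
    have 2: "BBB_assoc (TP (ga (letter_deg p) (P u v)) (X p \<otimes>\<^bsub>A\<^esub> c)) = PT (da p u) (P (da p v) (X p \<otimes>\<^bsub>A\<^esub> c))"
      unfolding ga_pure[OF d u v] BBB_assoc_pure[OF cl(2,3) xc] ..
    have 3: "coprod3_op p (BBB_assoc (TP (P u v) c)) = PT (X p \<otimes>\<^bsub>A\<^esub> u) (P v c) \<oplus>\<^bsub>TT\<^esub>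
      (PT (da p u) (P (X p \<otimes>\<^bsub>A\<^esub> v) c) \<oplus>\<^bsub>TT\<^esub> PT (da p u) (P (da p v) (X p \<otimes>\<^bsub>A\<^esub> c)))"
      unfolding BBB_assoc_pure[OF u v c] coprod3_op_pure[OF p u P_closed[OF v c]] coprod_op_pure[OF p v c]
        lin_map_add[OF bilin_right[OF PT_bilin cl(2)] P_closed[OF cl'(2) c] P_closed[OF cl(3) xc]] ..
    show "BBB_assoc (TP (coprod_op p (P u v)) c) \<oplus>\<^bsub>TT\<^esub> BBB_assoc (TP (ga (letter_deg p) (P u v)) (X p \<otimes>\<^bsub>A\<^esub> c)) =
      coprod3_op p (BBB_assoc (TP (P u v) c))"
      unfolding 1 2 3 by (rule TT.M.a_assoc) (intro PT_closed P_closed cl cl' xc)+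
  qed
qed

text \<open>Coassociativity reduces to the fact that both iterated coproducts turn
  \<open>coprod_op p\<close> into the same operator on the threefold tensor product. In this
  bracketing the coproduct is applied to |p|.b, and its equivariance produces the action on both
  factors.\<close>

lemma coassoc_left_op:
  assumes p: "p \<in> FK_letters N" and t: "t \<in> carrier T"
  shows "BBB_assoc (coprod_id (coprod_op p t)) = coprod3_op p (BBB_assoc (coprod_id t))"
proof (rule T_eqI[OF TT_mod
      lin_map_comp[OF lin_map_comp[OF coprod_op_lin_map[OF p] coprod_id_lin_map] BBB_assoc_lin_map]
      lin_map_comp[OF lin_map_comp[OF coprod_id_lin_map BBB_assoc_lin_map] coprod3_op_lin_map[OF p]] _ t])
  fix b c assume b: "b \<in> carrier A" and c: "c \<in> carrier A"
  note d = letter_deg_closed[OF p] and db = da_closed[OF p b]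
  have xb: "X p \<otimes>\<^bsub>A\<^esub> b \<in> carrier A" "X p \<otimes>\<^bsub>A\<^esub> c \<in> carrier A" using gen_closed[OF p] b c by auto
  have "BBB_assoc (coprod_id (coprod_op p (P b c))) =
    BBB_assoc (TP (coprod_op p (coprod b)) c) \<oplus>\<^bsub>TT\<^esub> BBB_assoc (TP (ga (letter_deg p) (coprod b)) (X p \<otimes>\<^bsub>A\<^esub> c))"
    unfolding coprod_op_pure[OF p b c] lin_map_add[OF coprod_id_lin_map P_closed[OF xb(1) c] P_closed[OF db xb(2)]]
      coprod_id_pure[OF xb(1) c] coprod_id_pure[OF db xb(2)]
      lin_map_add[OF BBB_assoc_lin_map TP_closed[OF coprod_closed[OF xb(1)] c] TP_closed[OF coprod_closed[OF db] xb(2)]]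
    unfolding coprod_mult[OF p b] coprod_act[OF d b] ..
  also have "\<dots> = coprod3_op p (BBB_assoc (coprod_id (P b c)))"
    unfolding BBB_assoc_coprod_op[OF p coprod_closed[OF b] c] coprod_id_pure[OF b c] ..
  finally show "BBB_assoc (coprod_id (coprod_op p (P b c))) = coprod3_op p (BBB_assoc (coprod_id (P b c)))" .
qed

lemma coassoc_right_op:
  assumes p: "p \<in> FK_letters N" and t: "t \<in> carrier T"
  shows "id_coprod (coprod_op p t) = coprod3_op p (id_coprod t)"
proof (rule T_eqI[OF TT_mod lin_map_comp[OF coprod_op_lin_map[OF p] id_coprod_lin_map]
      lin_map_comp[OF id_coprod_lin_map coprod3_op_lin_map[OF p]] _ t])
  fix b c assume b: "b \<in> carrier A" and c: "c \<in> carrier A"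
  have xb: "X p \<otimes>\<^bsub>A\<^esub> b \<in> carrier A" "X p \<otimes>\<^bsub>A\<^esub> c \<in> carrier A" using gen_closed[OF p] b c by auto
  note db = da_closed[OF p b]
  show "id_coprod (coprod_op p (P b c)) = coprod3_op p (id_coprod (P b c))"
    unfolding coprod_op_pure[OF p b c] lin_map_add[OF id_coprod_lin_map P_closed[OF xb(1) c] P_closed[OF db xb(2)]]
      id_coprod_pure[OF xb(1) c] id_coprod_pure[OF db xb(2)] id_coprod_pure[OF b c]
      coprod3_op_pure[OF p b coprod_closed[OF c]] coprod_mult[OF p c] ..
qed

lemma coprod_coassoc:
  assumes b: "b \<in> carrier A"
  shows "BBB_assoc (coprod_id (coprod b)) = id_coprod (coprod b)"
proof (rule FK_eqI[OF TT_mod lin_map_comp[OF lin_map_comp[OF coprod_lin_map coprod_id_lin_map] BBB_assoc_lin_map]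
      lin_map_comp[OF coprod_lin_map id_coprod_lin_map] _ _ b])
  note o = A.one_closed
  show "BBB_assoc (coprod_id (coprod \<one>\<^bsub>A\<^esub>)) = id_coprod (coprod \<one>\<^bsub>A\<^esub>)"
    unfolding coprod_one coprod_id_pure[OF o o] id_coprod_pure[OF o o] BBB_assoc_pure[OF o o o] ..
  fix p b assume p: "p \<in> FK_letters N" and b: "b \<in> carrier A"
    and IH: "BBB_assoc (coprod_id (coprod b)) = id_coprod (coprod b)"
  show "BBB_assoc (coprod_id (coprod (X p \<otimes>\<^bsub>A\<^esub> b))) = id_coprod (coprod (X p \<otimes>\<^bsub>A\<^esub> b))"
    unfolding coprod_mult[OF p b] coassoc_left_op[OF p coprod_closed[OF b]]
      coassoc_right_op[OF p coprod_closed[OF b]] IH ..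
qed

subsection \<open>Multiplicativity of the coproduct\<close>

abbreviation (input) "BS \<equiv> braided_square K (sym_group N) (FK_crossed K N)"

lemma braided_square_simps:
  "carrier BS = carrier T" "add BS = add T" "smult BS = smult T" "zero BS = zero T"
  "one BS = P \<one>\<^bsub>A\<^esub> \<one>\<^bsub>A\<^esub>"
  by (simp_all add: braided_square_def Let_def)

text \<open>The product of a \<otimes> b and c \<otimes> d as a function of four arguments, isolated
  from the nested lifts in \<open>braided_square\<close> so that linearity can be shown in each
  argument.\<close>

definition "mul4 a b c d = tensor_lift K T (\<lambda>p q. P (a \<otimes>\<^bsub>A\<^esub> p) (q \<otimes>\<^bsub>A\<^esub> d)) (braiding K G B B (P b c))"

definition "mulT s t = tensor_lift K T (\<lambda>a b. tensor_lift K T (\<lambda>c d. mul4 a b c d) t) s"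

lemma braided_square_mult: "mult BS = mulT"
  by (intro ext) (simp add: braided_square_def Let_def mulT_def mul4_def)

lemma sandwich_bilin:
  "\<lbrakk>a \<in> carrier A; d \<in> carrier A\<rbrakk> \<Longrightarrow> bilin K A A T (\<lambda>p q. P (a \<otimes>\<^bsub>A\<^esub> p) (q \<otimes>\<^bsub>A\<^esub> d))"
  by (rule bilin_comp[OF P_bilin mult_left_lin_map[OF FK_assoc_algebra] mult_right_lin_map[OF FK_assoc_algebra]])

lemma bilin_dom_FK_crossed: "bilin K B B U b = bilin K A A U b"
  by (simp add: bilin_def)

text \<open>The outer arguments occur inside the bilinear map that is lifted and are handled by
  \<open>tensor_lift_param\<close>. The inner two enter through the braiding, so there linearity is
  a composition of linear maps.\<close>

lemma mul4_lin_maps: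
  shows mul4_lin1: "\<lbrakk>b \<in> carrier A; c \<in> carrier A; d \<in> carrier A\<rbrakk> \<Longrightarrow> (\<lambda>a. mul4 a b c d) \<in> lin_map K A T"
    and mul4_lin2: "\<lbrakk>a \<in> carrier A; c \<in> carrier A; d \<in> carrier A\<rbrakk> \<Longrightarrow> (\<lambda>b. mul4 a b c d) \<in> lin_map K A T"
    and mul4_lin3: "\<lbrakk>a \<in> carrier A; b \<in> carrier A; d \<in> carrier A\<rbrakk> \<Longrightarrow> (\<lambda>c. mul4 a b c d) \<in> lin_map K A T"
    and mul4_lin4: "\<lbrakk>a \<in> carrier A; b \<in> carrier A; c \<in> carrier A\<rbrakk> \<Longrightarrow> (\<lambda>d. mul4 a b c d) \<in> lin_map K A T"
proof -
  note lift = T_lift_lin_map[OF T_mod sandwich_bilin]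
  have br: "braiding K G B B (P b c) \<in> carrier T" if "b \<in> carrier A" "c \<in> carrier A" for b c
    using lin_map_closed[OF B_braiding_lin_map P_closed[OF that]] .
  note left = bilin_left[OF sandwich_bilin] and right = bilin_right[OF sandwich_bilin]
  show "(\<lambda>a. mul4 a b c d) \<in> lin_map K A T" if "b \<in> carrier A" "c \<in> carrier A" "d \<in> carrier A" for b c d
    unfolding mul4_def
  proof (rule tensor_lift_param[OF B_mod B_mod A_mod T_mod _ _ br[OF that(1,2)]])
    fix p q assume "p \<in> carrier B" "q \<in> carrier B"
    then show "(\<lambda>a. P (a \<otimes>\<^bsub>A\<^esub> p) (q \<otimes>\<^bsub>A\<^esub> d)) \<in> lin_map K A T"
      using that by (intro lin_map_comp[OF mult_right_lin_map[OF FK_assoc_algebra] P_left]) auto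
  qed (use that sandwich_bilin in \<open>simp add: bilin_dom_FK_crossed\<close>)
  show "(\<lambda>b. mul4 a b c d) \<in> lin_map K A T" if "a \<in> carrier A" "c \<in> carrier A" "d \<in> carrier A" for a c d
    unfolding mul4_def
    by (rule lin_map_comp[OF lin_map_comp[OF P_left[OF that(2)] B_braiding_lin_map] lift[OF that(1,3)]])
  show "(\<lambda>c. mul4 a b c d) \<in> lin_map K A T" if "a \<in> carrier A" "b \<in> carrier A" "d \<in> carrier A" for a b d
    unfolding mul4_def
    by (rule lin_map_comp[OF lin_map_comp[OF P_right[OF that(2)] B_braiding_lin_map] lift[OF that(1,3)]])
  show "(\<lambda>d. mul4 a b c d) \<in> lin_map K A T" if "a \<in> carrier A" "b \<in> carrier A" "c \<in> carrier A" for a b c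
    unfolding mul4_def
  proof (rule tensor_lift_param[OF B_mod B_mod A_mod T_mod _ _ br[OF that(2,3)]])
    fix p q assume "p \<in> carrier B" "q \<in> carrier B"
    then show "(\<lambda>d. P (a \<otimes>\<^bsub>A\<^esub> p) (q \<otimes>\<^bsub>A\<^esub> d)) \<in> lin_map K A T"
      using that by (intro lin_map_comp[OF mult_left_lin_map[OF FK_assoc_algebra] P_right]) auto
  qed (use that sandwich_bilin in \<open>simp add: bilin_dom_FK_crossed\<close>)
qed

lemma mul4_bilin_right: "\<lbrakk>a \<in> carrier A; b \<in> carrier A\<rbrakk> \<Longrightarrow> bilin K A A T (\<lambda>c d. mul4 a b c d)"
  by (intro bilinI mul4_lin3 mul4_lin4)

lemma mulT_bilin_left:
  assumes "t \<in> carrier T"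
  shows "bilin K A A T (\<lambda>a b. tensor_lift K T (\<lambda>c d. mul4 a b c d) t)"
proof (rule bilinI)
  fix a assume a: "a \<in> carrier A"
  show "(\<lambda>b. tensor_lift K T (\<lambda>c d. mul4 a b c d) t) \<in> lin_map K A T"
    by (rule tensor_lift_param[OF B_mod B_mod A_mod T_mod _ _ assms])
      (simp_all add: bilin_dom_FK_crossed mul4_bilin_right a mul4_lin2)
next
  fix b assume b: "b \<in> carrier A"
  show "(\<lambda>a. tensor_lift K T (\<lambda>c d. mul4 a b c d) t) \<in> lin_map K A T"
    by (rule tensor_lift_param[OF B_mod B_mod A_mod T_mod _ _ assms])
      (simp_all add: bilin_dom_FK_crossed mul4_bilin_right b mul4_lin1)
qed

lemma mulT_lin_left: "t \<in> carrier T \<Longrightarrow> (\<lambda>s. mulT s t) \<in> lin_map K T T"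
  unfolding mulT_def by (rule T_lift_lin_map[OF T_mod mulT_bilin_left])

lemma mulT_pure_left:
  "\<lbrakk>a \<in> carrier A; b \<in> carrier A; t \<in> carrier T\<rbrakk> \<Longrightarrow> mulT (P a b) t = tensor_lift K T (\<lambda>c d. mul4 a b c d) t"
  unfolding mulT_def by (rule T_lift_pure[OF T_mod mulT_bilin_left])

lemma mulT_lin_right:
  assumes a: "a \<in> carrier A" and b: "b \<in> carrier A"
  shows "(\<lambda>t. mulT (P a b) t) \<in> lin_map K T T"
  by (rule lin_map_cong[OF T_mod T_lift_lin_map[OF T_mod mul4_bilin_right[OF a b]]])
    (simp add: mulT_pure_left[OF a b])

lemma mulT_pure:
  assumes g: "g \<in> carrier G" and a: "a \<in> carrier A" and b: "b \<in> grade B g" and c: "c \<in> carrier A" and d: "d \<in> carrier A"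
  shows "mulT (P a b) (P c d) = P (a \<otimes>\<^bsub>A\<^esub> FK_act K N g c) (b \<otimes>\<^bsub>A\<^esub> d)"
proof -
  have bA: "b \<in> carrier A" using b by simp
  have "mulT (P a b) (P c d) = mul4 a b c d"
    unfolding mulT_pure_left[OF a bA P_closed[OF c d]] by (rule T_lift_pure[OF T_mod mul4_bilin_right[OF a bA] c d])
  also have "\<dots> = P (a \<otimes>\<^bsub>A\<^esub> FK_act K N g c) (b \<otimes>\<^bsub>A\<^esub> d)"
    unfolding mul4_def B_braiding[OF g b c]
    by (rule T_lift_pure[OF T_mod sandwich_bilin[OF a d] FK_act_closed[OF g c] bA])
  finally show ?thesis .
qed

lemma mulT_one:
  assumes t: "t \<in> carrier T" shows "mulT (P \<one>\<^bsub>A\<^esub> \<one>\<^bsub>A\<^esub>) t = t"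
proof (rule T_eqI[OF T_mod mulT_lin_right[OF A.one_closed A.one_closed] lin_map_id _ t])
  fix b c assume "b \<in> carrier A" "c \<in> carrier A"
  then show "mulT (P \<one>\<^bsub>A\<^esub> \<one>\<^bsub>A\<^esub>) (P b c) = P b c"
    using mulT_pure[OF id_in_sym A.one_closed grade_one, of b c] by (simp add: FK_act_id)
qed

text \<open>The instance of associativity on which multiplicativity of the coproduct rests. For
  \<open>b\<close> of degree \<open>g\<close> both products are explicit: \<open>X p\<close> times
  \<open>b\<close> has degree |p| g, and acting by it is acting first by \<open>g\<close> and then
  by |p|.\<close>

lemma mulT_coprod_op_pure:
  assumes p: "p \<in> FK_letters N" and a: "a \<in> carrier A" and g: "g \<in> carrier G" and b: "b \<in> grade B g"
    and t: "t \<in> carrier T"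
  shows "mulT (coprod_op p (P a b)) t = coprod_op p (mulT (P a b) t)"
proof -
  note d = letter_deg_closed[OF p] and da = da_closed[OF p a]
  have bA: "b \<in> carrier A" using b by simp
  note xb = grade_mult[OF grade_gen[OF p] b] and dg = comp_closed[OF d g]
  have xA: "X p \<otimes>\<^bsub>A\<^esub> a \<in> carrier A" "X p \<otimes>\<^bsub>A\<^esub> b \<in> carrier A" using gen_closed[OF p] a bA by auto
  have split: "mulT (coprod_op p (P a b)) t = mulT (P (X p \<otimes>\<^bsub>A\<^esub> a) b) t \<oplus>\<^bsub>T\<^esub> mulT (P (da p a) (X p \<otimes>\<^bsub>A\<^esub> b)) t"
    if "t \<in> carrier T" for t
    unfolding coprod_op_pure[OF p a bA]
      lin_map_add[OF mulT_lin_left[OF that] P_closed[OF xA(1) bA] P_closed[OF da xA(2)]] ..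
  show ?thesis
    unfolding split[OF t]
  proof (rule T_eqI[OF T_mod lin_map_plus[OF T_mod mulT_lin_right[OF xA(1) bA] mulT_lin_right[OF da xA(2)]]
        lin_map_comp[OF mulT_lin_right[OF a bA] coprod_op_lin_map[OF p]] _ t])
    fix c e assume c: "c \<in> carrier A" and e: "e \<in> carrier A"
    note gc = FK_act_closed[OF g c]
    have "mulT (P (X p \<otimes>\<^bsub>A\<^esub> a) b) (P c e) \<oplus>\<^bsub>T\<^esub> mulT (P (da p a) (X p \<otimes>\<^bsub>A\<^esub> b)) (P c e) =
      P (X p \<otimes>\<^bsub>A\<^esub> a \<otimes>\<^bsub>A\<^esub> FK_act K N g c) (b \<otimes>\<^bsub>A\<^esub> e) \<oplus>\<^bsub>T\<^esub>
      P (da p a \<otimes>\<^bsub>A\<^esub> da p (FK_act K N g c)) (X p \<otimes>\<^bsub>A\<^esub> b \<otimes>\<^bsub>A\<^esub> e)"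
      unfolding mulT_pure[OF g xA(1) b c e] mulT_pure[OF dg da xb c e] FK_act_comp[OF d g c] ..
    also have "\<dots> = coprod_op p (P (a \<otimes>\<^bsub>A\<^esub> FK_act K N g c) (b \<otimes>\<^bsub>A\<^esub> e))"
      using gen_closed[OF p] a bA gc e by (simp add: coprod_op_pure[OF p] FK_act_mult[OF d] A.m_assoc)
    also have "\<dots> = coprod_op p (mulT (P a b) (P c e))"
      unfolding mulT_pure[OF g a b c e] ..
    finally show "mulT (P (X p \<otimes>\<^bsub>A\<^esub> a) b) (P c e) \<oplus>\<^bsub>T\<^esub> mulT (P (da p a) (X p \<otimes>\<^bsub>A\<^esub> b)) (P c e) =
      coprod_op p (mulT (P a b) (P c e))" .
  qed
qed

text \<open>Removes the homogeneity of the right tensor factor, since homogeneous elements span the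
  algebra.\<close>

lemma mulT_coprod_op:
  assumes p: "p \<in> FK_letters N" and s: "s \<in> carrier T" and t: "t \<in> carrier T"
  shows "mulT (coprod_op p s) t = coprod_op p (mulT s t)"
proof (rule tensor_eqI_span[OF B_mod B_mod T_mod lin_map_comp[OF coprod_op_lin_map[OF p] mulT_lin_left[OF t]]
      lin_map_comp[OF mulT_lin_left[OF t] coprod_op_lin_map[OF p]] lin_span_carrier[OF B_mod] B_span _ s])
  fix a b assume "a \<in> carrier B" and b: "b \<in> (\<Union>g\<in>carrier G. grade B g)"
  then have a: "a \<in> carrier A" by simp
  from b obtain g where "g \<in> carrier G" "b \<in> grade B g" by blast
  then show "mulT (coprod_op p (P a b)) t = coprod_op p (mulT (P a b) t)"
    by (rule mulT_coprod_op_pure[OF p a _ _ t])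
qed

lemma coprod_alg_hom: "coprod \<in> alg_hom K B BS"
proof (rule alg_homI)
  have BS: "lin_map K A BS = lin_map K A T" by (rule lin_map_cod_cong) (simp_all add: braided_square_simps)
  show "coprod \<in> lin_map K B BS" using coprod_lin_map by (simp add: BS)
  show "coprod \<one>\<^bsub>B\<^esub> = \<one>\<^bsub>BS\<^esub>" by (simp add: braided_square_simps coprod_one)
  fix a b assume "a \<in> carrier B" "b \<in> carrier B"
  then have a: "a \<in> carrier A" and b: "b \<in> carrier A" by simp_all
  note Tb = coprod_closed[OF b]
  have "coprod (a \<otimes>\<^bsub>A\<^esub> b) = mulT (coprod a) (coprod b)"
  proof (rule FK_eqI[OF T_mod lin_map_comp[OF mult_right_lin_map[OF FK_assoc_algebra b] coprod_lin_map]
        lin_map_comp[OF coprod_lin_map mulT_lin_left[OF Tb]] _ _ a])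
    show "coprod (\<one>\<^bsub>A\<^esub> \<otimes>\<^bsub>A\<^esub> b) = mulT (coprod \<one>\<^bsub>A\<^esub>) (coprod b)"
      using b by (simp add: coprod_one mulT_one[OF Tb])
    fix p a assume p: "p \<in> FK_letters N" and a: "a \<in> carrier A"
      and IH: "coprod (a \<otimes>\<^bsub>A\<^esub> b) = mulT (coprod a) (coprod b)"
    show "coprod (X p \<otimes>\<^bsub>A\<^esub> a \<otimes>\<^bsub>A\<^esub> b) = mulT (coprod (X p \<otimes>\<^bsub>A\<^esub> a)) (coprod b)"
      unfolding A.m_assoc[OF gen_closed[OF p] a b] coprod_mult[OF p A.m_closed[OF a b]] coprod_mult[OF p a]
        mulT_coprod_op[OF p coprod_closed[OF a] Tb] IH ..
  qed
  then show "coprod (a \<otimes>\<^bsub>B\<^esub> b) = coprod a \<otimes>\<^bsub>BS\<^esub> coprod b" by (simp add: braided_square_mult)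
qed

lemma mult_morphism_B: "tensor_lift K B (mult A) \<in> crossed_hom K G (crossed_tensor K G B B) B"
proof -
  note bil = mult_bilin[OF FK_assoc_algebra, folded bilin_FK_crossed]
  note lin = T_lift_lin_map[OF B_mod bil]
  note linA = lin[unfolded lin_map_FK_crossed]
  note pure = T_lift_pure[OF B_mod bil]
  show ?thesis
    unfolding crossed_hom_def mem_Collect_eq
  proof (intro conjI ballI)
    show "tensor_lift K B (mult A) \<in> lin_map K (crossed_tensor K G B B) B" using linA by simp
    fix g assume g: "g \<in> carrier G"
    show "tensor_lift K B (mult A) (act (crossed_tensor K G B B) g t) = act B g (tensor_lift K B (mult A) t)"
      if "t \<in> carrier (crossed_tensor K G B B)" for t
    proof -
      have t: "t \<in> carrier T" using that by simp
      have "tensor_lift K B (mult A) (ga g t) = FK_act K N g (tensor_lift K B (mult A) t)"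
        by (rule T_eqI[OF A_mod lin_map_comp[OF ga_lin_map[OF g] linA] lin_map_comp[OF linA FK_act_lin_map[OF g]] _ t])
          (simp add: ga_pure[OF g] pure FK_act_closed[OF g] FK_act_mult[OF g])
      then show ?thesis by simp
    qed
    have sub: "submodule (grade B g) K B"
      using crossed_module.grade_submodule[OF B_crossed_module g] .
    have "tensor_lift K B (mult A) t \<in> grade B g" if t: "t \<in> Tgrade g" for t
    proof (rule Tgrade_map[OF B_mod lin sub t])
      fix h l v w assume g: "g = h \<circ> l" and v: "v \<in> grade B h" and w: "w \<in> grade B l"
      have vw: "v \<in> carrier A" "w \<in> carrier A" using v w by simp_all
      show "tensor_lift K B (mult A) (P v w) \<in> grade B g"
        unfolding pure[OF vw] g by (rule grade_mult[OF v w])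
    qed
    then show "tensor_lift K B (mult A) ` grade (crossed_tensor K G B B) g \<subseteq> grade B g" by blast
  qed
qed

lemma unit_morphism_B: "(\<lambda>a. a \<odot>\<^bsub>A\<^esub> \<one>\<^bsub>A\<^esub>) \<in> crossed_hom K G E1 B"
  unfolding crossed_hom_def mem_Collect_eq
proof (intro conjI ballI)
  show "(\<lambda>a. a \<odot>\<^bsub>A\<^esub> \<one>\<^bsub>A\<^esub>) \<in> lin_map K E1 B" using unit_lin_map by simp
  fix g assume g: "g \<in> carrier G"
  show "act E1 g a \<odot>\<^bsub>A\<^esub> \<one>\<^bsub>A\<^esub> = act B g (a \<odot>\<^bsub>A\<^esub> \<one>\<^bsub>A\<^esub>)" if "a \<in> carrier E1" for a
    using that by (simp add: lin_map_smult[OF FK_act_lin_map[OF g]] FK_act_one[OF g])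
  show "(\<lambda>a. a \<odot>\<^bsub>A\<^esub> \<one>\<^bsub>A\<^esub>) ` grade E1 g \<subseteq> grade B g"
    by (auto simp: sym_group_one lin_map_smult[OF FK_comp_lin_map] FK_comp_one
        lin_map_zero[OF A_mod A_mod FK_comp_lin_map] split: if_splits)
qed

lemma B_braided_group: "braided_group K G B coprod counit antipode"
proof (intro braided_group.intro braided_algebra.intro B_crossed_module B_alg
    braided_algebra_axioms.intro braided_group_axioms.intro coprod_morphism counit_morphism antipode_morphism
    coprod_alg_hom counit_alg_hom)
  show "tensor_lift K B (mult B) \<in> crossed_hom K G (crossed_tensor K G B B) B"
    using mult_morphism_B by simp
  show "(\<lambda>a. a \<odot>\<^bsub>B\<^esub> \<one>\<^bsub>B\<^esub>) \<in> crossed_hom K G E1 B" using unit_morphism_B by simp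
  fix b assume "b \<in> carrier B"
  then have b: "b \<in> carrier A" by simp
  show "BBB_assoc (coprod_id (coprod b)) = id_coprod (coprod b)" by (rule coprod_coassoc[OF b])
  show "tensor_lift K B (\<lambda>y z. counit y \<odot>\<^bsub>B\<^esub> z) (coprod b) = b" using counit_left[OF b] by simp
  show "tensor_lift K B (\<lambda>y z. counit z \<odot>\<^bsub>B\<^esub> y) (coprod b) = b" using counit_right[OF b] by simp
  show "tensor_lift K B (\<lambda>y z. antipode y \<otimes>\<^bsub>B\<^esub> z) (coprod b) = counit b \<odot>\<^bsub>B\<^esub> \<one>\<^bsub>B\<^esub>"
    using antipode_left[OF b] by simp
  show "tensor_lift K B (\<lambda>y z. y \<otimes>\<^bsub>B\<^esub> antipode z) (coprod b) = counit b \<odot>\<^bsub>B\<^esub> \<one>\<^bsub>B\<^esub>"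
    using antipode_right[OF b] by simp
qed

section \<open>Uniqueness of coproduct and counit among algebra homomorphisms\<close>

lemma B_alg_hom_unique:
  assumes "module K U" "f \<in> alg_hom K B U" "f' \<in> alg_hom K B U"
    "\<And>p. p \<in> FK_letters N \<Longrightarrow> f (X p) = f' (X p)" "b \<in> carrier B"
  shows "f b = f' b"
proof -
  have "alg_hom K B U = alg_hom K A U" by (simp add: alg_hom_def ring_hom_def)
  with assms show ?thesis using FK_alg_hom_unique[of U f f' b] by simp
qed

lemma braided_square_module: "module K BS"
  by (rule module_cong[OF T_mod]) (simp_all add: braided_square_simps)

end

section \<open>The crossed module \<open>E\<^sub>N\<close>\<close>

lemma E_space_simps [simp]:
  "carrier (E_space K N) = carrier (free_module K (E_basis N))"
  "zero (E_space K N) = zero (free_module K (E_basis N))"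
  "add (E_space K N) = add (free_module K (E_basis N))"
  "smult (E_space K N) = smult (free_module K (E_basis N))"
  "act (E_space K N) g f = (\<Oplus>\<^bsub>free_module K (E_basis N)\<^esub>p\<in>E_basis N.
    f p \<odot>\<^bsub>free_module K (E_basis N)\<^esub> E_gen K N (g (fst p)) (g (snd p)))"
  "grade (E_space K N) g = lin_span K (free_module K (E_basis N))
    {E_gen K N i j | i j. (i, j) \<in> E_basis N \<and> Transposition.transpose i j = g}"
  by (simp_all add: E_space_def Let_def module.defs crossed.defs)

lemma lin_map_E_space [simp]:
  "lin_map K (E_space K N) U = lin_map K (free_module K (E_basis N)) U"
  "lin_map K U (E_space K N) = lin_map K U (free_module K (E_basis N))"
  by (rule lin_map_dom_cong lin_map_cod_cong; simp)+

lemma E_basis_finite: "finite (E_basis N)"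
  by (rule finite_subset[of _ "{1..N} \<times> {1..N}"]) (auto simp: E_basis_def)

lemma E_basis_letters: "p \<in> E_basis N \<Longrightarrow> p \<in> FK_letters N"
  by (auto simp: E_basis_def FK_letters_def)

lemma E_basis_or_swap: "(i, j) \<in> FK_letters N \<Longrightarrow> (i, j) \<in> E_basis N \<or> (j, i) \<in> E_basis N"
  by (auto simp: E_basis_def FK_letters_def)

context FK_base
begin

interpretation K: cring K by (rule K)

interpretation A: assoc_algebra K A by (rule FK_assoc_algebra)

abbreviation (input) "E \<equiv> free_module K (E_basis N)"
abbreviation (input) "ES \<equiv> E_space K N"
abbreviation (input) "e p \<equiv> E_gen K N (fst p) (snd p)"

lemmas E_mod = free_module_module[OF K, of "E_basis N"]

interpretation E: module K E by (rule E_mod)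

lemma ES_mod: "module K ES"
  by (rule module_cong[OF E_mod]) simp_all

lemma E_gen_basis: "p \<in> E_basis N \<Longrightarrow> e p = basis_vec K p"
  by (auto simp: E_gen_def E_basis_def)

lemma E_gen_swap:
  assumes "(i, j) \<in> FK_letters N" shows "E_gen K N j i = \<ominus>\<^bsub>E\<^esub> E_gen K N i j"
proof (cases "i < j")
  case True then show ?thesis by (simp add: E_gen_def)
next
  case False
  then have "(j, i) \<in> E_basis N" "j < i" using assms by (auto simp: E_basis_def FK_letters_def)
  then show ?thesis
    using E.M.minus_minus[OF basis_vec_closed[OF K, of "(j, i)" "E_basis N"]] by (simp add: E_gen_def)
qed

lemma E_gen_closed: "p \<in> FK_letters N \<Longrightarrow> e p \<in> carrier E"
proof -
  assume p: "p \<in> FK_letters N"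
  obtain i j where ij: "p = (i, j)" by (cases p)
  show "e p \<in> carrier E"
  proof (cases "(i, j) \<in> E_basis N")
    case True then show ?thesis using E_gen_basis[OF True] basis_vec_closed[OF K True] by (simp add: ij)
  next
    case False
    then have ji: "(j, i) \<in> E_basis N" using E_basis_or_swap p ij by blast
    then show ?thesis
      using E_gen_basis[OF ji] basis_vec_closed[OF K ji] E_gen_swap[OF FK_letters_swap[OF p[unfolded ij]]]
      by (simp add: ij)
  qed
qed

lemma E_span: "lin_span K E (e ` E_basis N) = carrier E"
  using free_module_span[OF K, of "E_basis N"] E_gen_basis by (simp cong: image_cong)

lemma E_eqI:
  assumes "module K U" "f \<in> lin_map K E U" "f' \<in> lin_map K E U"
    "\<And>p. p \<in> E_basis N \<Longrightarrow> f (e p) = f' (e p)" "v \<in> carrier E"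
  shows "f v = f' v"
proof (rule lin_map_eq_on_span[OF E_mod assms(1-3)])
  show "v \<in> lin_span K E (e ` E_basis N)" using assms(5) by (simp only: E_span)
  show "e ` E_basis N \<subseteq> carrier E" using E_gen_closed E_basis_letters by blast
qed (use assms(4) in blast)

text \<open>A linear map on \<open>E\<close> is prescribed on the pairs with i < j. Antisymmetry of
  \<open>y\<close> makes it correct on reversed pairs too, so later arguments can use all ordered
  letters without distinguishing cases.\<close>

lemma E_ext:
  assumes U: "module K U" and y: "\<And>p. p \<in> FK_letters N \<Longrightarrow> y p \<in> carrier U"
    and swap: "\<And>i j. (i, j) \<in> FK_letters N \<Longrightarrow> y (j, i) = \<ominus>\<^bsub>U\<^esub> y (i, j)"
  shows "lin_ext K U y \<in> lin_map K E U" and "p \<in> FK_letters N \<Longrightarrow> lin_ext K U y (e p) = y p"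
proof -
  show lin: "lin_ext K U y \<in> lin_map K E U"
    by (rule lin_ext_lin_map[OF U]) (use y E_basis_letters in blast)
  have basis: "lin_ext K U y (e p) = y p" if "p \<in> E_basis N" for p
    unfolding E_gen_basis[OF that] by (rule lin_ext_basis[where \<phi> = y, OF U]) (rule y[OF E_basis_letters[OF that]])
  assume p: "p \<in> FK_letters N"
  obtain i j where ij: "p = (i, j)" by (cases p)
  show "lin_ext K U y (e p) = y p"
  proof (cases "(i, j) \<in> E_basis N")
    case True then show ?thesis using basis[OF True] by (simp add: ij)
  next
    case False
    then have ji: "(j, i) \<in> E_basis N" using E_basis_or_swap p ij by blast
    note l = E_basis_letters[OF ji]
    show ?thesis
      using basis[OF ji] lin_map_uminus[OF E_mod U lin E_gen_closed[OF l]] E_gen_swap[OF l] swap[OF l]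
      by (simp add: ij)
  qed
qed

text \<open>The action is defined by a sum over the whole finite basis, \<open>lin_ext\<close> by a
  sum over the support; the additional terms vanish.\<close>

lemma E_act_eq:
  assumes g: "g \<in> carrier G" and f: "f \<in> carrier E"
  shows "act ES g f = lin_ext K E (\<lambda>p. e (perm_letter g p)) f"
proof -
  have "lin_ext K E (\<lambda>p. e (perm_letter g p)) f =
    (\<Oplus>\<^bsub>E\<^esub>p\<in>E_basis N. f p \<odot>\<^bsub>E\<^esub> e (perm_letter g p))"
    by (rule lin_ext_eq[OF E_mod _ f E_basis_finite])
      (use f E_gen_closed[OF perm_letter_closed[OF g E_basis_letters]] in \<open>auto simp: free_module_carrier[of f]\<close>)
  then show ?thesis by (simp del: free_module_simps)
qed

lemma E_act_ext:
  assumes g: "g \<in> carrier G"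
  shows E_act_lin_map: "act ES g \<in> lin_map K E E"
    and E_act_gen: "p \<in> FK_letters N \<Longrightarrow> act ES g (e p) = e (perm_letter g p)"
proof -
  have y: "e (perm_letter g p) \<in> carrier E" if "p \<in> FK_letters N" for p
    by (rule E_gen_closed[OF perm_letter_closed[OF g that]])
  have swap: "e (perm_letter g (j, i)) = \<ominus>\<^bsub>E\<^esub> e (perm_letter g (i, j))" if "(i, j) \<in> FK_letters N" for i j
    using E_gen_swap perm_letter_closed[OF g that] by simp
  note ext = E_ext[where y = "\<lambda>p. e (perm_letter g p)", OF E_mod y swap]
  show "act ES g \<in> lin_map K E E"
    by (rule lin_map_cong[OF E_mod ext(1)]) (simp_all only: E_act_eq[OF g])
  show "act ES g (e p) = e (perm_letter g p)" if p: "p \<in> FK_letters N"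
    unfolding E_act_eq[OF g E_gen_closed[OF p]] by (rule ext(2)) (use p in simp_all)
qed

definition E_comp :: "(nat \<Rightarrow> nat) \<Rightarrow> (nat \<times> nat \<Rightarrow> 'k) \<Rightarrow> nat \<times> nat \<Rightarrow> 'k"
  where "E_comp g f = (\<lambda>p. if letter_deg p = g then f p else \<zero>\<^bsub>K\<^esub>)"

lemma E_comp_lin_map: "E_comp g \<in> lin_map K E E"
proof (rule lin_mapI)
  fix f assume f: "f \<in> carrier E"
  have "{p. E_comp g f p \<noteq> \<zero>\<^bsub>K\<^esub>} \<subseteq> {p. f p \<noteq> \<zero>\<^bsub>K\<^esub>}" by (auto simp: E_comp_def)
  with f show "E_comp g f \<in> carrier E"
    unfolding free_module_carrier by (auto simp: E_comp_def intro: finite_subset)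
qed (auto simp: E_comp_def free_module_carrier)

lemma E_comp_gen:
  assumes p: "p \<in> FK_letters N"
  shows "E_comp g (e p) = (if letter_deg p = g then e p else \<zero>\<^bsub>E\<^esub>)"
proof -
  have basis: "E_comp g (e p) = (if letter_deg p = g then e p else \<zero>\<^bsub>E\<^esub>)" if "p \<in> E_basis N" for p
    unfolding E_gen_basis[OF that] by (auto simp: E_comp_def basis_vec_def)
  obtain i j where ij: "p = (i, j)" by (cases p)
  show ?thesis
  proof (cases "(i, j) \<in> E_basis N")
    case True then show ?thesis using basis[OF True] by (simp add: ij)
  next
    case False
    then have ji: "(j, i) \<in> E_basis N" using E_basis_or_swap p ij by blast
    note l = E_basis_letters[OF ji]
    show ?thesis
      using basis[OF ji] lin_map_uminus[OF E_mod E_mod E_comp_lin_map E_gen_closed[OF l]] E_gen_swap[OF l]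
        letter_deg_swap[of j i]
      by (simp add: ij del: free_module_simps)
  qed
qed

text \<open>The grading of \<open>E_space\<close> is defined by spans. As the fixed points of
  projections it fits the framework for crossed modules used for the algebra as well.\<close>

lemma E_grade:
  "grade ES g = {v \<in> carrier ES. E_comp g v = v}"
proof -
  let ?S = "{E_gen K N i j | i j. (i, j) \<in> E_basis N \<and> Transposition.transpose i j = g}"
  have S: "?S = e ` {p \<in> E_basis N. letter_deg p = g}" by (force simp: letter_deg_def)
  have sub: "?S \<subseteq> carrier E" unfolding S using E_gen_closed E_basis_letters by blast
  have "lin_span K E ?S = {v \<in> carrier E. E_comp g v = v}"
  proof
    show "lin_span K E ?S \<subseteq> {v \<in> carrier E. E_comp g v = v}"
    proof (rule lin_span_minimal[OF submodule_equalizer[OF E_mod E_mod E_comp_lin_map lin_map_id]])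
      show "?S \<subseteq> {v \<in> carrier E. E_comp g v = v}"
        unfolding S using E_comp_gen[OF E_basis_letters] E_gen_closed[OF E_basis_letters] by auto
    qed
    show "{v \<in> carrier E. E_comp g v = v} \<subseteq> lin_span K E ?S"
    proof
      fix v assume v: "v \<in> {v \<in> carrier E. E_comp g v = v}"
      have "E_comp g v \<in> lin_span K E ?S"
      proof (rule lin_span_map[OF E_mod E_mod E_comp_lin_map lin_span_submodule[OF E_mod sub]])
        show "v \<in> lin_span K E (e ` E_basis N)" using v by (simp only: E_span mem_Collect_eq)
        show "e ` E_basis N \<subseteq> carrier E" using E_gen_closed E_basis_letters by blast
        fix w assume "w \<in> e ` E_basis N"
        then obtain p where p: "p \<in> E_basis N" "w = e p" by blast
        show "E_comp g w \<in> lin_span K E ?S"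
          unfolding p(2) E_comp_gen[OF E_basis_letters[OF p(1)]]
          using submodule_zero[OF lin_span_submodule[OF E_mod sub]] p(1)
          by (auto simp: S simp del: free_module_simps intro!: lin_span_base)
      qed
      with v show "v \<in> lin_span K E ?S" by simp
    qed
  qed
  then show ?thesis by simp
qed

lemma E_comp_comp: "E_comp g (E_comp h v) = (if g = h then E_comp g v else \<zero>\<^bsub>ES\<^esub>)"
  by (auto simp: E_comp_def)

text \<open>Sums in the two records are different terms although the operations agree. The identity
  is a linear map between the records, so \<open>lin_map_finsum\<close> identifies the
  values.\<close>

lemma ES_finsum:
  assumes "finite I" "f \<in> I \<rightarrow> carrier E" shows "(\<Oplus>\<^bsub>ES\<^esub>i\<in>I. f i) = (\<Oplus>\<^bsub>E\<^esub>i\<in>I. f i)"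
  using lin_map_finsum[OF E_mod ES_mod _ assms, of "\<lambda>x. x"] by (simp add: lin_map_id)

lemma E_comp_sum:
  assumes v: "v \<in> carrier E" shows "(\<Oplus>\<^bsub>ES\<^esub>g\<in>carrier G. E_comp g v) = v"
proof -
  have "(\<Oplus>\<^bsub>E\<^esub>g\<in>carrier G. E_comp g v) = v"
  proof (rule E_eqI[OF E_mod lin_map_sum[OF E_mod E_mod sym_group_finite E_comp_lin_map] lin_map_id _ v])
    fix p assume "p \<in> E_basis N"
    then have p: "p \<in> FK_letters N" by (rule E_basis_letters)
    have "(\<Oplus>\<^bsub>E\<^esub>g\<in>carrier G. E_comp g (e p)) = (\<Oplus>\<^bsub>E\<^esub>g\<in>carrier G. if letter_deg p = g then e p else \<zero>\<^bsub>E\<^esub>)"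
      using E_gen_closed[OF p] by (intro E.M.finsum_cong') (auto simp: E_comp_gen[OF p] simp del: free_module_simps)
    also have "\<dots> = e p"
      by (rule E.M.finsum_singleton[OF letter_deg_closed[OF p] sym_group_finite]) (use E_gen_closed[OF p] in blast)
    finally show "(\<Oplus>\<^bsub>E\<^esub>g\<in>carrier G. E_comp g (e p)) = e p" .
  qed
  then show ?thesis
    using ES_finsum[OF sym_group_finite, of "\<lambda>g. E_comp g v"] lin_map_closed[OF E_comp_lin_map v] by simp
qed

lemma E_act_id: "v \<in> carrier E \<Longrightarrow> act ES id v = v"
  by (rule E_eqI[OF E_mod E_act_lin_map[OF id_in_sym] lin_map_id])
    (simp_all only: E_act_gen[OF id_in_sym E_basis_letters] id_apply fst_conv snd_conv)

lemma E_act_comp: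
  assumes g: "g \<in> carrier G" and h: "h \<in> carrier G" and v: "v \<in> carrier E"
  shows "act ES (g \<circ> h) v = act ES g (act ES h v)"
  by (rule E_eqI[OF E_mod E_act_lin_map[OF comp_closed[OF g h]] lin_map_comp[OF E_act_lin_map[OF h] E_act_lin_map[OF g]] _ v])
    (simp only: E_act_gen[OF comp_closed[OF g h] E_basis_letters] E_act_gen[OF h E_basis_letters]
      E_act_gen[OF g perm_letter_closed[OF h E_basis_letters]] o_apply fst_conv snd_conv,
     use E_act_gen[OF g perm_letter_closed[OF h E_basis_letters]] in \<open>simp del: E_space_simps\<close>)

lemma E_act_proj:
  assumes h: "h \<in> carrier G" and v: "v \<in> carrier E"
  shows "act ES h (E_comp g v) = E_comp (h \<circ> g \<circ> inv' h) (act ES h v)"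
proof (rule E_eqI[OF E_mod lin_map_comp[OF E_comp_lin_map E_act_lin_map[OF h]]
      lin_map_comp[OF E_act_lin_map[OF h] E_comp_lin_map] _ v])
  fix p assume "p \<in> E_basis N"
  then have p: "p \<in> FK_letters N" by (rule E_basis_letters)
  have hi: "inv' h \<circ> h = id" "h \<circ> inv' h = id" using h by (simp_all add: sym_group_carrier permutes_inv_o)
  note hp = letter_deg_perm[OF h, of p]
  \<comment> \<open>The two sides agree on a generator because conjugation by \<open>h\<close> is
    injective and takes the degree of a letter to the degree of the moved letter.\<close>
  have "letter_deg (perm_letter h p) = h \<circ> letter_deg p \<circ> inv' h"
    unfolding hp[symmetric] by (simp add: hi flip: o_assoc)
  moreover have "x = y" if "h \<circ> x \<circ> inv' h = h \<circ> y \<circ> inv' h" for x y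
  proof -
    have "inv' h \<circ> (h \<circ> x \<circ> inv' h) \<circ> h = inv' h \<circ> (h \<circ> y \<circ> inv' h) \<circ> h" by (simp only: that)
    moreover have "inv' h \<circ> (h \<circ> z \<circ> inv' h) \<circ> h = z" for z :: "nat \<Rightarrow> nat"
    proof -
      have "inv' h \<circ> (h \<circ> z \<circ> inv' h) \<circ> h = (inv' h \<circ> h) \<circ> z \<circ> (inv' h \<circ> h)" by (simp only: o_assoc)
      then show ?thesis by (simp only: hi id_comp comp_id)
    qed
    ultimately show ?thesis by simp
  qed
  ultimately have deg: "letter_deg (perm_letter h p) = h \<circ> g \<circ> inv' h \<longleftrightarrow> letter_deg p = g" by auto
  show "act ES h (E_comp g (e p)) = E_comp (h \<circ> g \<circ> inv' h) (act ES h (e p))"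
    unfolding E_act_gen[OF h p] E_comp_gen[OF perm_letter_closed[OF h p]] E_comp_gen[OF p] deg
    using lin_map_zero[OF E_mod E_mod E_act_lin_map[OF h]] E_act_gen[OF h p] by (simp del: free_module_simps E_space_simps)
qed

lemmas E_proj_facts = ES_mod sym_group_is_group[of N] sym_group_finite[of N]

lemma E_crossed_module: "crossed_module K G ES"
proof (rule crossed_moduleI[OF E_proj_facts, of E_comp])
  fix g v assume "v \<in> carrier ES"
  then show "(\<Oplus>\<^bsub>ES\<^esub>g\<in>carrier G. E_comp g v) = v" using E_comp_sum by simp
next
  fix g assume "g \<in> carrier G" then show "act ES g \<in> lin_map K ES ES" using E_act_lin_map by simp
next
  fix v assume "v \<in> carrier ES" then show "act ES \<one>\<^bsub>G\<^esub> v = v"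
    unfolding sym_group_one using E_act_id by (simp del: E_space_simps(5))
next
  fix g h v assume "g \<in> carrier G" "h \<in> carrier G" "v \<in> carrier ES"
  then show "act ES (g \<otimes>\<^bsub>G\<^esub> h) v = act ES g (act ES h v)"
    unfolding sym_group_mult using E_act_comp by (simp del: E_space_simps(5))
next
  fix g h v assume h: "h \<in> carrier G" and v: "v \<in> carrier ES"
  then show "act ES h (E_comp g v) = E_comp (h \<otimes>\<^bsub>G\<^esub> g \<otimes>\<^bsub>G\<^esub> inv\<^bsub>G\<^esub> h) (act ES h v)"
    unfolding sym_group_mult sym_group_inv[OF h] using E_act_proj[OF h] by (simp del: E_space_simps(5))
qed (simp_all add: E_comp_lin_map E_grade E_comp_comp del: E_space_simps(2,6))

lemma E_uminus: "v \<in> carrier E \<Longrightarrow> \<ominus>\<^bsub>E\<^esub> v = \<ominus>\<^bsub>ES\<^esub> v"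
  using lin_map_uminus[OF E_mod ES_mod, of "\<lambda>x. x"] by (simp add: lin_map_id)

subsection \<open>The braiding on \<open>E\<^sub>N \<otimes> E\<^sub>N\<close>\<close>

abbreviation (input) "EE \<equiv> tensor K (E_space K N) (E_space K N)"
abbreviation (input) "PE \<equiv> pure K (E_space K N) (E_space K N)"
abbreviation (input) "\<Psi> \<equiv> braiding K (sym_group N) (E_space K N) (E_space K N)"

lemma EE_mod: "module K EE"
  by (rule tensor_module[OF ES_mod ES_mod])

interpretation EE: module K EE by (rule EE_mod)

lemma PE_bilin: "bilin K E E EE PE"
  using pure_bilin[OF ES_mod ES_mod] by (simp add: bilin_def)

lemmas PE_closed = bilin_closed[OF PE_bilin E_gen_closed E_gen_closed]

lemma PE_swap:
  assumes "(i, j) \<in> FK_letters N" "v \<in> carrier E"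
  shows "PE (E_gen K N j i) v = \<ominus>\<^bsub>EE\<^esub> PE (E_gen K N i j) v"
    and "PE v (E_gen K N j i) = \<ominus>\<^bsub>EE\<^esub> PE v (E_gen K N i j)"
  unfolding E_gen_swap[OF assms(1)]
  using lin_map_uminus[OF E_mod EE_mod bilin_left[OF PE_bilin assms(2)] E_gen_closed[OF assms(1)]]
    lin_map_uminus[OF E_mod EE_mod bilin_right[OF PE_bilin assms(2)] E_gen_closed[OF assms(1)]] by simp_all

lemma \<Psi>_facts:
  shows \<Psi>_lin_map: "\<Psi> \<in> lin_map K EE EE"
    and \<Psi>_homogeneous: "\<lbrakk>g \<in> carrier G; v \<in> grade ES g; w \<in> carrier E\<rbrakk> \<Longrightarrow> \<Psi> (PE v w) = PE (act ES g w) v"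
proof -
  have P_sum: "(\<Oplus>\<^bsub>ES\<^esub>g\<in>carrier G. E_comp g v) = v" if "v \<in> carrier ES" for v using that E_comp_sum by simp
  have act: "act ES g \<in> lin_map K ES ES" if "g \<in> carrier G" for g using E_act_lin_map[OF that] by simp
  have P: "E_comp g \<in> lin_map K ES ES" for g using E_comp_lin_map by simp
  show "\<Psi> \<in> lin_map K EE EE"
    by (rule braiding_lin_map[OF E_proj_facts P E_grade E_comp_comp P_sum ES_mod act])
  show "\<Psi> (PE v w) = PE (act ES g w) v" if "g \<in> carrier G" "v \<in> grade ES g" "w \<in> carrier E"
    using braiding_homogeneous[OF E_proj_facts P E_grade E_comp_comp P_sum ES_mod act that(1,2)] that(3)
    by (simp del: E_space_simps(5))
qed

lemma \<Psi>_pair: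
  assumes p: "(i, j) \<in> FK_letters N" and q: "(k, m) \<in> FK_letters N"
  shows "\<Psi> (PE (E_gen K N i j) (E_gen K N k m)) =
    PE (E_gen K N (letter_deg (i, j) k) (letter_deg (i, j) m)) (E_gen K N i j)"
proof -
  have "e (i, j) \<in> grade ES (letter_deg (i, j))"
    using E_gen_closed[OF p] E_comp_gen[OF p, of "letter_deg (i, j)"] by (simp add: E_grade del: E_space_simps(6))
  from \<Psi>_homogeneous[OF letter_deg_closed[OF p] this E_gen_closed[OF q]]
  show ?thesis unfolding E_act_gen[OF letter_deg_closed[OF p] q] unfolding fst_conv snd_conv .
qed

end

section \<open>The Fomin--Kirillov algebra as a quotient of the tensor algebra\<close>

context FK_base
begin

interpretation K: cring K by (rule K)

interpretation A: assoc_algebra K A by (rule FK_assoc_algebra)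

interpretation E: module K E by (rule E_mod)

interpretation EE: module K EE by (rule EE_mod)

abbreviation (input) "FE \<equiv> free_algebra K (carrier (E_space K N))"
abbreviation (input) "TE \<equiv> tensor_algebra K (E_space K N)"
abbreviation (input) "lin_ideal \<equiv> Idl\<^bsub>free_algebra K (carrier (E_space K N))\<^esub> (linearity_rels K (E_space K N))"
abbreviation (input) "\<iota> \<equiv> tensor_algebra_incl K (E_space K N)"
abbreviation (input) "\<iota>2 \<equiv> tensor_algebra_incl2 K (E_space K N)"
abbreviation (input) "Ker \<equiv> a_kernel (tensor K (E_space K N) (E_space K N)) (tensor K (E_space K N) (E_space K N))
  (\<lambda>t. t \<oplus>\<^bsub>tensor K (E_space K N) (E_space K N)\<^esub> braiding K (sym_group N) (E_space K N) (E_space K N) t)"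
abbreviation (input) "J \<equiv> braided_ideal K (sym_group N) (E_space K N)"
abbreviation (input) "Q \<equiv> quot (tensor_algebra K (E_space K N)) (braided_ideal K (sym_group N) (E_space K N))"

interpretation FE: assoc_algebra K FE by (rule free_algebra_assoc_algebra[OF K])

lemma vector_word_closed: "v \<in> carrier E \<Longrightarrow> basis_vec K [v] \<in> carrier FE"
  by (rule basis_word_closed[OF K]) simp

lemma linearity_rels_cases:
  assumes "r \<in> linearity_rels K ES"
  obtains (add) v w where "v \<in> carrier E" "w \<in> carrier E"
      "r = basis_vec K [v \<oplus>\<^bsub>E\<^esub> w] \<ominus>\<^bsub>FE\<^esub> (basis_vec K [v] \<oplus>\<^bsub>FE\<^esub> basis_vec K [w])"
  | (smult) a v where "a \<in> carrier K" "v \<in> carrier E"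
      "r = basis_vec K [a \<odot>\<^bsub>E\<^esub> v] \<ominus>\<^bsub>FE\<^esub> a \<odot>\<^bsub>FE\<^esub> basis_vec K [v]"
  using assms unfolding linearity_rels_def Let_def
  by (elim UnE CollectE exE conjE) (auto simp del: free_module_simps intro: that)

lemma linearity_rels_subset: "linearity_rels K ES \<subseteq> carrier FE"
proof
  fix r assume "r \<in> linearity_rels K ES"
  then show "r \<in> carrier FE"
  proof (cases rule: linearity_rels_cases)
    case (add v w)
    then show ?thesis
      by (simp only:) (intro FE.M.minus_closed FE.M.a_closed vector_word_closed E.M.a_closed; assumption)
  next
    case (smult a v)
    then show ?thesis
      by (simp only:) (intro FE.M.minus_closed FE.smult_closed vector_word_closed E.smult_closed; assumption)
  qed
qed

lemmas lin_ideal_ideal = FE.genideal_ideal[OF linearity_rels_subset]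

lemmas FE_sub = assoc_algebra_module[OF FE.assoc_algebra] ideal_submodule[OF FE.assoc_algebra lin_ideal_ideal]

lemma TE_eq: "TE = quot FE lin_ideal"
  by (simp add: tensor_algebra_def Let_def)

lemma incl_eq: "\<iota> v = lin_ideal +>\<^bsub>FE\<^esub> basis_vec K [v]"
  by (simp add: tensor_algebra_incl_def Let_def)

lemma TE_alg: "assoc_algebra K TE"
  unfolding TE_eq by (rule quot_assoc_algebra[OF FE.assoc_algebra lin_ideal_ideal])

interpretation TE: assoc_algebra K TE by (rule TE_alg)

lemmas TE_mod = assoc_algebra_module[OF TE_alg]

lemma incl_lin_map: "\<iota> \<in> lin_map K E TE"
proof (rule lin_mapI)
  note cs = coset_closed[OF FE_sub] coset_add[OF FE_sub] coset_smult[OF FE_sub] coset_eq_iff[OF FE_sub]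
  note vw = vector_word_closed
  have rel: "r \<in> lin_ideal" if "r \<in> linearity_rels K ES" for r
    using FE.genideal_self[OF linearity_rels_subset] that by blast
  fix v assume v: "v \<in> carrier E"
  show "\<iota> v \<in> carrier TE" unfolding TE_eq incl_eq by (rule cs(1)[OF vw[OF v]])
  show "\<iota> (v \<oplus>\<^bsub>E\<^esub> w) = \<iota> v \<oplus>\<^bsub>TE\<^esub> \<iota> w" if w: "w \<in> carrier E" for w
  proof -
    have "basis_vec K [v \<oplus>\<^bsub>E\<^esub> w] \<ominus>\<^bsub>FE\<^esub> (basis_vec K [v] \<oplus>\<^bsub>FE\<^esub> basis_vec K [w]) \<in> linearity_rels K ES"
      using v w unfolding linearity_rels_def Let_def E_space_simps by blast
    from rel[OF this] show ?thesis
      unfolding TE_eq incl_eq cs(2)[OF vw[OF v] vw[OF w]]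
      by (subst cs(4)[OF vw[OF E.M.a_closed[OF v w]] FE.M.a_closed[OF vw[OF v] vw[OF w]]])
  qed
  show "\<iota> (a \<odot>\<^bsub>E\<^esub> v) = a \<odot>\<^bsub>TE\<^esub> \<iota> v" if a: "a \<in> carrier K" for a
  proof -
    have "basis_vec K [a \<odot>\<^bsub>E\<^esub> v] \<ominus>\<^bsub>FE\<^esub> a \<odot>\<^bsub>FE\<^esub> basis_vec K [v] \<in> linearity_rels K ES"
      using v a unfolding linearity_rels_def Let_def E_space_simps by blast
    from rel[OF this] show ?thesis
      unfolding TE_eq incl_eq cs(3)[OF a vw[OF v]]
      by (subst cs(4)[OF vw[OF E.smult_closed[OF a v]] FE.smult_closed[OF a vw[OF v]]])
  qed
qed

lemmas incl_closed = lin_map_closed[OF incl_lin_map]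

lemma incl2_bilin: "bilin K ES ES TE (\<lambda>v w. \<iota> v \<otimes>\<^bsub>TE\<^esub> \<iota> w)"
  using bilin_comp[OF mult_bilin[OF TE_alg] incl_lin_map incl_lin_map] by (simp add: bilin_def)

lemma incl2_lin_map: "\<iota>2 \<in> lin_map K EE TE"
  unfolding tensor_algebra_incl2_def by (rule tensor_lift_lin_map[OF ES_mod ES_mod TE_mod incl2_bilin])

lemma incl2_pure: "\<lbrakk>v \<in> carrier E; w \<in> carrier E\<rbrakk> \<Longrightarrow> \<iota>2 (PE v w) = \<iota> v \<otimes>\<^bsub>TE\<^esub> \<iota> w"
  unfolding tensor_algebra_incl2_def by (rule tensor_lift_pure[OF ES_mod ES_mod TE_mod incl2_bilin]) simp_all

lemma Ker_iff: "t \<in> Ker \<longleftrightarrow> t \<in> carrier EE \<and> t \<oplus>\<^bsub>EE\<^esub> \<Psi> t = \<zero>\<^bsub>EE\<^esub>"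
  by (simp add: a_kernel_def kernel_def)

lemma J_eq: "J = Idl\<^bsub>TE\<^esub> (\<iota>2 ` Ker)"
  by (simp add: braided_ideal_def Let_def)

lemma incl2_Ker_subset: "\<iota>2 ` Ker \<subseteq> carrier TE"
  using lin_map_closed[OF incl2_lin_map] Ker_iff by blast

lemma J_ideal: "ideal J TE"
  unfolding J_eq by (rule TE.genideal_ideal[OF incl2_Ker_subset])

lemmas TE_sub = TE_mod ideal_submodule[OF TE_alg J_ideal]

lemma Q_alg: "assoc_algebra K Q"
  by (rule quot_assoc_algebra[OF TE_alg J_ideal])

interpretation Q: assoc_algebra K Q by (rule Q_alg)

lemmas Q_mod = assoc_algebra_module[OF Q_alg]

lemma quad_lin_map: "(\<lambda>t. J +>\<^bsub>TE\<^esub> \<iota>2 t) \<in> lin_map K EE Q"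
  by (rule lin_map_comp[OF incl2_lin_map coset_lin_map[OF TE_sub]])

lemma quad_Ker: "t \<in> Ker \<Longrightarrow> J +>\<^bsub>TE\<^esub> \<iota>2 t = \<zero>\<^bsub>Q\<^esub>"
  unfolding J_eq by (rule genideal_coset_zero[OF TE_alg incl2_Ker_subset]) blast

abbreviation (input) "Qgen p \<equiv> J +>\<^bsub>TE\<^esub> \<iota> (e p)"

lemma Qgen_closed: "p \<in> FK_letters N \<Longrightarrow> Qgen p \<in> carrier Q"
  by (rule coset_closed[OF TE_sub incl_closed[OF E_gen_closed]])

lemma Qgen_mult:
  assumes p: "p \<in> FK_letters N" and q: "q \<in> FK_letters N"
  shows "Qgen p \<otimes>\<^bsub>Q\<^esub> Qgen q = J +>\<^bsub>TE\<^esub> \<iota>2 (PE (e p) (e q))"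
  unfolding coset_mult[OF J_ideal incl_closed[OF E_gen_closed[OF p]] incl_closed[OF E_gen_closed[OF q]]]
    incl2_pure[OF E_gen_closed[OF p] E_gen_closed[OF q]] ..

text \<open>Antisymmetry already holds in \<open>E\<close>. Each quadratic relation is the sum over
  one orbit of -\<Psi>, of length 1 for squares, 2 for commutators and 3 for triples; such a sum is
  fixed by -\<Psi> and hence lies in the kernel that is divided out.\<close>

lemma FK_elems_Qgen: "FK_elems K N Q (\<lambda>p. Qgen p)"
proof (rule FK_elemsI)
  fix p assume "p \<in> FK_letters N" then show "Qgen p \<in> carrier Q" by (rule Qgen_closed)
next
  note add = lin_map_add[OF quad_lin_map, symmetric]
  fix i j assume ij: "(i, j) \<in> FK_letters N"
  note ji = FK_letters_swap[OF ij]
  have "\<iota> (E_gen K N j i) = \<ominus>\<^bsub>TE\<^esub> \<iota> (E_gen K N i j)"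
    unfolding E_gen_swap[OF ij] using lin_map_uminus[OF E_mod TE_mod incl_lin_map E_gen_closed[OF ij]] by simp
  then have "Qgen (j, i) = \<ominus>\<^bsub>Q\<^esub> Qgen (i, j)"
    using lin_map_uminus[OF TE_mod Q_mod coset_lin_map[OF TE_sub] incl_closed[OF E_gen_closed[OF ij]]] by simp
  then show "Qgen (i, j) \<oplus>\<^bsub>Q\<^esub> Qgen (j, i) = \<zero>\<^bsub>Q\<^esub>" using Qgen_closed[OF ij] by (simp add: Q.M.r_neg)
  have "\<Psi> (PE (e (i, j)) (e (i, j))) = \<ominus>\<^bsub>EE\<^esub> PE (e (i, j)) (e (i, j))"
    unfolding \<Psi>_pair[OF ij ij] fst_conv snd_conv letter_deg_apply
    by (rule PE_swap(1)[OF ij]) (use E_gen_closed[OF ij] in simp)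
  then have "PE (e (i, j)) (e (i, j)) \<in> Ker"
    using PE_closed[OF ij ij] by (simp add: Ker_iff EE.M.r_neg)
  then show "Qgen (i, j) \<otimes>\<^bsub>Q\<^esub> Qgen (i, j) = \<zero>\<^bsub>Q\<^esub>"
    unfolding Qgen_mult[OF ij ij] by (rule quad_Ker)
next
  fix i j k m assume ijkm: "{i, j, k, m} \<subseteq> {1..N}" "distinct [i, j, k, m]"
  have l: "(i, j) \<in> FK_letters N" "(k, m) \<in> FK_letters N" using FK_letters_of4 ijkm by blast+
  have la: "letter_deg (i, j) k = k" "letter_deg (i, j) m = m" "letter_deg (k, m) i = i" "letter_deg (k, m) j = j"
    using ijkm(2) by (auto simp: letter_deg_apply)
  let ?a = "PE (e (i, j)) (e (k, m))" and ?b = "PE (e (k, m)) (e (i, j))"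
  have ab: "?a \<in> carrier EE" "?b \<in> carrier EE" using PE_closed l by blast+
  have "\<Psi> ?a = ?b" "\<Psi> ?b = ?a"
    unfolding \<Psi>_pair[OF l] \<Psi>_pair[OF l(2,1)] fst_conv snd_conv la by (rule refl)+
  then have "\<Psi> (?a \<ominus>\<^bsub>EE\<^esub> ?b) = ?b \<ominus>\<^bsub>EE\<^esub> ?a" using lin_map_minus[OF EE_mod EE_mod \<Psi>_lin_map ab] by simp
  moreover have "(?a \<ominus>\<^bsub>EE\<^esub> ?b) \<oplus>\<^bsub>EE\<^esub> (?b \<ominus>\<^bsub>EE\<^esub> ?a) = \<zero>\<^bsub>EE\<^esub>"
    using ab EE.M.cancel_pairs[of ?a "\<ominus>\<^bsub>EE\<^esub> ?b"] by (simp add: a_minus_def EE.M.minus_minus EE.M.a_comm)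
  ultimately have "?a \<ominus>\<^bsub>EE\<^esub> ?b \<in> Ker" using ab by (simp only: Ker_iff EE.M.minus_closed)
  then have "(J +>\<^bsub>TE\<^esub> \<iota>2 ?a) \<ominus>\<^bsub>Q\<^esub> (J +>\<^bsub>TE\<^esub> \<iota>2 ?b) = \<zero>\<^bsub>Q\<^esub>"
    using quad_Ker lin_map_minus[OF EE_mod Q_mod quad_lin_map ab] by simp
  then show "Qgen (i, j) \<otimes>\<^bsub>Q\<^esub> Qgen (k, m) = Qgen (k, m) \<otimes>\<^bsub>Q\<^esub> Qgen (i, j)"
    unfolding Qgen_mult[OF l] Qgen_mult[OF l(2,1)]
    using Q.M.minus_eq_zero_iff lin_map_closed[OF quad_lin_map] ab by blast
next
  fix i j k assume ijk: "{i, j, k} \<subseteq> {1..N}" "distinct [i, j, k]"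
  have l: "(i, j) \<in> FK_letters N" "(j, k) \<in> FK_letters N" "(k, i) \<in> FK_letters N"
    using FK_letters_of ijk by blast+
  have la: "letter_deg (i, j) j = i" "letter_deg (i, j) k = k" "letter_deg (j, k) k = j"
    "letter_deg (j, k) i = i" "letter_deg (k, i) i = k" "letter_deg (k, i) j = j"
    using ijk(2) by (auto simp: letter_deg_apply)
  let ?a = "PE (e (i, j)) (e (j, k))" and ?b = "PE (e (j, k)) (e (k, i))" and ?c = "PE (e (k, i)) (e (i, j))"
  have abc: "?a \<in> carrier EE" "?b \<in> carrier EE" "?c \<in> carrier EE" using PE_closed l by blast+
  \<comment> \<open>So -\<Psi> permutes the three tensors cyclically, \<open>?a\<close> to
    \<open>?c\<close> to \<open>?b\<close> and back to \<open>?a\<close>. The sign comes from the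
    letter that the braiding reverses.\<close>
  have psi: "\<Psi> ?a = \<ominus>\<^bsub>EE\<^esub> ?c" "\<Psi> ?b = \<ominus>\<^bsub>EE\<^esub> ?a" "\<Psi> ?c = \<ominus>\<^bsub>EE\<^esub> ?b"
    unfolding \<Psi>_pair[OF l(1,2)] \<Psi>_pair[OF l(2,3)] \<Psi>_pair[OF l(3,1)] fst_conv snd_conv la
    using PE_swap(1)[OF l(3) E_gen_closed[OF l(1)]] PE_swap(1)[OF l(1) E_gen_closed[OF l(2)]]
      PE_swap(1)[OF l(2) E_gen_closed[OF l(3)]] by simp_all
  have "\<Psi> (?a \<oplus>\<^bsub>EE\<^esub> ?b \<oplus>\<^bsub>EE\<^esub> ?c) = \<ominus>\<^bsub>EE\<^esub> ?c \<oplus>\<^bsub>EE\<^esub> \<ominus>\<^bsub>EE\<^esub> ?a \<oplus>\<^bsub>EE\<^esub> \<ominus>\<^bsub>EE\<^esub> ?b"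
    using abc by (simp only: lin_map_add[OF \<Psi>_lin_map] EE.M.a_closed psi)
  also have "\<dots> = \<ominus>\<^bsub>EE\<^esub> (?a \<oplus>\<^bsub>EE\<^esub> ?b \<oplus>\<^bsub>EE\<^esub> ?c)"
    using abc by (simp only: EE.M.minus_add EE.M.a_ac EE.M.a_closed EE.M.a_inv_closed)
  finally have "?a \<oplus>\<^bsub>EE\<^esub> ?b \<oplus>\<^bsub>EE\<^esub> ?c \<in> Ker" using abc by (simp only: Ker_iff EE.M.a_closed EE.M.r_neg)
  from quad_Ker[OF this]
  show "Qgen (i, j) \<otimes>\<^bsub>Q\<^esub> Qgen (j, k) \<oplus>\<^bsub>Q\<^esub> Qgen (j, k) \<otimes>\<^bsub>Q\<^esub> Qgen (k, i) \<oplus>\<^bsub>Q\<^esub> Qgen (k, i) \<otimes>\<^bsub>Q\<^esub> Qgen (i, j) = \<zero>\<^bsub>Q\<^esub>"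
    unfolding Qgen_mult[OF l(1,2)] Qgen_mult[OF l(2,3)] Qgen_mult[OF l(3,1)]
    using abc by (simp only: lin_map_add[OF quad_lin_map] EE.M.a_closed)
qed

definition "FK_to_Q = word_rec K Q (\<lambda>p b. Qgen p \<otimes>\<^bsub>Q\<^esub> b) \<one>\<^bsub>Q\<^esub>"

lemma FK_to_Q_alg_hom: "FK_to_Q \<in> alg_hom K A Q"
  unfolding FK_to_Q_def by (rule FK_rec_alg_hom[OF Q_alg FK_elems_Qgen])

lemma FK_to_Q_gen: "p \<in> FK_letters N \<Longrightarrow> FK_to_Q (X p) = Qgen p"
  unfolding FK_to_Q_def by (rule FK_rec_gen[OF Q_alg FK_elems_Qgen])

subsection \<open>The inverse map\<close>

definition "E_to_A = lin_ext K A X"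

lemma E_to_A_facts:
  shows E_to_A_lin_map: "E_to_A \<in> lin_map K E A"
    and E_to_A_gen: "p \<in> FK_letters N \<Longrightarrow> E_to_A (e p) = X p"
proof -
  have swap: "X (j, i) = \<ominus>\<^bsub>A\<^esub> X (i, j)" if "(i, j) \<in> FK_letters N" for i j
    using gen_swap[OF that] by simp
  note ext = E_ext[where y = X, OF A_mod gen_closed swap]
  show "E_to_A \<in> lin_map K E A" unfolding E_to_A_def by (rule ext(1))
  show "p \<in> FK_letters N \<Longrightarrow> E_to_A (e p) = X p" unfolding E_to_A_def by (rule ext(2))
qed

lemmas E_to_A_closed = lin_map_closed[OF E_to_A_lin_map]

abbreviation (input) "\<theta>A \<equiv> (\<lambda>v b. E_to_A v \<otimes>\<^bsub>A\<^esub> b)"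

lemma \<theta>A_lin_map: "v \<in> carrier ES \<Longrightarrow> \<theta>A v \<in> lin_map K A A"
  by (rule mult_left_lin_map[OF FK_assoc_algebra E_to_A_closed]) simp

lemma \<theta>A_rels:
  assumes r: "r \<in> linearity_rels K ES" and b: "b \<in> carrier A"
  shows "word_act K A \<theta>A b r = \<zero>\<^bsub>A\<^esub>"
proof -
  have lin: "word_act K A \<theta>A b \<in> lin_map K FE A"
    by (rule word_act_lin_map[OF A_mod \<theta>A_lin_map b])
  have basis: "word_act K A \<theta>A b (basis_vec K [v]) = E_to_A v \<otimes>\<^bsub>A\<^esub> b" if "v \<in> carrier E" for v
    using word_act_basis[OF A_mod \<theta>A_lin_map b, where w = "[v]"] that by simp
  note FE_mod = assoc_algebra_module[OF FE.assoc_algebra]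
  from r show ?thesis
  proof (cases rule: linearity_rels_cases)
    case (add v w)
    note vw = vector_word_closed[OF add(1)] vector_word_closed[OF add(2)] vector_word_closed[OF E.M.a_closed[OF add(1,2)]]
    have "word_act K A \<theta>A b r = word_act K A \<theta>A b (basis_vec K [v \<oplus>\<^bsub>E\<^esub> w]) \<ominus>\<^bsub>A\<^esub>
      (word_act K A \<theta>A b (basis_vec K [v]) \<oplus>\<^bsub>A\<^esub> word_act K A \<theta>A b (basis_vec K [w]))"
      using lin_map_minus[OF FE_mod A_mod lin vw(3) FE.M.a_closed[OF vw(1,2)]] lin_map_add[OF lin vw(1,2)]
      unfolding add(3) by (simp only:)
    also have "\<dots> = \<zero>\<^bsub>A\<^esub>"
      unfolding basis[OF add(1)] basis[OF add(2)] basis[OF E.M.a_closed[OF add(1,2)]]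
        lin_map_add[OF E_to_A_lin_map add(1,2)]
      using E_to_A_closed[OF add(1)] E_to_A_closed[OF add(2)] b
      by (simp add: A.l_distr A.M.minus_eq_zero_iff)
    finally show ?thesis .
  next
    case (smult a v)
    note vw = vector_word_closed[OF smult(2)] vector_word_closed[OF E.smult_closed[OF smult(1,2)]]
    have "word_act K A \<theta>A b r = word_act K A \<theta>A b (basis_vec K [a \<odot>\<^bsub>E\<^esub> v]) \<ominus>\<^bsub>A\<^esub>
      a \<odot>\<^bsub>A\<^esub> word_act K A \<theta>A b (basis_vec K [v])"
      using lin_map_minus[OF FE_mod A_mod lin vw(2) FE.smult_closed[OF smult(1) vw(1)]] lin_map_smult[OF lin smult(1) vw(1)]
      unfolding smult(3) by (simp only:)
    also have "\<dots> = \<zero>\<^bsub>A\<^esub>"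
      unfolding basis[OF smult(2)] basis[OF E.smult_closed[OF smult(1,2)]] lin_map_smult[OF E_to_A_lin_map smult(1,2)]
      using E_to_A_closed[OF smult(2)] b smult(1)
      by (simp add: A.smult_mult_left A.M.minus_eq_zero_iff)
    finally show ?thesis .
  qed
qed

definition "TE_to_A = word_rec K A \<theta>A \<one>\<^bsub>A\<^esub>"

lemma TE_to_A_lin_map: "TE_to_A \<in> lin_map K TE A"
  unfolding TE_to_A_def TE_eq
  by (rule word_rec_lin_map[OF A_mod \<theta>A_lin_map linearity_rels_subset \<theta>A_rels A.one_closed])

lemma TE_to_A_one: "TE_to_A \<one>\<^bsub>TE\<^esub> = \<one>\<^bsub>A\<^esub>"
  unfolding TE_to_A_def TE_eq
  by (rule word_rec_one[OF A_mod \<theta>A_lin_map linearity_rels_subset \<theta>A_rels A.one_closed])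

lemma TE_to_A_mult_incl:
  assumes "v \<in> carrier E" "x \<in> carrier TE"
  shows "TE_to_A (\<iota> v \<otimes>\<^bsub>TE\<^esub> x) = E_to_A v \<otimes>\<^bsub>A\<^esub> TE_to_A x"
  using assms unfolding TE_to_A_def TE_eq incl_eq
  by (intro word_rec_mult[OF A_mod \<theta>A_lin_map linearity_rels_subset \<theta>A_rels A.one_closed]) simp_all

lemma TE_induct:
  assumes "submodule H K TE" "\<one>\<^bsub>TE\<^esub> \<in> H"
    "\<And>v x. \<lbrakk>v \<in> carrier E; x \<in> H\<rbrakk> \<Longrightarrow> \<iota> v \<otimes>\<^bsub>TE\<^esub> x \<in> H" "x \<in> carrier TE"
  shows "x \<in> H"
proof (rule presented_induct[OF K linearity_rels_subset, folded TE_eq, OF assms(1,2) _ assms(4)])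
  fix v x assume "v \<in> carrier ES" "x \<in> H"
  then show "(lin_ideal +>\<^bsub>FE\<^esub> basis_vec K [v]) \<otimes>\<^bsub>TE\<^esub> x \<in> H"
    using assms(3) by (simp only: incl_eq E_space_simps)
qed

text \<open>Makes the kernel a two-sided ideal, so that it contains \<open>J\<close> as soon as it
  contains the generators of \<open>J\<close>.\<close>

lemma TE_to_A_mult:
  assumes "x \<in> carrier TE" "y \<in> carrier TE"
  shows "TE_to_A (x \<otimes>\<^bsub>TE\<^esub> y) = TE_to_A x \<otimes>\<^bsub>A\<^esub> TE_to_A y"
proof -
  note lin = TE_to_A_lin_map
  note ly = lin_map_closed[OF lin assms(2)]
  let ?H = "{x \<in> carrier TE. TE_to_A (x \<otimes>\<^bsub>TE\<^esub> y) = TE_to_A x \<otimes>\<^bsub>A\<^esub> TE_to_A y}"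
  have "x \<in> ?H"
  proof (rule TE_induct[OF submodule_equalizer[OF TE_mod A_mod
          lin_map_comp[OF mult_right_lin_map[OF TE_alg assms(2)] lin]
          lin_map_comp[OF lin mult_right_lin_map[OF FK_assoc_algebra ly]]] _ _ assms(1)])
    show "\<one>\<^bsub>TE\<^esub> \<in> ?H" using assms(2) ly by (simp add: TE_to_A_one)
    fix v x assume v: "v \<in> carrier E" and x: "x \<in> ?H"
    then have xc: "x \<in> carrier TE" by simp
    show "\<iota> v \<otimes>\<^bsub>TE\<^esub> x \<in> ?H"
      using x E_to_A_closed[OF v] incl_closed[OF v] lin_map_closed[OF lin xc] ly assms(2)
      by (simp add: TE.m_assoc TE_to_A_mult_incl[OF v] A.m_assoc)
  qed
  then show ?thesis by simp
qed

text \<open>The degree two part of the map out of the tensor algebra, defined directly on the tensor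
  square where \<Psi> lives; \<open>TE_to_A_incl2\<close> says that the two agree.\<close>

definition "E2_to_A = tensor_lift K A (\<lambda>v w. E_to_A v \<otimes>\<^bsub>A\<^esub> E_to_A w)"

lemma E2_bilin: "bilin K ES ES A (\<lambda>v w. E_to_A v \<otimes>\<^bsub>A\<^esub> E_to_A w)"
  using bilin_comp[OF mult_bilin[OF FK_assoc_algebra] E_to_A_lin_map E_to_A_lin_map] by (simp add: bilin_def)

lemma E2_to_A_lin_map: "E2_to_A \<in> lin_map K EE A"
  unfolding E2_to_A_def by (rule tensor_lift_lin_map[OF ES_mod ES_mod A_mod E2_bilin])

lemma E2_to_A_pure: "\<lbrakk>v \<in> carrier E; w \<in> carrier E\<rbrakk> \<Longrightarrow> E2_to_A (PE v w) = E_to_A v \<otimes>\<^bsub>A\<^esub> E_to_A w"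
  unfolding E2_to_A_def by (rule tensor_lift_pure[OF ES_mod ES_mod A_mod E2_bilin]) simp_all

lemma E2_to_A_gen:
  "\<lbrakk>p \<in> FK_letters N; q \<in> FK_letters N\<rbrakk> \<Longrightarrow> E2_to_A (PE (e p) (e q)) = X p \<otimes>\<^bsub>A\<^esub> X q"
  by (simp add: E2_to_A_pure E_gen_closed E_to_A_gen del: fst_conv snd_conv)

lemma TE_to_A_incl: "v \<in> carrier E \<Longrightarrow> TE_to_A (\<iota> v) = E_to_A v"
  using TE_to_A_mult_incl[of v "\<one>\<^bsub>TE\<^esub>"] incl_closed[of v] E_to_A_closed[of v] by (simp add: TE_to_A_one)

lemma TE_to_A_incl2:
  assumes t: "t \<in> carrier EE" shows "TE_to_A (\<iota>2 t) = E2_to_A t"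
proof (rule tensor_eqI[OF ES_mod ES_mod A_mod lin_map_comp[OF incl2_lin_map TE_to_A_lin_map] E2_to_A_lin_map _ t])
  fix v w assume "v \<in> carrier ES" "w \<in> carrier ES"
  then have v: "v \<in> carrier E" and w: "w \<in> carrier E" by simp_all
  show "TE_to_A (\<iota>2 (PE v w)) = E2_to_A (PE v w)"
    unfolding incl2_pure[OF v w] E2_to_A_pure[OF v w] TE_to_A_mult[OF incl_closed[OF v] incl_closed[OF w]]
      TE_to_A_incl[OF v] TE_to_A_incl[OF w] ..
qed

text \<open>
  The orbit lengths divide 6, so a tensor \<open>t\<close> fixed by \<open>-\<Psi>\<close> satisfies \<open>6 t = (\<Sum>n<6. (-\<Psi>)\<^sup>n t)\<close>;
  \<open>orbit_sum t\<close> is the image in \<open>A\<close> of the right-hand side.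
\<close>

abbreviation (input) "neg\<Psi> t \<equiv> \<ominus>\<^bsub>tensor K (E_space K N) (E_space K N)\<^esub> braiding K (sym_group N) (E_space K N) (E_space K N) t"

lemma neg\<Psi>_lin_map: "(\<lambda>t. neg\<Psi> t) \<in> lin_map K EE EE"
  by (rule lin_map_neg[OF EE_mod \<Psi>_lin_map])

definition "orbit_sum t =
  E2_to_A t \<oplus>\<^bsub>A\<^esub> E2_to_A (neg\<Psi> t) \<oplus>\<^bsub>A\<^esub> E2_to_A (neg\<Psi> (neg\<Psi> t)) \<oplus>\<^bsub>A\<^esub>
  (E2_to_A (neg\<Psi> (neg\<Psi> (neg\<Psi> t))) \<oplus>\<^bsub>A\<^esub> E2_to_A (neg\<Psi> (neg\<Psi> (neg\<Psi> (neg\<Psi> t)))) \<oplus>\<^bsub>A\<^esub>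
   E2_to_A (neg\<Psi> (neg\<Psi> (neg\<Psi> (neg\<Psi> (neg\<Psi> t))))))"

lemma orbit_sum_lin_map: "orbit_sum \<in> lin_map K EE A"
proof -
  note n = neg\<Psi>_lin_map and m = E2_to_A_lin_map
  note n2 = lin_map_comp[OF n n] note n3 = lin_map_comp[OF n2 n] note n4 = lin_map_comp[OF n3 n]
  note n5 = lin_map_comp[OF n4 n]
  show ?thesis
    unfolding orbit_sum_def[abs_def]
    by (rule lin_map_plus[OF A_mod lin_map_plus[OF A_mod lin_map_plus[OF A_mod m lin_map_comp[OF n m]] lin_map_comp[OF n2 m]]
          lin_map_plus[OF A_mod lin_map_plus[OF A_mod lin_map_comp[OF n3 m] lin_map_comp[OF n4 m]] lin_map_comp[OF n5 m]]])
qed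

text \<open>The tensor is fixed by -\<Psi>, so all six summands are the square of a letter.\<close>

lemma orbit_sum_square:
  assumes ij: "(i, j) \<in> FK_letters N"
  shows "orbit_sum (PE (e (i, j)) (e (i, j))) = \<zero>\<^bsub>A\<^esub>"
proof -
  let ?t = "PE (e (i, j)) (e (i, j))"
  have "\<Psi> ?t = \<ominus>\<^bsub>EE\<^esub> ?t"
    unfolding \<Psi>_pair[OF ij ij] fst_conv snd_conv letter_deg_apply
    by (rule PE_swap(1)[OF ij]) (use E_gen_closed[OF ij] in simp)
  then have "neg\<Psi> ?t = ?t" using PE_closed[OF ij ij] by (simp only: EE.M.minus_minus)
  then show ?thesis
    unfolding orbit_sum_def using E2_to_A_gen[OF ij ij] FK_elemsD(3)[OF FK_elems_gen ij] by simp
qed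

text \<open>The orbit alternates between \<open>?a\<close> and \<open>\<ominus> ?b\<close>. Their
  images are opposite because disjoint letters commute, so the six summands cancel in pairs.\<close>

lemma orbit_sum_disjoint:
  assumes ijkm: "{i, j, k, m} \<subseteq> {1..N}" "distinct [i, j, k, m]"
  shows "orbit_sum (PE (e (i, j)) (e (k, m))) = \<zero>\<^bsub>A\<^esub>"
proof -
  have l: "(i, j) \<in> FK_letters N" "(k, m) \<in> FK_letters N" using FK_letters_of4 ijkm by blast+
  have la: "letter_deg (i, j) k = k" "letter_deg (i, j) m = m" "letter_deg (k, m) i = i" "letter_deg (k, m) j = j"
    using ijkm(2) by (auto simp: letter_deg_apply)
  let ?a = "PE (e (i, j)) (e (k, m))" and ?b = "PE (e (k, m)) (e (i, j))"
  have ab: "?a \<in> carrier EE" "?b \<in> carrier EE" using PE_closed l by blast+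
  have psi: "\<Psi> ?a = ?b" "\<Psi> ?b = ?a"
    unfolding \<Psi>_pair[OF l] \<Psi>_pair[OF l(2,1)] fst_conv snd_conv la by (rule refl)+
  have neg: "neg\<Psi> (\<ominus>\<^bsub>EE\<^esub> ?b) = ?a"
    using ab lin_map_uminus[OF EE_mod EE_mod \<Psi>_lin_map ab(2)] psi(2) by (simp only: EE.M.minus_minus)
  define x where "x = X (i, j) \<otimes>\<^bsub>A\<^esub> X (k, m)"
  have x: "x \<in> carrier A" unfolding x_def by (rule A.m_closed[OF gen_closed[OF l(1)] gen_closed[OF l(2)]])
  have mu: "E2_to_A ?a = x" "E2_to_A (\<ominus>\<^bsub>EE\<^esub> ?b) = \<ominus>\<^bsub>A\<^esub> x"
    unfolding lin_map_uminus[OF EE_mod A_mod E2_to_A_lin_map ab(2)] E2_to_A_gen[OF l] E2_to_A_gen[OF l(2,1)] x_def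
      FK_elemsD(4)[OF FK_elems_gen ijkm] by (rule refl)+
  show ?thesis
    unfolding orbit_sum_def psi(1) neg mu using x by (simp add: A.M.r_neg A.M.l_neg A.M.a_assoc)
qed

text \<open>The orbit of length three is run through twice, and the images over each period add up
  to the triple relation. The bracketing of \<open>orbit_sum\<close> into two groups of three is
  chosen for this.\<close>

lemma orbit_sum_triple:
  assumes ijk: "{i, j, k} \<subseteq> {1..N}" "distinct [i, j, k]"
  shows "orbit_sum (PE (e (i, j)) (e (j, k))) = \<zero>\<^bsub>A\<^esub>"
proof -
  have l: "(i, j) \<in> FK_letters N" "(j, k) \<in> FK_letters N" "(k, i) \<in> FK_letters N"
    using FK_letters_of ijk by blast+
  have la: "letter_deg (i, j) j = i" "letter_deg (i, j) k = k" "letter_deg (j, k) k = j"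
    "letter_deg (j, k) i = i" "letter_deg (k, i) i = k" "letter_deg (k, i) j = j"
    using ijk(2) by (auto simp: letter_deg_apply)
  let ?a = "PE (e (i, j)) (e (j, k))" and ?b = "PE (e (j, k)) (e (k, i))" and ?c = "PE (e (k, i)) (e (i, j))"
  have abc: "?a \<in> carrier EE" "?b \<in> carrier EE" "?c \<in> carrier EE" using PE_closed l by blast+
  have psi: "\<Psi> ?a = \<ominus>\<^bsub>EE\<^esub> ?c" "\<Psi> ?b = \<ominus>\<^bsub>EE\<^esub> ?a" "\<Psi> ?c = \<ominus>\<^bsub>EE\<^esub> ?b"
    unfolding \<Psi>_pair[OF l(1,2)] \<Psi>_pair[OF l(2,3)] \<Psi>_pair[OF l(3,1)] fst_conv snd_conv la
    using PE_swap(1)[OF l(3) E_gen_closed[OF l(1)]] PE_swap(1)[OF l(1) E_gen_closed[OF l(2)]]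
      PE_swap(1)[OF l(2) E_gen_closed[OF l(3)]] by simp_all
  define x y z where "x = X (i, j) \<otimes>\<^bsub>A\<^esub> X (j, k)" and "y = X (j, k) \<otimes>\<^bsub>A\<^esub> X (k, i)" and "z = X (k, i) \<otimes>\<^bsub>A\<^esub> X (i, j)"
  have xyz: "x \<in> carrier A" "y \<in> carrier A" "z \<in> carrier A"
    unfolding x_def y_def z_def by (intro A.m_closed gen_closed l)+
  have mu: "E2_to_A ?a = x" "E2_to_A ?b = y" "E2_to_A ?c = z"
    unfolding E2_to_A_gen[OF l(1,2)] E2_to_A_gen[OF l(2,3)] E2_to_A_gen[OF l(3,1)] x_def y_def z_def by (rule refl)+
  have "x \<oplus>\<^bsub>A\<^esub> y \<oplus>\<^bsub>A\<^esub> z = \<zero>\<^bsub>A\<^esub>" unfolding x_def y_def z_def by (rule FK_elemsD(5)[OF FK_elems_gen ijk])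
  then have "x \<oplus>\<^bsub>A\<^esub> z \<oplus>\<^bsub>A\<^esub> y = \<zero>\<^bsub>A\<^esub>" using xyz by (simp add: A.M.a_ac)
  then show ?thesis
    unfolding orbit_sum_def using abc by (simp only: psi EE.M.minus_minus mu A.M.l_zero A.M.zero_closed)
qed

text \<open>\<open>orbit_sum\<close> is linear and reversing a letter negates the tensor, so each
  letter may be oriented at will.\<close>

lemma orbit_sum_swap:
  assumes p: "(i, j) \<in> FK_letters N" and q: "(k, m) \<in> FK_letters N"
    and zero: "orbit_sum (PE (e (i, j)) (e (k, m))) = \<zero>\<^bsub>A\<^esub>"
  shows "orbit_sum (PE (e (j, i)) (e (k, m))) = \<zero>\<^bsub>A\<^esub>" "orbit_sum (PE (e (i, j)) (e (m, k))) = \<zero>\<^bsub>A\<^esub>"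
proof -
  have "orbit_sum (\<ominus>\<^bsub>EE\<^esub> PE (e (i, j)) (e (k, m))) = \<zero>\<^bsub>A\<^esub>"
    unfolding lin_map_uminus[OF EE_mod A_mod orbit_sum_lin_map PE_closed[OF p q]] zero by simp
  then show "orbit_sum (PE (e (j, i)) (e (k, m))) = \<zero>\<^bsub>A\<^esub>" "orbit_sum (PE (e (i, j)) (e (m, k))) = \<zero>\<^bsub>A\<^esub>"
    using PE_swap(1)[OF p E_gen_closed[OF q]] PE_swap(2)[OF q E_gen_closed[OF p]] by simp_all
qed

lemma orbit_sum_gen:
  assumes p: "p \<in> FK_letters N" and q: "q \<in> FK_letters N"
  shows "orbit_sum (PE (e p) (e q)) = \<zero>\<^bsub>A\<^esub>"
proof -
  obtain i j k m where pq: "p = (i, j)" "q = (k, m)" by (cases p, cases q)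
  note l = p[unfolded pq] q[unfolded pq]
  have ij: "i \<in> {1..N}" "j \<in> {1..N}" "i \<noteq> j" and km: "k \<in> {1..N}" "m \<in> {1..N}" "k \<noteq> m"
    using l unfolding FK_letters_iff by blast+
  \<comment> \<open>Two letters have the same indices, disjoint indices or exactly one index in
    common. In the last case both can be oriented so that the common index ends the first letter and
    begins the second, the shape treated by \<open>orbit_sum_triple\<close>.\<close>
  consider (eq) "i = k" "j = m" | (rev) "i = m" "j = k" | (disj) "distinct [i, j, k, m]"
    | (jk) "j = k" "m \<noteq> i" | (ik) "i = k" "m \<noteq> j" | (jm) "j = m" "k \<noteq> i" | (im) "i = m" "k \<noteq> j"
    using ij(3) km(3) by auto
  then show ?thesis
    unfolding pq
  proof cases
    case eq
    then show "orbit_sum (PE (e (i, j)) (e (k, m))) = \<zero>\<^bsub>A\<^esub>" using orbit_sum_square[OF l(1)] by (simp only:)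
  next
    case rev
    then show "orbit_sum (PE (e (i, j)) (e (k, m))) = \<zero>\<^bsub>A\<^esub>"
      using orbit_sum_swap(2)[OF l(1) l(1) orbit_sum_square[OF l(1)]] by (simp only:)
  next
    case disj
    then show "orbit_sum (PE (e (i, j)) (e (k, m))) = \<zero>\<^bsub>A\<^esub>" using ij km by (intro orbit_sum_disjoint) auto
  next
    case jk
    then have "orbit_sum (PE (e (i, j)) (e (j, m))) = \<zero>\<^bsub>A\<^esub>" using ij km by (intro orbit_sum_triple) auto
    then show "orbit_sum (PE (e (i, j)) (e (k, m))) = \<zero>\<^bsub>A\<^esub>" using jk by (simp only:)
  next
    case ik
    then have "orbit_sum (PE (e (j, i)) (e (i, m))) = \<zero>\<^bsub>A\<^esub>" using ij km by (intro orbit_sum_triple) auto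
    from orbit_sum_swap(1)[OF FK_letters_swap[OF l(1)] _ this]
    show "orbit_sum (PE (e (i, j)) (e (k, m))) = \<zero>\<^bsub>A\<^esub>" using l(2) ik by (simp only:)
  next
    case jm
    then have "orbit_sum (PE (e (i, j)) (e (j, k))) = \<zero>\<^bsub>A\<^esub>" using ij km by (intro orbit_sum_triple) auto
    from orbit_sum_swap(2)[OF l(1) _ this]
    show "orbit_sum (PE (e (i, j)) (e (k, m))) = \<zero>\<^bsub>A\<^esub>" using FK_letters_swap[OF l(2)] jm by (simp only:)
  next
    case im
    then have "orbit_sum (PE (e (j, i)) (e (i, k))) = \<zero>\<^bsub>A\<^esub>" using ij km by (intro orbit_sum_triple) auto
    from orbit_sum_swap(1)[OF FK_letters_swap[OF l(1)] _ this]
    have "orbit_sum (PE (e (i, j)) (e (i, k))) = \<zero>\<^bsub>A\<^esub>" using FK_letters_swap[OF l(2)] im by (simp only:)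
    from orbit_sum_swap(2)[OF l(1) _ this]
    show "orbit_sum (PE (e (i, j)) (e (k, m))) = \<zero>\<^bsub>A\<^esub>" using FK_letters_swap[OF l(2)] im by (simp only:)
  qed
qed

lemma ES_span: "lin_span K ES (e ` E_basis N) = carrier ES"
proof -
  have "submodule H K ES \<longleftrightarrow> submodule H K E" for H
    by (simp add: submodule_def subgroup_def submodule_axioms_def m_inv_def del: free_module_simps)
  then show ?thesis using E_span by (simp add: lin_span_def)
qed

lemma orbit_sum_zero:
  assumes t: "t \<in> carrier EE" shows "orbit_sum t = \<zero>\<^bsub>A\<^esub>"
proof (rule tensor_eqI_span[OF ES_mod ES_mod A_mod orbit_sum_lin_map lin_map_const_zero[OF A_mod] ES_span ES_span _ t])
  fix v w assume "v \<in> e ` E_basis N" "w \<in> e ` E_basis N"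
  then obtain p q where p: "p \<in> E_basis N" "v = e p" and q: "q \<in> E_basis N" "w = e q" by blast
  show "orbit_sum (PE v w) = \<zero>\<^bsub>A\<^esub>"
    unfolding p(2) q(2) by (rule orbit_sum_gen[OF E_basis_letters[OF p(1)] E_basis_letters[OF q(1)]])
qed

section \<open>The kernel of id + \<Psi> and the inverse isomorphism, with 6 invertible\<close>

context
  fixes s
  assumes s: "s \<in> carrier K"
    and six: "s \<otimes>\<^bsub>K\<^esub> (\<one>\<^bsub>K\<^esub> \<oplus>\<^bsub>K\<^esub> \<one>\<^bsub>K\<^esub> \<oplus>\<^bsub>K\<^esub> \<one>\<^bsub>K\<^esub> \<oplus>\<^bsub>K\<^esub> (\<one>\<^bsub>K\<^esub> \<oplus>\<^bsub>K\<^esub> \<one>\<^bsub>K\<^esub> \<oplus>\<^bsub>K\<^esub> \<one>\<^bsub>K\<^esub>)) = \<one>\<^bsub>K\<^esub>"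
begin

text \<open>On the kernel -\<Psi> is the identity, so the vanishing orbit sum consists of six equal
  summands, and \<open>s\<close> divides by 6. The six ones in the assumption on \<open>s\<close>
  are bracketed like the summands of \<open>orbit_sum\<close>, so that the two expressions
  match.\<close>

lemma E2_to_A_Ker:
  assumes "t \<in> Ker" shows "E2_to_A t = \<zero>\<^bsub>A\<^esub>"
proof -
  have t: "t \<in> carrier EE" and sum: "t \<oplus>\<^bsub>EE\<^esub> \<Psi> t = \<zero>\<^bsub>EE\<^esub>" using assms by (simp_all only: Ker_iff)
  have psi: "\<Psi> t \<in> carrier EE" by (rule lin_map_closed[OF \<Psi>_lin_map t])
  have "neg\<Psi> t = t" by (rule EE.M.minus_equality[OF sum psi t])
  define m where "m = E2_to_A t"
  have m: "m \<in> carrier A" unfolding m_def by (rule lin_map_closed[OF E2_to_A_lin_map t])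
  let ?six = "\<one>\<^bsub>K\<^esub> \<oplus>\<^bsub>K\<^esub> \<one>\<^bsub>K\<^esub> \<oplus>\<^bsub>K\<^esub> \<one>\<^bsub>K\<^esub> \<oplus>\<^bsub>K\<^esub> (\<one>\<^bsub>K\<^esub> \<oplus>\<^bsub>K\<^esub> \<one>\<^bsub>K\<^esub> \<oplus>\<^bsub>K\<^esub> \<one>\<^bsub>K\<^esub>)"
  have "m \<oplus>\<^bsub>A\<^esub> m \<oplus>\<^bsub>A\<^esub> m \<oplus>\<^bsub>A\<^esub> (m \<oplus>\<^bsub>A\<^esub> m \<oplus>\<^bsub>A\<^esub> m) = \<zero>\<^bsub>A\<^esub>"
    using orbit_sum_zero[OF t] unfolding orbit_sum_def \<open>neg\<Psi> t = t\<close> m_def .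
  then have "?six \<odot>\<^bsub>A\<^esub> m = \<zero>\<^bsub>A\<^esub>" using m by (simp add: A.smult_l_distr)
  then have "(s \<otimes>\<^bsub>K\<^esub> ?six) \<odot>\<^bsub>A\<^esub> m = \<zero>\<^bsub>A\<^esub>" using s m by (simp add: A.smult_assoc1)
  then show ?thesis using m unfolding six by (simp add: m_def)
qed

lemma TE_to_A_J:
  assumes "x \<in> J" shows "TE_to_A x = \<zero>\<^bsub>A\<^esub>"
proof -
  let ?H = "{x \<in> carrier TE. TE_to_A x = \<zero>\<^bsub>A\<^esub>}"
  note lin = TE_to_A_lin_map
  have "ideal ?H TE"
  proof (rule idealI[OF TE.ring_axioms])
    show "subgroup ?H (add_monoid TE)"
      using submodule_equalizer[OF TE_mod A_mod lin lin_map_const_zero[OF A_mod]] by (simp add: submodule_def)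
  qed (use lin_map_closed[OF lin] in \<open>auto simp: TE_to_A_mult\<close>)
  moreover have "\<iota>2 ` Ker \<subseteq> ?H"
  proof (rule image_subsetI)
    fix t assume "t \<in> Ker"
    then have t: "t \<in> carrier EE" "E2_to_A t = \<zero>\<^bsub>A\<^esub>" using E2_to_A_Ker by (simp_all only: Ker_iff)
    show "\<iota>2 t \<in> ?H" using lin_map_closed[OF incl2_lin_map t(1)] TE_to_A_incl2[OF t(1)] t(2) by simp
  qed
  ultimately have "J \<subseteq> ?H" unfolding J_eq by (rule TE.genideal_minimal)
  with assms show ?thesis by blast
qed

definition "Q_to_A t = the_elem (TE_to_A ` t)"

lemma Q_to_A_lin_map: "Q_to_A \<in> lin_map K Q A"
  unfolding Q_to_A_def[abs_def] by (rule quot_lift_lin_map[OF TE_sub A_mod TE_to_A_lin_map TE_to_A_J])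

lemma Q_to_A_coset: "x \<in> carrier TE \<Longrightarrow> Q_to_A (J +>\<^bsub>TE\<^esub> x) = TE_to_A x"
  unfolding Q_to_A_def by (rule quot_lift_coset[OF TE_sub A_mod TE_to_A_lin_map TE_to_A_J])

lemma Q_to_A_gen_mult:
  assumes p: "p \<in> FK_letters N" and z: "z \<in> carrier Q"
  shows "Q_to_A (Qgen p \<otimes>\<^bsub>Q\<^esub> z) = X p \<otimes>\<^bsub>A\<^esub> Q_to_A z"
proof -
  obtain x where x: "x \<in> carrier TE" "z = J +>\<^bsub>TE\<^esub> x" using z by (auto simp: quot_carrier[OF TE_sub])
  note ep = E_gen_closed[OF p]
  show ?thesis
    unfolding x(2) coset_mult[OF J_ideal incl_closed[OF ep] x(1)] Q_to_A_coset[OF TE.m_closed[OF incl_closed[OF ep] x(1)]]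
      Q_to_A_coset[OF x(1)] TE_to_A_mult_incl[OF ep x(1)] E_to_A_gen[OF p] ..
qed

lemma Q_to_A_FK_to_Q:
  assumes b: "b \<in> carrier A" shows "Q_to_A (FK_to_Q b) = b"
proof (rule FK_eqI[OF A_mod lin_map_comp[OF alg_homD(1)[OF FK_to_Q_alg_hom] Q_to_A_lin_map] lin_map_id _ _ b])
  note hom = alg_homD[OF FK_to_Q_alg_hom]
  show "Q_to_A (FK_to_Q \<one>\<^bsub>A\<^esub>) = \<one>\<^bsub>A\<^esub>"
    unfolding hom(2) quot_one Q_to_A_coset[OF TE.one_closed] TE_to_A_one ..
  fix p b assume p: "p \<in> FK_letters N" and b: "b \<in> carrier A" and IH: "Q_to_A (FK_to_Q b) = b"
  show "Q_to_A (FK_to_Q (X p \<otimes>\<^bsub>A\<^esub> b)) = X p \<otimes>\<^bsub>A\<^esub> b"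
    unfolding hom(3)[OF gen_closed[OF p] b] FK_to_Q_gen[OF p] Q_to_A_gen_mult[OF p lin_map_closed[OF hom(1) b]] IH ..
qed

lemma FK_to_Q_E_to_A:
  assumes "v \<in> carrier E" shows "FK_to_Q (E_to_A v) = J +>\<^bsub>TE\<^esub> \<iota> v"
  by (rule E_eqI[OF Q_mod lin_map_comp[OF E_to_A_lin_map alg_homD(1)[OF FK_to_Q_alg_hom]]
        lin_map_comp[OF incl_lin_map coset_lin_map[OF TE_sub]] _ assms])
    (simp only: E_to_A_gen[OF E_basis_letters] FK_to_Q_gen[OF E_basis_letters])

text \<open>With \<open>Q_to_A_coset\<close> this makes \<open>Q_to_A\<close> a right inverse of
  \<open>FK_to_Q\<close>. It holds by induction over the tensor algebra, as both sides turn left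
  multiplication by a vector of \<open>E\<close> into multiplication by its class.\<close>

lemma FK_to_Q_TE_to_A:
  assumes "x \<in> carrier TE" shows "FK_to_Q (TE_to_A x) = J +>\<^bsub>TE\<^esub> x"
proof -
  note hom = alg_homD[OF FK_to_Q_alg_hom]
  let ?H = "{x \<in> carrier TE. FK_to_Q (TE_to_A x) = J +>\<^bsub>TE\<^esub> x}"
  have "x \<in> ?H"
  proof (rule TE_induct[OF submodule_equalizer[OF TE_mod Q_mod lin_map_comp[OF TE_to_A_lin_map hom(1)]
          coset_lin_map[OF TE_sub]] _ _ assms])
    show "\<one>\<^bsub>TE\<^esub> \<in> ?H" by (simp add: TE_to_A_one hom(2) quot_one)
    fix v x assume v: "v \<in> carrier E" and "x \<in> ?H"
    then have x: "x \<in> carrier TE" "FK_to_Q (TE_to_A x) = J +>\<^bsub>TE\<^esub> x" by simp_all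
    have "FK_to_Q (TE_to_A (\<iota> v \<otimes>\<^bsub>TE\<^esub> x)) = J +>\<^bsub>TE\<^esub> (\<iota> v \<otimes>\<^bsub>TE\<^esub> x)"
      unfolding TE_to_A_mult_incl[OF v x(1)] hom(3)[OF E_to_A_closed[OF v] lin_map_closed[OF TE_to_A_lin_map x(1)]]
        FK_to_Q_E_to_A[OF v] x(2) coset_mult[OF J_ideal incl_closed[OF v] x(1)] ..
    then show "\<iota> v \<otimes>\<^bsub>TE\<^esub> x \<in> ?H" using incl_closed[OF v] x(1) by simp
  qed
  then show ?thesis by simp
qed

lemma FK_to_Q_bij: "bij_betw FK_to_Q (carrier A) (carrier Q)"
proof (rule bij_betw_byWitness[of _ Q_to_A])
  show "\<forall>b\<in>carrier A. Q_to_A (FK_to_Q b) = b" using Q_to_A_FK_to_Q by blast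
  show "\<forall>z\<in>carrier Q. FK_to_Q (Q_to_A z) = z"
    using FK_to_Q_TE_to_A Q_to_A_coset by (auto simp: quot_carrier[OF TE_sub])
  show "FK_to_Q ` carrier A \<subseteq> carrier Q" using lin_map_closed[OF alg_homD(1)[OF FK_to_Q_alg_hom]] by blast
  show "Q_to_A ` carrier Q \<subseteq> carrier A" using lin_map_closed[OF Q_to_A_lin_map] by blast
qed

end

end

context FK_base
begin

lemma E_space_formulas:
  assumes "1 \<le> i" "i < j" "j \<le> N"
  shows "g \<in> carrier G \<Longrightarrow> act ES g (E_gen K N i j) = E_gen K N (g i) (g j)"
    and "g \<in> carrier G \<Longrightarrow> E_gen K N (g i) (g j) =
      (if g i < g j then E_gen K N (g i) (g j) else \<ominus>\<^bsub>ES\<^esub> E_gen K N (g j) (g i))"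
    and "E_gen K N i j \<in> grade ES (Transposition.transpose i j)"
proof -
  have ij: "(i, j) \<in> FK_letters N" using assms by (simp add: FK_letters_iff)
  show "act ES g (E_gen K N i j) = E_gen K N (g i) (g j)" if "g \<in> carrier G"
    using E_act_gen[OF that ij] by (simp del: E_space_simps)
  show "E_gen K N (g i) (g j) =
      (if g i < g j then E_gen K N (g i) (g j) else \<ominus>\<^bsub>ES\<^esub> E_gen K N (g j) (g i))" if g: "g \<in> carrier G"
  proof -
    have ji: "(g j, g i) \<in> FK_letters N"
      using perm_letter_closed[OF g FK_letters_swap[OF ij]] by simp
    show ?thesis using E_gen_swap[OF ji] E_uminus[OF E_gen_closed[OF ji]] by simp
  qed
  show "E_gen K N i j \<in> grade ES (Transposition.transpose i j)"
    using E_gen_closed[OF ij] E_comp_gen[OF ij, of "Transposition.transpose i j"]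
    by (simp add: E_grade letter_deg_def del: E_space_simps(6))
qed

end

theorem theorem6p1:
  fixes K :: "('k, 'r) ring_scheme" and N :: nat
  assumes "field K"
    and char_zero: "\<And>n :: nat. n > 0 \<Longrightarrow> [n] \<cdot>\<^bsub>K\<^esub> \<one>\<^bsub>K\<^esub> \<noteq> \<zero>\<^bsub>K\<^esub>"
    and "2 \<le> N"
  shows "
    (crossed_module K (sym_group N) (E_space K N) \<and>
     (\<forall>g\<in>carrier (sym_group N). \<forall>i j. 1 \<le> i \<and> i < j \<and> j \<le> N \<longrightarrow>
        act (E_space K N) g (E_gen K N i j) = E_gen K N (g i) (g j) \<and>
        E_gen K N (g i) (g j) =
          (if g i < g j then E_gen K N (g i) (g j)
           else \<ominus>\<^bsub>E_space K N\<^esub> E_gen K N (g j) (g i))) \<and>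
     (\<forall>i j. 1 \<le> i \<and> i < j \<and> j \<le> N \<longrightarrow>
        E_gen K N i j \<in> grade (E_space K N) (Transposition.transpose i j)))
    \<and>
    (let TE = tensor_algebra K (E_space K N);
         J = braided_ideal K (sym_group N) (E_space K N)
     in \<exists>\<phi> \<in> alg_hom K (FK_algebra K N) (quot TE J).
          bij_betw \<phi> (carrier (FK_algebra K N)) (carrier (quot TE J)) \<and>
          (\<forall>i\<in>{1..N}. \<forall>j\<in>{1..N}. i \<noteq> j \<longrightarrow>
             \<phi> (FK_gen K N i j) =
               J +>\<^bsub>TE\<^esub> tensor_algebra_incl K (E_space K N) (E_gen K N i j)))
    \<and>
    (\<exists>(B :: ('k, ((nat \<times> nat) list \<Rightarrow> 'k) set, nat \<Rightarrow> nat) crossed) \<Delta> \<epsilon> S.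
       module.truncate B = FK_algebra K N \<and>
       (\<forall>i\<in>{1..N}. \<forall>j\<in>{1..N}. i \<noteq> j \<longrightarrow>
          (\<forall>g\<in>carrier (sym_group N). act B g (FK_gen K N i j) = FK_gen K N (g i) (g j)) \<and>
          FK_gen K N i j \<in> grade B (Transposition.transpose i j)) \<and>
       braided_group K (sym_group N) B \<Delta> \<epsilon> S \<and>
       (\<forall>i\<in>{1..N}. \<forall>j\<in>{1..N}. i \<noteq> j \<longrightarrow>
          \<Delta> (FK_gen K N i j) =
            pure K B B (FK_gen K N i j) \<one>\<^bsub>B\<^esub>
              \<oplus>\<^bsub>tensor K B B\<^esub> pure K B B \<one>\<^bsub>B\<^esub> (FK_gen K N i j) \<and>
          \<epsilon> (FK_gen K N i j) = \<zero>\<^bsub>K\<^esub>) \<and>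
       (\<forall>\<Delta>' \<in> alg_hom K B (braided_square K (sym_group N) B).
          (\<forall>i\<in>{1..N}. \<forall>j\<in>{1..N}. i \<noteq> j \<longrightarrow> \<Delta>' (FK_gen K N i j) = \<Delta> (FK_gen K N i j)) \<longrightarrow>
          (\<forall>x\<in>carrier B. \<Delta>' x = \<Delta> x)) \<and>
       (\<forall>\<epsilon>' \<in> alg_hom K B (crossed_unit K (sym_group N)).
          (\<forall>i\<in>{1..N}. \<forall>j\<in>{1..N}. i \<noteq> j \<longrightarrow> \<epsilon>' (FK_gen K N i j) = \<epsilon> (FK_gen K N i j)) \<longrightarrow>
          (\<forall>x\<in>carrier B. \<epsilon>' x = \<epsilon> x)))"
proof -
  interpret K: field K by fact
  interpret FK_base K N by (rule FK_base.intro) (rule K.is_cring)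
  let ?G = "sym_group N" and ?B = "FK_crossed K N" and ?A = "FK_algebra K N"
  let ?six = "\<one>\<^bsub>K\<^esub> \<oplus>\<^bsub>K\<^esub> \<one>\<^bsub>K\<^esub> \<oplus>\<^bsub>K\<^esub> \<one>\<^bsub>K\<^esub> \<oplus>\<^bsub>K\<^esub> (\<one>\<^bsub>K\<^esub> \<oplus>\<^bsub>K\<^esub> \<one>\<^bsub>K\<^esub> \<oplus>\<^bsub>K\<^esub> \<one>\<^bsub>K\<^esub>)"
  \<comment> \<open>Characteristic zero at n = 6, the least common multiple of the orbit lengths 1,
    2 and 3 of -\<Psi>. In a field this makes 6 a unit, whose inverse is the scalar \<open>s\<close>
    used for the kernel.\<close>
  have "[(6::nat)] \<cdot>\<^bsub>K\<^esub> \<one>\<^bsub>K\<^esub> = ?six"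
    by (simp add: numeral_eq_Suc K.add.nat_pow_Suc K.a_assoc)
  then have "?six \<in> Units K" using char_zero[of 6] by (simp add: K.field_Units)
  note s = K.Units_inv_closed[OF this] K.Units_l_inv[OF this]
  have letter: "(i, j) \<in> FK_letters N" if "i \<in> {1..N}" "j \<in> {1..N}" "i \<noteq> j" for i j
    using that by (simp add: FK_letters_iff)
  show ?thesis
  proof (intro conjI)
    show "crossed_module K ?G (E_space K N)" by (rule E_crossed_module)
    show "\<forall>g\<in>carrier ?G. \<forall>i j. 1 \<le> i \<and> i < j \<and> j \<le> N \<longrightarrow>
        act (E_space K N) g (E_gen K N i j) = E_gen K N (g i) (g j) \<and>
        E_gen K N (g i) (g j) =
          (if g i < g j then E_gen K N (g i) (g j) else \<ominus>\<^bsub>E_space K N\<^esub> E_gen K N (g j) (g i))"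
      using E_space_formulas(1,2) by blast
    show "\<forall>i j. 1 \<le> i \<and> i < j \<and> j \<le> N \<longrightarrow>
        E_gen K N i j \<in> grade (E_space K N) (Transposition.transpose i j)"
      using E_space_formulas(3) by blast
    show "let TE = tensor_algebra K (E_space K N);
         J = braided_ideal K ?G (E_space K N)
     in \<exists>\<phi> \<in> alg_hom K ?A (quot TE J).
          bij_betw \<phi> (carrier ?A) (carrier (quot TE J)) \<and>
          (\<forall>i\<in>{1..N}. \<forall>j\<in>{1..N}. i \<noteq> j \<longrightarrow>
             \<phi> (FK_gen K N i j) = J +>\<^bsub>TE\<^esub> tensor_algebra_incl K (E_space K N) (E_gen K N i j))"
      unfolding Let_def
      using FK_to_Q_bij[OF s] FK_to_Q_gen[OF letter, unfolded fst_conv snd_conv]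
      by (intro bexI[OF _ FK_to_Q_alg_hom]) blast
    show "\<exists>(B :: ('k, ((nat \<times> nat) list \<Rightarrow> 'k) set, nat \<Rightarrow> nat) crossed) \<Delta> \<epsilon> S.
       module.truncate B = FK_algebra K N \<and>
       (\<forall>i\<in>{1..N}. \<forall>j\<in>{1..N}. i \<noteq> j \<longrightarrow>
          (\<forall>g\<in>carrier (sym_group N). act B g (FK_gen K N i j) = FK_gen K N (g i) (g j)) \<and>
          FK_gen K N i j \<in> grade B (Transposition.transpose i j)) \<and>
       braided_group K (sym_group N) B \<Delta> \<epsilon> S \<and>
       (\<forall>i\<in>{1..N}. \<forall>j\<in>{1..N}. i \<noteq> j \<longrightarrow>
          \<Delta> (FK_gen K N i j) =
            pure K B B (FK_gen K N i j) \<one>\<^bsub>B\<^esub>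
              \<oplus>\<^bsub>tensor K B B\<^esub> pure K B B \<one>\<^bsub>B\<^esub> (FK_gen K N i j) \<and>
          \<epsilon> (FK_gen K N i j) = \<zero>\<^bsub>K\<^esub>) \<and>
       (\<forall>\<Delta>' \<in> alg_hom K B (braided_square K (sym_group N) B).
          (\<forall>i\<in>{1..N}. \<forall>j\<in>{1..N}. i \<noteq> j \<longrightarrow> \<Delta>' (FK_gen K N i j) = \<Delta> (FK_gen K N i j)) \<longrightarrow>
          (\<forall>x\<in>carrier B. \<Delta>' x = \<Delta> x)) \<and>
       (\<forall>\<epsilon>' \<in> alg_hom K B (crossed_unit K (sym_group N)).
          (\<forall>i\<in>{1..N}. \<forall>j\<in>{1..N}. i \<noteq> j \<longrightarrow> \<epsilon>' (FK_gen K N i j) = \<epsilon> (FK_gen K N i j)) \<longrightarrow>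
          (\<forall>x\<in>carrier B. \<epsilon>' x = \<epsilon> x))"
    proof (rule exI[of _ ?B], rule exI[of _ coprod], rule exI[of _ counit], rule exI[of _ antipode],
        intro conjI ballI impI)
      show "module.truncate ?B = ?A" by (rule FK_crossed_truncate)
      show "braided_group K ?G ?B coprod counit antipode" by (rule B_braided_group)
      fix i j assume ij: "i \<in> {1..N}" "j \<in> {1..N}" "i \<noteq> j"
      note l = letter[OF ij]
      show "act ?B g (FK_gen K N i j) = FK_gen K N (g i) (g j)" if "g \<in> carrier ?G" for g
        using FK_act_gen[OF that l] by simp
      show "FK_gen K N i j \<in> grade ?B (Transposition.transpose i j)"
        using grade_gen[OF l] by (simp add: letter_deg_def)
      show "coprod (FK_gen K N i j) = pure K ?B ?B (FK_gen K N i j) \<one>\<^bsub>?B\<^esub>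
              \<oplus>\<^bsub>tensor K ?B ?B\<^esub> pure K ?B ?B \<one>\<^bsub>?B\<^esub> (FK_gen K N i j)"
        using coprod_gen[OF l] by simp
      show "counit (FK_gen K N i j) = \<zero>\<^bsub>K\<^esub>" using counit_gen[OF l] by simp
    next
      fix \<Delta>' x assume \<Delta>': "\<Delta>' \<in> alg_hom K ?B (braided_square K ?G ?B)"
        and eq: "\<forall>i\<in>{1..N}. \<forall>j\<in>{1..N}. i \<noteq> j \<longrightarrow> \<Delta>' (FK_gen K N i j) = coprod (FK_gen K N i j)"
        and x: "x \<in> carrier ?B"
      show "\<Delta>' x = coprod x"
        by (rule B_alg_hom_unique[OF braided_square_module \<Delta>' coprod_alg_hom _ x])
          (use eq in \<open>auto simp: FK_letters_def\<close>)
    next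
      fix \<epsilon>' x assume \<epsilon>': "\<epsilon>' \<in> alg_hom K ?B (crossed_unit K ?G)"
        and eq: "\<forall>i\<in>{1..N}. \<forall>j\<in>{1..N}. i \<noteq> j \<longrightarrow> \<epsilon>' (FK_gen K N i j) = counit (FK_gen K N i j)"
        and x: "x \<in> carrier ?B"
      show "\<epsilon>' x = counit x"
        by (rule B_alg_hom_unique[OF E1_mod \<epsilon>' counit_alg_hom _ x])
          (use eq in \<open>auto simp: FK_letters_def\<close>)
    qed
  qed
qed

end
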